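(* Let $N$ be an H-type group with centre of dimension $m$ and $\dim\mathfrak z^\perp=2n$. Let $f\in L^1\cap L^2(N)$ be such that for some $M_1>n$, $M_2\ge0$ and each $\omega\in\mathbb S^{m-1}$, $$\int_{\mathbb R^{2n}\times\mathbb R^m}\int_{\mathbb R}\frac{\left|(-\Delta_t)^{(m-1)/4}f(z,t)\right|\,\|\hat f(\lambda,\omega)\|_{HS}\,e^{|t||\lambda|}\,|\lambda|^{n+(m-1)/2}}{(1+|z|)^{M_1}(1+|\lambda|+|t|)^{M_2}}\,d\lambda\,dz\,dt<\infty .$$ Then for each $\omega\in\mathbb S^{m-1}$, $$R_\omega f(z,a)=e^{-c_\omega a^2}(1+|z|)^{M_1}\left(\sum_{j=0}^{l}\psi_{j,\omega}(z)\,a^j\right),$$ where $c_\omega$ is a constant, the functions $\psi_{j,\omega}$ belong to $L^1(\mathbb C^n)\cap L^2(\mathbb C^n)$, and $l<\frac{M_2-n/2-1}{2}$.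
   Context: H-type groups. An H-type algebra is a finite-dimensional real Lie algebra $\mathfrak n$ with an inner product such that, $\mathfrak z$ being its centre, $[\mathfrak z^\perp,\mathfrak z^\perp]=\mathfrak z$ and for each unit $z\in\mathfrak z$ the map $J_z:\mathfrak z^\perp\to\mathfrak z^\perp$, $\langle J_z v,w\rangle=\langle z,[v,w]\rangle$, is orthogonal. $N$ is the connected simply connected Lie group of $\mathfrak n$, identified with $\mathfrak n=\mathfrak z^\perp\oplus\mathfrak z\cong\mathbb R^{2n}\times\mathbb R^m$ ($\mathbb R^{2n}\cong\mathbb C^n$) by the exponential map, with group law $(Z,t)(W,s)=(Z+W,t+s+\tfrac12[Z,W])$ and Haar measure the Lebesgue measure. Representations. For a unit vector $\omega\in\mathbb S^{m-1}\subset\mathfrak z\cong\mathbb R^m$ choose an orthonormal basis $E_1,\dots,E_n,E_1',\dots,E_n'$ of $\mathfrak z^\perp$ with $J_\omega E_j=-E_j'$, $J_\omega E_j'=E_j$, and write $(x,u)\in\mathbb R^n\times\mathbb R^n$ for $\sum_j(x_jE_j+u_jE_j')$. For $\lambda\in\mathbb R\setminus\{0\}$, $\pi_{\lambda,\omega}(x,u,t)\varphi(\xi)=e^{i\lambda t\cdot\omega}e^{i\lambda(x\cdot\xi+\frac12x\cdot u)}\varphi(\xi+u)$, $\varphi\in L^2(\mathbb R^n)$, is an irreducible unitary representation of $N$. The group Fourier transform is $\hat f(\lambda,\omega)=\int_Nf(x,u,t)\,\pi_{\lambda,\omega}(x,u,t)\,dx\,du\,dt$, and $\|\cdot\|_{HS}$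 is the Hilbert–Schmidt norm. Modified Radon transform. $\Delta_t$ is the Laplacian in the central variable $t\in\mathbb R^m$ and $(-\Delta_t)^{(m-1)/4}$ is the Fourier multiplier in $t$ with symbol $|\boldsymbol\lambda|^{(m-1)/2}$ (understood in the distribution sense; the hypothesis includes that $(-\Delta_t)^{(m-1)/4}f$ is a measurable function). For a function $g$ on $N$ and $\omega\in\mathbb S^{m-1}$ the partial Radon transform is $g_\omega(z,a)=\int_{t\cdot\omega=a}g(z,t)\,d\sigma_1(t)$, $z\in\mathbb R^{2n}$, $a\in\mathbb R$, with $d\sigma_1$ the Lebesgue measure on the $(m-1)$-dimensional hyperplane $\{t\cdot\omega=a\}$. The modified Radon transform is $R_\omega f=\left((-\Delta_t)^{(m-1)/4}f\right)_\omega$; equivalently $\int_{\mathbb R}R_\omega f(z,a)e^{i\lambda a}\,da=|\lambda|^{(m-1)/2}\int_{\mathbb R^m}f(z,t)e^{i\lambda\omega\cdot t}\,dt$. *)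

theory Defs
  imports "HOL-Analysis.Analysis"
begin

subsection \<open>H-type algebras and their groups\<close>

definition lie_bracket :: "('g::real_vector \<Rightarrow> 'g \<Rightarrow> 'g) \<Rightarrow> bool" where
  "lie_bracket br \<longleftrightarrow> bilinear br \<and> (\<forall>x. br x x = 0) \<and>
     (\<forall>x y z. br x (br y z) + br y (br z x) + br z (br x y) = 0)"

definition lie_center :: "('g::real_vector \<Rightarrow> 'g \<Rightarrow> 'g) \<Rightarrow> 'g set" where
  "lie_center br = {z. \<forall>x. br z x = 0}"

text \<open>
  \<open>J_map br z v\<close> satisfies \<open>J_map br z v \<bullet> w = z \<bullet> br v w\<close> for all \<open>w\<close>. For \<open>w\<close> in the centre
  the right-hand side vanishes, so \<open>J_map br z v\<close> lies in the orthogonal complement of the centre,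
  and on this complement it is the usual \<open>J\<^sub>z v\<close>.
\<close>

definition J_map :: "('g::euclidean_space \<Rightarrow> 'g \<Rightarrow> 'g) \<Rightarrow> 'g \<Rightarrow> 'g \<Rightarrow> 'g" where
  "J_map br z v = adjoint (br v) z"

definition H_type_algebra :: "('g::euclidean_space \<Rightarrow> 'g \<Rightarrow> 'g) \<Rightarrow> bool" where
  "H_type_algebra br \<longleftrightarrow> lie_bracket br \<and>
     span {br v w | v w. v \<in> (lie_center br)\<^sup>\<bottom> \<and> w \<in> (lie_center br)\<^sup>\<bottom>} = lie_center br \<and>
     (\<forall>z\<in>lie_center br. norm z = 1 \<longrightarrow>
        (\<forall>v\<in>(lie_center br)\<^sup>\<bottom>. J_map br z v \<in> (lie_center br)\<^sup>\<bottom>) \<and>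
        (\<forall>v\<in>(lie_center br)\<^sup>\<bottom>. \<forall>w\<in>(lie_center br)\<^sup>\<bottom>. J_map br z v \<bullet> J_map br z w = v \<bullet> w))"

text \<open>
  The group is the Lie algebra itself, via the exponential map. For an algebra on \<open>'v \<times> 'z\<close> with
  centre \<open>{0} \<times> UNIV\<close>, the law below reads \<open>(Z, t)(W, s) = (Z + W, t + s + [Z, W] / 2)\<close>, and Haar
  measure is Lebesgue measure \<open>lborel\<close>.
\<close>

definition H_type_mult :: "('g::real_vector \<Rightarrow> 'g \<Rightarrow> 'g) \<Rightarrow> 'g \<Rightarrow> 'g \<Rightarrow> 'g" where
  "H_type_mult br p q = p + q + (1/2) *\<^sub>R br p q"


subsection \<open>The representations and the group Fourier transform\<close>

definition adapted_basis ::
  "('v::euclidean_space \<times> 'z::euclidean_space \<Rightarrow> 'v \<times> 'z \<Rightarrow> 'v \<times> 'z) \<Rightarrow> 'z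
     \<Rightarrow> ('n::finite \<Rightarrow> 'v) \<Rightarrow> ('n \<Rightarrow> 'v) \<Rightarrow> bool" where
  "adapted_basis br \<omega> E E' \<longleftrightarrow>
     (\<forall>i j. E i \<bullet> E j = of_bool (i = j) \<and> E' i \<bullet> E' j = of_bool (i = j) \<and> E i \<bullet> E' j = 0) \<and>
     span (range E \<union> range E') = UNIV \<and>
     (\<forall>j. J_map br (0, \<omega>) (E j, 0) = - (E' j, 0) \<and> J_map br (0, \<omega>) (E' j, 0) = (E j, 0))"

definition coord :: "('n::finite \<Rightarrow> 'v::euclidean_space) \<Rightarrow> ('n \<Rightarrow> 'v) \<Rightarrow> real^'n \<Rightarrow> real^'n \<Rightarrow> 'v" where
  "coord E E' x u = (\<Sum>j\<in>UNIV. (x $ j) *\<^sub>R E j + (u $ j) *\<^sub>R E' j)"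

definition schroedinger_rep ::
  "'z::euclidean_space \<Rightarrow> real \<Rightarrow> real^'n \<Rightarrow> real^'n \<Rightarrow> 'z
     \<Rightarrow> (real^'n \<Rightarrow> complex) \<Rightarrow> real^'n::finite \<Rightarrow> complex" where
  "schroedinger_rep \<omega> \<nu> x u t \<phi> \<xi> =
     cis (\<nu> * (t \<bullet> \<omega>)) * cis (\<nu> * (x \<bullet> \<xi> + (1/2) * (x \<bullet> u))) * \<phi> (\<xi> + u)"

text \<open>
  The representation parameter usually written lambda is \<open>\<nu>\<close> here, meant for \<open>\<nu> \<noteq> 0\<close>.
  The operator-valued integral defining the group Fourier transform, applied to \<open>\<phi>\<close> and evaluated
  at \<open>\<xi>\<close>. For \<open>f\<close> in \<open>L\<^sup>1\<close> and \<open>\<phi>\<close> in \<open>L\<^sup>2\<close> the integral converges absolutely for almost every \<open>\<xi>\<close>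
  (Minkowski) and represents the \<open>L\<^sup>2\<close>-valued integral.
\<close>

definition group_fourier ::
  "('n::finite \<Rightarrow> 'v::euclidean_space) \<Rightarrow> ('n \<Rightarrow> 'v) \<Rightarrow> ('v \<times> 'z::euclidean_space \<Rightarrow> complex)
     \<Rightarrow> real \<Rightarrow> 'z \<Rightarrow> (real^'n \<Rightarrow> complex) \<Rightarrow> real^'n \<Rightarrow> complex" where
  "group_fourier E E' f \<nu> \<omega> \<phi> \<xi> =
     (\<integral>((x, u), t). f (coord E E' x u, t) * schroedinger_rep \<omega> \<nu> x u t \<phi> \<xi> \<partial>lborel)"

definition L2_fun :: "('a::euclidean_space \<Rightarrow> complex) \<Rightarrow> bool" where
  "L2_fun f \<longleftrightarrow> f \<in> borel_measurable lborel \<and> integrable lborel (\<lambda>x. (norm (f x))\<^sup>2)"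

definition L2_orthonormal_basis :: "(nat \<Rightarrow> 'a::euclidean_space \<Rightarrow> complex) \<Rightarrow> bool" where
  "L2_orthonormal_basis e \<longleftrightarrow> (\<forall>k. L2_fun (e k)) \<and>
     (\<forall>j k. (\<integral>x. e j x * cnj (e k x) \<partial>lborel) = of_bool (j = k)) \<and>
     (\<forall>h. L2_fun h \<longrightarrow> (\<forall>k. (\<integral>x. h x * cnj (e k x) \<partial>lborel) = 0) \<longrightarrow> (AE x in lborel. h x = 0))"

text \<open>
  The Hilbert--Schmidt norm, with value \<open>\<infinity>\<close> for operators that are not Hilbert--Schmidt; the sum
  does not depend on the orthonormal basis. The value \<open>\<infinity>\<close> matters: for \<open>f\<close> in \<open>L\<^sup>1\<close> and \<open>L\<^sup>2\<close> the
  Fourier transform is Hilbert--Schmidt at almost every \<open>(\<nu>, \<omega>)\<close>, but not necessarily for every \<open>\<omega>\<close>.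
\<close>

definition hs_norm :: "(('a::euclidean_space \<Rightarrow> complex) \<Rightarrow> 'a \<Rightarrow> complex) \<Rightarrow> ennreal" where
  "hs_norm T =
     (let e = (SOME e. L2_orthonormal_basis e);
          S = (\<Sum>k. \<integral>\<^sup>+\<xi>. ennreal ((norm (T (e k) \<xi>))\<^sup>2) \<partial>lborel)
      in if S = \<infinity> then \<infinity> else ennreal (sqrt (enn2real S)))"


subsection \<open>Fractional powers of the central Laplacian\<close>

primrec C_k :: "nat \<Rightarrow> ('a::euclidean_space \<Rightarrow> complex) \<Rightarrow> bool" where
  "C_k 0 f \<longleftrightarrow> continuous_on UNIV f"
| "C_k (Suc k) f \<longleftrightarrow> (\<forall>x. f differentiable (at x)) \<and> (\<forall>v. C_k k (\<lambda>x. frechet_derivative f (at x) v))"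

definition test_function :: "('a::euclidean_space \<Rightarrow> complex) \<Rightarrow> bool" where
  "test_function \<phi> \<longleftrightarrow> (\<forall>k. C_k k \<phi>) \<and> compact (closure {x. \<phi> x \<noteq> 0})"

text \<open>
  The multiplier \<open>(-\<Delta>\<^sub>t)\<^sup>s\<close>, with symbol \<open>|\<mu>|\<^bsup>2s\<^esup>\<close>, on test functions: the Fourier transform in the
  central variable uses the kernel \<open>exp (i \<mu> \<bullet> t)\<close> and its inverse carries the factor \<open>(2 \<pi>)\<^bsup>-m\<^esup>\<close>.
\<close>

definition central_frac_laplacian ::
  "real \<Rightarrow> ('v::euclidean_space \<times> 'z::euclidean_space \<Rightarrow> complex) \<Rightarrow> 'v \<times> 'z \<Rightarrow> complex" where
  "central_frac_laplacian s \<phi> = (\<lambda>(z, t).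
     complex_of_real (1 / (2 * pi) ^ DIM('z)) *
     (\<integral>\<mu>. complex_of_real (norm \<mu> powr (2 * s)) * cis (- (\<mu> \<bullet> t)) *
           (\<integral>t'. \<phi> (z, t') * cis (\<mu> \<bullet> t') \<partial>lborel) \<partial>lborel))"

text \<open>
  \<open>g\<close> is a (locally integrable) function representing the distribution \<open>(-\<Delta>\<^sub>t)\<^sup>s f\<close>, where \<open>f\<close> is
  integrable. The multiplier is even, hence symmetric for the bilinear pairing.
\<close>

definition is_central_frac_laplacian ::
  "real \<Rightarrow> ('v::euclidean_space \<times> 'z::euclidean_space \<Rightarrow> complex) \<Rightarrow> ('v \<times> 'z \<Rightarrow> complex) \<Rightarrow> bool" where
  "is_central_frac_laplacian s f g \<longleftrightarrow>
     g \<in> borel_measurable lborel \<and> (\<forall>K. compact K \<longrightarrow> set_integrable lborel K g) \<and>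
     (\<forall>\<phi>. test_function \<phi> \<longrightarrow>
        (\<integral>p. g p * \<phi> p \<partial>lborel) = (\<integral>p. f p * central_frac_laplacian s \<phi> p \<partial>lborel))"


subsection \<open>The partial Radon transform\<close>

definition orthonormal_basis_of :: "'z::euclidean_space set \<Rightarrow> 'z set \<Rightarrow> bool" where
  "orthonormal_basis_of S B \<longleftrightarrow> pairwise orthogonal B \<and> (\<forall>b\<in>B. norm b = 1) \<and> span B = S"

text \<open>
  Lebesgue measure on the hyperplane \<open>{t. t \<bullet> \<omega> = a}\<close> for a unit vector \<open>\<omega>\<close>, by orthonormal
  coordinates. In dimension one the hyperplane is the point \<open>a \<omega>\<close> and the measure its unit mass.
\<close>

definition hyperplane_lebesgue :: "'z::euclidean_space \<Rightarrow> real \<Rightarrow> 'z measure" where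
  "hyperplane_lebesgue \<omega> a =
     (let B = (SOME B. orthonormal_basis_of ({\<omega>}\<^sup>\<bottom>) B)
      in distr (\<Pi>\<^sub>M b\<in>B. lborel) borel (\<lambda>y. a *\<^sub>R \<omega> + (\<Sum>b\<in>B. y b *\<^sub>R b)))"

definition partial_radon ::
  "('v \<times> 'z::euclidean_space \<Rightarrow> complex) \<Rightarrow> 'z \<Rightarrow> 'v \<Rightarrow> real \<Rightarrow> complex" where
  "partial_radon g \<omega> z a = (\<integral>t. g (z, t) \<partial>hyperplane_lebesgue \<omega> a)"

end

(*
  On the Fourier side the multiplier becomes a factor |nu|^((m-1)/2), so for a fixed direction omega
  the partial Radon transform v(z,a) of g, weighted by w(z) = (1+|z|)^(-M1), has a Fourier transform
  in a equal to a constant times w(z) |nu|^((m-1)/2) times the central Fourier transform of f at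
  nu omega. The L^2 norm of the latter in z is at most a constant times |nu|^(n/2) times the
  Hilbert-Schmidt norm of the group Fourier transform. As w is in L^2 and |t . omega| <= |t|, the
  hypothesis becomes a Beurling condition for v with values in L^1 in z, with weight
  |nu|^(n/2) e^(|a nu|) / (1+|a|+|nu|)^M2.

  Pair v with a bounded function h of z, giving v_h(a), and convolve with a Gaussian: the result F_h
  is entire, and |F_h(x+iy)| is bounded by e^(y^2/2) A(x) and by B(y), where A(x) B(x) has polynomial
  growth. Hence F_h(z) F_k(iz) is a polynomial for all h and k (Phragmen-Lindelof), so every F_h is a
  polynomial times a Gaussian (Hadamard), with an exponent that does not depend on h. Then v_h and
  its Fourier transform have the same form, the condition bounds the degree, and Lagrange
  interpolation in nu expresses the coefficients by finitely many values of the Fourier transform,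
  chosen among those that are in L^2.
*)
theory Submission
 imports Defs "HOL-Probability.Probability" "HOL-Complex_Analysis.Complex_Analysis"
begin

text \<open>The function \<open>g\<close> only represents a distribution and is merely locally
  integrable, so neither its Radon transform nor its central Fourier transform is known to converge.
  Unless \<open>g\<close> vanishes, the integrability condition at one suitable direction and
  frequency yields an exponential moment of \<open>g\<close> against the weight \<open>w\<close>.
  This makes the weighted Radon transform integrable in every direction and its Fourier transform
  analytic in a strip. The multiplier is then identified by testing with wave packets that
  concentrate at a single frequency.

  The Hilbert--Schmidt norm must be bounded below at every frequency, where the operator kernel may
  be merely integrable. Hence the Plancherel and Parseval estimates are one-sided, hold on all of
  \<open>L\<^sup>1\<close>, and allow the value infinity.

  Replacing \<open>norm t\<close> by \<open>abs (t \<bullet> \<omega>)\<close> also changes the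
  polynomial denominator. The exponential absorbs the loss once \<open>abs \<nu> \<ge> 1\<close>, so
  the one-dimensional condition is kept on that range, and a transform of bounded support is treated
  separately, by analyticity in the strip.\<close>

abbreviation (input) cor :: "real \<Rightarrow> complex" where "cor \<equiv> of_real"

abbreviation (input) cexp :: "real \<Rightarrow> complex" where "cexp x \<equiv> cor (exp x)"

abbreviation (input) nrm :: "'a::real_normed_vector \<Rightarrow> ennreal" where "nrm x \<equiv> ennreal (norm x)"

abbreviation (input) nrmsq :: "'a::real_normed_vector \<Rightarrow> ennreal" where "nrmsq x \<equiv> ennreal ((norm x)\<^sup>2)"

abbreviation (input) Borel :: "('a::topological_space \<Rightarrow> 'b::topological_space) set" where "Borel \<equiv> borel_measurable borel"

abbreviation (input) nn_lborel :: "('a::euclidean_space \<Rightarrow> ennreal) \<Rightarrow> ennreal" (binder "NN " 60)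
 where "nn_lborel f \<equiv> nn_integral lborel f"

section \<open>Integration on Euclidean spaces\<close>

text \<open>Rational corners make the family countable, so that its indicators can be enumerated for
  Gram--Schmidt, while it still generates the Borel sets and is closed under intersection.\<close>

definition rational_box :: "'a::euclidean_space set set" where
 "rational_box = {box a b | a b. (\<forall>i\<in>Basis. a \<bullet> i \<in> \<rat>) \<and> (\<forall>i\<in>Basis. b \<bullet> i \<in> \<rat>)}"

text \<open>The class in which completeness of a basis is tested. It contains
  \<open>L\<^sup>1\<close> and \<open>L\<^sup>2\<close>, and also central Fourier transforms that
  are integrable only against a decaying weight.\<close>

definition loc_integrable :: "('a::euclidean_space \<Rightarrow> complex) \<Rightarrow> bool" where
 "loc_integrable h \<longleftrightarrow> h \<in> Borel \<and> (\<forall>K. compact K \<longrightarrow> set_integrable lborel K h)"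

lemma loc_integrable_borel [measurable_dest]: "loc_integrable h \<Longrightarrow> h \<in> Borel"
 by (simp add: loc_integrable_def)

lemma integrable_imp_loc_integrable:
 fixes h :: "'a::euclidean_space \<Rightarrow> complex"
 shows "integrable lborel h \<Longrightarrow> loc_integrable h"
 using borel_measurable_integrable[of lborel h] by (auto simp: loc_integrable_def set_integrable_def borel_compact intro!: integrable_mult_indicator)

lemma loc_integrable_diff:
 fixes f g :: "'a::euclidean_space \<Rightarrow> complex"
 shows "loc_integrable f \<Longrightarrow> loc_integrable g \<Longrightarrow> loc_integrable (\<lambda>x. f x - g x)"
 by (auto simp: loc_integrable_def intro!: set_integral_diff)

lemma loc_integrable_set:
 assumes "loc_integrable h" "A \<in> sets borel" "bounded A"
 shows "set_integrable lborel A h"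
proof (rule set_integrable_subset)
 show "set_integrable lborel (closure A) h" using assms by (auto simp: loc_integrable_def compact_closure)
qed (use assms closure_subset in auto)

lemma countable_rational_box: "countable (rational_box :: 'a::euclidean_space set set)"
proof -
 have c: "countable {a::'a. \<forall>i\<in>Basis. a \<bullet> i \<in> \<rat>}"
 proof (rule countable_subset)
  show "{a::'a. \<forall>i\<in>Basis. a \<bullet> i \<in> \<rat>} \<subseteq> (\<lambda>f. \<Sum>i\<in>Basis. f i *\<^sub>R i) ` (Basis \<rightarrow>\<^sub>E \<rat>)"
  proof
   fix a :: 'a assume "a \<in> {a. \<forall>i\<in>Basis. a \<bullet> i \<in> \<rat>}"
   then have "restrict (\<lambda>i. a \<bullet> i) Basis \<in> Basis \<rightarrow>\<^sub>E \<rat>" by auto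
   moreover have "a = (\<Sum>i\<in>Basis. restrict (\<lambda>i. a \<bullet> i) Basis i *\<^sub>R i)" by (simp add: euclidean_representation)
   ultimately show "a \<in> (\<lambda>f. \<Sum>i\<in>Basis. f i *\<^sub>R i) ` (Basis \<rightarrow>\<^sub>E \<rat>)" by blast
  qed
  show "countable ((\<lambda>f. \<Sum>i\<in>Basis. f i *\<^sub>R (i::'a)) ` (Basis \<rightarrow>\<^sub>E \<rat>))"
   by (intro countable_image countable_PiE countable_rat) auto
 qed
 have "rational_box = (\<lambda>(a, b). box a b) ` ({a::'a. \<forall>i\<in>Basis. a \<bullet> i \<in> \<rat>} \<times> {b. \<forall>i\<in>Basis. b \<bullet> i \<in> \<rat>})"
  by (auto simp: rational_box_def)
 moreover have "countable ({a::'a. \<forall>i\<in>Basis. a \<bullet> i \<in> \<rat>} \<times> {b::'a. \<forall>i\<in>Basis. b \<bullet> i \<in> \<rat>})"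
  using c c by (rule countable_SIGMA)
 ultimately show ?thesis by (metis (no_types, lifting) countable_image)
qed

lemma borel_rational_box: "sets borel = sigma_sets UNIV (rational_box :: 'a::euclidean_space set set)"
proof -
 have "(borel::'a measure) = sigma UNIV ((\<lambda>X. X) ` rational_box)"
 proof (rule borel_eq_sigmaI1[OF borel_def])
  fix M :: "'a set" assume "M \<in> {S. open S}"
  then have "open M" by simp
  have *: "box (\<Sum>i\<in>Basis. fst (f i) *\<^sub>R i) (\<Sum>i\<in>Basis. snd (f i) *\<^sub>R i) \<in> rational_box"
   if "f \<in> Basis \<rightarrow>\<^sub>E \<rat> \<times> \<rat>" for f :: "'a \<Rightarrow> real \<times> real"
   using that unfolding rational_box_def PiE_iff by (intro CollectI exI conjI refl) (auto simp: mem_Times_iff)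
  show "M \<in> sets (sigma UNIV ((\<lambda>X. X) ` rational_box))"
   apply (subst open_UNION_box[OF \<open>open M\<close>])
   apply (intro sets.countable_UN'' countable_Collect countable_PiE) using * by (auto intro: countable_rat)
 qed (auto simp: rational_box_def)
 then have "sets borel = sets (sigma UNIV (rational_box :: 'a set set))" by simp
 also have "... = sigma_sets UNIV rational_box" by (rule sets_measure_of) simp
 finally show ?thesis .
qed

lemma rational_box_Int: "A \<in> rational_box \<Longrightarrow> B \<in> rational_box \<Longrightarrow> A \<inter> B \<in> rational_box"
proof -
 assume "A \<in> rational_box" "B \<in> rational_box"
 then obtain a b c d where *: "A = box a b" "B = box c d"
  and q: "\<forall>i\<in>Basis. a \<bullet> i \<in> \<rat> \<and> b \<bullet> i \<in> \<rat> \<and> c \<bullet> i \<in> \<rat> \<and> d \<bullet> i \<in> \<rat>"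
  unfolding rational_box_def by blast
 show "A \<inter> B \<in> rational_box" unfolding * box_Int_box rational_box_def using q
  by (intro CollectI exI conjI refl) (auto simp: max_def min_def)
qed

lemma centered_box_rational: "box (- (real N *\<^sub>R One)) (real N *\<^sub>R One) \<in> (rational_box :: 'a::euclidean_space set set)"
 unfolding rational_box_def by (intro CollectI exI conjI refl) auto

text \<open>Cut off by a large box, \<open>h\<close> is integrable, and the sets over which its
  integral vanishes form a Dynkin system. Rational boxes generate the Borel sets and are stable
  under intersection, so every Borel set belongs to that system.\<close>

lemma AE_zero_rational_box:
 fixes h :: "'a::euclidean_space \<Rightarrow> complex"
 assumes h: "loc_integrable h"
  and z: "\<And>B. B \<in> rational_box \<Longrightarrow> (LINT x:B|lborel. h x) = 0"
 shows "AE x in lborel. h x = 0"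
proof -
 have hm[measurable]: "h \<in> Borel" using h by (rule loc_integrable_borel)
 have "AE x in lborel. indicator (box (- (real N *\<^sub>R One)) (real N *\<^sub>R One)) x *\<^sub>R h x = 0" for N :: nat
 proof -
  let ?B = "box (- (real N *\<^sub>R One)) (real N *\<^sub>R One) :: 'a set"
  let ?H = "\<lambda>x. indicator ?B x *\<^sub>R h x"
  have Hi: "integrable lborel ?H" using loc_integrable_set[OF h, of ?B] by (simp add: set_integrable_def)
  \<comment> \<open>Passing to complements needs the total integral to vanish; the box used for the
    cut-off is itself rational.\<close>
  have tot: "(LBINT x. ?H x) = 0" using z[OF centered_box_rational[of N]] by (simp add: set_lebesgue_integral_def)
  have "(LINT x:A|lborel. ?H x) = 0" if "A \<in> sets borel" for A
  proof -
   have "A \<in> sigma_sets UNIV rational_box" using that by (simp add: borel_rational_box)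
   with _ _ show ?thesis
   proof (induct rule: sigma_sets_induct_disjoint)
    show "Int_stable (rational_box :: 'a set set)" using rational_box_Int by (auto simp: Int_stable_def)
    show "(rational_box :: 'a set set) \<subseteq> Pow UNIV" by simp
   next
    fix A :: "'a set" assume "A \<in> rational_box"
    then have "A \<inter> ?B \<in> rational_box" by (intro rational_box_Int centered_box_rational)
    from z[OF this] show "(LINT x:A|lborel. ?H x) = 0" by (simp add: set_lebesgue_integral_def indicator_inter_arith ac_simps)
   next
    show "(LINT x:{}|lborel. ?H x) = 0" by (simp add: set_lebesgue_integral_def)
   next
    fix A assume A: "A \<in> sigma_sets UNIV (rational_box :: 'a set set)" "(LINT x:A|lborel. ?H x) = 0"
    then have [measurable]: "A \<in> sets borel" by (simp add: borel_rational_box)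
    have "(LINT x:UNIV - A|lborel. ?H x) = (LBINT x. ?H x - indicator A x *\<^sub>R ?H x)"
     unfolding set_lebesgue_integral_def by (intro Bochner_Integration.integral_cong) (auto simp: indicator_def)
    also have "... = (LBINT x. ?H x) - (LINT x:A|lborel. ?H x)" unfolding set_lebesgue_integral_def
     by (intro Bochner_Integration.integral_diff Hi integrable_mult_indicator) auto
    finally show "(LINT x:UNIV - A|lborel. ?H x) = 0" using A tot by simp
   next
    fix A :: "nat \<Rightarrow> 'a set"
    assume A: "disjoint_family A" "range A \<subseteq> sigma_sets UNIV rational_box"
     and 0: "\<And>i. (LINT x:A i|lborel. ?H x) = 0"
    have m: "A i \<in> sets lborel" for i using A by (auto simp: borel_rational_box)
    have U: "(\<Union>i. A i) \<in> sets lborel" using m by auto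
    have "(LINT x:(\<Union>i. A i)|lborel. ?H x) = (\<Sum>i. (LINT x:A i|lborel. ?H x))" using A m U by (intro lebesgue_integral_countable_add)
       (auto simp: disjoint_family_on_def set_integrable_def simp del: scaleR_scaleR intro: integrable_mult_indicator[OF _ Hi])
    then show "(LINT x:(\<Union>i. A i)|lborel. ?H x) = 0" using 0 by simp
   qed
  qed
  then show ?thesis by (intro sigma_finite_measure.density_zero[OF sigma_finite_lborel Hi]) auto
 qed
 then have "AE x in lborel. \<forall>N::nat. indicator (box (- (real N *\<^sub>R One)) (real N *\<^sub>R One)) x *\<^sub>R h x = 0"
  unfolding AE_all_countable by blast
 then show ?thesis
 proof eventually_elim
  case (elim x)
  from UN_box_eq_UNIV[where 'a='a] obtain N :: nat where "x \<in> box (- (real N *\<^sub>R One)) (real N *\<^sub>R One)" by blast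
  with elim[rule_format, of N] show ?case by simp
 qed
qed

section \<open>Affine changes of variables and products of one-variable functions\<close>

lemma nn_integral_affine:
 fixes f :: "'a::euclidean_space \<Rightarrow> ennreal"
 assumes [measurable]: "f \<in> Borel" and c: "c \<noteq> 0"
 shows "(NN x. f x) = ennreal (abs c ^ DIM('a)) * (NN x. f (t + c *\<^sub>R x))"
 by (subst lborel_affine[OF c, of t])
   (simp add: nn_integral_density nn_integral_distr nn_integral_cmult)

lemma integrable_affine:
 fixes f :: "'a::euclidean_space \<Rightarrow> 'b::{banach, second_countable_topology}"
 assumes f: "integrable lborel f" and c: "c \<noteq> 0"
 shows "integrable lborel (\<lambda>x. f (t + c *\<^sub>R x))"
 using f f[THEN borel_measurable_integrable] c unfolding integrable_iff_bounded
 by (subst (asm) nn_integral_affine[where c=c and t=t]) (auto simp: ennreal_mult_less_top)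

lemma integral_affine:
 fixes f :: "'a::euclidean_space \<Rightarrow> 'b::{banach, second_countable_topology}"
 assumes c: "c \<noteq> 0"
 shows "(LBINT x. f x) = abs c ^ DIM('a) *\<^sub>R (LBINT x. f (t + c *\<^sub>R x))"
proof (cases "integrable lborel f")
 case True
 note f = True and [measurable] = borel_measurable_integrable[OF True]
 show ?thesis using c f integrable_affine[OF f c, of t] by (subst lborel_affine[OF c, of t]) (simp add: integral_density integral_distr)
next
 case False
 have "\<not> integrable lborel (\<lambda>x. f (t + c *\<^sub>R x))"
 proof
  assume "integrable lborel (\<lambda>x. f (t + c *\<^sub>R x))"
  from integrable_affine[OF this, of "1 / c" "- (1/c) *\<^sub>R t"] c have "integrable lborel f"
   by (simp add: scaleR_diff_right scaleR_right_distrib)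
  with False show False by simp
 qed
 with False show ?thesis by (simp add: not_integrable_integral_eq)
qed

text \<open>Lebesgue measure is the image of a finite product of one-dimensional measures, so Fubini
  for such products applies coordinate by coordinate.\<close>

lemma lborel_product_integral:
 fixes f :: "'a::euclidean_space \<Rightarrow> real \<Rightarrow> complex"
 assumes "\<And>i. i \<in> Basis \<Longrightarrow> integrable lborel (f i)"
 shows "integrable lborel (\<lambda>x. \<Prod>i\<in>Basis. f i (x \<bullet> i))"
  and "(LBINT x. (\<Prod>i\<in>Basis. f i (x \<bullet> i))) = (\<Prod>i\<in>Basis. (LBINT x. f i x))"
proof -
 interpret product_sigma_finite "\<lambda>_::'a. lborel :: real measure" ..
 have [measurable]: "(\<lambda>x. f i x) \<in> Borel" if "i \<in> Basis" for i
  using assms[OF that] by (simp add: borel_measurable_integrable)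
 have M: "(\<lambda>g. \<Sum>b\<in>Basis. g b *\<^sub>R b) \<in> (\<Pi>\<^sub>M b\<in>Basis. lborel) \<rightarrow>\<^sub>M (borel :: 'a measure)"
  by measurable
 have F: "(\<lambda>x. \<Prod>i\<in>Basis. f i (x \<bullet> i)) \<in> Borel" by measurable
 have e: "(\<Prod>i\<in>Basis. f i ((\<Sum>b\<in>Basis. g b *\<^sub>R b) \<bullet> i)) = (\<Prod>i\<in>Basis. f i (g i))" for g
  by (intro prod.cong) auto
 show "integrable lborel (\<lambda>x. \<Prod>i\<in>Basis. f i (x \<bullet> i))" by (subst lborel_eq, subst integrable_distr_eq[OF M F], unfold e)
    (intro product_integrable_prod assms, auto)
 show "(LBINT x. (\<Prod>i\<in>Basis. f i (x \<bullet> i))) = (\<Prod>i\<in>Basis. (LBINT x. f i x))"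
  by (subst lborel_eq, subst integral_distr[OF M F], unfold e)
    (intro product_integral_prod assms, auto)
qed

section \<open>Fourier transforms of Gaussians\<close>

lemma borel_measurable_cis [measurable (raw)]:
 assumes "f \<in> borel_measurable M"
 shows "(\<lambda>x. cis (f x)) \<in> borel_measurable M"
 unfolding cis_conv_exp using assms by measurable

text \<open>The characteristic function of the standard normal distribution is the case
  \<open>\<epsilon> = 1\<close>; scaling by \<open>sqrt \<epsilon>\<close> gives the rest.\<close>

lemma gaussian_1d:
 fixes \<epsilon> x :: real
 assumes "\<epsilon> > 0"
 shows "integrable lborel (\<lambda>y. cexp (- \<epsilon> * y\<^sup>2 / 2) * cis (y * x))"
  and "(LBINT y. cexp (- \<epsilon> * y\<^sup>2 / 2) * cis (y * x))
    = cor (sqrt (2 * pi / \<epsilon>) * exp (- x\<^sup>2 / (2 * \<epsilon>)))"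
proof -
 define s where "s = sqrt \<epsilon>"
 have s: "s > 0" "s\<^sup>2 = \<epsilon>" using assms by (auto simp: s_def)
 have r: "integrable lborel (\<lambda>y. exp (- y\<^sup>2 / 2) :: real)"
  using integrable_mult_right[OF integrable_normal_moment[of 1 0 0], of "sqrt (2 * pi)"] by (simp add: normal_density_def)
 have i1: "integrable lborel (\<lambda>y. cexp (- y\<^sup>2 / 2) * cis (y * t))" for t
  by (rule Bochner_Integration.integrable_bound[OF integrable_of_real[OF r, where 'a=complex]])
    (auto simp: norm_mult)
 have "cexp (- t\<^sup>2 / 2) = char std_normal_distribution t" for t by (simp add: char_std_normal_distribution)
 also have "char std_normal_distribution t = (LBINT y. std_normal_density y *\<^sub>R cis (t * y))" for t
  unfolding char_def by (subst integral_density) (auto simp: normal_density_nonneg cis_conv_exp)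
 also have "(LBINT y. std_normal_density y *\<^sub>R cis (t * y))
   = cor (1 / sqrt (2 * pi)) * (LBINT y. cexp (- y\<^sup>2 / 2) * cis (y * t))" for t
  by (subst integral_mult_right_zero[symmetric]) (simp add: normal_density_def scaleR_conv_of_real mult_ac)
 finally have v: "(LBINT y. cexp (- y\<^sup>2 / 2) * cis (y * t))
   = cor (sqrt (2 * pi) * exp (- t\<^sup>2 / 2))" for t by (simp add: field_simps)
 have e: "cexp (- \<epsilon> * y\<^sup>2 / 2) * cis (y * x)
   = (\<lambda>y. cexp (- y\<^sup>2 / 2) * cis (y * (x / s))) (0 + s * y)" for y using s by (simp add: power_mult_distrib)
 show "integrable lborel (\<lambda>y. cexp (- \<epsilon> * y\<^sup>2 / 2) * cis (y * x))"
  unfolding e using s(1) by (intro lborel_integrable_real_affine i1) auto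
 have "cor (sqrt (2 * pi) * exp (- (x / s)\<^sup>2 / 2))
   = s *\<^sub>R (LBINT y. cexp (- \<epsilon> * y\<^sup>2 / 2) * cis (y * x))"
  unfolding e v[symmetric] using s(1) by (subst lborel_integral_real_affine[of s _ 0]) auto
 then have "(LBINT y. cexp (- \<epsilon> * y\<^sup>2 / 2) * cis (y * x))
   = cor (sqrt (2 * pi) * exp (- (x / s)\<^sup>2 / 2) / s)" using s(1) by (simp add: scaleR_conv_of_real field_simps)
 also have "sqrt (2 * pi) * exp (- (x / s)\<^sup>2 / 2) / s = sqrt (2 * pi / \<epsilon>) * exp (- x\<^sup>2 / (2 * \<epsilon>))"
  by (simp add: s_def real_sqrt_divide power_divide assms less_imp_le mult.commute)
 finally show "(LBINT y. cexp (- \<epsilon> * y\<^sup>2 / 2) * cis (y * x))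
    = cor (sqrt (2 * pi / \<epsilon>) * exp (- x\<^sup>2 / (2 * \<epsilon>)))" .
qed

lemma exp_sum_Basis: "exp (- c * (norm y)\<^sup>2) = (\<Prod>i\<in>Basis. exp (- c * (y \<bullet> i)\<^sup>2))"
 for y :: "'a::euclidean_space" and c :: real
proof -
 have "(norm y)\<^sup>2 = (\<Sum>i\<in>Basis. (y \<bullet> i)\<^sup>2)"
  unfolding power2_norm_eq_inner by (subst euclidean_inner) (simp add: power2_eq_square)
 then show ?thesis by (simp add: exp_sum[symmetric] sum_distrib_left)
qed

lemma cis_sum: "finite A \<Longrightarrow> cis (\<Sum>i\<in>A. f i) = (\<Prod>i\<in>A. cis (f i))"
 by (induction A rule: finite_induct) (auto simp: cis_mult[symmetric])

lemma gaussian_fourier: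
 fixes x :: "'a::euclidean_space"
 assumes "\<epsilon> > 0"
 shows "integrable lborel (\<lambda>y. cexp (- \<epsilon> * (norm y)\<^sup>2 / 2) * cis (y \<bullet> x))"
  and "(LBINT y. cexp (- \<epsilon> * (norm y)\<^sup>2 / 2) * cis (y \<bullet> x))
    = cor (sqrt (2 * pi / \<epsilon>) ^ DIM('a) * exp (- (norm x)\<^sup>2 / (2 * \<epsilon>)))"
proof -
 have e: "cexp (- \<epsilon> * (norm y)\<^sup>2 / 2) * cis (y \<bullet> x)
   = (\<Prod>i\<in>Basis. cexp (- \<epsilon> * (y \<bullet> i)\<^sup>2 / 2) * cis ((y \<bullet> i) * (x \<bullet> i)))" for y
  using exp_sum_Basis[of "\<epsilon>/2" y] by (simp add: prod.distrib cis_sum[symmetric] euclidean_inner[of y x] flip: of_real_prod)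
 show "integrable lborel (\<lambda>y. cexp (- \<epsilon> * (norm y)\<^sup>2 / 2) * cis (y \<bullet> x))"
  unfolding e by (intro lborel_product_integral gaussian_1d assms)
 have "(LBINT y. cexp (- \<epsilon> * (norm y)\<^sup>2 / 2) * cis (y \<bullet> x))
   = (\<Prod>i\<in>Basis. cor (sqrt (2 * pi / \<epsilon>) * exp (- (x \<bullet> i)\<^sup>2 / (2 * \<epsilon>))))" unfolding e
  by (subst lborel_product_integral(2)) (simp_all only: gaussian_1d[OF assms])
 also have "... = cor (\<Prod>i\<in>(Basis::'a set). sqrt (2 * pi / \<epsilon>) * exp (- (1 / (2 * \<epsilon>)) * (x \<bullet> i)\<^sup>2))" by simp
 also have "(\<Prod>i\<in>(Basis::'a set). sqrt (2 * pi / \<epsilon>) * exp (- (1 / (2 * \<epsilon>)) * (x \<bullet> i)\<^sup>2))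
   = sqrt (2 * pi / \<epsilon>) ^ DIM('a) * exp (- (norm x)\<^sup>2 / (2 * \<epsilon>))"
  using exp_sum_Basis[of "1 / (2 * \<epsilon>)" x] by (simp add: prod.distrib)
 finally show "(LBINT y. cexp (- \<epsilon> * (norm y)\<^sup>2 / 2) * cis (y \<bullet> x))
    = cor (sqrt (2 * pi / \<epsilon>) ^ DIM('a) * exp (- (norm x)\<^sup>2 / (2 * \<epsilon>)))" .
qed

lemma integrable_gaussian:
 assumes "c > 0"
 shows "integrable lborel (\<lambda>y::'a::euclidean_space. exp (- c * (norm y)\<^sup>2))"
 using integrable_Re[OF gaussian_fourier(1)[of "2 * c" "0::'a"]] assms by simp

section \<open>Laplace transforms in a vertical strip\<close>

lemma norm_exp_minus_1_le: "norm (exp w - 1) \<le> norm w * exp (norm w)" for w :: complex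
proof -
 have "norm (exp w - exp 0) \<le> exp (norm w) * norm (w - 0)"
 proof (rule field_differentiable_bound[where S="cball 0 (norm w)" and f'=exp])
  show "norm (exp z) \<le> exp (norm w)" if "z \<in> cball 0 (norm w)" for z using that norm_exp[of z] by (auto intro: order_trans)
 qed (auto intro!: DERIV_exp has_field_derivative_at_within)
 then show ?thesis by (simp add: mult.commute)
qed

text \<open>The derivative may be taken under the integral because the strip is open: the difference
  quotients are dominated at the cost of a small part of the exponential moment.\<close>

lemma holomorphic_laplace:
 fixes u :: "real \<Rightarrow> complex"
 assumes [measurable]: "u \<in> Borel" and \<delta>: "\<delta> > 0"
  and int: "integrable lborel (\<lambda>a. norm (u a) * exp (\<delta> * abs a))"
 shows "(\<lambda>z. (LBINT a. u a * exp (z * cor a))) holomorphic_on {z. (abs (Re z)) < \<delta>}"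
proof -
 have expint: "integrable lborel (\<lambda>a. u a * exp (z * cor a))" if "abs (Re z) < \<delta>" for z
 proof (rule Bochner_Integration.integrable_bound[OF int])
  have "Re z * a \<le> \<delta> * abs a" for a
  proof -
   have "Re z * a \<le> abs (Re z) * abs a" by (metis abs_ge_self abs_mult)
   also have "... \<le> \<delta> * abs a" using that by (intro mult_right_mono) auto
   finally show ?thesis .
  qed
  then show "AE a in lborel. norm (u a * exp (z * cor a)) \<le> norm (norm (u a) * exp (\<delta> * abs a))"
   by (intro AE_I2) (simp add: norm_mult mult_left_mono)
 qed measurable
 have D: "((\<lambda>z. (LBINT a. u a * exp (z * cor a))) has_field_derivative
   (LBINT a. u a * (a * exp (z * cor a)))) (at z)" if z: "abs (Re z) < \<delta>" for z
 proof -
  \<comment> \<open>Twice \<open>\<eta>\<close> is the distance to the boundary of the strip. One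
    \<open>\<eta>\<close> bounds the increment, the other pays for the factor \<open>abs a\<close>
    produced by differentiation.\<close>
  define \<eta> where "\<eta> = (\<delta> - abs (Re z)) / 2"
  have \<eta>: "\<eta> > 0" using z by (simp add: \<eta>_def)
  have "((\<lambda>h. ((LBINT a. u a * exp ((z + h) * cor a)) - (LBINT a. u a * exp (z * cor a))) / h)
    \<longlongrightarrow> (LBINT a. u a * (a * exp (z * cor a)))) (at 0)" unfolding tendsto_at_iff_sequentially
  proof (intro allI impI)
   fix X :: "nat \<Rightarrow> complex" assume X: "\<forall>i. X i \<in> UNIV - {0}" "X \<longlonglongrightarrow> 0"
   from X(2) \<eta> have "\<forall>\<^sub>F i in sequentially. norm (X i) < \<eta>" by (simp add: LIMSEQ_iff eventually_sequentially)
   then obtain N where N: "\<And>i. i \<ge> N \<Longrightarrow> norm (X i) < \<eta>" by (auto simp: eventually_sequentially)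
   have XN: "(\<lambda>i. X (i + N)) \<longlonglongrightarrow> 0" using X(2) by (rule LIMSEQ_ignore_initial_segment)
   have small: "abs (Re (z + X (i + N))) < \<delta>" for i
   proof -
    have "abs (Re (X (i + N))) < \<eta>" using N[of "i+N"] abs_Re_le_cmod[of "X (i+N)"] by linarith
    then show ?thesis using z by (simp add: \<eta>_def)
   qed
   have q: "((LBINT a. u a * exp ((z + X (i+N)) * cor a)) - (LBINT a. u a * exp (z * cor a))) / X (i+N)
    = (LBINT a. u a * exp (z * cor a) * ((exp (X (i+N) * cor a) - 1) / X (i+N)))" for i
   proof -
    have "(LBINT a. u a * exp ((z + X (i+N)) * cor a)) - (LBINT a. u a * exp (z * cor a))
     = (LBINT a. u a * exp ((z + X (i+N)) * cor a) - u a * exp (z * cor a))"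
     by (rule Bochner_Integration.integral_diff[symmetric, OF expint[OF small] expint[OF z]])
    also have "... / X (i+N) = (LBINT a. (u a * exp ((z + X (i+N)) * cor a) - u a * exp (z * cor a)) / X (i+N))"
     by (rule integral_divide_zero[symmetric])
    also have "(\<lambda>a. (u a * exp ((z + X (i+N)) * cor a) - u a * exp (z * cor a)) / X (i+N))
     = (\<lambda>a. u a * exp (z * cor a) * ((exp (X (i+N) * cor a) - 1) / X (i+N)))"
     by (rule ext) (simp add: distrib_right exp_add right_diff_distrib mult.assoc)
    finally show ?thesis .
   qed
   have "(\<lambda>i. (LBINT a. u a * exp (z * cor a) * ((exp (X (i+N) * cor a) - 1) / X (i+N))))
     \<longlonglongrightarrow> (LBINT a. u a * (a * exp (z * cor a)))"
   proof (rule integral_dominated_convergence[where w="\<lambda>a. (norm (u a) * exp (\<delta> * abs a)) * (1 / \<eta>)"])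
    show "integrable lborel (\<lambda>a. (norm (u a) * exp (\<delta> * abs a)) * (1 / \<eta>))" using int by (rule integrable_mult_left)
    show "AE a in lborel. (\<lambda>i. u a * exp (z * cor a) * ((exp (X (i+N) * cor a) - 1) / X (i+N)))
      \<longlonglongrightarrow> u a * (a * exp (z * cor a))"
    proof (intro AE_I2)
     fix a :: real
     have "((\<lambda>w. exp (w * cor a)) has_field_derivative a) (at 0)" by (auto intro!: derivative_eq_intros)
     then have "((\<lambda>h. (exp (h * cor a) - 1) / h) \<longlongrightarrow> a) (at 0)" by (simp add: DERIV_def)
     then have "(\<lambda>i. (exp (X (i+N) * cor a) - 1) / X (i+N)) \<longlonglongrightarrow> a"
      by (rule filterlim_compose) (use X(1) XN in \<open>auto simp: filterlim_at\<close>)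
     then have "(\<lambda>i. u a * exp (z * cor a) * ((exp (X (i+N) * cor a) - 1) / X (i+N)))
       \<longlonglongrightarrow> u a * exp (z * cor a) * a" by (intro tendsto_mult tendsto_const)
     then show "(\<lambda>i. u a * exp (z * cor a) * ((exp (X (i+N) * cor a) - 1) / X (i+N)))
      \<longlonglongrightarrow> u a * (a * exp (z * cor a))" by (simp add: mult_ac)
    qed
    show "AE a in lborel. norm (u a * exp (z * cor a) * ((exp (X (i+N) * cor a) - 1) / X (i+N)))
      \<le> (norm (u a) * exp (\<delta> * abs a)) * (1 / \<eta>)" for i
    proof (intro AE_I2)
     fix a :: real
     let ?h = "X (i+N)"
     have h0: "?h \<noteq> 0" using X(1) by auto
     have "norm ((exp (?h * cor a) - 1) / ?h) \<le> abs a * exp (norm ?h * abs a)" using norm_exp_minus_1_le[of "?h * cor a"] h0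
      by (simp add: norm_divide norm_mult divide_le_eq mult_ac)
     also have "... \<le> abs a * exp (\<eta> * abs a)" using N[of "i+N"] by (intro mult_left_mono) (auto intro: mult_right_mono)
     also have "... \<le> (exp (\<eta> * abs a) / \<eta>) * exp (\<eta> * abs a)"
     proof (rule mult_right_mono)
      have "\<eta> * abs a \<le> exp (\<eta> * abs a)" using exp_ge_add_one_self[of "\<eta> * abs a"] by linarith
      then show "abs a \<le> exp (\<eta> * abs a) / \<eta>" using \<eta> by (simp add: field_simps)
     qed simp
     finally have 1: "norm ((exp (?h * cor a) - 1) / ?h) \<le> exp (2 * \<eta> * abs a) / \<eta>" by (simp add: exp_add[symmetric] algebra_simps)
     have 2: "norm (exp (z * cor a)) \<le> exp (abs (Re z) * abs a)" by (simp, metis abs_ge_self abs_mult)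
     have "norm (u a * exp (z * cor a) * ((exp (?h * cor a) - 1) / ?h))
       \<le> norm (u a) * exp (abs (Re z) * abs a) * (exp (2 * \<eta> * abs a) / \<eta>)"
      unfolding norm_mult using 1 2 by (intro mult_mono) (auto simp: \<eta> less_imp_le)
     also have "... = norm (u a) * exp (abs (Re z) * abs a + 2 * \<eta> * abs a) * (1 / \<eta>)" by (simp add: exp_add)
     also have "abs (Re z) * abs a + 2 * \<eta> * abs a = \<delta> * abs a" by (simp add: \<eta>_def field_simps)
     finally show "norm (u a * exp (z * cor a) * ((exp (?h * cor a) - 1) / ?h))
      \<le> (norm (u a) * exp (\<delta> * abs a)) * (1 / \<eta>)" .
    qed
   qed measurable
   then have "(\<lambda>i. ((LBINT a. u a * exp ((z + X (i+N)) * cor a)) - (LBINT a. u a * exp (z * cor a))) / X (i+N))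
     \<longlonglongrightarrow> (LBINT a. u a * (a * exp (z * cor a)))" unfolding q .
   from LIMSEQ_offset[OF this]
   show "((\<lambda>h. ((LBINT a. u a * exp ((z + h) * cor a)) - (LBINT a. u a * exp (z * cor a))) / h) \<circ> X)
    \<longlonglongrightarrow> (LBINT a. u a * (a * exp (z * cor a)))" by (simp add: comp_def)
  qed
  then show ?thesis by (simp add: DERIV_def)
 qed
 have "open {z. (abs (Re z)) < \<delta>}" by (intro open_Collect_less continuous_intros)
 then show ?thesis using D by (subst holomorphic_on_open) auto
qed

section \<open>Orthonormal systems\<close>

definition L2_inner :: "('a::euclidean_space \<Rightarrow> complex) \<Rightarrow> ('a \<Rightarrow> complex) \<Rightarrow> complex" where
 "L2_inner f g = (LBINT x. f x * cnj (g x))"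

lemma L2_fun_borel [measurable_dest]: "L2_fun f \<Longrightarrow> f \<in> Borel"
 by (simp add: L2_fun_def)

lemma borel_measurable_cnj [measurable (raw)]:
 "f \<in> borel_measurable M \<Longrightarrow> (\<lambda>x. cnj (f x)) \<in> borel_measurable M"
 by (rule borel_measurable_continuous_on[of cnj]) (auto intro: continuous_intros)

lemma L2_fun_zero: "L2_fun (\<lambda>x. 0)"
 by (simp add: L2_fun_def)

lemma L2_fun_scale: "L2_fun f \<Longrightarrow> L2_fun (\<lambda>x. c * f x)"
 by (auto simp: L2_fun_def norm_mult power_mult_distrib)

lemma L2_fun_add:
 assumes "L2_fun f" "L2_fun g"
 shows "L2_fun (\<lambda>x. f x + g x)"
proof -
 have [measurable]: "f \<in> Borel" "g \<in> Borel" using assms by (simp_all add: L2_fun_def)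
 have "integrable lborel (\<lambda>x. 2 * (norm (f x))\<^sup>2 + 2 * (norm (g x))\<^sup>2)" using assms by (auto simp: L2_fun_def)
 then have "integrable lborel (\<lambda>x. (norm (f x + g x))\<^sup>2)"
 proof (rule Bochner_Integration.integrable_bound)
  have "(norm (f x + g x))\<^sup>2 \<le> 2 * (norm (f x))\<^sup>2 + 2 * (norm (g x))\<^sup>2" for x
  proof -
   have "(norm (f x + g x))\<^sup>2 \<le> (norm (f x) + norm (g x))\<^sup>2" by (intro power_mono norm_triangle_ineq) auto
   also have "... \<le> 2 * (norm (f x))\<^sup>2 + 2 * (norm (g x))\<^sup>2"
    using zero_le_power2[of "norm (f x) - norm (g x)"] by (simp add: power2_sum power2_diff)
   finally show ?thesis .
  qed
  then show "AE x in lborel. norm ((norm (f x + g x))\<^sup>2) \<le> norm (2 * (norm (f x))\<^sup>2 + 2 * (norm (g x))\<^sup>2)"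
   by (intro AE_I2) (simp add: abs_of_nonneg)
 qed measurable
 then show ?thesis by (simp add: L2_fun_def)
qed

lemma L2_fun_diff: "L2_fun f \<Longrightarrow> L2_fun g \<Longrightarrow> L2_fun (\<lambda>x. f x - g x)"
 using L2_fun_add[of f "\<lambda>x. (-1) * g x"] L2_fun_scale[of g "-1"] by simp

lemma L2_fun_sum: "finite J \<Longrightarrow> (\<And>j. j \<in> J \<Longrightarrow> L2_fun (f j)) \<Longrightarrow> L2_fun (\<lambda>x. \<Sum>j\<in>J. f j x)"
 by (induction J rule: finite_induct) (auto intro: L2_fun_zero L2_fun_add)

lemma L2_fun_mult_integrable:
 assumes "L2_fun f" "L2_fun g"
 shows "integrable lborel (\<lambda>x. f x * cnj (g x))"
proof -
 have [measurable]: "f \<in> Borel" "g \<in> Borel" using assms by (simp_all add: L2_fun_def)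
 have "integrable lborel (\<lambda>x. (norm (f x))\<^sup>2 + (norm (g x))\<^sup>2)" using assms by (auto simp: L2_fun_def)
 then show ?thesis
 proof (rule Bochner_Integration.integrable_bound)
  have "norm (f x) * norm (g x) \<le> (norm (f x))\<^sup>2 + (norm (g x))\<^sup>2" for x
  proof -
   have "0 \<le> norm (f x) * norm (g x)" by simp
   then show ?thesis using sum_squares_bound[of "norm (f x)" "norm (g x)"] by linarith
  qed
  then show "AE x in lborel. norm (f x * cnj (g x)) \<le> norm ((norm (f x))\<^sup>2 + (norm (g x))\<^sup>2)" by (intro AE_I2) (simp add: norm_mult)
 qed measurable
qed

lemma L2_inner_add: "L2_fun f \<Longrightarrow> L2_fun g \<Longrightarrow> L2_fun h \<Longrightarrow>
  L2_inner (\<lambda>x. f x + g x) h = L2_inner f h + L2_inner g h"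
 using L2_fun_mult_integrable[of f h] L2_fun_mult_integrable[of g h] by (simp add: L2_inner_def distrib_right)

lemma L2_inner_diff: "L2_fun f \<Longrightarrow> L2_fun g \<Longrightarrow> L2_fun h \<Longrightarrow>
  L2_inner (\<lambda>x. f x - g x) h = L2_inner f h - L2_inner g h"
 using L2_fun_mult_integrable[of f h] L2_fun_mult_integrable[of g h] by (simp add: L2_inner_def left_diff_distrib)

lemma L2_inner_scale: "L2_inner (\<lambda>x. c * f x) h = c * L2_inner f h"
 by (simp add: L2_inner_def mult.assoc)

lemma L2_inner_cnj: "cnj (L2_inner f g) = L2_inner g f"
 unfolding L2_inner_def Bochner_Integration.integral_cnj[symmetric] by (simp add: mult.commute del: Bochner_Integration.integral_cnj)

lemma L2_inner_sum: "finite J \<Longrightarrow> (\<And>j. j \<in> J \<Longrightarrow> L2_fun (f j)) \<Longrightarrow> L2_fun h \<Longrightarrow>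
  L2_inner (\<lambda>x. \<Sum>j\<in>J. f j x) h = (\<Sum>j\<in>J. L2_inner (f j) h)"
proof (induction J rule: finite_induct)
 case (insert j J)
 then show ?case by (simp add: L2_inner_add L2_fun_sum)
qed (simp add: L2_inner_def)

lemma L2_inner_self: "L2_inner f f = cor (LBINT x. (norm (f x))\<^sup>2)"
 by (simp add: L2_inner_def complex_norm_square[symmetric] del: of_real_power)

lemma nn_integral_L2: "L2_fun f \<Longrightarrow> (NN x. nrmsq (f x)) = ennreal (LBINT x. (norm (f x))\<^sup>2)"
 by (rule nn_integral_eq_integral) (auto simp: L2_fun_def)

lemma L2_funI:
 assumes [measurable]: "f \<in> Borel" and "(NN x. nrmsq (f x)) < \<infinity>"
 shows "L2_fun f"
 using assms(2) by (simp add: L2_fun_def integrable_iff_bounded)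

lemma L2_funD: "L2_fun f \<Longrightarrow> (NN x. nrmsq (f x)) < \<infinity>"
 by (simp add: nn_integral_L2)

lemma L2_norm_diff:
 assumes f: "L2_fun f" and g: "L2_fun g"
 shows "(LBINT x. (norm (f x - g x))\<^sup>2)
  = (LBINT x. (norm (f x))\<^sup>2) + (LBINT x. (norm (g x))\<^sup>2) - 2 * Re (L2_inner f g)"
proof -
 have "L2_inner (\<lambda>x. f x - g x) (\<lambda>x. f x - g x)
  = L2_inner f (\<lambda>x. f x - g x) - L2_inner g (\<lambda>x. f x - g x)" by (intro L2_inner_diff f g L2_fun_diff)
 also have "L2_inner f (\<lambda>x. f x - g x) = cnj (L2_inner f f - L2_inner g f)"
  unfolding L2_inner_diff[OF f g f, symmetric] by (simp add: L2_inner_cnj)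
 also have "L2_inner g (\<lambda>x. f x - g x) = cnj (L2_inner f g - L2_inner g g)"
  unfolding L2_inner_diff[OF f g g, symmetric] by (simp add: L2_inner_cnj)
 finally have "L2_inner (\<lambda>x. f x - g x) (\<lambda>x. f x - g x)
   = L2_inner f f - L2_inner f g - L2_inner g f + L2_inner g g" by (simp add: L2_inner_cnj)
 then have "Re (L2_inner (\<lambda>x. f x - g x) (\<lambda>x. f x - g x))
   = Re (L2_inner f f) - Re (L2_inner f g) - Re (cnj (L2_inner f g)) + Re (L2_inner g g)" by (simp add: L2_inner_cnj)
 then show ?thesis by (simp add: L2_inner_self)
qed

lemma L2_Cauchy_Schwarz:
 assumes "L2_fun f" "L2_fun g"
 shows "(norm (L2_inner f g))\<^sup>2 \<le> (LBINT x. (norm (f x))\<^sup>2) * (LBINT x. (norm (g x))\<^sup>2)"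
proof -
 have [measurable]: "f \<in> Borel" "g \<in> Borel" using assms by (simp_all add: L2_fun_def)
 have "nrm (L2_inner f g) \<le> (NN x. norm (f x * cnj (g x)))"
  unfolding L2_inner_def by (intro integral_norm_bound_ennreal L2_fun_mult_integrable assms)
 also have "... = (NN x. nrm (f x) * nrm (g x))" by (simp add: norm_mult ennreal_mult)
 finally have "(nrm (L2_inner f g))\<^sup>2 \<le> (NN x. nrm (f x) * nrm (g x))\<^sup>2" by (intro power_mono) auto
 also have "... \<le> (NN x. (nrm (f x))\<^sup>2) * (NN x. (nrm (g x))\<^sup>2)" by (rule Cauchy_Schwarz_nn_integral) auto
 also have "... = ennreal ((LBINT x. (norm (f x))\<^sup>2) * (LBINT x. (norm (g x))\<^sup>2))"
  using assms by (simp add: ennreal_power nn_integral_L2 ennreal_mult)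
 finally show ?thesis by (simp add: ennreal_power)
qed

text \<open>Zero vectors are admitted, so that Gram--Schmidt needs no reindexing.\<close>

definition orthonormal_system :: "(nat \<Rightarrow> 'a::euclidean_space \<Rightarrow> complex) \<Rightarrow> nat set \<Rightarrow> bool" where
 "orthonormal_system b I \<longleftrightarrow> (\<forall>j. L2_fun (b j)) \<and>
   (\<forall>j k. L2_inner (b j) (b k) = of_bool (j = k \<and> j \<in> I))"

lemma orthonormal_system_L2: "orthonormal_system b I \<Longrightarrow> L2_fun (b j)"
 by (simp add: orthonormal_system_def)

lemma orthonormal_system_inner: "orthonormal_system b I \<Longrightarrow> L2_inner (b j) (b k) = of_bool (j = k \<and> j \<in> I)"
 by (simp add: orthonormal_system_def)

lemma orthonormal_system_zero:
 assumes on: "orthonormal_system b I" and j: "j \<notin> I"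
 shows "AE x in lborel. b j x = 0"
proof -
 have "(LBINT x. (norm (b j x))\<^sup>2) = 0" using orthonormal_system_inner[OF on, of j j] j by (simp add: L2_inner_self)
 moreover have "integrable lborel (\<lambda>x. (norm (b j x))\<^sup>2)" using orthonormal_system_L2[OF on, of j] by (simp add: L2_fun_def)
 ultimately have "AE x in lborel. (norm (b j x))\<^sup>2 = 0" by (subst (asm) integral_nonneg_eq_0_iff_AE) auto
 then show ?thesis by simp
qed

lemma integral_orthonormal_zero:
 assumes on: "orthonormal_system b I" and j: "j \<notin> I"
 shows "(LBINT x. h x * cnj (b j x)) = 0"
 by (rule integral_eq_zero_AE) (use orthonormal_system_zero[OF assms] in eventually_elim, simp)

lemma inner_combination:
 assumes on: "orthonormal_system b I" and J: "finite J" and c0: "\<And>j. j \<notin> I \<Longrightarrow> c j = 0"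
 shows "L2_inner (\<lambda>x. \<Sum>j\<in>J. c j * b j x) (b k) = (if k \<in> J then c k else 0)"
proof -
 have "L2_inner (\<lambda>x. \<Sum>j\<in>J. c j * b j x) (b k) = (\<Sum>j\<in>J. c j * L2_inner (b j) (b k))"
  by (subst L2_inner_sum) (auto intro!: J L2_fun_scale orthonormal_system_L2[OF on] simp: L2_inner_scale)
 also have "... = (\<Sum>j\<in>J. if j = k then c k else 0)" by (intro sum.cong) (auto simp: orthonormal_system_inner[OF on] c0)
 finally show ?thesis using J by simp
qed

lemma norm_combination:
 assumes on: "orthonormal_system b I" and J: "finite J" and c0: "\<And>j. j \<notin> I \<Longrightarrow> c j = 0"
 shows "(LBINT x. (norm (\<Sum>j\<in>J. c j * b j x))\<^sup>2) = (\<Sum>j\<in>J. (norm (c j))\<^sup>2)"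
proof -
 let ?s = "\<lambda>x. \<Sum>j\<in>J. c j * b j x"
 have s: "L2_fun ?s" by (intro L2_fun_sum J L2_fun_scale orthonormal_system_L2[OF on])
 have "L2_inner ?s ?s = (\<Sum>j\<in>J. c j * L2_inner (b j) ?s)"
  by (subst L2_inner_sum) (auto intro!: J s L2_fun_scale orthonormal_system_L2[OF on] simp: L2_inner_scale)
 also have "... = (\<Sum>j\<in>J. c j * cnj (L2_inner ?s (b j)))" by (simp add: L2_inner_cnj)
 also have "... = (\<Sum>j\<in>J. c j * cnj (c j))" by (intro sum.cong refl) (simp add: inner_combination[OF on J c0])
 also have "... = cor (\<Sum>j\<in>J. (norm (c j))\<^sup>2)" by (simp add: complex_norm_square[symmetric] del: of_real_power)
 finally show ?thesis unfolding L2_inner_self of_real_eq_iff .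
qed

lemma bessel_finite:
 assumes on: "orthonormal_system b I" and J: "finite J" and h: "L2_fun h"
 shows "(\<Sum>j\<in>J. (norm (L2_inner h (b j)))\<^sup>2) \<le> (LBINT x. (norm (h x))\<^sup>2)"
proof -
 let ?c = "\<lambda>j. L2_inner h (b j)"
 let ?s = "\<lambda>x. \<Sum>j\<in>J. ?c j * b j x"
 have c0: "?c j = 0" if "j \<notin> I" for j unfolding L2_inner_def by (rule integral_orthonormal_zero[OF on that])
 have s: "L2_fun ?s" by (intro L2_fun_sum J L2_fun_scale orthonormal_system_L2[OF on])
 have "L2_inner h ?s = cnj (\<Sum>j\<in>J. ?c j * L2_inner (b j) h)" by (subst L2_inner_cnj[symmetric], subst L2_inner_sum)
    (auto intro!: J h L2_fun_scale orthonormal_system_L2[OF on] simp: L2_inner_scale)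
 also have "... = (\<Sum>j\<in>J. cnj (?c j) * ?c j)" by (simp add: L2_inner_cnj)
 also have "... = cor (\<Sum>j\<in>J. (norm (?c j))\<^sup>2)" by (simp add: complex_norm_square[symmetric] mult.commute del: of_real_power)
 finally have i: "Re (L2_inner h ?s) = (\<Sum>j\<in>J. (norm (?c j))\<^sup>2)" by simp
 have "0 \<le> (LBINT x. (norm (h x - ?s x))\<^sup>2)" by simp
 also have "... = (LBINT x. (norm (h x))\<^sup>2) - (\<Sum>j\<in>J. (norm (?c j))\<^sup>2)"
  by (subst L2_norm_diff[OF h s], subst norm_combination[OF on J c0]) (simp_all add: i)
 finally show ?thesis by simp
qed

lemma bessel:
 assumes on: "orthonormal_system b I" and [measurable]: "h \<in> Borel"
 shows "(\<Sum>j. nrmsq (L2_inner h (b j))) \<le> (NN x. nrmsq (h x))"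
proof (cases "(NN x. nrmsq (h x)) < \<infinity>")
 case True
 then have h: "L2_fun h" by (intro L2_funI) auto
 show ?thesis by (intro suminf_le_const) (auto simp: nn_integral_L2[OF h] intro!: ennreal_leI bessel_finite[OF on _ h] simp del: of_real_power)
next
 case False
 then have "(NN x. nrmsq (h x)) = \<infinity>" by (simp add: less_top[symmetric])
 then show ?thesis by simp
qed

section \<open>Completeness of \<open>L\<^sup>2\<close> and Parseval's inequality\<close>

text \<open>The partial sums are Cauchy in \<open>L\<^sup>2\<close>. A subsequence with rapidly
  shrinking tails converges almost everywhere, and Fatou's lemma shows that the pointwise limit is
  also the limit in the mean.\<close>

theorem riesz_fischer:
 fixes b :: "nat \<Rightarrow> 'a::euclidean_space \<Rightarrow> complex"
 assumes on: "orthonormal_system b I" and c0: "\<And>j. j \<notin> I \<Longrightarrow> c j = 0"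
  and sm: "summable (\<lambda>j. (norm (c j))\<^sup>2)"
 obtains h where "L2_fun h" "\<And>j. L2_inner h (b j) = c j"
  "(LBINT x. (norm (h x))\<^sup>2) \<le> (\<Sum>j. (norm (c j))\<^sup>2)"
proof -
 define S where "S n x = (\<Sum>j<n. c j * b j x)" for n x
 have SL[simp]: "L2_fun (S n)" for n unfolding S_def by (intro L2_fun_sum L2_fun_scale orthonormal_system_L2[OF on]) auto
 have Sm[measurable]: "S n \<in> Borel" for n by (rule L2_fun_borel[OF SL])
 have Sd: "(LBINT x. (norm (S n x - S m x))\<^sup>2) = (\<Sum>j\<in>{m..<n}. (norm (c j))\<^sup>2)" if "m \<le> n" for m n
 proof -
  have "S n x - S m x = (\<Sum>j\<in>{m..<n}. c j * b j x)" for x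
   unfolding S_def using that by (simp add: sum_diff_nat_ivl atLeast0LessThan[symmetric])
  then show ?thesis by (simp add: norm_combination[OF on _ c0])
 qed
 define tail where "tail n = (\<Sum>j. (norm (c (j + n)))\<^sup>2)" for n
 have tail_le: "(\<Sum>j\<in>{m..<n}. (norm (c j))\<^sup>2) \<le> tail m" if "m \<le> n" for m n
 proof -
  have "(\<Sum>j\<in>{m..<n}. (norm (c j))\<^sup>2) = (\<Sum>j<n - m. (norm (c (j + m)))\<^sup>2)"
   using that sum.shift_bounds_nat_ivl[of "\<lambda>j. (norm (c j))\<^sup>2" 0 m "n - m"] by (simp add: atLeast0LessThan)
  also have "... \<le> tail m"
   unfolding tail_def using sm by (intro sum_le_suminf) (auto simp: summable_iff_shift[of "\<lambda>j. (norm (c j))\<^sup>2"])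
  finally show ?thesis .
 qed
 have tail0: "tail \<longlonglongrightarrow> 0" unfolding tail_def using suminf_exist_split2[OF sm] by simp
 have tailnn: "tail n \<ge> 0" for n unfolding tail_def by (intro suminf_nonneg) (auto simp: sm summable_iff_shift[of "\<lambda>j. (norm (c j))\<^sup>2"])
 \<comment> \<open>Tails below \<open>(1/4)^k\<close> leave a convergent geometric series even after
   multiplication by \<open>2^k\<close>, and that factor is what forces the differences to be
   summable pointwise.\<close>
 have "\<exists>P. \<forall>n\<ge>P. tail n < (1/4)^k" for k :: nat
  using order_tendstoD(2)[OF tail0, of "(1/4)^k"] by (simp add: eventually_sequentially)
 then obtain P where P: "\<And>k n. n \<ge> P k \<Longrightarrow> tail n < (1/4)^k" by metis
 \<comment> \<open>Adding up the \<open>P i\<close> makes the indices increasing without a recursive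
   choice.\<close>
 define Q where "Q k = k + (\<Sum>i\<le>k. P i)" for k
 have Q: "Q k \<ge> k" "Q k \<ge> P k" "Q k \<le> Q (Suc k)" for k unfolding Q_def by (auto intro!: trans_le_add2 member_le_sum)
 define T where "T k = S (Q k)" for k
 have Td: "(NN x. nrmsq (T (Suc k) x - T k x)) \<le> ennreal ((1/4)^k)" for k
 proof -
  have "L2_fun (\<lambda>x. T (Suc k) x - T k x)" unfolding T_def by (intro L2_fun_diff SL)
  then show ?thesis using Sd[OF Q(3)[of k]] tail_le[OF Q(3)[of k]] P[OF Q(2)[of k]] by (auto simp: nn_integral_L2 T_def intro!: ennreal_leI)
 qed
 have [measurable]: "T k \<in> Borel" for k unfolding T_def by measurable
 have "(NN x. (\<Sum>k. ennreal (2^k) * nrmsq (T (Suc k) x - T k x)))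
   = (\<Sum>k. ennreal (2^k) * (NN x. nrmsq (T (Suc k) x - T k x)))" by (simp add: nn_integral_suminf nn_integral_cmult)
 also have "... \<le> (\<Sum>k. ennreal ((1/2)^k))"
 proof (intro suminf_le summableI)
  fix k :: nat
  have "ennreal (2^k) * (NN x. nrmsq (T (Suc k) x - T k x)) \<le> ennreal (2^k) * ennreal ((1/4)^k)"
   by (intro mult_left_mono Td) auto
  also have "... = ennreal ((1/2)^k)" by (simp add: ennreal_mult[symmetric] power_mult_distrib[symmetric])
  finally show "ennreal (2^k) * (NN x. nrmsq (T (Suc k) x - T k x)) \<le> ennreal ((1/2)^k)" .
 qed
 also have "... = ennreal (\<Sum>k. (1/2)^k)" by (intro suminf_ennreal2 summable_geometric) auto
 also have "... < \<infinity>" by simp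
 finally have fin: "(NN x. (\<Sum>k. ennreal (2^k) * nrmsq (T (Suc k) x - T k x))) < \<infinity>" .
 have "AE x in lborel. (\<Sum>k. ennreal (2^k) * nrmsq (T (Suc k) x - T k x)) \<noteq> \<infinity>"
  by (rule nn_integral_noteq_infinite) (use fin in auto)
 then have conv: "AE x in lborel. (\<lambda>k. T k x) \<longlonglongrightarrow> lim (\<lambda>k. T k x)"
 proof eventually_elim
  case (elim x)
  let ?d = "\<lambda>k. T (Suc k) x - T k x"
  have "summable (\<lambda>k. 2^k * (norm (?d k))\<^sup>2)" using elim by (intro summable_suminf_not_top) (auto simp: ennreal_mult)
  then have "summable (\<lambda>k. (1/2)^k + 2^k * (norm (?d k))\<^sup>2)" by (intro summable_add summable_geometric) auto
  then have "summable ?d"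
  proof (rule summable_comparison_test'[where N=0])
   fix k :: nat
   show "norm (?d k) \<le> (1/2)^k + 2^k * (norm (?d k))\<^sup>2"
   \<comment> \<open>A difference is at most \<open>(1/2)^k\<close>, or else at most
     \<open>2^k\<close> times its square.\<close>
   proof (cases "norm (?d k) \<le> (1/2)^k")
    case False
    then have "1 \<le> 2^k * norm (?d k)" by (simp add: field_simps power_one_over)
    then have "norm (?d k) * 1 \<le> norm (?d k) * (2^k * norm (?d k))" by (intro mult_left_mono) auto
    then show ?thesis by (simp add: power2_eq_square mult_ac add_increasing)
   qed (simp add: add_increasing2)
  qed
  then have "convergent (\<lambda>n. \<Sum>k<n. ?d k)" by (simp add: summable_iff_convergent)
  then have "convergent (\<lambda>n. T n x - T 0 x)" using sum_lessThan_telescope[of "\<lambda>n. T n x"] by simp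
  then have "convergent (\<lambda>n. T n x)" using convergent_diff_const_right_iff[of "\<lambda>n. T n x" "T 0 x"] by simp
  then show ?case by (simp add: convergent_LIMSEQ_iff)
 qed
 define h where "h x = lim (\<lambda>k. T k x)" for x
 have [measurable]: "h \<in> Borel" unfolding h_def by measurable
 have hS: "(NN x. nrmsq (h x - S n x)) \<le> ennreal (tail n)" for n
 proof -
  have "(NN x. nrmsq (h x - S n x))
    = (NN x. liminf (\<lambda>k. nrmsq (T (k + n) x - S n x)))"
  proof (rule nn_integral_cong_AE)
   show "AE x in lborel. nrmsq (h x - S n x) = liminf (\<lambda>k. nrmsq (T (k + n) x - S n x))" using conv
   proof eventually_elim
    case (elim x)
    then have "(\<lambda>k. T (k + n) x) \<longlonglongrightarrow> h x" unfolding h_def by (rule LIMSEQ_ignore_initial_segment)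
    then have "(\<lambda>k. nrmsq (T (k + n) x - S n x)) \<longlonglongrightarrow> nrmsq (h x - S n x)"
     by (intro tendsto_intros)
    then show ?case by (intro lim_imp_Liminf[symmetric]) auto
   qed
  qed
  also have "... \<le> liminf (\<lambda>k. (NN x. nrmsq (T (k + n) x - S n x)))" by (rule nn_integral_liminf) measurable
  also have "... \<le> liminf (\<lambda>k::nat. ennreal (tail n))"
  proof (intro Liminf_mono always_eventually allI)
   fix k
   have "n \<le> Q (k + n)" using Q(1)[of "k+n"] by simp
   moreover have "L2_fun (\<lambda>x. S (Q (k + n)) x - S n x)" by (intro L2_fun_diff SL)
   ultimately show "(NN x. nrmsq (T (k + n) x - S n x)) \<le> ennreal (tail n)"
    by (simp add: T_def nn_integral_L2 Sd tail_le ennreal_leI)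
  qed
  also have "... = ennreal (tail n)" by (simp add: Liminf_const)
  finally show ?thesis .
 qed
 have S0: "S 0 x = 0" for x by (simp add: S_def)
 have hL: "L2_fun h" using hS[of 0] by (intro L2_funI) (auto simp: S0 less_top intro: le_less_trans)
 have hn: "(LBINT x. (norm (h x))\<^sup>2) \<le> (\<Sum>j. (norm (c j))\<^sup>2)"
  using hS[of 0] tailnn[of 0] by (simp add: S0 nn_integral_L2[OF hL] tail_def)
 have hc: "L2_inner h (b j) = c j" for j
 proof -
  have bnd: "(norm (L2_inner h (b j) - c j))\<^sup>2 \<le> tail n" if "n > j" for n
  proof -
   have "L2_inner (S n) (b j) = c j" using inner_combination[OF on, of "{..<n}" c j] c0 that by (simp add: S_def[abs_def])
   then have "L2_inner h (b j) - c j = L2_inner (\<lambda>x. h x - S n x) (b j)"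
    by (subst L2_inner_diff) (auto intro: hL orthonormal_system_L2[OF on])
   then have "(norm (L2_inner h (b j) - c j))\<^sup>2
     \<le> (LBINT x. (norm (h x - S n x))\<^sup>2) * (LBINT x. (norm (b j x))\<^sup>2)"
    using L2_Cauchy_Schwarz[OF L2_fun_diff[OF hL SL] orthonormal_system_L2[OF on]] by simp
   also have "(LBINT x. (norm (h x - S n x))\<^sup>2) \<le> tail n"
    using hS[of n] tailnn[of n] by (simp add: nn_integral_L2[OF L2_fun_diff[OF hL SL]])
   also have "(LBINT x. (norm (b j x))\<^sup>2) \<le> 1"
    using orthonormal_system_inner[OF on, of j j] by (cases "j \<in> I") (simp_all add: L2_inner_self)
   finally show ?thesis using tailnn[of n] by (simp add: mult_left_mono mult_right_mono)
  qed
  have "(norm (L2_inner h (b j) - c j))\<^sup>2 \<le> 0"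
  proof (rule tendsto_lowerbound[OF tail0])
   show "\<forall>\<^sub>F n in sequentially. (norm (L2_inner h (b j) - c j))\<^sup>2 \<le> tail n"
    using bnd by (auto simp: eventually_sequentially intro!: exI[of _ "Suc j"])
  qed simp
  then show ?thesis by simp
 qed
 from that[OF hL hc hn] show thesis .
qed

text \<open>Nothing is known beforehand about the size of \<open>h\<close>. If its coefficients are
  square summable, Riesz--Fischer supplies an \<open>L\<^sup>2\<close> function with the same
  coefficients, and completeness identifies the two; otherwise the right side is infinite.\<close>

lemma parseval_ge:
 fixes b :: "nat \<Rightarrow> 'a::euclidean_space \<Rightarrow> complex"
 assumes on: "orthonormal_system b I"
  and compl: "\<And>h'. L2_fun h' \<Longrightarrow> (\<And>j. (LBINT x. h x * cnj (b j x)) = (LBINT x. h' x * cnj (b j x)))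
    \<Longrightarrow> AE x in lborel. h x = h' x"
 shows "(NN x. nrmsq (h x)) \<le> (\<Sum>j. nrmsq (LBINT x. h x * cnj (b j x)))"
proof (cases "(\<Sum>j. nrmsq (LBINT x. h x * cnj (b j x))) = \<infinity>")
 case False
 let ?c = "\<lambda>j. (LBINT x. h x * cnj (b j x))"
 have sm: "summable (\<lambda>j. (norm (?c j))\<^sup>2)" using False by (intro summable_suminf_not_top) auto
 obtain h' where h': "L2_fun h'" "\<And>j. L2_inner h' (b j) = ?c j"
  "(LBINT x. (norm (h' x))\<^sup>2) \<le> (\<Sum>j. (norm (?c j))\<^sup>2)" using riesz_fischer[OF on integral_orthonormal_zero[OF on] sm] by blast
 have "AE x in lborel. h x = h' x" using h'(2) by (intro compl h'(1)) (simp add: L2_inner_def)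
 then have "(NN x. nrmsq (h x)) = (NN x. nrmsq (h' x))" by (intro nn_integral_cong_AE) auto
 also have "... \<le> ennreal (\<Sum>j. (norm (?c j))\<^sup>2)" using h'(3) by (simp add: nn_integral_L2[OF h'(1)] ennreal_leI)
 also have "... = (\<Sum>j. nrmsq (?c j))" using sm by (intro suminf_ennreal2[symmetric]) auto
 finally show ?thesis .
qed simp


section \<open>Tonelli and Fubini on products of Euclidean spaces\<close>

lemma tonelli_1:
 fixes f :: "'a::euclidean_space \<times> 'b::euclidean_space \<Rightarrow> ennreal"
 assumes "f \<in> Borel"
 shows "(NN p. f p) = (NN x. NN y. f (x, y))"
 using assms lborel.nn_integral_fst[of f lborel] by (simp add: lborel_prod)

lemma tonelli_2:
 fixes f :: "'a::euclidean_space \<times> 'b::euclidean_space \<Rightarrow> ennreal"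
 assumes "f \<in> Borel"
 shows "(NN p. f p) = (NN y. NN x. f (x, y))"
 using assms lborel_pair.nn_integral_snd[of f] by (simp add: lborel_prod)

lemma fubini_1:
 fixes f :: "'a::euclidean_space \<times> 'b::euclidean_space \<Rightarrow> complex"
 assumes "integrable lborel f"
 shows "(LBINT p. f p) = (LBINT x. LBINT y. f (x, y))"
  and "AE x in lborel. integrable lborel (\<lambda>y. f (x, y))"
  and "integrable lborel (\<lambda>x. (LBINT y. f (x, y)))"
 using assms lborel_pair.integral_fst'[of f] lborel_pair.AE_integrable_fst'[of f]
  lborel_pair.integrable_fst'[of f] by (simp_all add: lborel_prod)

lemma fubini_2:
 fixes f :: "'a::euclidean_space \<times> 'b::euclidean_space \<Rightarrow> complex"
 assumes f: "integrable lborel f"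
 shows "(LBINT p. f p) = (LBINT y. LBINT x. f (x, y))"
  and "AE y in lborel. integrable lborel (\<lambda>x. f (x, y))"
  and "integrable lborel (\<lambda>y. (LBINT x. f (x, y)))"
proof -
 have f': "integrable (lborel \<Otimes>\<^sub>M lborel) (case_prod (\<lambda>x y. f (x, y)))" using f by (simp add: lborel_prod)
 show "(LBINT p. f p) = (LBINT y. LBINT x. f (x, y))" using lborel_pair.integral_snd[OF f'] by (simp add: lborel_prod)
 show "AE y in lborel. integrable lborel (\<lambda>x. f (x, y))" using lborel_pair.AE_integrable_snd[OF f'] by simp
 show "integrable lborel (\<lambda>y. (LBINT x. f (x, y)))" using lborel_pair.integrable_snd[OF f'] by simp
qed

lemma integrable_pairI:
 fixes f :: "'a::euclidean_space \<times> 'b::euclidean_space \<Rightarrow> complex"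
 assumes [measurable]: "f \<in> Borel"
  and "(NN x. NN y. nrm (f (x, y))) < \<infinity>"
 shows "integrable lborel f"
 using assms(2) by (simp add: integrable_iff_bounded tonelli_1)

lemma integrable_tensor:
 fixes f :: "'a::euclidean_space \<Rightarrow> complex" and g :: "'b::euclidean_space \<Rightarrow> complex"
 assumes "integrable lborel f" "integrable lborel g"
 shows "integrable lborel (\<lambda>p. f (fst p) * g (snd p))"
proof (rule integrable_pairI)
 have [measurable]: "f \<in> Borel" "g \<in> Borel" using assms by (auto dest: borel_measurable_integrable)
 show "(\<lambda>p. f (fst p) * g (snd p)) \<in> Borel" by (simp add: borel_prod[symmetric])
 show "(NN x. NN y. nrm (f (fst (x, y)) * g (snd (x, y)))) < \<infinity>"
  using assms by (simp add: norm_mult ennreal_mult nn_integral_cmult nn_integral_multc integrable_iff_bounded ennreal_mult_less_top)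
qed

lemma L2_fun_loc_integrable:
 assumes h: "L2_fun h"
 shows "loc_integrable h"
 unfolding loc_integrable_def
proof (intro conjI allI impI)
 show hm[measurable]: "h \<in> Borel" using h by (rule L2_fun_borel)
 fix K :: "'a set" assume K: "compact K"
 have [measurable]: "K \<in> sets borel" using K by (rule borel_compact)
 have fin: "emeasure lborel K < \<infinity>" by (rule emeasure_bounded_finite[OF compact_imp_bounded[OF K]])
 have "L2_fun (\<lambda>x. cor (indicator K x))" unfolding L2_fun_def
 proof
  have "(\<lambda>x. (norm (cor (indicator K x)))\<^sup>2) = (indicator K :: 'a \<Rightarrow> real)" by (auto simp: indicator_def)
  then show "integrable lborel (\<lambda>x. (norm (cor (indicator K x)))\<^sup>2)" using fin by simp
 qed simp
 from L2_fun_mult_integrable[OF h this] show "set_integrable lborel K h" by (simp add: set_integrable_def scaleR_conv_of_real mult.commute)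
qed

section \<open>An orthonormal basis of bounded functions with bounded support\<close>

text \<open>Boundedness and bounded support make the pairing with any locally integrable function
  converge; continuity almost everywhere lets Gaussian averages converge pointwise. Indicators of
  boxes qualify and the class is a vector space, so Gram--Schmidt stays inside it.\<close>

definition nice :: "('a::euclidean_space \<Rightarrow> complex) \<Rightarrow> bool" where
 "nice b \<longleftrightarrow> b \<in> Borel \<and> (\<exists>C. \<forall>x. norm (b x) \<le> C) \<and>
   (\<exists>R. \<forall>x. R < norm x \<longrightarrow> b x = 0) \<and> (AE x in lborel. isCont b x)"

lemma nice_borel [measurable_dest]: "nice b \<Longrightarrow> b \<in> Borel"
 by (simp add: nice_def)

lemma nice_bounded: "nice b \<Longrightarrow> \<exists>C\<ge>0. \<forall>x. norm (b x) \<le> C"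
 unfolding nice_def by (meson norm_ge_zero order_trans)

lemma nice_scale: "nice b \<Longrightarrow> nice (\<lambda>x. c * b x)"
 unfolding nice_def
proof (elim conjE exE, intro conjI)
 fix C R assume *: "b \<in> Borel" "\<forall>x. norm (b x) \<le> C"
  "\<forall>x. R < norm x \<longrightarrow> b x = 0" "AE x in lborel. isCont b x"
 show "(\<lambda>x. c * b x) \<in> Borel" using *(1) by simp
 show "\<exists>C. \<forall>x. norm (c * b x) \<le> C" using *(2) by (intro exI[of _ "norm c * C"]) (auto simp: norm_mult mult_left_mono)
 show "\<exists>R. \<forall>x. R < norm x \<longrightarrow> c * b x = 0" using *(3) by auto
 show "AE x in lborel. isCont (\<lambda>x. c * b x) x" using *(4) by eventually_elim (auto intro: continuous_intros)
qed

lemma nice_add: "nice b \<Longrightarrow> nice d \<Longrightarrow> nice (\<lambda>x. b x + d x)"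
 unfolding nice_def
proof (elim conjE exE, intro conjI)
 fix C R C' R' assume *: "b \<in> Borel" "\<forall>x. norm (b x) \<le> C"
  "\<forall>x. R < norm x \<longrightarrow> b x = 0" "AE x in lborel. isCont b x"
  "d \<in> Borel" "\<forall>x. norm (d x) \<le> C'"
  "\<forall>x. R' < norm x \<longrightarrow> d x = 0" "AE x in lborel. isCont d x"
 show "(\<lambda>x. b x + d x) \<in> Borel" using *(1,5) by simp
 show "\<exists>C. \<forall>x. norm (b x + d x) \<le> C" using *(2,6) by (intro exI[of _ "C + C'"]) (auto intro!: norm_triangle_mono)
 show "\<exists>R. \<forall>x. R < norm x \<longrightarrow> b x + d x = 0" using *(3,7) by (intro exI[of _ "max R R'"]) auto
 show "AE x in lborel. isCont (\<lambda>x. b x + d x) x" using *(4,8) by eventually_elim (auto intro: continuous_intros)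
qed

lemma nice_zero: "nice (\<lambda>x. 0)"
 by (auto simp: nice_def)

lemma nice_diff: "nice b \<Longrightarrow> nice d \<Longrightarrow> nice (\<lambda>x. b x - d x)"
 using nice_add[of b "\<lambda>x. (-1) * d x"] nice_scale[of d "-1"] by simp

lemma nice_sum: "finite J \<Longrightarrow> (\<And>j. j \<in> J \<Longrightarrow> nice (f j)) \<Longrightarrow> nice (\<lambda>x. \<Sum>j\<in>J. f j x)"
 by (induction J rule: finite_induct) (auto intro: nice_zero nice_add)

lemma nice_box: "nice (\<lambda>x. cor (indicator (box a b) x))"
 unfolding nice_def
proof (intro conjI)
 show "\<exists>C. \<forall>x. norm (cor (indicator (box a b) x)) \<le> C" by (intro exI[of _ 1]) (auto simp: indicator_def)
 obtain R where "\<forall>x\<in>box a b. norm x \<le> R" using bounded_box[of a b] by (auto simp: bounded_iff)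
 then show "\<exists>R. \<forall>x. R < norm x \<longrightarrow> cor (indicator (box a b) x) = 0" by (intro exI[of _ R]) (auto simp: indicator_def)
 have "negligible (frontier (box a b))" by (simp add: negligible_convex_frontier)
 then have "frontier (box a b) \<in> null_sets lborel" by (subst (asm) negligible_iff_null_sets, subst (asm) null_sets_completion_iff) auto
 then have "AE x in lborel. x \<notin> frontier (box a b)" by (rule AE_not_in)
 then show "AE x in lborel. isCont (\<lambda>x. cor (indicator (box a b) x)) x"
 proof eventually_elim
  case (elim x)
  then have "isCont (indicator (box a b) :: 'a \<Rightarrow> real) x" by (rule isCont_indicator[THEN iffD2])
  then show ?case by (intro continuous_intros)
 qed
qed simp

lemma nice_integrable_mult:
 assumes b: "nice b" and h: "loc_integrable h"
 shows "integrable lborel (\<lambda>x. h x * b x)"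
proof -
 have [measurable]: "h \<in> Borel" "b \<in> Borel" using assms by (auto intro: nice_borel loc_integrable_borel)
 obtain C where C: "\<And>x. norm (b x) \<le> C" "C \<ge> 0" using nice_bounded[OF b] by blast
 obtain R where R: "\<And>x. R < norm x \<Longrightarrow> b x = 0" using b by (auto simp: nice_def)
 have "integrable lborel (\<lambda>x. C *\<^sub>R (indicator (cball 0 R) x *\<^sub>R h x))"
  using h by (intro integrable_scaleR_right) (auto simp: loc_integrable_def set_integrable_def)
 then show ?thesis
 proof (rule Bochner_Integration.integrable_bound)
  show "AE x in lborel. norm (h x * b x) \<le> norm (C *\<^sub>R (indicator (cball 0 R) x *\<^sub>R h x))"
  proof (intro AE_I2)
   fix x
   show "norm (h x * b x) \<le> norm (C *\<^sub>R (indicator (cball 0 R) x *\<^sub>R h x))" using C(1)[of x] C(2) R[of x]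
    by (cases "R < norm x") (auto simp: norm_mult indicator_def intro: mult_right_mono simp: mult.commute)
  qed
 qed measurable
qed

lemma nice_cnj: "nice b \<Longrightarrow> nice (\<lambda>x. cnj (b x))"
proof -
 assume b: "nice b"
 have "AE x in lborel. isCont (\<lambda>x. cnj (b x)) x" using b[unfolded nice_def, THEN conjunct2, THEN conjunct2, THEN conjunct2]
  by eventually_elim (auto intro: continuous_intros)
 then show ?thesis using b by (auto simp: nice_def)
qed

lemma nice_integrable: "nice b \<Longrightarrow> integrable lborel b"
proof -
 assume b: "nice b"
 have "loc_integrable (\<lambda>x::'a. 1)" unfolding loc_integrable_def set_integrable_def
  by (auto intro!: integrable_scaleR_left integrable_real_indicator borel_compact emeasure_bounded_finite[unfolded infinity_ennreal_def] compact_imp_bounded)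
 from nice_integrable_mult[OF b this] show ?thesis by simp
qed

lemma nice_L2: "nice b \<Longrightarrow> L2_fun b"
proof -
 assume b: "nice b"
 have "integrable lborel (\<lambda>x. b x * cnj (b x))"
  by (rule nice_integrable_mult[OF nice_cnj[OF b] integrable_imp_loc_integrable[OF nice_integrable[OF b]]])
 then have "integrable lborel (\<lambda>x. cor ((norm (b x))\<^sup>2))" by (simp add: complex_norm_square[symmetric] del: of_real_power)
 then show ?thesis using b unfolding L2_fun_def nice_def by (subst (asm) complex_of_real_integrable_eq) auto
qed

fun gram_schmidt :: "(nat \<Rightarrow> 'a::euclidean_space \<Rightarrow> complex) \<Rightarrow> nat \<Rightarrow> 'a \<Rightarrow> complex" where
 "gram_schmidt \<phi> k =
  (\<lambda>v x. v x / cor (sqrt (LBINT y. (norm (v y))\<^sup>2)))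
  (\<lambda>x. \<phi> k x - (\<Sum>j<k. L2_inner (\<phi> k) (gram_schmidt \<phi> j) * gram_schmidt \<phi> j x))"

declare gram_schmidt.simps [simp del]

text \<open>The last clause recovers \<open>\<phi> k\<close> from the system almost everywhere; it
  is what carries completeness from the boxes to the orthonormalised functions.\<close>

lemma gram_schmidt_props:
 fixes \<phi> :: "nat \<Rightarrow> 'a::euclidean_space \<Rightarrow> complex"
 assumes \<phi>: "\<And>k. nice (\<phi> k)"
 defines "b \<equiv> gram_schmidt \<phi>"
 shows "nice (b k) \<and> (\<forall>i<k. L2_inner (b k) (b i) = 0) \<and>
   (L2_inner (b k) (b k) = 0 \<or> L2_inner (b k) (b k) = 1) \<and>
   (\<exists>s. AE x in lborel. \<phi> k x = s * b k x + (\<Sum>j<k. L2_inner (\<phi> k) (b j) * b j x))"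
proof (induction k rule: less_induct)
 case (less k)
 define v where "v x = \<phi> k x - (\<Sum>j<k. L2_inner (\<phi> k) (b j) * b j x)" for x
 define N where "N = (LBINT y. (norm (v y))\<^sup>2)"
 have bk: "b k = (\<lambda>x. v x / cor (sqrt N))" unfolding b_def by (subst gram_schmidt.simps) (simp add: v_def N_def b_def)
 have nb: "nice (b j)" if "j < k" for j using less that by auto
 have nv: "nice v" unfolding v_def using nb by (intro nice_diff \<phi> nice_sum nice_scale) auto
 have nbk: "nice (b k)" unfolding bk using nice_scale[OF nv, of "1 / cor (sqrt N)"] by simp
 have N0: "N \<ge> 0" by (simp add: N_def)
 have vz: "AE x in lborel. v x = 0" if "N = 0"
 proof -
  have "integrable lborel (\<lambda>x. (norm (v x))\<^sup>2)" using nice_L2[OF nv] by (simp add: L2_fun_def)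
  then have "AE x in lborel. (norm (v x))\<^sup>2 = 0" using that unfolding N_def by (subst (asm) integral_nonneg_eq_0_iff_AE) auto
  then show ?thesis by simp
 qed
 have bi: "L2_inner (b i) (b j) = (if i = j then L2_inner (b i) (b i) else 0)" if "i < k" "j < k" for i j
 proof (cases i j rule: linorder_cases)
  case less
  then have "L2_inner (b j) (b i) = 0" using less.IH[OF that(2)] by blast
  then show ?thesis using less L2_inner_cnj[of "b j" "b i"] by simp
 next
  case greater
  then show ?thesis using less.IH[OF that(1)] by simp
 qed simp
 have vi: "L2_inner v (b i) = 0" if i: "i < k" for i
 proof -
  have "L2_inner v (b i) = L2_inner (\<phi> k) (b i) - (\<Sum>j<k. L2_inner (\<phi> k) (b j) * L2_inner (b j) (b i))"
  proof -
   have L: "L2_fun (b j)" if "j < k" for j using nb[OF that] by (rule nice_L2)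
   have S: "L2_fun (\<lambda>x. \<Sum>j<k. L2_inner (\<phi> k) (b j) * b j x)" by (intro L2_fun_sum L2_fun_scale L) auto
   have "L2_inner (\<lambda>x. \<Sum>j<k. L2_inner (\<phi> k) (b j) * b j x) (b i) = (\<Sum>j<k. L2_inner (\<phi> k) (b j) * L2_inner (b j) (b i))"
    by (subst L2_inner_sum) (auto intro: L2_fun_scale L i simp: L2_inner_scale)
   then have 1: "L2_inner (\<phi> k) (b i) - L2_inner (\<lambda>x. \<Sum>j<k. L2_inner (\<phi> k) (b j) * b j x) (b i)
     = L2_inner (\<phi> k) (b i) - (\<Sum>j<k. L2_inner (\<phi> k) (b j) * L2_inner (b j) (b i))" by (rule arg_cong)
   have "v = (\<lambda>x. \<phi> k x - (\<Sum>j<k. L2_inner (\<phi> k) (b j) * b j x))" by (rule ext) (rule v_def)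
   then have "L2_inner v (b i) = L2_inner (\<lambda>x. \<phi> k x - (\<Sum>j<k. L2_inner (\<phi> k) (b j) * b j x)) (b i)" by (rule arg_cong)
   also have "... = L2_inner (\<phi> k) (b i) - L2_inner (\<lambda>x. \<Sum>j<k. L2_inner (\<phi> k) (b j) * b j x) (b i)"
    by (rule L2_inner_diff[OF nice_L2[OF \<phi>] S L[OF i]])
   also note 1
   finally show ?thesis .
  qed
  also have "(\<Sum>j<k. L2_inner (\<phi> k) (b j) * L2_inner (b j) (b i))
    = (\<Sum>j<k. if j = i then L2_inner (\<phi> k) (b i) * L2_inner (b i) (b i) else 0)"
  proof (rule sum.cong[OF refl])
   fix j assume "j \<in> {..<k}"
   then show "L2_inner (\<phi> k) (b j) * L2_inner (b j) (b i)
     = (if j = i then L2_inner (\<phi> k) (b i) * L2_inner (b i) (b i) else 0)" using bi[of j i] i by (cases "j = i") simp_all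
  qed
  also have "... = L2_inner (\<phi> k) (b i) * L2_inner (b i) (b i)" using i by simp
  \<comment> \<open>Where \<open>b i\<close> is a zero vector its squared norm is 0 rather than 1,
    but by Cauchy--Schwarz the coefficient vanishes as well.\<close>
  also have "... = L2_inner (\<phi> k) (b i)"
  proof (cases "L2_inner (b i) (b i) = 1")
   case False
   then have z: "L2_inner (b i) (b i) = 0" using less.IH[OF i] by blast
   have "(norm (L2_inner (\<phi> k) (b i)))\<^sup>2 \<le> (LBINT x. (norm (\<phi> k x))\<^sup>2) * (LBINT x. (norm (b i x))\<^sup>2)"
    by (intro L2_Cauchy_Schwarz nice_L2 \<phi> nb i)
   also have "... = 0" using z by (simp add: L2_inner_self)
   finally show ?thesis by simp
  qed simp
  finally show ?thesis by simp
 qed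
 have "L2_inner (b k) (b k) = cor (N / (sqrt N)\<^sup>2)"
  unfolding L2_inner_self by (simp add: bk norm_divide power_divide N_def del: real_sqrt_pow2)
 also have "... = (if N = 0 then 0 else 1)" using N0 by simp
 finally have n1: "L2_inner (b k) (b k) = (if N = 0 then 0 else 1)" .
 have "L2_inner (b k) (b i) = 0" if "i < k" for i using vi[OF that] L2_inner_scale[of "1 / cor (sqrt N)" v "b i"] by (simp add: bk)
 moreover have "AE x in lborel. \<phi> k x = cor (sqrt N) * b k x + (\<Sum>j<k. L2_inner (\<phi> k) (b j) * b j x)"
 proof (cases "N = 0")
  case True
  from vz[OF True] show ?thesis by eventually_elim (simp add: bk True v_def)
 next
  case False
  then show ?thesis by (simp add: bk v_def)
 qed
 ultimately show ?case using nbk n1 by auto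
qed

text \<open>Orthogonality to the system forces the integrals over all rational boxes to vanish,
  because each box indicator is almost everywhere a finite combination of the system.\<close>

lemma exists_nice_orthonormal_system:
 obtains b :: "nat \<Rightarrow> 'a::euclidean_space \<Rightarrow> complex" and I
 where "\<And>j. nice (b j)" "orthonormal_system b I"
  "\<And>H. loc_integrable H \<Longrightarrow> (\<And>j. (LBINT x. H x * cnj (b j x)) = 0) \<Longrightarrow> AE x in lborel. H x = 0"
proof -
 define \<phi> :: "nat \<Rightarrow> 'a \<Rightarrow> complex"
  where "\<phi> k x = cor (indicator (from_nat_into rational_box k) x)" for k x
 have ne: "(rational_box :: 'a set set) \<noteq> {}" using centered_box_rational by blast
 have n\<phi>: "nice (\<phi> k)" for k
 proof -
  have "from_nat_into rational_box k \<in> (rational_box :: 'a set set)" by (rule from_nat_into[OF ne])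
  then show ?thesis unfolding \<phi>_def rational_box_def using nice_box by auto
 qed
 define b where "b = gram_schmidt \<phi>"
 note P = gram_schmidt_props[of \<phi>, OF n\<phi>, folded b_def]
 have nb: "nice (b j)" for j using P by blast
 define I where "I = {j. L2_inner (b j) (b j) = 1}"
 have on: "orthonormal_system b I" unfolding orthonormal_system_def
 proof (intro conjI allI)
  show "L2_fun (b j)" for j by (rule nice_L2[OF nb])
  show "L2_inner (b j) (b k) = of_bool (j = k \<and> j \<in> I)" for j k
  proof (cases j k rule: linorder_cases)
   case less
   then have "L2_inner (b k) (b j) = 0" using P[of k] by blast
   then show ?thesis using less L2_inner_cnj[of "b k" "b j"] by simp
  next
   case equal
   then show ?thesis using P[of k] by (auto simp: I_def)
  next
   case greater
   then show ?thesis using P[of j] by simp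
  qed
 qed
 have compl: "AE x in lborel. H x = 0"
  if H: "loc_integrable H" and z: "\<And>j. (LBINT x. H x * cnj (b j x)) = 0" for H
 proof (rule AE_zero_rational_box[OF H])
  fix B :: "'a set" assume "B \<in> rational_box"
  then obtain k where k: "from_nat_into rational_box k = B" using from_nat_into_surj[OF countable_rational_box] by blast
  obtain s where s: "AE x in lborel. \<phi> k x = s * b k x + (\<Sum>j<k. L2_inner (\<phi> k) (b j) * b j x)" using P[of k] by blast
  have i: "integrable lborel (\<lambda>x. H x * cnj (b j x))" for j by (intro nice_integrable_mult nice_cnj nb H)
  have [measurable]: "H \<in> Borel" using H by (rule loc_integrable_borel)
  have [measurable]: "b j \<in> Borel" for j using nb by (rule nice_borel)
  have [measurable]: "\<phi> k \<in> Borel" using n\<phi> by (rule nice_borel)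
  have "(LINT x:B|lborel. H x) = (LBINT x. H x * cnj (\<phi> k x))"
   unfolding set_lebesgue_integral_def by (simp add: \<phi>_def k scaleR_conv_of_real mult.commute)
  also have "... = (LBINT x. H x * cnj (s * b k x + (\<Sum>j<k. L2_inner (\<phi> k) (b j) * b j x)))" using s by (intro integral_cong_AE) auto
  also have "... = (LBINT x. cnj s * (H x * cnj (b k x)) + (\<Sum>j<k. cnj (L2_inner (\<phi> k) (b j)) * (H x * cnj (b j x))))"
   by (simp add: distrib_left sum_distrib_left mult_ac)
  also have "... = 0" by (subst Bochner_Integration.integral_add) (auto simp: i z)
  finally show "(LINT x:B|lborel. H x) = 0" .
 qed
 from that[OF nb on compl] show thesis by blast
qed

text \<open>Disjoint unit boxes form an infinite orthonormal system. By completeness each keeps its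
  full norm when projected to the vectors indexed by \<open>I\<close>, while Bessel's inequality
  bounds the total of the projections by \<open>card I\<close>.\<close>

lemma infinite_orthonormal_system:
 fixes b :: "nat \<Rightarrow> 'a::euclidean_space \<Rightarrow> complex"
 assumes nb: "\<And>j. nice (b j)" and on: "orthonormal_system b I"
  and compl: "\<And>H. loc_integrable H \<Longrightarrow> (\<And>j. (LBINT x. H x * cnj (b j x)) = 0) \<Longrightarrow> AE x in lborel. H x = 0"
 shows "infinite I"
proof
 assume fin: "finite I"
 define B where "B i = (box (real i *\<^sub>R One) (real (Suc i) *\<^sub>R One) :: 'a set)" for i
 define s where "s i x = cor (indicator (B i) x)" for i x
 have ns: "nice (s i)" for i unfolding s_def B_def by (rule nice_box)
 have disj: "B i \<inter> B j = {}" if "i \<noteq> j" for i j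
 proof -
  have *: "B i \<inter> B j = {}" if "i < j" for i j
  proof (rule ccontr)
   assume "B i \<inter> B j \<noteq> {}"
   then obtain x where x: "x \<in> B i" "x \<in> B j" by blast
   obtain e :: 'a where e: "e \<in> Basis" using nonempty_Basis by blast
   have "x \<bullet> e < real (Suc i)" "real j < x \<bullet> e" using x e by (auto simp: B_def box_def)
   then show False using \<open>i < j\<close> by simp
  qed
  then show ?thesis using that by (metis Int_commute linorder_neqE_nat)
 qed
 have mB: "measure lborel (B i) = 1" for i by (simp add: B_def measure_lborel_box_eq algebra_simps)
 have inner_s: "L2_inner (s i) (s j) = of_bool (i = j)" for i j
 proof -
  have "(\<lambda>x. s i x * cnj (s j x)) = (\<lambda>x. cor (indicator (B i \<inter> B j) x))" by (auto simp: s_def indicator_def)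
  moreover have "B i \<in> sets borel" "B i \<inter> B j \<in> sets borel" by (auto simp: B_def)
  ultimately show ?thesis using disj[of i j] mB[of i] by (cases "i = j") (simp_all add: L2_inner_def)
 qed
 have os: "orthonormal_system s UNIV" unfolding orthonormal_system_def using inner_s nice_L2[OF ns] by simp
 have one: "1 \<le> (\<Sum>j\<in>I. (norm (L2_inner (s i) (b j)))\<^sup>2)" for i
 proof -
  have "(NN x. nrmsq (s i x)) \<le> (\<Sum>j. nrmsq (LBINT x. s i x * cnj (b j x)))"
  proof (rule parseval_ge[OF on])
   fix h' :: "'a \<Rightarrow> complex"
   assume h': "L2_fun h'" "\<And>j. (LBINT x. s i x * cnj (b j x)) = (LBINT x. h' x * cnj (b j x))"
   have l: "loc_integrable (s i)" "loc_integrable h'" by (auto intro: L2_fun_loc_integrable nice_L2 ns h')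
   have "AE x in lborel. s i x - h' x = 0"
   proof (rule compl)
    show "loc_integrable (\<lambda>x. s i x - h' x)" by (intro loc_integrable_diff l)
    show "(LBINT x. (s i x - h' x) * cnj (b j x)) = 0" for j
     using h'(2) nice_integrable_mult[OF nice_cnj[OF nb] l(1)] nice_integrable_mult[OF nice_cnj[OF nb] l(2)] by (simp add: left_diff_distrib)
   qed
   then show "AE x in lborel. s i x = h' x" by simp
  qed
  also have "... = (\<Sum>j\<in>I. nrmsq (L2_inner (s i) (b j)))"
   unfolding L2_inner_def by (intro suminf_finite fin) (simp add: integral_orthonormal_zero[OF on])
  also have "(NN x. nrmsq (s i x)) = 1" using inner_s[of i i] by (simp add: nn_integral_L2[OF nice_L2[OF ns]] L2_inner_self)
  finally show ?thesis by (simp add: sum_nonneg)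
 qed
 \<comment> \<open>One box more than there are vectors to carry them.\<close>
 define M where "M = Suc (card I)"
 have "real M \<le> (\<Sum>i<M. \<Sum>j\<in>I. (norm (L2_inner (s i) (b j)))\<^sup>2)"
  using sum_mono[of "{..<M}" "\<lambda>_. 1::real", OF one] by simp
 also have "... = (\<Sum>j\<in>I. \<Sum>i<M. (norm (L2_inner (s i) (b j)))\<^sup>2)" by (rule sum.swap)
 also have "... \<le> (\<Sum>j\<in>I. 1)"
 proof (rule sum_mono)
  fix j assume j: "j \<in> I"
  have "norm (L2_inner (s i) (b j)) = norm (L2_inner (b j) (s i))" for i by (metis L2_inner_cnj complex_mod_cnj)
  then have "(\<Sum>i<M. (norm (L2_inner (s i) (b j)))\<^sup>2) \<le> (LBINT x. (norm (b j x))\<^sup>2)"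
   using bessel_finite[OF os _ nice_L2[OF nb], of "{..<M}" j] by simp
  also have "... = 1" using orthonormal_system_inner[OF on, of j j] j by (simp add: L2_inner_self)
  finally show "(\<Sum>i<M. (norm (L2_inner (s i) (b j)))\<^sup>2) \<le> 1" .
 qed
 finally show False by (simp add: M_def)
qed

theorem exists_nice_basis:
 obtains b :: "nat \<Rightarrow> 'a::euclidean_space \<Rightarrow> complex"
 where "\<And>j. nice (b j)" "orthonormal_system b UNIV"
  "\<And>H. loc_integrable H \<Longrightarrow> (\<And>j. (LBINT x. H x * cnj (b j x)) = 0) \<Longrightarrow> AE x in lborel. H x = 0"
proof -
 obtain b :: "nat \<Rightarrow> 'a \<Rightarrow> complex" and I
 where b: "\<And>j. nice (b j)" "orthonormal_system b I"
  "\<And>H. loc_integrable H \<Longrightarrow> (\<And>j. (LBINT x. H x * cnj (b j x)) = 0) \<Longrightarrow> AE x in lborel. H x = 0"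
  by (rule exists_nice_orthonormal_system) blast
 have inf: "infinite I" by (rule infinite_orthonormal_system[OF b])
 define e where "e k = b (enumerate I k)" for k
 have "orthonormal_system e UNIV" using orthonormal_system_L2[OF b(2)] orthonormal_system_inner[OF b(2)] inf enumerate_in_set[OF inf]
  by (auto simp: orthonormal_system_def e_def strict_mono_eq[OF strict_mono_enumerate[OF inf]])
 moreover have "AE x in lborel. H x = 0"
  if "loc_integrable H" and z: "\<And>j. (LBINT x. H x * cnj (e j x)) = 0" for H
 proof (rule b(3)[OF that(1)])
  fix j
  show "(LBINT x. H x * cnj (b j x)) = 0"
  proof (cases "j \<in> I")
   case True
   then obtain k where "enumerate I k = j" using inf enumerate_Ex by metis
   then show ?thesis using z[of k] by (simp add: e_def)
  qed (rule integral_orthonormal_zero[OF b(2)])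
 qed
 ultimately show thesis using that[of e] b(1) by (simp add: e_def)
qed

text \<open>Without a witness the choice of a basis in \<open>hs_norm\<close> would be
  arbitrary.\<close>

lemma exists_L2_orthonormal_basis: "\<exists>e :: nat \<Rightarrow> 'a::euclidean_space \<Rightarrow> complex. L2_orthonormal_basis e"
proof -
 obtain b :: "nat \<Rightarrow> 'a \<Rightarrow> complex" where b: "\<And>j. nice (b j)" "orthonormal_system b UNIV"
  "\<And>H. loc_integrable H \<Longrightarrow> (\<And>j. (LBINT x. H x * cnj (b j x)) = 0) \<Longrightarrow> AE x in lborel. H x = 0"
  by (rule exists_nice_basis) blast
 have "L2_orthonormal_basis b" unfolding L2_orthonormal_basis_def
  using orthonormal_system_L2[OF b(2)] orthonormal_system_inner[OF b(2)] b(3)[OF L2_fun_loc_integrable] unfolding L2_inner_def by simp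
 then show ?thesis by blast
qed

lemma nice_parseval_ge:
 assumes b: "\<And>j. nice (b j)" "orthonormal_system b I"
  "\<And>H. loc_integrable H \<Longrightarrow> (\<And>j. (LBINT x. H x * cnj (b j x)) = 0) \<Longrightarrow> AE x in lborel. H x = 0"
  and h: "loc_integrable h"
 shows "(NN x. nrmsq (h x)) \<le> (\<Sum>j. nrmsq (LBINT x. h x * cnj (b j x)))"
proof (rule parseval_ge[OF b(2)])
 fix h' assume h': "L2_fun h'" "\<And>j. (LBINT x. h x * cnj (b j x)) = (LBINT x. h' x * cnj (b j x))"
 have l: "loc_integrable h'" by (rule L2_fun_loc_integrable[OF h'(1)])
 have "AE x in lborel. h x - h' x = 0"
 proof (rule b(3))
  show "loc_integrable (\<lambda>x. h x - h' x)" by (intro loc_integrable_diff h l)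
  show "(LBINT x. (h x - h' x) * cnj (b j x)) = 0" for j
   using h'(2) nice_integrable_mult[OF nice_cnj[OF b(1)] h] nice_integrable_mult[OF nice_cnj[OF b(1)] l] by (simp add: left_diff_distrib)
 qed
 then show "AE x in lborel. h x = h' x" by simp
qed

section \<open>The Plancherel inequality\<close>

definition fourier :: "('a::euclidean_space \<Rightarrow> complex) \<Rightarrow> 'a \<Rightarrow> complex" where
 "fourier h y = (LBINT x. h x * cis (x \<bullet> y))"

lemma fourier_borel [measurable]:
 assumes [measurable]: "h \<in> Borel"
 shows "fourier h \<in> Borel"
 unfolding fourier_def by measurable

lemma integrable_mult_cis:
 assumes "integrable lborel h" and [measurable]: "f \<in> Borel"
 shows "integrable lborel (\<lambda>x. h x * cis (f x))"
proof (rule Bochner_Integration.integrable_bound[OF assms(1)])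
 have [measurable]: "h \<in> Borel" using assms(1) by (auto dest: borel_measurable_integrable)
 show "(\<lambda>x. h x * cis (f x)) \<in> borel_measurable lborel" by measurable
qed (simp add: norm_mult)

section \<open>Gaussian regularisation\<close>

text \<open>The Fourier transform of \<open>exp (- \<epsilon> * (norm y)\<^sup>2 / 2)\<close>. With
  this normalisation its total mass is \<open>(2 * pi) ^ DIM('a)\<close> for every
  \<open>\<epsilon>\<close>.\<close>

definition heat_kernel :: "real \<Rightarrow> 'a::euclidean_space \<Rightarrow> real" where
 "heat_kernel \<epsilon> x = sqrt (2 * pi / \<epsilon>) ^ DIM('a) * exp (- (norm x)\<^sup>2 / (2 * \<epsilon>))"

lemma heat_kernel_borel [measurable]: "heat_kernel \<epsilon> \<in> Borel"
 unfolding heat_kernel_def by measurable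

lemma heat_kernel_nonneg: "\<epsilon> > 0 \<Longrightarrow> heat_kernel \<epsilon> x \<ge> 0"
 by (simp add: heat_kernel_def)

lemma heat_kernel_integrable: "\<epsilon> > 0 \<Longrightarrow> integrable lborel (heat_kernel \<epsilon> :: 'a::euclidean_space \<Rightarrow> real)"
 using integrable_mult_right[OF integrable_gaussian[of "1 / (2 * \<epsilon>)", where 'a='a], of "sqrt (2 * pi / \<epsilon>) ^ DIM('a)"]
 by (simp add: heat_kernel_def[abs_def])

lemma heat_kernel_scale:
 assumes "\<epsilon> > 0"
 shows "sqrt \<epsilon> ^ DIM('a) * heat_kernel \<epsilon> (sqrt \<epsilon> *\<^sub>R x) = heat_kernel 1 (x :: 'a::euclidean_space)"
 using assms by (simp add: heat_kernel_def power_mult_distrib[symmetric] real_sqrt_mult[symmetric] power_mult_distrib)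

lemma integral_heat_kernel:
 assumes "\<epsilon> > 0"
 shows "(LBINT x. heat_kernel \<epsilon> (x :: 'a::euclidean_space)) = (2 * pi) ^ DIM('a)"
proof -
 have e: "(\<lambda>y::'a. cexp (- (1/\<epsilon>) * (norm y)\<^sup>2 / 2) * cis (y \<bullet> 0)) = (\<lambda>y. cexp (- (norm y)\<^sup>2 / (2 * \<epsilon>)))"
  using assms by (auto simp: field_simps)
 have "cor (LBINT y. exp (- (norm (y::'a))\<^sup>2 / (2 * \<epsilon>))) = cor (sqrt (2 * pi * \<epsilon>) ^ DIM('a))"
  using gaussian_fourier(2)[of "1 / \<epsilon>" "0 :: 'a"] assms unfolding e integral_complex_of_real by simp
 then have "(LBINT y. exp (- (norm (y::'a))\<^sup>2 / (2 * \<epsilon>))) = sqrt (2 * pi * \<epsilon>) ^ DIM('a)" using of_real_eq_iff by blast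
 then have "(LBINT x. heat_kernel \<epsilon> (x :: 'a)) = (sqrt (2 * pi / \<epsilon>) * sqrt (2 * pi * \<epsilon>)) ^ DIM('a)"
  by (simp add: heat_kernel_def power_mult_distrib)
 also have "sqrt (2 * pi / \<epsilon>) * sqrt (2 * pi * \<epsilon>) = 2 * pi"
 proof -
  have "(2 * pi / \<epsilon>) * (2 * pi * \<epsilon>) = (2 * pi)\<^sup>2" using assms by (simp add: power2_eq_square)
  then show ?thesis by (metis abs_of_nonneg pi_ge_zero mult_nonneg_nonneg real_sqrt_abs real_sqrt_mult zero_le_numeral)
 qed
 finally show ?thesis .
qed

text \<open>Parseval's formula with a Gaussian inserted. The Gaussian makes the triple integral
  absolutely convergent, so the order of integration may be changed, and its own transform appears
  as a kernel in the difference of the two points.\<close>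

lemma gaussian_fourier_pairing:
 fixes h b :: "'a::euclidean_space \<Rightarrow> complex"
 assumes h: "integrable lborel h" and b: "integrable lborel b" and \<epsilon>: "\<epsilon> > 0"
 shows "(LBINT y. cexp (- \<epsilon> * (norm y)\<^sup>2 / 2) * (fourier h y * cnj (fourier b y)))
  = (LBINT p. h (fst p) * cnj (b (snd p)) * cor (heat_kernel \<epsilon> (fst p - snd p)))"
proof -
 have [measurable]: "h \<in> Borel" "b \<in> Borel" using h b by (auto dest: borel_measurable_integrable)
 define K where "K p = h (fst p) * cnj (b (snd p))" for p :: "'a \<times> 'a"
 have K: "integrable lborel K" unfolding K_def using integrable_tensor[OF h integrable_cnj[OF b]] by simp
 have [measurable]: "K \<in> Borel" using K by (auto dest: borel_measurable_integrable)
 define e where "e y = cexp (- \<epsilon> * (norm y)\<^sup>2 / 2)" for y :: 'a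
 have e: "integrable lborel e"
  unfolding e_def using integrable_gaussian[of "\<epsilon>/2", where 'a='a] \<epsilon> by (intro integrable_of_real) simp
 have [measurable]: "e \<in> Borel" unfolding e_def by measurable
 define F where "F q = K (fst q) * e (snd q) * cis ((fst (fst q) - snd (fst q)) \<bullet> snd q)" for q :: "('a \<times> 'a) \<times> 'a"
 have F: "integrable lborel F" unfolding F_def by (rule integrable_mult_cis[OF integrable_tensor[OF K e]]) (simp add: borel_prod[symmetric])
 have ft: "fourier h y * cnj (fourier b y) = (LBINT p. K p * cis ((fst p - snd p) \<bullet> y))" for y
 proof -
  have i: "integrable lborel (\<lambda>p::'a\<times>'a. K p * cis ((fst p - snd p) \<bullet> y))"
   by (rule integrable_mult_cis[OF K]) (simp add: borel_prod[symmetric])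
  have c: "cis ((x - x') \<bullet> y) = cis (x \<bullet> y) * cnj (cis (x' \<bullet> y))" for x x' by (simp add: inner_diff_left cis_mult cis_cnj)
  have "(LBINT p. K p * cis ((fst p - snd p) \<bullet> y))
    = (LBINT x. LBINT x'. (h x * cis (x \<bullet> y)) * cnj (b x' * cis (x' \<bullet> y)))"
   by (subst fubini_1(1)[OF i]) (simp add: K_def c mult_ac)
  also have "... = fourier h y * cnj (fourier b y)" unfolding fourier_def by (simp del: complex_cnj_mult)
  finally show ?thesis ..
 qed
 have "(LBINT y. e y * (fourier h y * cnj (fourier b y))) = (LBINT y. LBINT p. F (p, y))"
  unfolding ft F_def by (subst integral_mult_right_zero[symmetric]) (simp add: mult_ac)
 also have "... = (LBINT p. LBINT y. F (p, y))" using fubini_1(1)[OF F] fubini_2(1)[OF F] by simp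
 also have "... = (LBINT p. K p * cor (heat_kernel \<epsilon> (fst p - snd p)))"
 proof (intro Bochner_Integration.integral_cong refl)
  fix p :: "'a \<times> 'a"
  have "(LBINT y. F (p, y)) = K p * (LBINT y. e y * cis (y \<bullet> (fst p - snd p)))"
   unfolding F_def by (subst integral_mult_right_zero[symmetric]) (simp add: mult_ac inner_commute)
  then show "(LBINT y. F (p, y)) = K p * cor (heat_kernel \<epsilon> (fst p - snd p))"
   unfolding e_def gaussian_fourier(2)[OF \<epsilon>] heat_kernel_def .
 qed
 finally show ?thesis by (simp add: e_def K_def)
qed

lemma integrable_heat_pairing:
 fixes h b :: "'a::euclidean_space \<Rightarrow> complex"
 assumes h: "integrable lborel h" and b: "integrable lborel b" and \<epsilon>: "\<epsilon> > 0"
 shows "integrable lborel (\<lambda>p. h (fst p) * cnj (b (snd p)) * cor (heat_kernel \<epsilon> (fst p - snd p)))"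
proof -
 have [measurable]: "h \<in> Borel" "b \<in> Borel" using h b by (auto dest: borel_measurable_integrable)
 have "integrable lborel (\<lambda>p. sqrt (2 * pi / \<epsilon>) ^ DIM('a) *\<^sub>R (h (fst p) * cnj (b (snd p))))"
  using integrable_tensor[OF h integrable_cnj[OF b]] by simp
 then show ?thesis
 proof (rule Bochner_Integration.integrable_bound)
  have "exp (- (norm x)\<^sup>2 / (2 * \<epsilon>)) \<le> 1" for x :: 'a using \<epsilon> by simp
  then have "heat_kernel \<epsilon> x \<le> sqrt (2 * pi / \<epsilon>) ^ DIM('a)" for x :: 'a
   unfolding heat_kernel_def using \<epsilon> by (intro mult_left_le) auto
  then have *: "norm (h x) * norm (b y) * heat_kernel \<epsilon> (x - y) \<le> norm (h x) * norm (b y) * sqrt (2 * pi / \<epsilon>) ^ DIM('a)" for x y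
   by (intro mult_left_mono) auto
  show "AE p in lborel. norm (h (fst p) * cnj (b (snd p)) * cor (heat_kernel \<epsilon> (fst p - snd p)))
    \<le> norm (sqrt (2 * pi / \<epsilon>) ^ DIM('a) *\<^sub>R (h (fst p) * cnj (b (snd p))))"
   using \<epsilon> * by (intro AE_I2) (simp add: norm_mult heat_kernel_nonneg mult_ac)
 qed (simp add: borel_prod[symmetric])
qed

text \<open>As \<open>h\<close> is only integrable, the averaging is put on \<open>b\<close>: its
  Gaussian averages are uniformly bounded and converge wherever \<open>b\<close> is
  continuous.\<close>

lemma heat_pairing_limit:
 fixes h b :: "'a::euclidean_space \<Rightarrow> complex"
 assumes h: "integrable lborel h" and b: "nice b"
 shows "(\<lambda>k. (LBINT p. h (fst p) * cnj (b (snd p)) * cor (heat_kernel (1 / Suc k) (fst p - snd p))))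
  \<longlonglongrightarrow> (2 * pi) ^ DIM('a) * (LBINT x. h x * cnj (b x))"
proof -
 have [measurable]: "h \<in> Borel" "b \<in> Borel"
  using h b by (auto dest: borel_measurable_integrable nice_borel)
 obtain C where C: "C \<ge> 0" "\<And>x. norm (b x) \<le> C" using nice_bounded[OF b] by blast
 \<comment> \<open>Rescaling by the width of the Gaussian turns the varying kernels into the fixed
   one \<open>heat_kernel 1\<close>.\<close>
 define s where "s k = sqrt (1 / real (Suc k))" for k
 have s: "s k > 0" for k by (simp add: s_def)
 have s0: "s \<longlonglongrightarrow> 0" unfolding s_def using tendsto_real_sqrt[OF LIMSEQ_inverse_real_of_nat] by (simp add: inverse_eq_divide)
 let ?G = "\<lambda>x::'a. heat_kernel 1 x"
 have Gi: "integrable lborel (\<lambda>x::'a. C * ?G x)" by (intro integrable_mult_right heat_kernel_integrable) simp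
 define c where "c k x = (LBINT y. cnj (b (x - s k *\<^sub>R y)) * cor (?G y))" for k x
 have cb: "norm (c k x) \<le> C * (2 * pi) ^ DIM('a)" for k x
 proof -
  have "norm (c k x) \<le> (LBINT y. C * ?G y)" unfolding c_def
  proof (rule Bochner_Integration.integral_norm_bound_integral[OF _ Gi])
   show "integrable lborel (\<lambda>y. cnj (b (x - s k *\<^sub>R y)) * cor (?G y))" by (rule Bochner_Integration.integrable_bound[OF Gi])
      (use C in \<open>auto simp: norm_mult heat_kernel_nonneg intro!: mult_right_mono\<close>)
  qed (use C in \<open>auto simp: norm_mult heat_kernel_nonneg intro!: mult_right_mono\<close>)
  then show ?thesis by (simp add: integral_heat_kernel)
 qed
 have [measurable]: "c k \<in> Borel" for k unfolding c_def by measurable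
 have "(LBINT p. h (fst p) * cnj (b (snd p)) * cor (heat_kernel (1 / Suc k) (fst p - snd p)))
   = (LBINT x. h x * c k x)" for k
 proof -
  have A: "(LBINT p. h (fst p) * cnj (b (snd p)) * cor (heat_kernel (1 / Suc k) (fst p - snd p)))
    = (LBINT x. h x * (LBINT x'. cnj (b x') * cor (heat_kernel (1 / Suc k) (x - x'))))"
   by (subst fubini_1(1)[OF integrable_heat_pairing[OF h nice_integrable[OF b]]]) (simp_all add: mult.assoc)
  have B: "(LBINT x'. cnj (b x') * cor (heat_kernel (1 / Suc k) (x - x'))) = c k x" for x
  proof -
   have hs: "heat_kernel 1 y = s k ^ DIM('a) * heat_kernel (1 / Suc k) (s k *\<^sub>R y)" for y :: 'a
    using heat_kernel_scale[of "1 / Suc k" y] by (simp add: s_def)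
   have "(LBINT x'. cnj (b x') * cor (heat_kernel (1 / Suc k) (x - x')))
    = abs (- s k) ^ DIM('a) *\<^sub>R (LBINT y. cnj (b (x + (- s k) *\<^sub>R y)) * cor (heat_kernel (1 / Suc k) (x - (x + (- s k) *\<^sub>R y))))"
    by (rule integral_affine) (use s[of k] in simp)
   also have "... = cor (s k ^ DIM('a)) * (LBINT y. cnj (b (x - s k *\<^sub>R y)) * cor (heat_kernel (1 / Suc k) (s k *\<^sub>R y)))"
    using s[of k] by (simp add: scaleR_conv_of_real)
   also have "... = c k x" unfolding c_def integral_mult_right_zero[symmetric]
    by (intro Bochner_Integration.integral_cong refl) (simp add: hs mult_ac)
   finally show ?thesis .
  qed
  show ?thesis unfolding A B ..
 qed
 moreover have "(\<lambda>k. (LBINT x. h x * c k x)) \<longlonglongrightarrow> (LBINT x. h x * (cnj (b x) * (2 * pi) ^ DIM('a)))"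
 proof (rule integral_dominated_convergence[where w="\<lambda>x. norm (h x) * (C * (2 * pi) ^ DIM('a))"])
  show "integrable lborel (\<lambda>x. norm (h x) * (C * (2 * pi) ^ DIM('a)))" using h by auto
  show "AE x in lborel. norm (h x * c k x) \<le> norm (h x) * (C * (2 * pi) ^ DIM('a))" for k
   using cb by (auto simp: norm_mult intro!: mult_left_mono)
  have "AE x in lborel. isCont b x" using b by (simp add: nice_def)
  then show "AE x in lborel. (\<lambda>k. h x * c k x) \<longlonglongrightarrow> h x * (cnj (b x) * (2 * pi) ^ DIM('a))"
  proof eventually_elim
   case (elim x)
   have "(\<lambda>k. c k x) \<longlonglongrightarrow> (LBINT y. cnj (b x) * cor (?G y))" unfolding c_def
   proof (rule integral_dominated_convergence[OF _ _ Gi])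
    show "AE y in lborel. norm (cnj (b (x - s k *\<^sub>R y)) * cor (?G y)) \<le> C * ?G y" for k
     using C by (auto simp: norm_mult heat_kernel_nonneg intro!: mult_right_mono)
    show "AE y in lborel. (\<lambda>k. cnj (b (x - s k *\<^sub>R y)) * cor (?G y)) \<longlonglongrightarrow> cnj (b x) * cor (?G y)"
    proof (intro AE_I2 tendsto_intros)
     fix y
     have "(\<lambda>k. x - s k *\<^sub>R y) \<longlonglongrightarrow> x - 0 *\<^sub>R y" by (intro tendsto_intros s0)
     then show "(\<lambda>k. b (x - s k *\<^sub>R y)) \<longlonglongrightarrow> b x" using elim by (intro isCont_tendsto_compose[of x b]) simp_all
    qed
   qed measurable
   then show ?case by (intro tendsto_intros) (simp add: integral_heat_kernel)
  qed
 qed measurable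
 ultimately show ?thesis by (simp add: mult_ac flip: integral_mult_right_zero)
qed

text \<open>Schur's test: the product of two values is at most the mean of their squares, and the
  kernel has the same mass in either variable.\<close>

lemma heat_pairing_diagonal:
 fixes b :: "'a::euclidean_space \<Rightarrow> complex"
 assumes b: "integrable lborel b" "L2_fun b" and \<epsilon>: "\<epsilon> > 0"
 shows "norm (LBINT p. b (fst p) * cnj (b (snd p)) * cor (heat_kernel \<epsilon> (fst p - snd p)))
  \<le> (2 * pi) ^ DIM('a) * (LBINT x. (norm (b x))\<^sup>2)"
proof -
 have [measurable]: "b \<in> Borel" using b by (auto dest: borel_measurable_integrable)
 let ?H = "\<lambda>p::'a\<times>'a. heat_kernel \<epsilon> (fst p - snd p)"
 have Hnn: "heat_kernel \<epsilon> x \<ge> 0" for x :: 'a using \<epsilon> by (rule heat_kernel_nonneg)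
 have mass1: "(NN x. ennreal (heat_kernel \<epsilon> (t + c *\<^sub>R x))) = ennreal ((2 * pi) ^ DIM('a))"
  if "c = 1 \<or> c = -1" for t :: 'a and c using nn_integral_affine[of "\<lambda>x::'a. ennreal (heat_kernel \<epsilon> x)" c t] that
   nn_integral_eq_integral[OF heat_kernel_integrable[OF \<epsilon>, where 'a='a]] Hnn integral_heat_kernel[OF \<epsilon>, where 'a='a] by auto
 have "nrm (LBINT p. b (fst p) * cnj (b (snd p)) * cor (?H p))
   \<le> (NN p. norm (b (fst p) * cnj (b (snd p)) * cor (?H p)))"
  by (rule integral_norm_bound_ennreal[OF integrable_heat_pairing[OF b(1) b(1) \<epsilon>]])
 also have "... \<le> (NN p. ennreal (?H p * (norm (b (fst p)))\<^sup>2 / 2) + ennreal (?H p * (norm (b (snd p)))\<^sup>2 / 2))"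
 proof (rule nn_integral_mono)
  fix p :: "'a \<times> 'a"
  have "norm (b (fst p)) * norm (b (snd p)) \<le> ((norm (b (fst p)))\<^sup>2 + (norm (b (snd p)))\<^sup>2) / 2"
   using sum_squares_bound[of "norm (b (fst p))" "norm (b (snd p))"] by simp
  then have "norm (b (fst p)) * norm (b (snd p)) * ?H p \<le> ((norm (b (fst p)))\<^sup>2 + (norm (b (snd p)))\<^sup>2) / 2 * ?H p"
   using Hnn by (intro mult_right_mono) auto
  then show "nrm (b (fst p) * cnj (b (snd p)) * cor (?H p))
   \<le> ennreal (?H p * (norm (b (fst p)))\<^sup>2 / 2) + ennreal (?H p * (norm (b (snd p)))\<^sup>2 / 2)"
   using Hnn by (subst ennreal_plus[symmetric]) (auto simp: norm_mult field_simps intro!: ennreal_leI)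
 qed
 also have "... = (NN p. ennreal (?H p * (norm (b (fst p)))\<^sup>2 / 2)) + (NN p. ennreal (?H p * (norm (b (snd p)))\<^sup>2 / 2))"
  by (rule nn_integral_add) (simp_all add: borel_prod[symmetric])
 also have "(NN p. ennreal (?H p * (norm (b (fst p)))\<^sup>2 / 2))
   = (NN x. NN y. ennreal (?H (x,y) * (norm (b x))\<^sup>2 / 2))" by (subst tonelli_1) (simp_all add: borel_prod[symmetric])
 also have "... = (NN x. ennreal ((norm (b x))\<^sup>2 / 2) * ennreal ((2 * pi) ^ DIM('a)))"
 proof (rule nn_integral_cong)
  fix x
  have "(NN y. ennreal (?H (x,y) * (norm (b x))\<^sup>2 / 2))
    = (NN y. ennreal ((norm (b x))\<^sup>2 / 2) * ennreal (heat_kernel \<epsilon> (x + (-1) *\<^sub>R y)))"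
   using Hnn by (intro nn_integral_cong) (simp add: ennreal_mult[symmetric] mult.commute)
  then show "(NN y. ennreal (?H (x,y) * (norm (b x))\<^sup>2 / 2)) = ennreal ((norm (b x))\<^sup>2 / 2) * ennreal ((2 * pi) ^ DIM('a))"
   using mass1[of "-1" x] by (simp add: nn_integral_cmult)
 qed
 also have "(NN p. ennreal (?H p * (norm (b (snd p)))\<^sup>2 / 2))
   = (NN y. NN x. ennreal (?H (x,y) * (norm (b y))\<^sup>2 / 2))" by (subst tonelli_2) (simp_all add: borel_prod[symmetric])
 also have "... = (NN x. ennreal ((norm (b x))\<^sup>2 / 2) * ennreal ((2 * pi) ^ DIM('a)))"
 proof (rule nn_integral_cong)
  fix y
  have "(NN x. ennreal (?H (x,y) * (norm (b y))\<^sup>2 / 2))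
    = (NN x. ennreal ((norm (b y))\<^sup>2 / 2) * ennreal (heat_kernel \<epsilon> (- y + 1 *\<^sub>R x)))"
   using Hnn by (intro nn_integral_cong) (simp add: ennreal_mult[symmetric] mult.commute)
  then show "(NN x. ennreal (?H (x,y) * (norm (b y))\<^sup>2 / 2)) = ennreal ((norm (b y))\<^sup>2 / 2) * ennreal ((2 * pi) ^ DIM('a))"
   using mass1[of 1 "- y"] by (simp add: nn_integral_cmult)
 qed
 also have "(NN x. ennreal ((norm (b x))\<^sup>2 / 2) * ennreal ((2 * pi) ^ DIM('a)))
   = ennreal ((LBINT x. (norm (b x))\<^sup>2) / 2 * (2 * pi) ^ DIM('a))"
 proof -
  have "(NN x. ennreal ((norm (b x))\<^sup>2 / 2)) = ennreal (LBINT x. (norm (b x))\<^sup>2 / 2)"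
   using b(2) by (intro nn_integral_eq_integral) (auto simp: L2_fun_def)
  moreover have "(NN x. ennreal ((norm (b x))\<^sup>2 / 2) * ennreal ((2 * pi) ^ DIM('a)))
    = (NN x. ennreal ((norm (b x))\<^sup>2 / 2)) * ennreal ((2 * pi) ^ DIM('a))" by (rule nn_integral_multc) measurable
  moreover have "ennreal ((LBINT x. (norm (b x))\<^sup>2) / 2 * (2 * pi) ^ DIM('a))
    = ennreal ((LBINT x. (norm (b x))\<^sup>2) / 2) * ennreal ((2 * pi) ^ DIM('a))" by (rule ennreal_mult) auto
  ultimately show ?thesis by simp
 qed
 also have "ennreal ((LBINT x. (norm (b x))\<^sup>2) / 2 * (2 * pi) ^ DIM('a)) + ennreal ((LBINT x. (norm (b x))\<^sup>2) / 2 * (2 * pi) ^ DIM('a))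
   = ennreal ((2 * pi) ^ DIM('a) * (LBINT x. (norm (b x))\<^sup>2))" by (subst ennreal_plus[symmetric]) auto
 finally show ?thesis by (subst (asm) ennreal_le_iff) auto
qed

text \<open>The Gaussian is placed entirely on \<open>fourier b\<close> before Cauchy--Schwarz. The
  squared norm of that factor is again a diagonal Gaussian pairing and is bounded uniformly in the
  width, so the estimate survives the limit.\<close>

lemma nice_pairing_le:
 fixes h b :: "'a::euclidean_space \<Rightarrow> complex"
 assumes h: "integrable lborel h" and b: "nice b" and fh: "L2_fun (fourier h)"
 shows "(2 * pi) ^ DIM('a) * (norm (LBINT x. h x * cnj (b x)))\<^sup>2
  \<le> (LBINT y. (norm (fourier h y))\<^sup>2) * (LBINT x. (norm (b x))\<^sup>2)"
proof -
 have [measurable]: "h \<in> Borel" "b \<in> Borel"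
  using h b by (auto dest: borel_measurable_integrable nice_borel)
 define \<Gamma> where "\<Gamma> = (2 * pi) ^ DIM('a)"
 have \<Gamma>: "\<Gamma> > 0" by (simp add: \<Gamma>_def)
 define P where "P k = (LBINT p. h (fst p) * cnj (b (snd p)) * cor (heat_kernel (1 / Suc k) (fst p - snd p)))" for k
 note bi = nice_integrable[OF b]
 obtain B where B: "B \<ge> 0" "\<And>y. norm (fourier b y) \<le> B"
 proof
  show "norm (fourier b y) \<le> (LBINT x. norm (b x))" for y
   unfolding fourier_def using integral_norm_bound[of lborel "\<lambda>x. b x * cis (x \<bullet> y)"] by (simp add: norm_mult)
 qed simp
 have "(norm (P k))\<^sup>2 \<le> (LBINT y. (norm (fourier h y))\<^sup>2) * (\<Gamma> * (LBINT x. (norm (b x))\<^sup>2))" for k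
 proof -
  define \<epsilon> where "\<epsilon> = 1 / real (Suc k)"
  have \<epsilon>: "\<epsilon> > 0" by (simp add: \<epsilon>_def)
  define w where "w y = cexp (- \<epsilon> * (norm y)\<^sup>2 / 2) * fourier b y" for y
  have wm[measurable]: "w \<in> Borel" unfolding w_def by measurable
  \<comment> \<open>Squaring doubles the exponent of the Gaussian, hence the diagonal estimate is
    applied with \<open>2 * \<epsilon>\<close>.\<close>
  have w2: "(norm (w y))\<^sup>2 = exp (- (2 * \<epsilon>) * (norm y)\<^sup>2 / 2) * (norm (fourier b y))\<^sup>2" for y
   by (simp add: w_def norm_mult power_mult_distrib exp_double[symmetric])
  have wL: "L2_fun w" unfolding L2_fun_def
  proof
   have "integrable lborel (\<lambda>y::'a. B\<^sup>2 * exp (- \<epsilon> * (norm y)\<^sup>2))"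
    by (intro integrable_mult_right integrable_gaussian \<epsilon>)
   then show "integrable lborel (\<lambda>y. (norm (w y))\<^sup>2)" by (rule Bochner_Integration.integrable_bound)
      (auto simp: w2 mult.commute intro!: mult_left_mono power_mono B)
  qed simp
  have "(LBINT y. (norm (w y))\<^sup>2) = norm (cor (LBINT y. (norm (w y))\<^sup>2))" by simp
  also have "cor (LBINT y. (norm (w y))\<^sup>2)
    = (LBINT y. cexp (- (2 * \<epsilon>) * (norm y)\<^sup>2 / 2) * (fourier b y * cnj (fourier b y)))"
   by (simp only: integral_complex_of_real[symmetric] w2 of_real_mult complex_norm_square)
  also have "norm ... \<le> \<Gamma> * (LBINT x. (norm (b x))\<^sup>2)"
   using heat_pairing_diagonal[OF bi nice_L2[OF b], of "2 * \<epsilon>"] gaussian_fourier_pairing[OF bi bi, of "2 * \<epsilon>"] \<epsilon>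
   unfolding \<Gamma>_def by (simp only: mult_pos_pos zero_less_numeral)
  finally have wn: "(LBINT y. (norm (w y))\<^sup>2) \<le> \<Gamma> * (LBINT x. (norm (b x))\<^sup>2)" .
  have "P k = L2_inner (fourier h) w" unfolding P_def L2_inner_def \<epsilon>_def[symmetric] gaussian_fourier_pairing[OF h bi \<epsilon>, symmetric]
   by (simp add: w_def mult_ac)
  then have "(norm (P k))\<^sup>2 \<le> (LBINT y. (norm (fourier h y))\<^sup>2) * (LBINT y. (norm (w y))\<^sup>2)"
   using L2_Cauchy_Schwarz[OF fh wL] by simp
  also have "... \<le> (LBINT y. (norm (fourier h y))\<^sup>2) * (\<Gamma> * (LBINT x. (norm (b x))\<^sup>2))"
   using wn by (intro mult_left_mono) auto
  finally show ?thesis .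
 qed
 moreover have "(\<lambda>k. (norm (P k))\<^sup>2) \<longlonglongrightarrow> (norm (cor \<Gamma> * (LBINT x. h x * cnj (b x))))\<^sup>2"
  using heat_pairing_limit[OF h b] unfolding P_def \<Gamma>_def by (intro tendsto_intros) simp
 ultimately have "(norm (cor \<Gamma> * (LBINT x. h x * cnj (b x))))\<^sup>2
   \<le> (LBINT y. (norm (fourier h y))\<^sup>2) * (\<Gamma> * (LBINT x. (norm (b x))\<^sup>2))"
  by (intro LIMSEQ_le_const2[where X="\<lambda>k. (norm (P k))\<^sup>2"]) auto
 then have "\<Gamma> * (\<Gamma> * (norm (LBINT x. h x * cnj (b x)))\<^sup>2)
   \<le> \<Gamma> * ((LBINT y. (norm (fourier h y))\<^sup>2) * (LBINT x. (norm (b x))\<^sup>2))"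
  using \<Gamma> by (simp add: norm_mult power_mult_distrib power2_eq_square mult_ac)
 then show ?thesis using \<Gamma> unfolding \<Gamma>_def[symmetric] by simp
qed

text \<open>The pairing estimate bounds the coefficients of \<open>h\<close> in a nice basis, and
  Parseval's inequality turns this into a bound of the norm; square integrability of
  \<open>h\<close> is thus a consequence of that of its transform.\<close>

theorem plancherel_le:
 fixes h :: "'a::euclidean_space \<Rightarrow> complex"
 assumes h: "integrable lborel h"
 shows "ennreal ((2 * pi) ^ DIM('a)) * (NN x. nrmsq (h x))
  \<le> (NN y. nrmsq (fourier h y))"
proof (cases "(NN y. nrmsq (fourier h y)) < \<infinity>")
 case True
 have [measurable]: "h \<in> Borel" using h by (auto dest: borel_measurable_integrable)
 define \<Gamma> where "\<Gamma> = (2 * pi) ^ DIM('a)"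
 have \<Gamma>: "\<Gamma> > 0" by (simp add: \<Gamma>_def)
 from True have fh: "L2_fun (fourier h)" by (intro L2_funI) auto
 define F where "F = (LBINT y. (norm (fourier h y))\<^sup>2)"
 obtain b :: "nat \<Rightarrow> 'a \<Rightarrow> complex" where b: "\<And>j. nice (b j)" "orthonormal_system b UNIV"
  "\<And>H. loc_integrable H \<Longrightarrow> (\<And>j. (LBINT x. H x * cnj (b j x)) = 0) \<Longrightarrow> AE x in lborel. H x = 0"
  by (rule exists_nice_basis) blast
 define c where "c j = (LBINT x. h x * cnj (b j x))" for j
 have fin: "(\<Sum>j<N. (norm (c j))\<^sup>2) \<le> F / \<Gamma>" for N
 proof -
  define \<sigma> where "\<sigma> = (\<Sum>j<N. (norm (c j))\<^sup>2)"
  \<comment> \<open>Pairing \<open>h\<close> with this partial sum gives \<open>\<sigma>\<close>,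
    and so does the squared norm of the sum; one factor \<open>\<sigma>\<close> then
    cancels.\<close>
  define g where "g x = (\<Sum>j<N. c j * b j x)" for x
  have ng: "nice g" unfolding g_def by (intro nice_sum nice_scale b) auto
  have hb: "integrable lborel (\<lambda>x. h x * cnj (b j x))" for j by (intro nice_integrable_mult nice_cnj b integrable_imp_loc_integrable h)
  have "(LBINT x. h x * cnj (g x)) = (LBINT x. (\<Sum>j<N. cnj (c j) * (h x * cnj (b j x))))"
   unfolding g_def by (simp add: sum_distrib_left mult_ac)
  also have "... = (\<Sum>j<N. cnj (c j) * c j)" using hb by (simp add: c_def)
  also have "... = cor \<sigma>" by (simp add: \<sigma>_def complex_norm_square[symmetric] mult.commute del: of_real_power)
  finally have hg: "(LBINT x. h x * cnj (g x)) = cor \<sigma>" .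
  have gg: "(LBINT x. (norm (g x))\<^sup>2) = \<sigma>" unfolding g_def \<sigma>_def by (rule norm_combination[OF b(2)]) auto
  have \<sigma>0: "\<sigma> \<ge> 0" by (simp add: \<sigma>_def sum_nonneg)
  have "\<Gamma> * \<sigma>\<^sup>2 \<le> F * \<sigma>" using nice_pairing_le[OF h ng fh] unfolding hg gg \<Gamma>_def F_def using \<sigma>0 by simp
  then have "\<sigma> \<noteq> 0 \<Longrightarrow> \<Gamma> * \<sigma> \<le> F" using \<sigma>0 by (simp add: power2_eq_square mult.assoc[symmetric])
  moreover have "F \<ge> 0" by (simp add: F_def)
  ultimately show ?thesis using \<Gamma> unfolding \<sigma>_def[symmetric] by (cases "\<sigma> = 0") (auto simp: field_simps)
 qed
 have "(NN x. nrmsq (h x)) \<le> (\<Sum>j. nrmsq (c j))"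
  unfolding c_def by (rule nice_parseval_ge[OF b integrable_imp_loc_integrable[OF h]])
 also have "... \<le> ennreal (F / \<Gamma>)" by (intro suminf_le_const) (auto intro!: ennreal_leI fin)
 finally have "ennreal \<Gamma> * (NN x. nrmsq (h x)) \<le> ennreal \<Gamma> * ennreal (F / \<Gamma>)"
  by (rule mult_left_mono) simp
 also have "... = ennreal F" using \<Gamma> by (subst ennreal_mult'[symmetric]) auto
 also have "... = (NN y. nrmsq (fourier h y))" unfolding F_def by (rule nn_integral_L2[OF fh, symmetric])
 finally show ?thesis unfolding \<Gamma>_def .
next
 case False
 then have "(NN y. nrmsq (fourier h y)) = \<infinity>" by (simp add: less_top[symmetric])
 then show ?thesis by simp
qed

corollary fourier_zero_imp:
 fixes h :: "'a::euclidean_space \<Rightarrow> complex"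
 assumes h: "integrable lborel h" and z: "AE y in lborel. fourier h y = 0"
 shows "AE x in lborel. h x = 0"
proof -
 have [measurable]: "h \<in> Borel" using h by (auto dest: borel_measurable_integrable)
 have "(NN y. nrmsq (fourier h y)) = 0" using z by (subst nn_integral_0_iff_AE) auto
 then have "(NN x. nrmsq (h x)) = 0" using plancherel_le[OF h] by simp
 then have "AE x in lborel. nrmsq (h x) = 0" by (subst (asm) nn_integral_0_iff_AE) auto
 then show ?thesis by eventually_elim simp
qed

section \<open>A lower bound for the Hilbert--Schmidt norm\<close>

lemma borel_measurable_fst_snd [measurable]:
 "(fst :: 'a::euclidean_space \<times> 'b::euclidean_space \<Rightarrow> 'a) \<in> Borel"
 "(snd :: 'a::euclidean_space \<times> 'b::euclidean_space \<Rightarrow> 'b) \<in> Borel"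
 by (auto intro!: borel_measurable_continuous_onI continuous_intros)

lemma nn_integral_translate:
 fixes f :: "'a::euclidean_space \<Rightarrow> ennreal"
 assumes "f \<in> Borel"
 shows "(NN x. f (x + t)) = (NN x. f x)"
  and "(NN x. f (x - t)) = (NN x. f x)"
  and "(NN x. f (t - x)) = (NN x. f x)"
 using nn_integral_affine[OF assms, of 1 t] nn_integral_affine[OF assms, of 1 "- t"] nn_integral_affine[OF assms, of "-1" t]
 by (simp_all add: add.commute)

lemma integral_translate:
 fixes f :: "'a::euclidean_space \<Rightarrow> complex"
 shows "(LBINT x. f (x - t)) = (LBINT x. f x)"
  and "(LBINT x. f (t - x)) = (LBINT x. f x)"
 using integral_affine[of 1 f "- t"] integral_affine[of "-1" f t] by simp_all

text \<open>Serves the substitution from \<open>(\<xi>, u)\<close> to \<open>(\<xi> + u, u)\<close>: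
  for fixed second variable it is a translation.\<close>

lemma nn_integral_shear:
 fixes F :: "'a::euclidean_space \<times> 'a \<Rightarrow> ennreal"
 assumes [measurable]: "F \<in> Borel"
 shows "(NN p. F (fst p - snd p, snd p)) = (NN p. F p)"
proof -
 have [measurable]: "F \<in> borel_measurable (borel \<Otimes>\<^sub>M borel)" using assms by (simp add: borel_prod)
 have "(NN p. F (fst p - snd p, snd p)) = (NN u. NN x. F (x - u, u))" by (subst tonelli_2) (simp_all add: borel_prod[symmetric])
 also have "... = (NN u. NN x. F (x, u))" by (intro nn_integral_cong nn_integral_translate(2)[where f="\<lambda>x. F (x, _)"]) simp
 also have "... = (NN p. F p)" by (subst tonelli_2) auto
 finally show ?thesis .
qed

lemma integral_shear:
 fixes F :: "'a::euclidean_space \<times> 'a \<Rightarrow> complex"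
 assumes F: "integrable lborel F"
 shows "integrable lborel (\<lambda>p. F (fst p - snd p, snd p))"
  and "(LBINT p. F (fst p - snd p, snd p)) = (LBINT p. F p)"
proof -
 have Fm[measurable]: "F \<in> Borel" using F by (auto dest: borel_measurable_integrable)
 then have [measurable]: "F \<in> borel_measurable (borel \<Otimes>\<^sub>M borel)" by (simp add: borel_prod)
 show i: "integrable lborel (\<lambda>p. F (fst p - snd p, snd p))" using F nn_integral_shear[of "\<lambda>p. nrm (F p)"]
  unfolding integrable_iff_bounded by (simp add: borel_prod[symmetric])
 show "(LBINT p. F (fst p - snd p, snd p)) = (LBINT p. F p)" unfolding fubini_2(1)[OF i] fubini_2(1)[OF F]
 proof (rule Bochner_Integration.integral_cong[OF refl])
  fix u
  show "(LBINT x. F (fst (x, u) - snd (x, u), snd (x, u))) = (LBINT x. F (x, u))" using integral_translate(1)[of "\<lambda>x. F (x, u)" u] by simp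
 qed
qed

lemma suminf_swap_ennreal:
 fixes f :: "nat \<Rightarrow> nat \<Rightarrow> ennreal"
 shows "(\<Sum>k. \<Sum>j. f k j) = (\<Sum>j. \<Sum>k. f k j)"
 unfolding nn_integral_count_space_nat[symmetric, of "\<lambda>k. \<Sum>j. f k j"]
 by (subst nn_integral_suminf) (auto simp: nn_integral_count_space_nat)

lemma L2_orthonormal_basis_system: "L2_orthonormal_basis e \<Longrightarrow> orthonormal_system e UNIV"
 by (simp add: L2_orthonormal_basis_def orthonormal_system_def L2_inner_def)

lemma L2_basis_parseval_ge:
 assumes e: "L2_orthonormal_basis e" and h: "L2_fun h"
 shows "(NN x. nrmsq (h x)) \<le> (\<Sum>k. nrmsq (L2_inner (e k) h))"
proof -
 note on = L2_orthonormal_basis_system[OF e]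
 have 1: "(NN x. nrmsq (h x)) \<le> (\<Sum>k. nrmsq (LBINT x. h x * cnj (e k x)))"
 proof (rule parseval_ge[OF on])
  fix h' assume h': "L2_fun h'" "\<And>j. (LBINT x. h x * cnj (e j x)) = (LBINT x. h' x * cnj (e j x))"
  have "(LBINT x. (h x - h' x) * cnj (e j x)) = 0" for j
   using L2_inner_diff[OF h h'(1) orthonormal_system_L2[OF on]] h'(2) by (simp add: L2_inner_def)
  then have "AE x in lborel. h x - h' x = 0" using e L2_fun_diff[OF h h'(1)] unfolding L2_orthonormal_basis_def by blast
  then show "AE x in lborel. h x = h' x" by simp
 qed
 have "norm (LBINT x. h x * cnj (e k x)) = norm (L2_inner (e k) h)" for k by (metis L2_inner_cnj L2_inner_def complex_mod_cnj)
 with 1 show ?thesis by simp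
qed

text \<open>
 The sum over an arbitrary basis \<open>e\<close> is moved to the adjoint operator applied to a basis \<open>b\<close> of
 bounded functions with compact support, for which Parseval's inequality is available on all of \<open>L\<^sup>1\<close>.
\<close>

lemma kernel_hilbert_schmidt_ge:
 fixes \<kappa> :: "'a::euclidean_space \<Rightarrow> 'a \<Rightarrow> complex" and p :: "'a \<Rightarrow> real"
 assumes e: "L2_orthonormal_basis e"
  and \<kappa>m: "(\<lambda>q. \<kappa> (fst q) (snd q)) \<in> borel_measurable (borel \<Otimes>\<^sub>M borel)"
  and p: "integrable lborel p" and bd: "\<And>\<xi> u. norm (\<kappa> \<xi> u) \<le> p u"
  and Tm: "\<And>k. T k \<in> Borel"
  and T: "\<And>k. AE \<xi> in lborel. T k \<xi> = (LBINT u. \<kappa> \<xi> u * e k (\<xi> + u))"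
 shows "(NN \<xi>. NN u. nrmsq (\<kappa> \<xi> u))
  \<le> (\<Sum>k. (NN \<xi>. nrmsq (T k \<xi>)))"
proof -
 note [measurable] = Tm
 have [measurable]: "p \<in> Borel" using p by (auto dest: borel_measurable_integrable)

 have \<kappa>c2[measurable (raw)]: "(\<lambda>x. \<kappa> (f x) (g x)) \<in> borel_measurable M"
  if "f \<in> M \<rightarrow>\<^sub>M borel" "g \<in> M \<rightarrow>\<^sub>M borel" for f g and M :: "('a \<times> 'a) measure"
  using measurable_compose[OF measurable_Pair[OF that] \<kappa>m] by simp
 have \<kappa>c1[measurable (raw)]: "(\<lambda>x. \<kappa> (f x) (g x)) \<in> borel_measurable M"
  if "f \<in> M \<rightarrow>\<^sub>M borel" "g \<in> M \<rightarrow>\<^sub>M borel" for f g and M :: "'a measure"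
  using measurable_compose[OF measurable_Pair[OF that] \<kappa>m] by simp
 have p0: "p u \<ge> 0" for u using bd[of undefined u] norm_ge_zero order_trans by blast
 note on = L2_orthonormal_basis_system[OF e]
 have eL: "L2_fun (e k)" for k using on by (rule orthonormal_system_L2)
 have [measurable]: "e k \<in> Borel" for k using eL by (rule L2_fun_borel)
 obtain b :: "nat \<Rightarrow> 'a \<Rightarrow> complex" where b: "\<And>j. nice (b j)" "orthonormal_system b UNIV"
  "\<And>H. loc_integrable H \<Longrightarrow> (\<And>j. (LBINT x. H x * cnj (b j x)) = 0) \<Longrightarrow> AE x in lborel. H x = 0"
  by (rule exists_nice_basis) blast
 have [measurable]: "b j \<in> Borel" for j using b(1) by (rule nice_borel)
 have bL: "L2_fun (b j)" for j using b(1) by (rule nice_L2)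
 \<comment> \<open>The adjoint operator applied to \<open>b j\<close>, written in the variable
   \<open>\<eta> = \<xi> + u\<close> at which \<open>e k\<close> is evaluated.\<close>
 define \<psi> where "\<psi> j \<eta> = (LBINT u. cnj (\<kappa> (\<eta> - u) u) * b j (\<eta> - u))" for j \<eta>
 have [measurable]: "\<psi> j \<in> Borel" for j unfolding \<psi>_def by measurable
 define P where "P = (LBINT u. p u)"
 have Pnn: "(NN u. ennreal (p u)) = ennreal P" "P \<ge> 0" unfolding P_def by (auto intro!: nn_integral_eq_integral p simp: p0)
 have \<psi>L: "L2_fun (\<psi> j)" for j
 proof (rule L2_funI)
  obtain C where C: "C \<ge> 0" "\<And>x. norm (b j x) \<le> C" using nice_bounded[OF b(1)] by blast
  have n\<psi>: "nrm (\<psi> j \<eta>) \<le> (NN u. ennreal (p u) * nrm (b j (\<eta> - u)))" for \<eta>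
  proof (cases "integrable lborel (\<lambda>u. cnj (\<kappa> (\<eta> - u) u) * b j (\<eta> - u))")
   case True
   have "nrm (\<psi> j \<eta>) \<le> (NN u. norm (cnj (\<kappa> (\<eta> - u) u) * b j (\<eta> - u)))"
    unfolding \<psi>_def by (rule integral_norm_bound_ennreal[OF True])
   also have "... \<le> (NN u. ennreal (p u) * nrm (b j (\<eta> - u)))" by (intro nn_integral_mono)
      (simp add: norm_mult ennreal_mult[symmetric] p0 bd mult_right_mono ennreal_leI)
   finally show ?thesis .
  qed (simp add: \<psi>_def not_integrable_integral_eq)
  have "norm (\<psi> j \<eta>) \<le> P * C" for \<eta>
  proof -
   have "nrm (\<psi> j \<eta>) \<le> (NN u. ennreal (p u) * ennreal C)"
    by (rule order_trans[OF n\<psi>]) (intro nn_integral_mono mult_left_mono ennreal_leI C, simp)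
   also have "... = ennreal (P * C)" using C by (simp add: nn_integral_multc Pnn ennreal_mult)
   finally show ?thesis using Pnn C by (subst (asm) ennreal_le_iff) auto
  qed
  \<comment> \<open>The function is bounded, so its square is dominated by a multiple of its modulus
    and an \<open>L\<^sup>1\<close> bound is enough.\<close>
  then have "(norm (\<psi> j \<eta>))\<^sup>2 \<le> (P * C) * norm (\<psi> j \<eta>)" for \<eta> by (simp add: power2_eq_square mult_right_mono)
  then have "(NN \<eta>. nrmsq (\<psi> j \<eta>)) \<le> (NN \<eta>. ennreal (P * C) * nrm (\<psi> j \<eta>))"
   using Pnn C by (intro nn_integral_mono) (simp add: ennreal_mult[symmetric] ennreal_leI)
  also have "... \<le> (NN \<eta>. ennreal (P * C) * (NN u. ennreal (p u) * nrm (b j (\<eta> - u))))"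
   by (intro nn_integral_mono mult_left_mono n\<psi>) simp
  also have "... = ennreal (P * C) * (NN \<eta>. NN u. ennreal (p u) * nrm (b j (\<eta> - u)))" by (rule nn_integral_cmult) measurable
  also have "(NN \<eta>. NN u. ennreal (p u) * nrm (b j (\<eta> - u)))
    = (NN u. NN \<eta>. ennreal (p u) * nrm (b j (\<eta> - u)))" by (rule lborel_pair.Fubini'[symmetric]) measurable
  also have "... = (NN u. ennreal (p u) * (NN \<eta>. nrm (b j \<eta>)))" by (intro nn_integral_cong)
     (simp add: nn_integral_cmult nn_integral_translate(2)[where f="\<lambda>\<eta>. nrm (b j \<eta>)"])
  also have "ennreal (P * C) * ... < \<infinity>" using nice_integrable[OF b(1)[of j]]
   by (simp add: nn_integral_multc Pnn integrable_iff_bounded ennreal_mult_less_top)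
  finally show "(NN \<eta>. nrmsq (\<psi> j \<eta>)) < \<infinity>" .
 qed measurable
 have pair: "L2_inner (T k) (b j) = L2_inner (e k) (\<psi> j)" for k j
 proof -
  define \<Phi> where "\<Phi> q = \<kappa> (fst q) (snd q) * e k (fst q + snd q) * cnj (b j (fst q))" for q
  have \<Phi>m: "\<Phi> \<in> Borel" unfolding \<Phi>_def borel_prod[symmetric] by measurable
  then have [measurable]: "\<Phi> \<in> borel_measurable (borel \<Otimes>\<^sub>M borel)" by (simp add: borel_prod)
  have \<Phi>: "integrable lborel \<Phi>" unfolding integrable_iff_bounded
  proof
   show "\<Phi> \<in> borel_measurable lborel" using \<Phi>m by simp
   have "(NN q. nrm (\<Phi> q)) = (NN u. NN \<xi>. nrm (\<Phi> (\<xi>, u)))" by (subst tonelli_2) (use \<Phi>m in auto)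
   also have "... \<le> (NN u. ennreal (p u) * 2)"
   proof (rule nn_integral_mono)
    fix u
    have "(NN \<xi>. nrm (\<Phi> (\<xi>, u)))
      \<le> (NN \<xi>. ennreal (p u) * (nrmsq (e k (\<xi> + u)) + nrmsq (b j \<xi>)))"
    proof (rule nn_integral_mono)
     fix \<xi>
     have "norm (e k (\<xi> + u)) * norm (b j \<xi>) \<le> (norm (e k (\<xi> + u)))\<^sup>2 + (norm (b j \<xi>))\<^sup>2"
     proof -
      have "0 \<le> norm (e k (\<xi> + u)) * norm (b j \<xi>)" by simp
      then show ?thesis using sum_squares_bound[of "norm (e k (\<xi> + u))" "norm (b j \<xi>)"] by linarith
     qed
     then have "norm (\<kappa> \<xi> u) * (norm (e k (\<xi> + u)) * norm (b j \<xi>)) \<le> p u * ((norm (e k (\<xi> + u)))\<^sup>2 + (norm (b j \<xi>))\<^sup>2)"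
      by (intro mult_mono bd) (auto simp: p0)
     then show "nrm (\<Phi> (\<xi>, u)) \<le> ennreal (p u) * (nrmsq (e k (\<xi> + u)) + nrmsq (b j \<xi>))"
      by (simp add: \<Phi>_def norm_mult ennreal_mult[symmetric] p0 mult.assoc ennreal_leI flip: ennreal_plus)
    qed
    also have "... = ennreal (p u) * ((NN \<xi>. nrmsq (e k \<xi>)) + (NN \<xi>. nrmsq (b j \<xi>)))"
     by (simp add: nn_integral_cmult nn_integral_add nn_integral_translate(1)[where f="\<lambda>\<xi>. nrmsq (e k \<xi>)"])
    also have "(NN \<xi>. nrmsq (e k \<xi>)) = 1"
     using orthonormal_system_inner[OF on, of k k] by (simp add: nn_integral_L2[OF eL] L2_inner_self)
    also have "(NN \<xi>. nrmsq (b j \<xi>)) = 1"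
     using orthonormal_system_inner[OF b(2), of j j] by (simp add: nn_integral_L2[OF bL] L2_inner_self)
    finally show "(NN \<xi>. nrm (\<Phi> (\<xi>, u))) \<le> ennreal (p u) * 2" by simp
   qed
   also have "... < \<infinity>" by (simp add: nn_integral_multc Pnn ennreal_mult_less_top)
   finally show "(NN q. nrm (\<Phi> q)) < \<infinity>" .
  qed
  have "L2_inner (T k) (b j) = (LBINT \<xi>. (LBINT u. \<kappa> \<xi> u * e k (\<xi> + u)) * cnj (b j \<xi>))"
   unfolding L2_inner_def using T[of k] by (intro integral_cong_AE) auto
  also have "... = (LBINT \<xi>. LBINT u. \<Phi> (\<xi>, u))" unfolding \<Phi>_def by (simp flip: integral_mult_left_zero)
  also have "... = (LBINT q. \<Phi> (fst q - snd q, snd q))" using fubini_1(1)[OF \<Phi>] integral_shear(2)[OF \<Phi>] by simp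
  also have "... = (LBINT \<eta>. LBINT u. \<Phi> (\<eta> - u, u))" by (subst fubini_1(1)[OF integral_shear(1)[OF \<Phi>]]) simp
  also have "... = (LBINT \<eta>. e k \<eta> * (LBINT u. cnj (cnj (\<kappa> (\<eta> - u) u) * b j (\<eta> - u))))"
   unfolding \<Phi>_def by (simp add: mult_ac flip: integral_mult_right_zero)
  also have "... = L2_inner (e k) (\<psi> j)" unfolding L2_inner_def \<psi>_def by (simp only: Bochner_Integration.integral_cnj)
  finally show ?thesis .
 qed
 have "(NN \<xi>. NN u. nrmsq (\<kappa> \<xi> u))
   = (NN \<xi>. NN \<eta>. nrmsq (\<kappa> \<xi> (\<eta> - \<xi>)))"
  by (intro nn_integral_cong nn_integral_translate(2)[where f="\<lambda>u. nrmsq (\<kappa> _ u)", symmetric]) simp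
 also have "... = (NN \<eta>. NN \<xi>. nrmsq (\<kappa> \<xi> (\<eta> - \<xi>)))" by (rule lborel_pair.Fubini') measurable
 also have "... \<le> (NN \<eta>. (\<Sum>j. nrmsq (\<psi> j \<eta>)))"
 proof (rule nn_integral_mono)
  fix \<eta>
  have "integrable lborel (\<lambda>\<xi>. p (\<eta> - \<xi>))" using integrable_affine[OF p, of "-1" \<eta>] by simp
  then have i: "integrable lborel (\<lambda>\<xi>. \<kappa> \<xi> (\<eta> - \<xi>))"
   by (rule Bochner_Integration.integrable_bound) (auto simp: p0 bd)
  have 1: "(NN \<xi>. nrmsq (\<kappa> \<xi> (\<eta> - \<xi>)))
    \<le> (\<Sum>j. nrmsq (LBINT \<xi>. \<kappa> \<xi> (\<eta> - \<xi>) * cnj (b j \<xi>)))"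
   by (rule nice_parseval_ge[OF b integrable_imp_loc_integrable[OF i]])
  have "norm (LBINT \<xi>. \<kappa> \<xi> (\<eta> - \<xi>) * cnj (b j \<xi>)) = norm (\<psi> j \<eta>)" for j
  proof -
   have "\<psi> j \<eta> = (LBINT \<xi>. cnj (\<kappa> \<xi> (\<eta> - \<xi>)) * b j \<xi>)"
    unfolding \<psi>_def using integral_translate(2)[of "\<lambda>\<xi>. cnj (\<kappa> \<xi> (\<eta> - \<xi>)) * b j \<xi>" \<eta>] by simp
   also have "... = (LBINT \<xi>. cnj (\<kappa> \<xi> (\<eta> - \<xi>) * cnj (b j \<xi>)))" by simp
   also have "... = cnj (LBINT \<xi>. \<kappa> \<xi> (\<eta> - \<xi>) * cnj (b j \<xi>))" by (rule Bochner_Integration.integral_cnj)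
   finally show ?thesis by simp
  qed
  with 1 show "(NN \<xi>. nrmsq (\<kappa> \<xi> (\<eta> - \<xi>))) \<le> (\<Sum>j. nrmsq (\<psi> j \<eta>))" by simp
 qed
 also have "... = (\<Sum>j. (NN \<eta>. nrmsq (\<psi> j \<eta>)))" by (rule nn_integral_suminf) measurable
 also have "... \<le> (\<Sum>j. \<Sum>k. nrmsq (L2_inner (e k) (\<psi> j)))"
  by (intro suminf_le summableI L2_basis_parseval_ge[OF e \<psi>L])
 \<comment> \<open>Until here \<open>e\<close> has only been applied to \<open>\<psi> j\<close>,
   which lies in \<open>L\<^sup>2\<close>. After the exchange of the sums Bessel's inequality for
   \<open>b\<close> reassembles the norm of \<open>T k\<close>.\<close>
 also have "... = (\<Sum>k. \<Sum>j. nrmsq (L2_inner (T k) (b j)))"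
  by (simp add: pair suminf_swap_ennreal[of "\<lambda>j k. nrmsq (L2_inner (e k) (\<psi> j))"])
 also have "... \<le> (\<Sum>k. (NN \<xi>. nrmsq (T k \<xi>)))" by (intro suminf_le summableI bessel[OF b(2)]) measurable
 finally show ?thesis .
qed

text \<open>The basis inside \<open>hs_norm\<close> is an unspecified choice, so the estimate is
  asked for every orthonormal basis.\<close>

lemma le_hs_norm_power2:
 assumes "\<And>e. L2_orthonormal_basis e \<Longrightarrow> Q \<le> (\<Sum>k. (NN \<xi>. nrmsq (T (e k) \<xi>)))"
 shows "Q \<le> (hs_norm T)\<^sup>2"
proof -
 define e where "e = (SOME e :: nat \<Rightarrow> 'a \<Rightarrow> complex. L2_orthonormal_basis e)"
 have e: "L2_orthonormal_basis e" unfolding e_def by (rule someI_ex[OF exists_L2_orthonormal_basis])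
 define S where "S = (\<Sum>k. (NN \<xi>. nrmsq (T (e k) \<xi>)))"
 have hs: "hs_norm T = (if S = \<infinity> then \<infinity> else ennreal (sqrt (enn2real S)))" unfolding hs_norm_def Let_def S_def e_def ..
 have "S = (hs_norm T)\<^sup>2" by (cases S) (auto simp: hs ennreal_power)
 then show ?thesis using assms[OF e] by (simp add: S_def)
qed

text \<open>Integrating out the centre leaves a function \<open>k\<close> of \<open>(x, u)\<close>,
  and the operator gets a kernel whose dependence on \<open>\<xi>\<close> is a Fourier transform of
  \<open>k (x, u)\<close> in \<open>x\<close>. Plancherel in \<open>x\<close> and scaling by
  \<open>\<nu>\<close> produce the two powers with exponent \<open>CARD('n)\<close>.\<close>

lemma weyl_transform_hs_norm_ge:
 fixes F :: "((real^'n::finite) \<times> (real^'n)) \<times> 'z::euclidean_space \<Rightarrow> complex"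
 assumes F: "integrable lborel F" and \<nu>: "\<nu> \<noteq> 0"
 shows "ennreal ((2 * pi) ^ CARD('n)) * (NN q. nrmsq (LBINT t. F (q, t) * cis (\<nu> * (t \<bullet> \<omega>))))
  \<le> ennreal (abs \<nu> ^ CARD('n)) *
   (hs_norm (\<lambda>\<phi> \<xi>. \<integral>((x, u), t). F ((x, u), t) * schroedinger_rep \<omega> \<nu> x u t \<phi> \<xi> \<partial>lborel))\<^sup>2"
proof -
 have Fm[measurable]: "F \<in> Borel" using F by (auto dest: borel_measurable_integrable)
 have F3[measurable]: "F \<in> borel_measurable ((borel \<Otimes>\<^sub>M borel) \<Otimes>\<^sub>M borel)" using Fm by (simp add: borel_prod)
 define T where "T = (\<lambda>\<phi> \<xi>. \<integral>((x, u), t). F ((x, u), t) * schroedinger_rep \<omega> \<nu> x u t \<phi> \<xi> \<partial>lborel)"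
 define k where "k q = (LBINT t. F (q, t) * cis (\<nu> * (t \<bullet> \<omega>)))" for q
 have ki: "integrable lborel k" unfolding k_def using fubini_1(3)[OF integrable_mult_cis[OF F, of "\<lambda>r. \<nu> * (snd r \<bullet> \<omega>)"]]
  by (simp add: borel_prod[symmetric])
 have km: "k \<in> Borel" using ki by (auto dest: borel_measurable_integrable)
 then have [measurable]: "k \<in> borel_measurable (borel \<Otimes>\<^sub>M borel)" by (simp add: borel_prod)
 define \<kappa> where "\<kappa> \<xi> u = (LBINT x. k (x, u) * cis (\<nu> * (x \<bullet> \<xi> + (1/2) * (x \<bullet> u))))" for \<xi> u
 have \<kappa>m: "(\<lambda>q. \<kappa> (fst q) (snd q)) \<in> borel_measurable (borel \<Otimes>\<^sub>M borel)" unfolding \<kappa>_def by measurable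
 define p where "p u = (LBINT x. norm (k (x, u)))" for u
 have p: "integrable lborel p" using fubini_2(3)[OF integrable_of_real[OF integrable_norm[OF ki]]]
  unfolding p_def integral_complex_of_real by (simp only: complex_of_real_integrable_eq)
 have bd: "norm (\<kappa> \<xi> u) \<le> p u" for \<xi> u unfolding \<kappa>_def p_def
  using integral_norm_bound[of lborel "\<lambda>x. k (x, u) * cis (\<nu> * (x \<bullet> \<xi> + (1/2) * (x \<bullet> u)))"] by (simp add: norm_mult)
 have Tm: "T \<phi> \<in> Borel" if [measurable]: "\<phi> \<in> Borel" for \<phi>
 proof -
  have "(\<lambda>\<xi>. (LBINT r. F r * (cis (\<nu> * (snd r \<bullet> \<omega>)) * cis (\<nu> * (fst (fst r) \<bullet> \<xi> + (1/2) * (fst (fst r) \<bullet> snd (fst r)))) * \<phi> (\<xi> + snd (fst r)))))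
   \<in> Borel" by measurable
  then show ?thesis unfolding T_def schroedinger_rep_def by (simp add: case_prod_beta')
 qed
 \<comment> \<open>For square integrable \<open>\<phi>\<close> the integrals may be rearranged at
   those \<open>\<xi>\<close> where
   \<open>norm (F r) * (norm (\<phi> (\<xi> + snd (fst r))))\<^sup>2\<close> is integrable in
   \<open>r\<close>, which is almost every \<open>\<xi>\<close>.\<close>
 have TK: "AE \<xi> in lborel. T \<phi> \<xi> = (LBINT u. \<kappa> \<xi> u * \<phi> (\<xi> + u))" if \<phi>: "L2_fun \<phi>" for \<phi>
 proof -
  have [measurable]: "\<phi> \<in> Borel" using \<phi> by (rule L2_fun_borel)
  have "(NN \<xi>. NN r. nrm (F r) * nrmsq (\<phi> (\<xi> + snd (fst r))))
   = (NN r. NN \<xi>. nrm (F r) * nrmsq (\<phi> (\<xi> + snd (fst r))))" by (rule lborel_pair.Fubini') measurable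
  also have "... = (NN r. nrm (F r) * (NN \<xi>. nrmsq (\<phi> \<xi>)))" by (intro nn_integral_cong)
     (simp add: nn_integral_cmult nn_integral_translate(1)[where f="\<lambda>\<xi>. nrmsq (\<phi> \<xi>)"])
  also have "... < \<infinity>" using F L2_funD[OF \<phi>] by (simp add: nn_integral_multc integrable_iff_bounded ennreal_mult_less_top)
  finally have "AE \<xi> in lborel. (NN r. nrm (F r) * nrmsq (\<phi> (\<xi> + snd (fst r)))) \<noteq> \<infinity>"
   by (intro nn_integral_noteq_infinite) auto
  then show ?thesis
  proof eventually_elim
   case (elim \<xi>)
   define G where "G r = F r * (cis (\<nu> * (snd r \<bullet> \<omega>)) * cis (\<nu> * (fst (fst r) \<bullet> \<xi> + (1/2) * (fst (fst r) \<bullet> snd (fst r)))) * \<phi> (\<xi> + snd (fst r)))" for r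
   have Gm: "G \<in> Borel" unfolding G_def borel_prod[symmetric] by measurable
   have G: "integrable lborel G" unfolding integrable_iff_bounded
   proof
    show "G \<in> borel_measurable lborel" using Gm by simp
    have "(NN r. nrm (G r))
      \<le> (NN r. nrm (F r) + nrm (F r) * nrmsq (\<phi> (\<xi> + snd (fst r))))"
    proof (rule nn_integral_mono)
     fix r :: "((real^'n) \<times> (real^'n)) \<times> 'z"
     let ?a = "norm (\<phi> (\<xi> + snd (fst r)))"
     have "?a \<le> 1 + ?a\<^sup>2" using sum_squares_bound[of ?a 1] norm_ge_zero[of "\<phi> (\<xi> + snd (fst r))"] by (simp, linarith)
     then have "norm (F r) * ?a \<le> norm (F r) * (1 + ?a\<^sup>2)" by (intro mult_left_mono) auto
     then show "nrm (G r) \<le> nrm (F r) + nrm (F r) * ennreal (?a\<^sup>2)"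
      by (simp add: G_def norm_mult distrib_left ennreal_leI flip: ennreal_mult ennreal_plus)
    qed
    also have "... = (NN r. nrm (F r)) + (NN r. nrm (F r) * nrmsq (\<phi> (\<xi> + snd (fst r))))"
     by (rule nn_integral_add) (simp_all add: borel_prod[symmetric])
    also have "... < \<infinity>" using F elim by (simp add: integrable_iff_bounded lborel_prod less_top)
    finally show "(NN r. nrm (G r)) < \<infinity>" .
   qed
   have "T \<phi> \<xi> = (LBINT r. G r)" unfolding T_def G_def schroedinger_rep_def by (simp add: case_prod_beta')
   also have "... = (LBINT q. LBINT t. G (q, t))" by (rule fubini_1(1)[OF G])
   also have "... = (LBINT u. LBINT x. LBINT t. G ((x, u), t))" by (rule fubini_2(1)[OF fubini_1(3)[OF G]])
   also have "... = (LBINT u. \<kappa> \<xi> u * \<phi> (\<xi> + u))"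
   proof (intro Bochner_Integration.integral_cong refl)
    fix u
    have "(LBINT t. G ((x, u), t)) = k (x, u) * cis (\<nu> * (x \<bullet> \<xi> + (1/2) * (x \<bullet> u))) * \<phi> (\<xi> + u)" for x
    proof -
     have "(LBINT t. G ((x, u), t))
       = (LBINT t. (F ((x, u), t) * cis (\<nu> * (t \<bullet> \<omega>))) * (cis (\<nu> * (x \<bullet> \<xi> + (1/2) * (x \<bullet> u))) * \<phi> (\<xi> + u)))"
      by (rule Bochner_Integration.integral_cong[OF refl]) (simp add: G_def mult_ac)
     also have "... = k (x, u) * (cis (\<nu> * (x \<bullet> \<xi> + (1/2) * (x \<bullet> u))) * \<phi> (\<xi> + u))"
      unfolding k_def by (rule integral_mult_left_zero)
     finally show ?thesis by (simp add: mult.assoc)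
    qed
    then show "(LBINT x. LBINT t. G ((x, u), t)) = \<kappa> \<xi> u * \<phi> (\<xi> + u)" unfolding \<kappa>_def by simp
   qed
   finally show ?case .
  qed
 qed
 have "(NN \<xi>. NN u. nrmsq (\<kappa> \<xi> u)) \<le> (hs_norm T)\<^sup>2"
 proof (rule le_hs_norm_power2)
  fix e :: "nat \<Rightarrow> real^'n \<Rightarrow> complex" assume e: "L2_orthonormal_basis e"
  have eL: "L2_fun (e k)" for k using L2_orthonormal_basis_system[OF e] by (rule orthonormal_system_L2)
  show "(NN \<xi>. NN u. nrmsq (\<kappa> \<xi> u))
   \<le> (\<Sum>k. (NN \<xi>. nrmsq (T (e k) \<xi>)))"
   by (rule kernel_hilbert_schmidt_ge[OF e \<kappa>m p bd]) (auto intro: Tm TK eL L2_fun_borel)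
 qed
 then have "ennreal (abs \<nu> ^ CARD('n)) * (NN \<xi>. NN u. nrmsq (\<kappa> \<xi> u)) \<le> ennreal (abs \<nu> ^ CARD('n)) * (hs_norm T)\<^sup>2"
  by (rule mult_left_mono) simp
 moreover have "ennreal ((2 * pi) ^ CARD('n)) * (NN q. nrmsq (k q))
  \<le> ennreal (abs \<nu> ^ CARD('n)) * (NN \<xi>. NN u. nrmsq (\<kappa> \<xi> u))"
 proof -
  have [measurable]: "(\<lambda>x. \<kappa> (fst x) (snd x)) \<in> borel_measurable (borel \<Otimes>\<^sub>M borel)" by (rule \<kappa>m)
  have "ennreal ((2 * pi) ^ CARD('n)) * (NN q. nrmsq (k q))
   = (NN u. ennreal ((2 * pi) ^ CARD('n)) * (NN x. nrmsq (k (x, u))))"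
   using km by (subst tonelli_2) (auto simp: nn_integral_cmult)
  also have "... \<le> (NN u. ennreal (abs \<nu> ^ CARD('n)) * (NN \<xi>. nrmsq (\<kappa> \<xi> u)))"
  proof (rule nn_integral_mono_AE)
   show "AE u in lborel. ennreal ((2 * pi) ^ CARD('n)) * (NN x. nrmsq (k (x, u)))
    \<le> ennreal (abs \<nu> ^ CARD('n)) * (NN \<xi>. nrmsq (\<kappa> \<xi> u))" using fubini_2(2)[OF ki]
   proof eventually_elim
    case (elim u)
    \<comment> \<open>The argument is affine in \<open>\<xi>\<close> with slope
      \<open>\<nu>\<close>; the part depending on \<open>u\<close> is a translation and leaves the
      norm in \<open>\<xi>\<close> unchanged.\<close>
    have kf: "\<kappa> \<xi> u = fourier (\<lambda>x. k (x, u)) ((\<nu> / 2) *\<^sub>R u + \<nu> *\<^sub>R \<xi>)" for \<xi>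
     unfolding \<kappa>_def fourier_def by (simp add: inner_add_right algebra_simps)
    have "ennreal ((2 * pi) ^ CARD('n)) * (NN x. nrmsq (k (x, u)))
     \<le> (NN y. nrmsq (fourier (\<lambda>x. k (x, u)) y))" using plancherel_le[OF elim] by simp
    also have "... = ennreal (abs \<nu> ^ CARD('n)) * (NN \<xi>. nrmsq (\<kappa> \<xi> u))"
     unfolding kf using \<nu> by (subst nn_integral_affine[of _ \<nu> "(\<nu> / 2) *\<^sub>R u"]) auto
    finally show ?case .
   qed
  qed
  also have "... = ennreal (abs \<nu> ^ CARD('n)) * (NN u. NN \<xi>. nrmsq (\<kappa> \<xi> u))"
  proof (rule nn_integral_cmult)
   have [measurable (raw)]: "(\<lambda>x. \<kappa> (f x) (g x)) \<in> borel_measurable M"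
    if "f \<in> M \<rightarrow>\<^sub>M borel" "g \<in> M \<rightarrow>\<^sub>M borel" for f g and M :: "((real^'n) \<times> (real^'n)) measure"
    using measurable_compose[OF measurable_Pair[OF that] \<kappa>m] by simp
   show "(\<lambda>u. (NN \<xi>. nrmsq (\<kappa> \<xi> u))) \<in> borel_measurable lborel" by measurable
  qed
  also have "(NN u. NN \<xi>. nrmsq (\<kappa> \<xi> u)) = (NN \<xi>. NN u. nrmsq (\<kappa> \<xi> u))"
   using lborel_pair.Fubini[of "\<lambda>q. nrmsq (\<kappa> (fst q) (snd q))"] by simp
  finally show ?thesis .
 qed
 ultimately show ?thesis unfolding k_def T_def by (rule order_trans[rotated])
qed

section \<open>Entire functions of order two\<close>

lemma holomorphic_on_UNIV_scale:
 fixes F :: "complex \<Rightarrow> complex"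
 assumes "F holomorphic_on UNIV"
 shows "(\<lambda>z. F (c * z)) holomorphic_on S"
proof -
 have "(F \<circ> (\<lambda>z. c * z)) holomorphic_on S" by (rule holomorphic_on_compose_gen[OF _ assms]) (auto intro!: holomorphic_intros)
 then show ?thesis by (simp add: o_def)
qed

text \<open>In the cone, \<open>Re (w\<^sup>2)\<close> is at least
  \<open>(1 - k\<^sup>2) * (Re w)\<^sup>2\<close>. The constant added to the logarithm therefore
  contributes at least 8 times \<open>(Re w)\<^sup>2\<close>, which outweighs the cross term because
  the argument of \<open>w\<close> is at most 4 in modulus.\<close>

lemma Re_power2_times_Ln_ge:
 fixes w :: complex
 assumes k: "0 < k" "k < 1" and w: "Re w \<ge> 1" "abs (Im w) \<le> k * Re w"
 shows "Re (w\<^sup>2 * (Ln w + cor (8 / (1 - k\<^sup>2)))) \<ge> (1 - k\<^sup>2) / 2 * (norm w)\<^sup>2 * ln (norm w)"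
  and "ln (norm w) \<ge> 0"
proof -
 define D where "D = 8 / (1 - k\<^sup>2)"
 have k2: "k\<^sup>2 < 1" using k by (simp add: power_less_one_iff abs_square_less_1)
 have w0: "w \<noteq> 0" using w by auto
 have y2: "(Im w)\<^sup>2 \<le> k\<^sup>2 * (Re w)\<^sup>2" using power_mono[OF w(2), of 2] by (simp add: power_mult_distrib)
 have n1: "norm w \<ge> 1" using w(1) complex_Re_le_cmod[of w] by linarith
 then show l0: "ln (norm w) \<ge> 0" by simp
 have nw: "(norm w)\<^sup>2 \<le> 2 * (Re w)\<^sup>2"
 proof -
  have "k\<^sup>2 * (Re w)\<^sup>2 \<le> 1 * (Re w)\<^sup>2" using k2 by (intro mult_right_mono) auto
  then show ?thesis using y2 by (simp add: cmod_power2)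
 qed
 have im: "abs (Im (Ln w)) \<le> 4" using mpi_less_Im_Ln[OF w0] Im_Ln_le_pi[OF w0] pi_less_4 by linarith
 have "abs (Re w * Im w) \<le> (Re w)\<^sup>2"
 proof -
  have "abs (Im w) \<le> Re w" using w k by (smt (verit) mult_le_cancel_right1)
  then have "abs (Re w) * abs (Im w) \<le> Re w * Re w" using w(1) by (intro mult_mono) auto
  then show ?thesis by (simp add: abs_mult power2_eq_square)
 qed
 then have xy: "abs (2 * (Re w * Im w) * Im (Ln w)) \<le> 2 * (Re w)\<^sup>2 * 4"
  unfolding abs_mult[of "2 * (Re w * Im w)"] using im by (intro mult_mono) (auto simp: abs_mult)
 have "Re (w\<^sup>2 * (Ln w + cor D)) = ((Re w)\<^sup>2 - (Im w)\<^sup>2) * (ln (norm w) + D) - 2 * (Re w * Im w) * Im (Ln w)"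
  using w0 by (simp add: Re_power2 Im_power2)
 moreover have "(1 - k\<^sup>2) * (Re w)\<^sup>2 * (ln (norm w) + D) \<le> ((Re w)\<^sup>2 - (Im w)\<^sup>2) * (ln (norm w) + D)"
  using y2 l0 k2 by (intro mult_right_mono) (auto simp: algebra_simps D_def)
 moreover have "(1 - k\<^sup>2) * (Re w)\<^sup>2 * (ln (norm w) + D) = (1 - k\<^sup>2) * (Re w)\<^sup>2 * ln (norm w) + 8 * (Re w)\<^sup>2"
  using k2 by (simp add: D_def field_simps)
 moreover have "(1 - k\<^sup>2) / 2 * (norm w)\<^sup>2 * ln (norm w) \<le> (1 - k\<^sup>2) * (Re w)\<^sup>2 * ln (norm w)"
 proof (rule mult_right_mono[OF _ l0])
  have "(1 - k\<^sup>2) / 2 * (norm w)\<^sup>2 \<le> (1 - k\<^sup>2) / 2 * (2 * (Re w)\<^sup>2)" using nw k2 by (intro mult_left_mono) auto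
  then show "(1 - k\<^sup>2) / 2 * (norm w)\<^sup>2 \<le> (1 - k\<^sup>2) * (Re w)\<^sup>2" by simp
 qed
 ultimately show "Re (w\<^sup>2 * (Ln w + cor (8 / (1 - k\<^sup>2)))) \<ge> (1 - k\<^sup>2) / 2 * (norm w)\<^sup>2 * ln (norm w)"
  using xy unfolding D_def[symmetric] by linarith
qed

text \<open>
 The aperture of the cone is less than a right angle, so \<open>exp (- \<delta> w\<^sup>2 (Ln w + D))\<close> with \<open>w = z + 1\<close>
 decays faster there than any function of order two grows.
\<close>

lemma phragmen_lindelof_cone:
 assumes hol: "f holomorphic_on {z. Re z > -1}" and k: "0 < k" "k < 1"
  and growth: "\<And>z. (abs (Im z)) \<le> k * Re z \<Longrightarrow> norm (f z) \<le> A * exp (K * (norm z)\<^sup>2)" and A: "A > 0" and K: "K \<ge> 0"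
  and bd: "\<And>z. (abs (Im z)) = k * Re z \<Longrightarrow> norm (f z) \<le> B" and B: "B > 0"
  and z0: "abs (Im z0) \<le> k * Re z0"
 shows "norm (f z0) \<le> B"
proof -
 define D where "D = cor (8 / (1 - k\<^sup>2))"
 define G where "G z = (z + 1)\<^sup>2 * (Ln (z + 1) + D)" for z
 have k2: "k\<^sup>2 < 1" using k by (simp add: power_less_one_iff abs_square_less_1)
 have cone: "Re z \<ge> 0" if "abs (Im z) \<le> k * Re z" for z using that k by (smt (verit) mult_pos_neg)
 have Gre: "Re (G z) \<ge> (1 - k\<^sup>2) / 2 * (norm (z+1))\<^sup>2 * ln (norm (z+1))" "ln (norm (z + 1)) \<ge> 0" if "abs (Im z) \<le> k * Re z" for z
 proof -
  have "abs (Im (z+1)) \<le> k * Re (z+1)" using that k by (simp add: distrib_left)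
  then show "Re (G z) \<ge> (1 - k\<^sup>2) / 2 * (norm (z+1))\<^sup>2 * ln (norm (z+1))" "ln (norm (z + 1)) \<ge> 0"
   using Re_power2_times_Ln_ge[OF k, of "z+1"] cone[OF that] unfolding G_def D_def by auto
 qed
 have Gnn: "Re (G z) \<ge> 0" if "abs (Im z) \<le> k * Re z" for z
 proof -
  have "0 \<le> (1 - k\<^sup>2) / 2 * (norm (z+1))\<^sup>2 * ln (norm (z+1))" using Gre(2)[OF that] k2 by (intro mult_nonneg_nonneg) auto
  then show ?thesis using Gre(1)[OF that] by linarith
 qed
 have main: "norm (f z0) \<le> B * exp (\<delta> * Re (G z0))" if \<delta>: "\<delta> > 0" for \<delta>
 proof -
  define h where "h z = f z * exp (- (cor \<delta>) * G z)" for z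
  have nh: "norm (h z) = norm (f z) * exp (- \<delta> * Re (G z))" for z by (simp add: h_def norm_mult)
  define \<delta>' where "\<delta>' = \<delta> * ((1 - k\<^sup>2) / 2)"
  have \<delta>': "\<delta>' > 0" using \<delta> k2 by (simp add: \<delta>'_def)
  define L where "L = abs (ln (A / B))"
  \<comment> \<open>The radius is so large that \<open>\<delta>' * ln r\<close> is at least
    \<open>K + L\<close>: on the arc the decay then beats the growth \<open>K\<close> and still
    brings \<open>A\<close> down to \<open>B\<close>.\<close>
  define r where "r = max (norm z0 + 1) (exp ((K + L) / \<delta>'))"
  have r1: "r \<ge> 1" unfolding r_def by (simp add: le_max_iff_disj)
  have lnr: "\<delta>' * ln r \<ge> K + L"
  proof -
   have "(K + L) / \<delta>' \<le> ln r" using r1 by (subst ln_ge_iff) (auto simp: r_def)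
   then show ?thesis using \<delta>' by (simp add: field_simps)
  qed
  define T where "T = {z. (abs (Im z)) \<le> k * Re z} \<inter> cball 0 r"
  have Tcl: "closed T" unfolding T_def by (intro closed_Int closed_Collect_le continuous_intros closed_cball)
  have Tsub: "T \<subseteq> {z. Re z > -1}" using cone by (force simp: T_def)
  have hhol: "h holomorphic_on {z. Re z > -1}" unfolding h_def G_def
  proof (intro holomorphic_intros hol)
   fix z assume "z \<in> {z. Re z > -1}"
   then show "z + 1 \<notin> \<real>\<^sub>\<le>\<^sub>0" by (auto simp: complex_nonpos_Reals_iff)
  qed
  have "norm (h z0) \<le> B"
  proof (rule maximum_modulus_frontier[where S=T and f=h and \<xi>=z0])
   show "h holomorphic_on interior T" using hhol Tsub interior_subset by (meson holomorphic_on_subset order_trans)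
   show "continuous_on (closure T) h" using holomorphic_on_imp_continuous_on[OF hhol] Tsub Tcl continuous_on_subset by auto
   show "bounded T" unfolding T_def by (rule bounded_Int) auto
   show "z0 \<in> T" using z0 by (simp add: T_def r_def)
   fix z assume z: "z \<in> frontier T"
   then have zT: "abs (Im z) \<le> k * Re z" "norm z \<le> r" using Tcl by (auto simp: frontier_def T_def)
   show "norm (h z) \<le> B"
   proof (cases "norm z = r")
    case True
    let ?w = "norm (z + 1)"
    have wr: "?w \<ge> r"
    proof -
     have "(norm z)\<^sup>2 \<le> (norm (z+1))\<^sup>2" using cone[OF zT(1)] unfolding cmod_power2 by (simp add: power2_eq_square algebra_simps)
     then have "norm z \<le> norm (z + 1)" by (rule power2_le_imp_le) simp
     then show ?thesis using True by simp
    qed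
    have "(K + L) * r\<^sup>2 \<le> \<delta>' * ln r * r\<^sup>2" using lnr by (intro mult_right_mono) auto
    also have "... \<le> \<delta>' * ln ?w * ?w\<^sup>2" using wr r1 \<delta>' by (intro mult_mono power_mono order_refl) (auto simp: ln_mono)
    also have "... \<le> \<delta> * Re (G z)" using mult_left_mono[OF Gre(1)[OF zT(1)], of \<delta>] \<delta> by (simp add: \<delta>'_def mult_ac)
    finally have g: "(K + L) * r\<^sup>2 \<le> \<delta> * Re (G z)" .
    have "norm (h z) \<le> A * exp (K * r\<^sup>2) * exp (- ((K + L) * r\<^sup>2))"
     unfolding nh using growth[OF zT(1)] g True A by (intro mult_mono) auto
    also have "... = A * exp (- (L * r\<^sup>2))" by (simp add: exp_add[symmetric] algebra_simps)
    also have "... \<le> A * exp (- L)"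
    proof -
     have "L * 1 \<le> L * r\<^sup>2" using r1 by (intro mult_left_mono) (auto simp: L_def)
     then show ?thesis using A by (intro mult_left_mono) auto
    qed
    also have "... \<le> A * exp (- ln (A / B))" using A by (intro mult_left_mono) (auto simp: L_def)
    also have "... = B" using A B by (simp add: exp_minus)
    finally show ?thesis .
   next
    case False
    have "abs (Im z) = k * Re z"
    proof (rule ccontr)
     assume ne: "abs (Im z) \<noteq> k * Re z"
     let ?U = "{z. (abs (Im z)) < k * Re z} \<inter> ball 0 r"
     have "open ?U" by (intro open_Int open_Collect_less continuous_intros open_ball)
     moreover have "?U \<subseteq> T" by (auto simp: T_def)
     moreover have "z \<in> ?U" using ne zT False by auto
     ultimately have "z \<in> interior T" by (meson interior_maximal subsetD)
     then show False using z by (simp add: frontier_def)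
    qed
    then have "norm (h z) \<le> B * exp (- \<delta> * Re (G z))" unfolding nh using bd by (intro mult_right_mono) auto
    also have "... \<le> B * 1" using B \<delta> Gnn[OF zT(1)] by (intro mult_left_mono) auto
    finally show ?thesis by simp
   qed
  qed
  then show ?thesis unfolding nh by (simp add: exp_minus field_simps)
 qed
 \<comment> \<open>The auxiliary factor disappears as \<open>\<delta>\<close> tends to 0.\<close>
 have "(\<lambda>n. B * exp (1 / real (Suc n) * Re (G z0))) \<longlonglongrightarrow> B * exp (0 * Re (G z0))"
  using LIMSEQ_inverse_real_of_nat by (intro tendsto_intros) (simp add: inverse_eq_divide)
 moreover have "norm (f z0) \<le> B * exp (1 / real (Suc n) * Re (G z0))" for n by (rule main) simp
 ultimately have "norm (f z0) \<le> B * exp (0 * Re (G z0))" by (intro LIMSEQ_le_const) auto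
 then show ?thesis by simp
qed

text \<open>On the edges of the quarter plane the exponent vanishes, but this aperture is critical
  for functions of order two. On a narrower cone the exponent along the edges is cancelled by
  \<open>exp (- s * z\<^sup>2)\<close>, and \<open>s\<close> tends to 0 as the cone opens.\<close>

lemma polynomial_growth_cone:
 assumes hol: "G holomorphic_on UNIV" and C: "C > 0"
  and bd: "\<And>z. norm (G z) \<le> C * (1 + norm z) ^ N * exp ((abs (Re z) - abs (Im z))\<^sup>2 / 4)"
  and z0: "abs (Im z0) < Re z0"
 shows "norm (G z0) \<le> C * 2 ^ N * (1 + norm z0) ^ N"
proof -
 define k0 where "k0 = max (1/2) (abs (Im z0) / Re z0)"
 have k0: "0 < k0" "k0 < 1" "abs (Im z0) \<le> k0 * Re z0" using z0 by (auto simp: k0_def field_simps max_def)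
 have main: "norm (G z0) \<le> C * 2 ^ N * (1 + norm z0) ^ N * exp ((1 - k) / (4 * (1 + k)) * Re (z0\<^sup>2))"
  if k: "k0 < k" "k < 1" for k
 proof -
  have kp: "0 < k" using k k0 by linarith
  \<comment> \<open>On the edge \<open>abs (Im z) = k * Re z\<close> the exponent is
    \<open>(1 - k)\<^sup>2 * (Re z)\<^sup>2 / 4\<close> and \<open>Re (z\<^sup>2)\<close> is
    \<open>(1 - k\<^sup>2) * (Re z)\<^sup>2\<close>; \<open>s\<close> is their quotient.\<close>
  define s where "s = (1 - k) / (4 * (1 + k))"
  have s0: "s \<ge> 0" using k kp by (simp add: s_def)
  \<comment> \<open>Division by \<open>(1 + z) ^ N\<close> removes the polynomial factor; its zero
    at -1 lies outside the half plane in question.\<close>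
  define f where "f z = G z * exp (- cor s * z\<^sup>2) / (1 + z) ^ N" for z
  have cone: "Re z \<ge> 0" if "abs (Im z) \<le> k * Re z" for z using that kp by (smt (verit) mult_pos_neg)
  have n1: "norm (1 + z) \<ge> (1 + norm z) / 2" "norm (1 + z) > 0" if "Re z \<ge> 0" for z
  proof -
   have "norm (1 + z) \<ge> 1" using that complex_Re_le_cmod[of "1+z"] by simp
   moreover have "(norm z)\<^sup>2 \<le> (norm (1+z))\<^sup>2" using that unfolding cmod_power2 by (simp add: power2_eq_square algebra_simps)
   then have "norm z \<le> norm (1 + z)" by (rule power2_le_imp_le) simp
   moreover have "1 \<le> a \<Longrightarrow> b \<le> a \<Longrightarrow> (1 + b) / 2 \<le> a \<and> 0 < a" for a b :: real by auto
   ultimately have "norm (1 + z) \<ge> (1 + norm z) / 2 \<and> norm (1 + z) > 0" by blast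
   then show "norm (1 + z) \<ge> (1 + norm z) / 2" "norm (1 + z) > 0" by auto
  qed
  have nf: "norm (f z) \<le> C * 2 ^ N * exp ((abs (Re z) - abs (Im z))\<^sup>2 / 4) * exp (- s * Re (z\<^sup>2))" if z: "Re z \<ge> 0" for z
  proof -
   have "(1 + norm z) ^ N \<le> (2 * norm (1 + z)) ^ N" using n1(1)[OF z] by (intro power_mono) auto
   then have p: "(1 + norm z) ^ N \<le> 2 ^ N * norm (1 + z) ^ N" by (simp add: power_mult_distrib)
   have "norm (f z) = norm (G z) * exp (- s * Re (z\<^sup>2)) / norm (1 + z) ^ N" by (simp add: f_def norm_mult norm_divide norm_power)
   also have "... \<le> (C * (2 ^ N * norm (1 + z) ^ N) * exp ((abs (Re z) - abs (Im z))\<^sup>2 / 4)) * exp (- s * Re (z\<^sup>2)) / norm (1 + z) ^ N"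
    using order_trans[OF bd[of z], of "C * (2 ^ N * norm (1 + z) ^ N) * exp ((abs (Re z) - abs (Im z))\<^sup>2 / 4)"] p C
    by (intro divide_right_mono mult_right_mono) (auto intro!: mult_right_mono)
   also have "... = C * 2 ^ N * exp ((abs (Re z) - abs (Im z))\<^sup>2 / 4) * exp (- s * Re (z\<^sup>2))" using n1(2)[OF z] by simp
   finally show ?thesis .
  qed
  have "norm (f z0) \<le> C * 2 ^ N"
  proof (rule phragmen_lindelof_cone[where f=f and k=k and K="1/4" and A="C * 2 ^ N"])
   show "f holomorphic_on {z. Re z > -1}" unfolding f_def
   proof (intro holomorphic_intros)
    show "G holomorphic_on {z. Re z > -1}" using hol by (rule holomorphic_on_subset) simp
    fix z :: complex assume "z \<in> {z. Re z > -1}"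
    then have "Re (1 + z) \<noteq> 0" by simp
    then show "(1 + z) ^ N \<noteq> 0" by (metis power_not_zero zero_complex.sel(1))
   qed
   fix z :: complex assume z: "abs (Im z) \<le> k * Re z"
   note z' = cone[OF z]
   have zz: "(Im z)\<^sup>2 \<le> (Re z)\<^sup>2"
   proof -
    have "k * Re z \<le> 1 * Re z" using k z' by (intro mult_right_mono) auto
    then show ?thesis using z z' by (simp add: abs_le_square_iff[symmetric])
   qed
   have E: "exp ((abs (Re z) - abs (Im z))\<^sup>2 / 4) * exp (- s * Re (z\<^sup>2)) \<le> exp (1 / 4 * (norm z)\<^sup>2) * 1"
   proof (intro mult_mono)
    have "0 \<le> abs (Re z) * abs (Im z)" by simp
    then show "exp ((abs (Re z) - abs (Im z))\<^sup>2 / 4) \<le> exp (1 / 4 * (norm z)\<^sup>2)" by (simp add: cmod_power2 power2_diff)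
    have "0 \<le> s * Re (z\<^sup>2)" using s0 zz by (intro mult_nonneg_nonneg) (auto simp: Re_power2)
    then show "exp (- s * Re (z\<^sup>2)) \<le> 1" by simp
   qed auto
   have "norm (f z) \<le> C * 2 ^ N * (exp ((abs (Re z) - abs (Im z))\<^sup>2 / 4) * exp (- s * Re (z\<^sup>2)))"
    using nf[OF z'] by (simp only: mult.assoc)
   also have "... \<le> C * 2 ^ N * (exp (1 / 4 * (norm z)\<^sup>2) * 1)" by (rule mult_left_mono[OF E]) (use C in simp)
   finally show "norm (f z) \<le> C * 2 ^ N * exp (1 / 4 * (norm z)\<^sup>2)" by simp
  next
   fix z :: complex assume z: "abs (Im z) = k * Re z"
   have z': "Re z \<ge> 0" using cone z by simp
   have se: "s * Re (z\<^sup>2) = (abs (Re z) - abs (Im z))\<^sup>2 / 4"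
   proof -
    have "(Im z)\<^sup>2 = (k * Re z)\<^sup>2" using z by (metis power2_abs)
    then have "Re (z\<^sup>2) = (Re z)\<^sup>2 * ((1 - k) * (1 + k))" by (simp add: Re_power2 power_mult_distrib power2_eq_square algebra_simps)
    moreover have "(abs (Re z) - abs (Im z))\<^sup>2 = (Re z)\<^sup>2 * (1 - k)\<^sup>2" using z z' by (simp add: power2_eq_square algebra_simps)
    ultimately show ?thesis using kp by (simp add: s_def power2_eq_square field_simps)
   qed
   have "exp ((abs (Re z) - abs (Im z))\<^sup>2 / 4) * exp (- s * Re (z\<^sup>2)) = 1" unfolding exp_add[symmetric] by (simp add: se)
   then show "norm (f z) \<le> C * 2 ^ N" using nf[OF z'] by (simp only: mult.assoc mult_1_right)
  next
   have "k0 * Re z0 \<le> k * Re z0" using k z0 by (intro mult_right_mono) auto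
   then show "abs (Im z0) \<le> k * Re z0" using k0 by linarith
  qed (use C k kp in auto)
  moreover have "norm (f z0) = norm (G z0) * exp (- s * Re (z0\<^sup>2)) / norm (1 + z0) ^ N" by (simp add: f_def norm_mult norm_divide norm_power)
  moreover have "norm (1 + z0) > 0" using n1(2)[of z0] z0 by simp
  ultimately have "norm (G z0) \<le> C * 2 ^ N * norm (1 + z0) ^ N * exp (s * Re (z0\<^sup>2))" by (simp add: exp_minus field_simps)
  also have "... \<le> C * 2 ^ N * (1 + norm z0) ^ N * exp (s * Re (z0\<^sup>2))"
   using C norm_triangle_ineq[of 1 z0] by (intro mult_right_mono mult_left_mono power_mono) auto
  finally show ?thesis unfolding s_def .
 qed
 have "((\<lambda>k. C * 2 ^ N * (1 + norm z0) ^ N * exp ((1 - k) / (4 * (1 + k)) * Re (z0\<^sup>2))) \<longlongrightarrow>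
   C * 2 ^ N * (1 + norm z0) ^ N * exp ((1 - 1) / (4 * (1 + 1)) * Re (z0\<^sup>2))) (at_left 1)" by (intro tendsto_intros) auto
 then have "norm (G z0) \<le> C * 2 ^ N * (1 + norm z0) ^ N * exp ((1 - 1) / (4 * (1 + 1)) * Re (z0\<^sup>2))"
  by (rule tendsto_lowerbound) (use main k0 in \<open>auto intro!: eventually_at_leftI[of k0]\<close>)
 then show ?thesis by simp
qed

text \<open>The bound is invariant under multiplication by powers of \<open>\<i>\<close>, which
  permute the four quarter planes between the diagonals; on the diagonals themselves the exponent is
  0.\<close>

lemma polynomial_growth:
 assumes hol: "G holomorphic_on UNIV" and C: "C > 0"
  and bd: "\<And>z. norm (G z) \<le> C * (1 + norm z) ^ N * exp ((abs (Re z) - abs (Im z))\<^sup>2 / 4)"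
 shows "norm (G z) \<le> C * 2 ^ N * (1 + norm z) ^ N"
proof -
 have rot: "norm (G z) \<le> C * 2 ^ N * (1 + norm z) ^ N"
  if c: "c = 1 \<or> c = -1 \<or> c = \<i> \<or> c = -\<i>" and z: "abs (Im (z / c)) < Re (z / c)" for c
 proof -
  have c1: "norm c = 1" "c \<noteq> 0" using c by auto
  have "norm ((\<lambda>w. G (c * w)) (z / c)) \<le> C * 2 ^ N * (1 + norm (z / c)) ^ N"
  proof (rule polynomial_growth_cone[OF _ C _ z])
   show "(\<lambda>w. G (c * w)) holomorphic_on UNIV" by (rule holomorphic_on_UNIV_scale[OF hol])
   fix w :: complex
   have "(abs (Re (c * w)) - abs (Im (c * w)))\<^sup>2 = (abs (Re w) - abs (Im w))\<^sup>2" using c by (auto simp: power2_commute)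
   then show "norm (G (c * w)) \<le> C * (1 + norm w) ^ N * exp ((abs (Re w) - abs (Im w))\<^sup>2 / 4)"
    using bd[of "c * w"] by (simp add: norm_mult c1)
  qed
  then show ?thesis using c1 by (simp add: norm_divide)
 qed
 consider "abs (Im z) < Re z" | "abs (Im z) < - Re z" | "abs (Re z) < Im z" | "abs (Re z) < - Im z" | "abs (Re z) = abs (Im z)" by linarith
 then show ?thesis
 proof cases
  case 5
  have "norm (G z) \<le> C * 1 * (1 + norm z) ^ N" using bd[of z] 5 by simp
  also have "... \<le> C * 2 ^ N * (1 + norm z) ^ N" using C by (intro mult_right_mono mult_left_mono) auto
  finally show ?thesis .
 qed (use rot[of 1] rot[of "-1"] rot[of \<i>] rot[of "-\<i>"] in \<open>auto simp: Re_divide_of_real divide_i\<close>)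
qed

lemma entire_polynomial_growth:
 assumes hol: "G holomorphic_on UNIV" and bd: "\<And>z. norm z \<ge> 1 \<Longrightarrow> norm (G z) \<le> C * (norm z) ^ N"
 shows "\<exists>p. degree p \<le> N \<and> (\<forall>z. G z = poly p z)"
proof -
 define p where "p = (\<Sum>k\<le>N. monom ((deriv^^k) G 0 / fact k) k)"
 have "G z = poly p z" for z using Liouville_polynomial[OF hol bd, where \<xi>=z] by (simp add: p_def poly_sum poly_monom)
 moreover have "degree p \<le> N" unfolding p_def by (intro degree_sum_le) (auto intro: order_trans[OF degree_monom_le])
 ultimately show ?thesis by blast
qed

text \<open>Rotation by \<open>pi / 4\<close> turns the exponent
  \<open>min ((Re z)\<^sup>2) ((Im z)\<^sup>2) / 2\<close> into
  \<open>(abs (Re z) - abs (Im z))\<^sup>2 / 4\<close>, which vanishes on the diagonals.\<close>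

lemma product_is_polynomial:
 assumes F: "F holomorphic_on UNIV" and H: "H holomorphic_on UNIV" and C: "C > 0"
  and bd: "\<And>z. norm (F z * H (\<i> * z)) \<le> C * (1 + norm z) ^ N * exp (min ((Re z)\<^sup>2) ((Im z)\<^sup>2) / 2)"
 shows "\<exists>p. \<forall>z. F z * H (\<i> * z) = poly p z"
proof -
 define c where "c = cis (pi / 4)"
 have c: "c = Complex (1 / sqrt 2) (1 / sqrt 2)" by (simp add: c_def complex_eq_iff cos_45 sin_45 field_simps)
 have c1: "norm c = 1" "c \<noteq> 0" by (simp_all add: c_def)
 define G where "G z = F (c * z) * H (\<i> * (c * z))" for z
 have Gh: "G holomorphic_on UNIV" unfolding G_def mult.assoc[symmetric, of \<i> c] by (intro holomorphic_intros holomorphic_on_UNIV_scale F H)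
 have Gb: "norm (G z) \<le> C * (1 + norm z) ^ N * exp ((abs (Re z) - abs (Im z))\<^sup>2 / 4)" for z
 proof -
  let ?x = "Re z" and ?y = "Im z"
  have "(Re (c * z))\<^sup>2 = (?x - ?y)\<^sup>2 / 2" "(Im (c * z))\<^sup>2 = (?x + ?y)\<^sup>2 / 2"
   by (simp_all add: c power_divide diff_divide_distrib[symmetric] add_divide_distrib[symmetric] add.commute)
  moreover have "min ((?x - ?y)\<^sup>2 / 2) ((?x + ?y)\<^sup>2 / 2) / 2 \<le> (abs (?x) - abs (?y))\<^sup>2 / 4"
  proof (cases "?x * ?y \<ge> 0")
   case True
   then have "(abs (?x) - abs (?y))\<^sup>2 = (?x - ?y)\<^sup>2" by (simp add: power2_diff abs_mult[symmetric] mult.assoc)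
   then show ?thesis by simp
  next
   case False
   then have "(abs (?x) - abs (?y))\<^sup>2 = (?x + ?y)\<^sup>2" by (simp add: power2_diff power2_sum abs_mult[symmetric] mult.assoc)
   then show ?thesis by simp
  qed
  ultimately have "exp (min ((Re (c * z))\<^sup>2) ((Im (c * z))\<^sup>2) / 2) \<le> exp ((abs (?x) - abs (?y))\<^sup>2 / 4)" by simp
  then have "C * (1 + norm z) ^ N * exp (min ((Re (c * z))\<^sup>2) ((Im (c * z))\<^sup>2) / 2)
    \<le> C * (1 + norm z) ^ N * exp ((abs (?x) - abs (?y))\<^sup>2 / 4)" using C by (intro mult_left_mono) auto
  then show ?thesis using bd[of "c * z"] by (simp add: G_def norm_mult c1)
 qed
 have "\<exists>p. degree p \<le> N \<and> (\<forall>z. G z = poly p z)"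
 proof (rule entire_polynomial_growth[OF Gh])
  fix z :: complex assume z: "norm z \<ge> 1"
  have "norm (G z) \<le> C * 2 ^ N * (1 + norm z) ^ N" by (rule polynomial_growth[OF Gh C Gb])
  also have "... \<le> C * 2 ^ N * (2 * norm z) ^ N" using C z by (intro mult_left_mono power_mono) auto
  finally show "norm (G z) \<le> (C * 2 ^ N * 2 ^ N) * norm z ^ N" by (simp add: power_mult_distrib mult_ac)
 qed
 then obtain p where p: "\<And>z. G z = poly p z" by blast
 have "F z * H (\<i> * z) = poly (pcompose p [:0, 1 / c:]) z" for z using p[of "z / c"] c1 by (simp add: G_def poly_pcompose)
 then show ?thesis by blast
qed

section \<open>Hadamard factorisation in order two\<close>

text \<open>Every zero of \<open>F\<close> is a root of \<open>p\<close>, so dividing it out of both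
  lowers the degree of \<open>p\<close>. When no zero is left, what remains of \<open>F\<close> is
  the factor \<open>E\<close>.\<close>

lemma entire_divisor_of_polynomial:
 assumes "F holomorphic_on UNIV" "H holomorphic_on UNIV" "p \<noteq> 0" "\<And>z. F z * H z = poly p z"
 shows "\<exists>R E. R \<noteq> 0 \<and> E holomorphic_on UNIV \<and> (\<forall>z. E z \<noteq> 0) \<and> (\<forall>z. F z = poly R z * E z)"
 using assms
proof (induction "degree p" arbitrary: p F rule: less_induct)
 case less
 show ?case
 proof (cases "\<exists>a. F a = 0")
  case False
  then show ?thesis using less.prems by (intro exI[of _ 1] exI[of _ F]) auto
 next
  case True
  then obtain a where a: "F a = 0" by blast
  then have "poly p a = 0" using less.prems(4)[of a] by simp
  then obtain q where q: "p = [:- a, 1:] * q" by (metis poly_eq_0_iff_dvd dvdE)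
  have q0: "q \<noteq> 0" using q less.prems by auto
  define F1 where "F1 z = (if z = a then deriv F a else (F z - F a) / (z - a))" for z
  have F1h: "F1 holomorphic_on UNIV" unfolding F1_def by (rule pole_lemma_open[OF less.prems(1)]) simp
  have F1: "F z = (z - a) * F1 z" for z using a by (simp add: F1_def)
  have ne: "F1 z * H z = poly q z" if "z \<noteq> a" for z
  proof -
   have "(z - a) * (F1 z * H z) = poly p z" using less.prems(4)[of z] by (simp only: F1 mult.assoc)
   also have "... = (z - a) * poly q z" by (simp add: q algebra_simps)
   finally show ?thesis using that by simp
  qed
  \<comment> \<open>Cancellation of \<open>z - a\<close> fails at \<open>a\<close> itself, where the
    identity follows by continuity.\<close>
  have c1: "isCont (\<lambda>z. F1 z * H z - poly q z) a"
  proof -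
   have "continuous_on UNIV (\<lambda>z. F1 z * H z - poly q z)" by (intro continuous_intros holomorphic_on_imp_continuous_on F1h less.prems)
   then show ?thesis by (simp add: continuous_on_eq_continuous_at)
  qed
  have "F1 a * H a - poly q a = 0"
  proof (rule LIM_unique)
   show "((\<lambda>z. F1 z * H z - poly q z) \<longlongrightarrow> F1 a * H a - poly q a) (at a)" using c1 by (simp add: isCont_def)
   show "((\<lambda>z. F1 z * H z - poly q z) \<longlongrightarrow> 0) (at a)" by (rule tendsto_eventually) (auto simp: eventually_at_filter ne)
  qed
  then have all: "F1 z * H z = poly q z" for z using ne[of z] by (cases "z = a") auto
  have "degree q < degree p" using degree_mult_eq[of "[:- a, 1:]" q] q q0 by (simp del: mult_pCons_left)
  from less.hyps[OF this F1h less.prems(2) q0 all]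
  obtain R E where "R \<noteq> 0" "E holomorphic_on UNIV" "\<forall>z. E z \<noteq> 0" "\<forall>z. F1 z = poly R z * E z" by blast
  moreover from this(1) have "[:- a, 1:] * R \<noteq> 0" by (metis mult_eq_0_iff one_neq_zero pCons_eq_0_iff)
  ultimately show ?thesis by (intro exI[of _ "[:- a, 1:] * R"] exI[of _ E]) (auto simp: F1 algebra_simps simp del: mult_pCons_left)
 qed
qed

text \<open>A one-sided bound of the real part controls \<open>g\<close> itself on a smaller disc
  (Borel--Caratheodory), so \<open>g\<close> grows at most quadratically and Liouville's theorem
  applies.\<close>

lemma quadratic_of_Re_le:
 assumes g: "g holomorphic_on UNIV" and C: "C \<ge> 0" and bd: "\<And>z. Re (g z) \<le> C * (1 + (norm z)\<^sup>2)"
 shows "\<exists>a b c. \<forall>z. g z = a + b * z + c * z\<^sup>2"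
proof -
 define g1 where "g1 z = g z - g 0" for z
 have g1h: "g1 holomorphic_on UNIV" unfolding g1_def by (intro holomorphic_intros g)
 have b1: "norm (g1 z) \<le> 2 * (C * (1 + (2 * norm z)\<^sup>2) + norm (g 0) + 1)" if z: "norm z > 0" for z
 proof -
  define r where "r = 2 * norm z"
  have r: "r > 0" using z by (simp add: r_def)
  define A where "A = C * (1 + r\<^sup>2) + norm (g 0) + 1"
  have A: "A > 0" unfolding A_def using C by (intro add_nonneg_pos add_nonneg_nonneg mult_nonneg_nonneg) auto
  have re: "Re (g1 w) < A" if "norm w \<le> r" for w
  proof -
   have "C * (1 + (norm w)\<^sup>2) \<le> C * (1 + r\<^sup>2)" using that C by (intro mult_left_mono add_left_mono power_mono) auto
   then show ?thesis using bd[of w] abs_Re_le_cmod[of "g 0"] unfolding g1_def A_def by simp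
  qed
  have ne: "2 * cor A - g1 w \<noteq> 0" if "norm w \<le> r" for w using re[OF that] A by (auto simp: complex_eq_iff)
  have lt: "norm (g1 w) < norm (2 * cor A - g1 w)" if "norm w \<le> r" for w
  proof -
   have "A * (A - Re (g1 w)) > 0" using re[OF that] A by simp
   then have "(norm (g1 w))\<^sup>2 < (norm (2 * cor A - g1 w))\<^sup>2" unfolding cmod_power2 by (simp add: power2_eq_square algebra_simps)
   then show ?thesis by (simp add: power_less_imp_less_base)
  qed
  \<comment> \<open>The map \<open>w / (2 * A - w)\<close> takes the half plane
    \<open>Re w < A\<close> into the unit disc and fixes 0. As \<open>z\<close> is halfway out in
    the disc of radius \<open>r\<close>, the Schwarz lemma gives modulus at most 1/2 there.\<close>
  define \<phi> where "\<phi> \<zeta> = g1 (r * \<zeta>) / (2 * cor A - g1 (r * \<zeta>))" for \<zeta> :: complex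
  have rl: "norm (cor r * \<zeta>) \<le> r" if "norm \<zeta> < 1" for \<zeta> using that r by (simp add: norm_mult mult_left_le)
  have gr: "(\<lambda>\<zeta>. g1 (cor r * \<zeta>)) holomorphic_on ball 0 1" by (rule holomorphic_on_UNIV_scale[OF g1h])
  have "norm (\<phi> (z / r)) \<le> norm (z / r)"
  proof (rule Schwarz_Lemma(1))
   show "\<phi> holomorphic_on ball 0 1" unfolding \<phi>_def using ne rl by (intro holomorphic_intros gr) auto
   show "\<phi> 0 = 0" by (simp add: \<phi>_def g1_def)
   show "norm (\<phi> \<zeta>) < 1" if "norm \<zeta> < 1" for \<zeta> using lt[OF rl[OF that]] by (simp add: \<phi>_def norm_divide divide_less_eq)
   show "norm (z / cor r) < 1" using z by (simp add: norm_divide r_def)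
  qed
  then have "norm (\<phi> (z / r)) \<le> 1/2" using z by (simp add: norm_divide r_def)
  moreover have "\<phi> (z / r) = g1 z / (2 * cor A - g1 z)" using r by (simp add: \<phi>_def)
  ultimately have "norm (g1 z) / norm (2 * cor A - g1 z) \<le> 1/2" by (simp add: norm_divide)
  moreover have "norm (2 * cor A - g1 z) > 0" using ne[of z] z by (simp add: r_def)
  ultimately have "2 * norm (g1 z) \<le> norm (2 * cor A - g1 z)" by (simp add: field_simps)
  also have "... \<le> 2 * A + norm (g1 z)" using norm_triangle_ineq4[of "2 * cor A" "g1 z"] A by simp
  finally show ?thesis unfolding A_def r_def by simp
 qed
 have "\<exists>p. degree p \<le> 2 \<and> (\<forall>z. g1 z = poly p z)"
 proof (rule entire_polynomial_growth[OF g1h])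
  fix z :: complex assume z: "norm z \<ge> 1"
  have n2: "1 \<le> (norm z)\<^sup>2" using z by (simp add: one_le_power)
  have "norm (g1 z) \<le> 2 * (C * (1 + (2 * norm z)\<^sup>2) + norm (g 0) + 1)" using z by (intro b1) linarith
  also have "... \<le> 2 * (C * ((norm z)\<^sup>2 + 4 * (norm z)\<^sup>2) + norm (g 0) * (norm z)\<^sup>2 + (norm z)\<^sup>2)"
  proof -
   have "C * (1 + (2 * norm z)\<^sup>2) \<le> C * ((norm z)\<^sup>2 + 4 * (norm z)\<^sup>2)"
    using n2 C by (intro mult_left_mono) (auto simp: power_mult_distrib)
   moreover have "norm (g 0) * 1 \<le> norm (g 0) * (norm z)\<^sup>2" using n2 by (intro mult_left_mono) auto
   ultimately show ?thesis using n2 by simp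
  qed
  also have "... = (2 * (5 * C + norm (g 0) + 1)) * (norm z)\<^sup>2" by (simp add: algebra_simps)
  finally show "norm (g1 z) \<le> (2 * (5 * C + norm (g 0) + 1)) * (norm z)\<^sup>2" .
 qed
 then obtain p where p: "degree p \<le> 2" "\<And>z. g1 z = poly p z" by blast
 have "poly p z = coeff p 0 + coeff p 1 * z + coeff p 2 * z\<^sup>2" for z
 proof -
  have "poly p z = (\<Sum>i\<le>degree p. coeff p i * z ^ i)" by (rule poly_altdef)
  also have "... = (\<Sum>i\<le>2. coeff p i * z ^ i)" using p(1) by (intro sum.mono_neutral_left) (auto simp: coeff_eq_0)
  finally show ?thesis by (simp add: numeral_2_eq_2)
 qed
 then have "g z = (g 0 + coeff p 0) + coeff p 1 * z + coeff p 2 * z\<^sup>2" for z using p(2)[of z] by (simp add: g1_def algebra_simps)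
 then show ?thesis by blast
qed

lemma pderiv_mult_degree_less:
 fixes a b :: "complex poly"
 shows "pderiv a * b = 0 \<or> degree (pderiv a * b) < degree a + degree b"
proof (cases "pderiv a = 0")
 case False
 then have "degree a > 0" by (simp add: pderiv_eq_0_iff)
 moreover have "degree (pderiv a * b) \<le> (degree a - 1) + degree b" using degree_mult_le[of "pderiv a" b] by (simp only: degree_pderiv)
 ultimately show ?thesis by linarith
qed simp

text \<open>Differentiating and eliminating the exponential gives
  \<open>q * p1 * p2 = pderiv p2 * p1 - pderiv p1 * p2\<close>, where \<open>q\<close> is the
  derivative of the exponent. Unless \<open>q\<close> is 0, the left side has the larger
  degree.\<close>

lemma exp_quadratic_polynomial:
 fixes p1 p2 :: "complex poly" and \<alpha> \<beta> :: complex
 assumes p1: "p1 \<noteq> 0" and eq: "\<And>z. poly p1 z * exp (\<alpha> * z + \<beta> * z\<^sup>2) = poly p2 z"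
 shows "\<alpha> = 0 \<and> \<beta> = 0"
proof (rule ccontr)
 assume n: "\<not> (\<alpha> = 0 \<and> \<beta> = 0)"
 define q where "q = [:\<alpha>, 2 * \<beta>:]"
 have q: "q \<noteq> 0" using n by (simp add: q_def)
 have p2: "p2 \<noteq> 0"
 proof
  assume "p2 = 0"
  then have "poly p1 z = 0" for z using eq[of z] by simp
  then have "p1 = 0" by (metis poly_all_0_iff_0)
  with p1 show False by simp
 qed
 have "poly (pderiv p2 * p1) z = poly ((pderiv p1 + q * p1) * p2) z" for z
 proof -
  let ?e = "exp (\<alpha> * z + \<beta> * z\<^sup>2)"
  have "((\<lambda>z. poly p1 z * exp (\<alpha> * z + \<beta> * z\<^sup>2)) has_field_derivative
    (poly (pderiv p1) z * ?e + poly p1 z * (?e * (\<alpha> + 2 * \<beta> * z)))) (at z)" by (auto intro!: derivative_eq_intros poly_DERIV)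
  then have "(poly p2 has_field_derivative (poly (pderiv p1) z * ?e + poly p1 z * (?e * (\<alpha> + 2 * \<beta> * z)))) (at z)" unfolding eq .
  from DERIV_unique[OF this poly_DERIV]
  have "poly (pderiv p2) z = (poly (pderiv p1) z + poly q z * poly p1 z) * ?e" by (simp add: q_def algebra_simps)
  then have "poly (pderiv p2) z * poly p1 z = (poly (pderiv p1) z + poly q z * poly p1 z) * (poly p1 z * ?e)" by (simp add: mult_ac)
  then show ?thesis unfolding eq by simp
 qed
 then have "pderiv p2 * p1 = (pderiv p1 + q * p1) * p2" by (metis poly_eq_poly_eq_iff ext)
 then have e: "q * p1 * p2 = pderiv p2 * p1 - pderiv p1 * p2" by (simp add: algebra_simps)
 have ne: "q * p1 * p2 \<noteq> 0" using q p1 p2 by simp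
 have dq: "degree (q * p1 * p2) \<ge> degree p1 + degree p2" using q p1 p2 by (simp add: degree_mult_eq)
 have "degree (pderiv p2 * p1 - pderiv p1 * p2) < degree p1 + degree p2 \<or> pderiv p2 * p1 - pderiv p1 * p2 = 0"
  using pderiv_mult_degree_less[of p2 p1] pderiv_mult_degree_less[of p1 p2] by (auto simp: add.commute intro: degree_diff_less)
 then show False using e ne dq by auto
qed

text \<open>As a divisor of a polynomial \<open>F\<close> has finitely many zeros, and the growth
  bound makes the zero-free factor the exponential of a quadratic. In
  \<open>F z * F (\<i> * z)\<close> the quadratic terms cancel and the linear ones do not, so there
  is no linear term.\<close>

theorem hadamard_gaussian:
 assumes F: "F holomorphic_on UNIV" and nz: "F w \<noteq> 0"
  and growth: "\<And>z. norm (F z) \<le> C * exp (K * (norm z)\<^sup>2)" and K: "K \<ge> 0"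
  and p: "\<And>z. F z * F (\<i> * z) = poly p z"
 shows "\<exists>R \<gamma>. R \<noteq> 0 \<and> (\<forall>z. F z = poly R z * exp (\<gamma> * z\<^sup>2))"
proof -
 have Fi: "(\<lambda>z. F (\<i> * z)) holomorphic_on UNIV" by (rule holomorphic_on_UNIV_scale[OF F])
 \<comment> \<open>If the product vanished identically, \<open>F (\<i> * z)\<close> would be 0 on
   the nonempty open set where \<open>F\<close> is not, hence everywhere.\<close>
 have p0: "p \<noteq> 0"
 proof
  assume "p = 0"
  then have z: "F z = 0 \<or> F (\<i> * z) = 0" for z using p[of z] by simp
  define U where "U = {z. F z \<noteq> 0}"
  have "open U" unfolding U_def using holomorphic_on_imp_continuous_on[OF F] by (intro open_Collect_neq) auto
  moreover have "w \<in> U" using nz by (simp add: U_def)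
  ultimately have "F (\<i> * (w / \<i>)) = 0" by (intro analytic_continuation_open[of U UNIV "\<lambda>z. F (\<i> * z)" "\<lambda>z. 0" "w / \<i>"])
     (use Fi z in \<open>auto simp: U_def intro: holomorphic_on_subset\<close>)
  then show False using nz by simp
 qed
 obtain R E where RE: "R \<noteq> 0" "E holomorphic_on UNIV" "\<And>z. E z \<noteq> 0" "\<And>z. F z = poly R z * E z"
  using entire_divisor_of_polynomial[OF F Fi p0 p] by blast
 obtain g where g: "g holomorphic_on UNIV" "\<And>z. E z = exp (g z)"
  using contractible_imp_holomorphic_log[OF RE(2) contractible_UNIV] RE(3) by auto
 \<comment> \<open>Outside a disc the polynomial factor stays away from 0, so the growth bound
   passes to \<open>E\<close>; inside, compactness gives a bound.\<close>
 have "\<exists>r \<epsilon>. \<epsilon> > 0 \<and> (\<forall>z. r \<le> norm z \<longrightarrow> \<epsilon> \<le> norm (poly R z))"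
 proof (cases "degree R = 0")
  case True
  then obtain a where "R = [:a:]" by (rule degree_eq_zeroE)
  then show ?thesis using RE(1) by (intro exI[of _ 0] exI[of _ "norm a"]) auto
 next
  case False
  then have "\<forall>\<^sub>F z in at_infinity. 1 \<le> norm (poly R z)"
   using filterlim_poly_at_infinity[of R] by (auto simp: filterlim_at_infinity[of 0])
  then show ?thesis unfolding eventually_at_infinity using zero_less_one by blast
 qed
 then obtain r \<epsilon> where r: "\<epsilon> > 0" "\<And>z. r \<le> norm z \<Longrightarrow> \<epsilon> \<le> norm (poly R z)" by blast
 have "compact (E ` cball 0 r)"
  using holomorphic_on_imp_continuous_on[OF RE(2)] by (intro compact_continuous_image) (auto intro: continuous_on_subset)
 then have "bounded (E ` cball 0 r)" by (rule compact_imp_bounded)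
 then obtain B where B: "\<And>z. norm z \<le> r \<Longrightarrow> norm (E z) \<le> B"
  unfolding bounded_iff ball_simps mem_cball_0[symmetric] by blast
 define C1 where "C1 = max 1 (max B (C / \<epsilon>))"
 have E1: "norm (E z) \<le> C1 * exp (K * (norm z)\<^sup>2)" for z
 proof (cases "norm z \<le> r")
  case True
  have "norm (E z) \<le> C1 * 1" using B[OF True] by (simp add: C1_def)
  also have "... \<le> C1 * exp (K * (norm z)\<^sup>2)" using K by (intro mult_left_mono) (auto simp: C1_def)
  finally show ?thesis .
 next
  case False
  then have "\<epsilon> * norm (E z) \<le> norm (poly R z) * norm (E z)" using r(2)[of z] by (intro mult_right_mono) auto
  also have "... \<le> C * exp (K * (norm z)\<^sup>2)" using growth[of z] by (simp add: RE(4) norm_mult)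
  finally have "norm (E z) \<le> C / \<epsilon> * exp (K * (norm z)\<^sup>2)" using r(1) by (simp add: field_simps)
  also have "... \<le> C1 * exp (K * (norm z)\<^sup>2)" by (intro mult_right_mono) (auto simp: C1_def)
  finally show ?thesis .
 qed
 have "\<exists>a b c. \<forall>z. g z = a + b * z + c * z\<^sup>2"
 proof (rule quadratic_of_Re_le[OF g(1), of "ln C1 + K"])
  have C1: "C1 \<ge> 1" by (simp add: C1_def)
  then show "0 \<le> ln C1 + K" using K by simp
  fix z
  have "exp (Re (g z)) \<le> C1 * exp (K * (norm z)\<^sup>2)" using E1[of z] by (simp add: g(2))
  also have "... = exp (ln C1 + K * (norm z)\<^sup>2)" using C1 by (simp add: exp_add)
  finally have "Re (g z) \<le> ln C1 + K * (norm z)\<^sup>2" by simp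
  also have "... \<le> (ln C1 + K) * (1 + (norm z)\<^sup>2)" using C1 K by (simp add: distrib_left distrib_right)
  finally show "Re (g z) \<le> (ln C1 + K) * (1 + (norm z)\<^sup>2)" .
 qed
 then obtain a b c where abc: "\<And>z. g z = a + b * z + c * z\<^sup>2" by blast
 have "poly (R * pcompose R [:0, \<i>:]) z * exp ((b * (1 + \<i>)) * z + 0 * z\<^sup>2) = poly (smult (exp (- 2 * a)) p) z" for z
 proof -
  have "poly p z = poly R z * poly R (\<i> * z) * exp (g z + g (\<i> * z))" unfolding p[symmetric] RE(4) g(2) exp_add by (simp add: mult_ac)
  also have "g z + g (\<i> * z) = 2 * a + (b * (1 + \<i>)) * z" unfolding abc by (simp add: power_mult_distrib algebra_simps)
  finally show ?thesis by (simp add: exp_add exp_minus poly_pcompose mult_ac)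
 qed
 moreover have "R * pcompose R [:0, \<i>:] \<noteq> 0" using RE(1) by (auto simp: pcompose_eq_0_iff)
 ultimately have "b * (1 + \<i>) = 0" using exp_quadratic_polynomial by blast
 then have "b = 0" by (simp add: complex_eq_iff)
 then have "F z = poly (smult (exp a) R) z * exp (c * z\<^sup>2)" for z unfolding RE(4) g(2) abc by (simp add: exp_add mult_ac)
 moreover have "smult (exp a) R \<noteq> 0" using RE(1) by simp
 ultimately show ?thesis by blast
qed

section \<open>Polynomials times Gaussians\<close>

lemma powr_le_exp:
 fixes M \<eta> :: real
 assumes "\<eta> > 0"
 obtains C where "C > 0" "\<And>x. x \<ge> 0 \<Longrightarrow> (1 + x) powr M \<le> C * exp (\<eta> * x)"
proof -
 define N where "N = nat \<lceil>max M 0\<rceil>"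
 have N: "M \<le> real N" unfolding N_def by linarith
 define C where "C = (1 + real N / \<eta>) ^ N"
 have base: "1 + x \<le> (1 + real N / \<eta>) * exp (\<eta> * x / real N)" if x: "x \<ge> 0" and N0: "N > 0" for x
 proof -
  have "1 + \<eta> * x / real N \<le> exp (\<eta> * x / real N)" by (rule exp_ge_add_one_self)
  then have "(1 + real N / \<eta>) * (1 + \<eta> * x / real N) \<le> (1 + real N / \<eta>) * exp (\<eta> * x / real N)"
   using assms by (intro mult_left_mono) auto
  moreover have "(1 + real N / \<eta>) * (1 + \<eta> * x / real N) = 1 + x + (real N / \<eta> + \<eta> * x / real N)"
   using assms N0 by (simp add: field_simps)
  moreover have "real N / \<eta> + \<eta> * x / real N \<ge> 0" using assms x by simp
  ultimately show ?thesis by linarith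
 qed
 have "(1 + x) powr M \<le> C * exp (\<eta> * x)" if x: "x \<ge> 0" for x
 proof -
  have "(1 + x) powr M \<le> (1 + x) powr real N" using x N by (intro powr_mono) auto
  also have "... = (1 + x) ^ N" using x by (simp add: powr_realpow)
  also have "... \<le> C * exp (\<eta> * x)"
  proof (cases "N = 0")
   case False
   then have "(1 + x) ^ N \<le> ((1 + real N / \<eta>) * exp (\<eta> * x / real N)) ^ N" using x base[OF x] by (intro power_mono) auto
   also have "... = C * exp (\<eta> * x)" using False by (simp add: C_def power_mult_distrib exp_of_nat_mult[symmetric])
   finally show ?thesis .
  qed (use x assms in \<open>simp add: C_def\<close>)
  finally show ?thesis .
 qed
 moreover have "C > 0" unfolding C_def using assms by (intro zero_less_power add_pos_nonneg) auto
 ultimately show thesis using that by blast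
qed

lemma poly_gaussian_bound:
 fixes P :: "complex poly" and c :: real
 assumes "c > 0"
 shows "\<exists>K. \<forall>a::real. norm (poly P (cor a)) \<le> K * exp (c * a\<^sup>2)"
 using assms
proof (induction P arbitrary: c)
 case 0
 show ?case by (intro exI[of _ 0]) simp
next
 case (pCons q P)
 then obtain K where K: "\<And>a::real. norm (poly P (cor a)) \<le> K * exp (c/2 * a\<^sup>2)" using pCons.IH[of "c/2"] by auto
 have K0: "K \<ge> 0" using K[of 0] norm_ge_zero[of "poly P 0"] by (simp del: norm_ge_zero)
 have "norm (poly (pCons q P) (cor a)) \<le> (norm q + (1 + 2/c) * K) * exp (c * a\<^sup>2)" for a :: real
 proof -
  have e1: "1 \<le> exp (c/2 * a\<^sup>2)" using pCons.prems by simp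
  have "abs a \<le> 1 + a\<^sup>2"
  proof -
   have "2 * abs a \<le> a\<^sup>2 + 1" using sum_squares_bound[of "abs a" 1] by simp
   then show ?thesis using abs_ge_zero[of a] by linarith
  qed
  also have "... \<le> (1 + 2/c) * exp (c/2 * a\<^sup>2)"
  proof -
   have "c/2 * a\<^sup>2 \<le> exp (c/2 * a\<^sup>2)" using exp_ge_add_one_self[of "c/2 * a\<^sup>2"] by linarith
   then have "a\<^sup>2 \<le> 2/c * exp (c/2 * a\<^sup>2)" using pCons.prems by (simp add: field_simps)
   then show ?thesis unfolding distrib_right using e1 by linarith
  qed
  finally have a: "abs a \<le> (1 + 2/c) * exp (c/2 * a\<^sup>2)" .
  have "norm (poly (pCons q P) (cor a)) \<le> norm q + abs a * norm (poly P (cor a))"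
   using norm_triangle_ineq[of q "cor a * poly P (cor a)"] by (simp add: norm_mult)
  also have "abs a * norm (poly P (cor a)) \<le> ((1 + 2/c) * exp (c/2 * a\<^sup>2)) * (K * exp (c/2 * a\<^sup>2))"
   using a K[of a] pCons.prems by (intro mult_mono) auto
  also have "... = (1 + 2/c) * K * exp (c * a\<^sup>2)" by (simp add: exp_add[symmetric] mult_ac)
  also have "norm q \<le> norm q * exp (c * a\<^sup>2)" using pCons.prems by (simp add: mult_le_cancel_left1)
  finally show ?thesis by (simp add: distrib_right)
 qed
 then show ?case by blast
qed

lemma borel_measurable_poly [measurable (raw)]:
 fixes P :: "complex poly"
 assumes "f \<in> borel_measurable M"
 shows "(\<lambda>x. poly P (f x)) \<in> borel_measurable M"
 using assms by (rule borel_measurable_continuous_on[of "poly P", rotated]) (auto intro: continuous_intros)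

lemma poly_gaussian_integrable:
 fixes P :: "complex poly" and c :: real
 assumes c: "c > 0"
 shows "integrable lborel (\<lambda>a. poly P (cor a) * cexp (- c * a\<^sup>2))"
proof -
 obtain K where K: "\<And>a::real. norm (poly P (cor a)) \<le> K * exp (c/2 * a\<^sup>2)" using poly_gaussian_bound[of "c/2" P] c by auto
 have "integrable lborel (\<lambda>a::real. K * exp (- (c/2) * (norm a)\<^sup>2))" using c by (intro integrable_mult_right integrable_gaussian) simp
 then show ?thesis
 proof (rule Bochner_Integration.integrable_bound)
  have "norm (poly P (cor a)) * exp (- c * a\<^sup>2) \<le> K * exp (c/2 * a\<^sup>2) * exp (- c * a\<^sup>2)" for a :: real
   using K by (rule mult_right_mono) simp
  also have "K * exp (c/2 * a\<^sup>2) * exp (- c * a\<^sup>2) = K * exp (- (c/2) * a\<^sup>2)" for a :: real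
   by (simp add: mult.assoc exp_add[symmetric] field_simps)
  finally show "AE a in lborel. norm (poly P (cor a) * cexp (- c * a\<^sup>2)) \<le> norm (K * exp (- (c/2) * (norm a)\<^sup>2))"
   by (intro AE_I2) (simp add: norm_mult order_trans[OF _ abs_ge_self])
 qed measurable
qed

lemma integral_derivative_zero:
 fixes f :: "real \<Rightarrow> complex"
 assumes d: "\<And>x. (f has_vector_derivative f' x) (at x)" and c: "\<And>x. isCont f' x"
  and i: "integrable lborel f'" and l: "(\<lambda>n. f (real n)) \<longlonglongrightarrow> 0" "(\<lambda>n. f (- real n)) \<longlonglongrightarrow> 0"
 shows "(LBINT x. f' x) = 0"
proof -
 have "(LBINT x. indicator {- real n..real n} x *\<^sub>R f' x) = f (real n) - f (- real n)" for n
  by (rule integral_FTC_Icc) (auto intro: has_vector_derivative_at_within d c continuous_at_imp_continuous_on)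
 moreover have "(\<lambda>n. (LBINT x. indicator {- real n..real n} x *\<^sub>R f' x)) \<longlonglongrightarrow> (LBINT x. f' x)"
 proof (rule integral_dominated_convergence[where w="\<lambda>x. norm (f' x)"])
  show "AE x in lborel. (\<lambda>n. indicator {- real n..real n} x *\<^sub>R f' x) \<longlonglongrightarrow> f' x"
  proof (intro AE_I2 tendsto_eventually)
   fix x :: real
   obtain N where N: "abs x \<le> real N" using real_arch_simple by blast
   show "\<forall>\<^sub>F n in sequentially. indicator {- real n..real n} x *\<^sub>R f' x = f' x"
    unfolding eventually_sequentially using N by (intro exI[of _ N]) (auto simp: indicator_def)
  qed
 qed (use i in \<open>auto simp: indicator_def\<close>)
 moreover have "(\<lambda>n. f (real n) - f (- real n)) \<longlonglongrightarrow> 0 - 0" by (intro tendsto_intros l)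
 ultimately show ?thesis using LIMSEQ_unique by auto
qed

text \<open>Multiplication by \<open>\<mu>\<close> on the Fourier side is \<open>\<i>\<close> times the derivative, hence the induction over \<open>Q\<close>.\<close>

lemma gaussian_polynomial_transform:
 fixes Q :: "complex poly" and c :: real
 assumes c: "c > 0"
 shows "\<exists>P. degree P = degree Q \<and> (\<forall>\<mu>::real. (LBINT a. poly P (cor a) * cexp (- c * a\<^sup>2) * cis (a * \<mu>))
   = poly Q (cor \<mu>) * cexp (- \<mu>\<^sup>2 / (4 * c)))"
proof (induction Q)
 case 0
 show ?case by (intro exI[of _ 0]) simp
next
 case (pCons q Q1)
 let ?e = "\<lambda>a::real. cexp (- c * a\<^sup>2)"
 have const: "(LBINT a. (q * cor (sqrt (c / pi))) * ?e a * cis (a * \<mu>))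
   = q * cexp (- \<mu>\<^sup>2 / (4 * c))" for \<mu>
 proof -
  have "(LBINT a. (q * cor (sqrt (c / pi))) * ?e a * cis (a * \<mu>))
   = (q * cor (sqrt (c / pi))) * (LBINT a. ?e a * cis (a * \<mu>))" by (simp add: mult.assoc)
  also have "(LBINT a. ?e a * cis (a * \<mu>)) = cor (sqrt (pi / c) * exp (- \<mu>\<^sup>2 / (4 * c)))"
   using gaussian_1d(2)[of "2 * c" \<mu>] c by simp
  also have "(q * cor (sqrt (c / pi))) * cor (sqrt (pi / c) * exp (- \<mu>\<^sup>2 / (4 * c)))
    = q * cor ((sqrt (c / pi) * sqrt (pi / c)) * exp (- \<mu>\<^sup>2 / (4 * c)))" by simp
  also have "sqrt (c / pi) * sqrt (pi / c) = 1" using c by (simp add: real_sqrt_mult[symmetric])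
  finally show ?thesis by simp
 qed
 show ?case
 proof (cases "Q1 = 0")
  case True
  show ?thesis using const True c by (intro exI[of _ "[:q * cor (sqrt (c / pi)):]"]) simp
 next
  case False
  obtain P1 where P1: "degree P1 = degree Q1"
   "\<And>\<mu>::real. (LBINT a. poly P1 (cor a) * ?e a * cis (a * \<mu>))
    = poly Q1 (cor \<mu>) * cexp (- \<mu>\<^sup>2 / (4 * c))" using pCons.IH by blast
  have P10: "P1 \<noteq> 0"
  proof
   assume "P1 = 0"
   then have z: "poly Q1 (cor \<mu>) = 0" for \<mu> :: real using P1(2)[of \<mu>] by simp
   have "infinite (range cor)" by (meson finite_imageD infinite_UNIV_char_0 inj_of_real)
   then show False using poly_roots_finite[OF False] z finite_subset[of "range cor" "{x. poly Q1 x = 0}"] by auto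
  qed
  \<comment> \<open>\<open>D\<close> times the Gaussian is the derivative of \<open>P1\<close> times
    the Gaussian, and its degree is one more than that of \<open>P1\<close>.\<close>
  define D where "D = pderiv P1 - smult (cor (2 * c)) (pCons 0 P1)"
  \<comment> \<open>The constant term of \<open>pCons q Q1\<close> comes from a multiple of the pure
    Gaussian, normalised by \<open>sqrt (c / pi)\<close>.\<close>
  define P where "P = [:q * cor (sqrt (c / pi)):] + smult \<i> D"
  have "degree (smult (cor (2 * c)) (pCons 0 P1)) = Suc (degree P1)" using P10 c by simp
  then have dD: "degree D = Suc (degree P1)" unfolding D_def
   using P10 c by (subst diff_conv_add_uminus, subst degree_add_eq_right) (simp_all add: degree_pderiv)
  have dP: "degree P = degree (pCons q Q1)" unfolding P_def using False P1(1) dD by (subst degree_add_eq_right) auto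
  have parts: "(LBINT a. poly D (cor a) * ?e a * cis (a * \<mu>))
    = - \<i> * cor \<mu> * (LBINT a. poly P1 (cor a) * ?e a * cis (a * \<mu>))" for \<mu> :: real
  proof -
   define f where "f a = poly P1 (cor a) * exp (- cor c * (cor a)\<^sup>2) * exp (\<i> * cor a * cor \<mu>)" for a :: real
   define f' where "f' a = poly D (cor a) * ?e a * cis (a * \<mu>) + \<i> * cor \<mu> * (poly P1 (cor a) * ?e a * cis (a * \<mu>))" for a :: real
   have conv: "exp (- cor c * (cor a)\<^sup>2) = ?e a" "exp (\<i> * cor a * cor \<mu>) = cis (a * \<mu>)" for a
    by (simp_all add: exp_of_real[symmetric] cis_conv_exp mult_ac)
   have feq: "f a = poly P1 (cor a) * ?e a * cis (a * \<mu>)" for a by (simp only: f_def conv)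
   have i: "integrable lborel (\<lambda>a. poly R (cor a) * ?e a * cis (a * \<mu>))" for R
    by (intro integrable_mult_cis poly_gaussian_integrable c) simp
   have "(LBINT a. f' a) = 0"
   proof (rule integral_derivative_zero[where f=f])
    fix x :: real
    have "((\<lambda>z. poly P1 z * exp (- cor c * z\<^sup>2) * exp (\<i> * z * cor \<mu>)) has_field_derivative
      (poly (pderiv P1) x * exp (- cor c * (cor x)\<^sup>2) - 2 * c * x * poly P1 x * exp (- cor c * (cor x)\<^sup>2)) * exp (\<i> * x * cor \<mu>)
      + poly P1 x * exp (- cor c * (cor x)\<^sup>2) * (\<i> * \<mu> * exp (\<i> * x * cor \<mu>))) (at (cor x))"
     by (auto intro!: derivative_eq_intros poly_DERIV simp: algebra_simps)
    from has_vector_derivative_real_field[OF this]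
    have "(f has_vector_derivative
      (poly (pderiv P1) x * exp (- cor c * (cor x)\<^sup>2) - 2 * c * x * poly P1 x * exp (- cor c * (cor x)\<^sup>2)) * exp (\<i> * x * cor \<mu>)
      + poly P1 x * exp (- cor c * (cor x)\<^sup>2) * (\<i> * \<mu> * exp (\<i> * x * cor \<mu>))) (at x)" unfolding f_def .
    then show "(f has_vector_derivative f' x) (at x)" unfolding conv f'_def D_def by (simp add: algebra_simps)
    show "isCont f' x" unfolding f'_def cis_conv_exp by (intro continuous_intros)
   next
    show "integrable lborel f'" unfolding f'_def by (intro Bochner_Integration.integrable_add i integrable_mult_right)
    obtain K where K: "\<And>a::real. norm (poly P1 (cor a)) \<le> K * exp (c/2 * a\<^sup>2)" using poly_gaussian_bound[of "c/2" P1] c by auto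
    have fb: "norm (f a) \<le> K * exp (- (c/2) * a\<^sup>2)" for a
    proof -
     have "norm (f a) \<le> K * exp (c/2 * a\<^sup>2) * exp (- c * a\<^sup>2)" unfolding feq using K by (simp add: norm_mult mult_right_mono)
     also have "... = K * exp (- (c/2) * a\<^sup>2)" by (simp add: mult.assoc exp_add[symmetric] field_simps)
     finally show ?thesis .
    qed
    have lim: "(\<lambda>n. K * exp (- (c/2) * (real n)\<^sup>2)) \<longlonglongrightarrow> 0" using c by real_asymp
    show "(\<lambda>n. f (real n)) \<longlonglongrightarrow> 0" by (rule Lim_null_comparison[OF _ lim]) (use fb in auto)
    show "(\<lambda>n. f (- real n)) \<longlonglongrightarrow> 0" by (rule Lim_null_comparison[OF _ lim]) (use fb[of "- real _"] in auto)
   qed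
   moreover have "(LBINT a. f' a) = (LBINT a. poly D (cor a) * ?e a * cis (a * \<mu>))
     + (LBINT a. \<i> * cor \<mu> * (poly P1 (cor a) * ?e a * cis (a * \<mu>)))"
    unfolding f'_def by (rule Bochner_Integration.integral_add[OF i integrable_mult_right[OF i]])
   moreover have "(LBINT a. \<i> * cor \<mu> * (poly P1 (cor a) * ?e a * cis (a * \<mu>)))
     = \<i> * cor \<mu> * (LBINT a. poly P1 (cor a) * ?e a * cis (a * \<mu>))" by (rule integral_mult_right_zero)
   ultimately show ?thesis by (simp only: minus_mult_left[symmetric] eq_neg_iff_add_eq_0)
  qed
  have "(LBINT a. poly P (cor a) * ?e a * cis (a * \<mu>))
   = poly (pCons q Q1) (cor \<mu>) * cexp (- \<mu>\<^sup>2 / (4 * c))" for \<mu> :: real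
  proof -
   have i: "integrable lborel (\<lambda>a. poly R (cor a) * ?e a * cis (a * \<mu>))" for R
    by (intro integrable_mult_cis poly_gaussian_integrable c) simp
   have "(LBINT a. poly P (cor a) * ?e a * cis (a * \<mu>))
    = (LBINT a. (q * cor (sqrt (c / pi))) * ?e a * cis (a * \<mu>) + \<i> * (poly D (cor a) * ?e a * cis (a * \<mu>)))"
    unfolding P_def by (simp add: algebra_simps)
   also have "... = q * cexp (- \<mu>\<^sup>2 / (4 * c)) + \<i> * (LBINT a. poly D (cor a) * ?e a * cis (a * \<mu>))"
    using i[of "[:q * cor (sqrt (c / pi)):]"] i[of D] const[of \<mu>] by (subst Bochner_Integration.integral_add) auto
   also have "... = poly (pCons q Q1) (cor \<mu>) * cexp (- \<mu>\<^sup>2 / (4 * c))" unfolding parts P1(2) by (simp add: algebra_simps)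
   finally show ?thesis .
  qed
  with dP show ?thesis by blast
 qed
qed

section \<open>Uniqueness and continuity of the Fourier transform\<close>

lemma fourier_unique:
 fixes f g :: "'a::euclidean_space \<Rightarrow> complex"
 assumes "integrable lborel f" "integrable lborel g" "AE y in lborel. fourier f y = fourier g y"
 shows "AE x in lborel. f x = g x"
proof -
 have d: "fourier (\<lambda>x. f x - g x) y = fourier f y - fourier g y" for y unfolding fourier_def left_diff_distrib
  by (intro Bochner_Integration.integral_diff integrable_mult_cis assms) auto
 have "AE y in lborel. fourier (\<lambda>x. f x - g x) y = 0" using assms(3) by eventually_elim (simp add: d)
 then have "AE x in lborel. f x - g x = 0" by (rule fourier_zero_imp[OF Bochner_Integration.integrable_diff[OF assms(1,2)]])
 then show ?thesis by simp
qed

lemma continuous_fourier: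
 fixes h :: "'a::euclidean_space \<Rightarrow> complex"
 assumes h: "integrable lborel h"
 shows "isCont (fourier h) y"
 unfolding continuous_at_sequentially
proof (intro allI impI)
 fix X :: "nat \<Rightarrow> 'a" assume X: "X \<longlonglongrightarrow> y"
 have [measurable]: "h \<in> Borel" using h by (auto dest: borel_measurable_integrable)
 show "(fourier h \<circ> X) \<longlonglongrightarrow> fourier h y" unfolding fourier_def comp_def
 proof (rule integral_dominated_convergence[where w="\<lambda>x. norm (h x)"])
  show "AE x in lborel. (\<lambda>i. h x * cis (x \<bullet> X i)) \<longlonglongrightarrow> h x * cis (x \<bullet> y)"
   using X by (intro AE_I2 tendsto_intros)
 qed (use h in \<open>auto simp: norm_mult\<close>)
qed

lemma AE_continuous_zero:
 fixes f :: "'a::euclidean_space \<Rightarrow> complex"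
 assumes "AE x in lborel. x \<in> S \<longrightarrow> f x = 0" and S: "open S" "x \<in> S" and c: "\<And>x. isCont f x"
 shows "f x = 0"
proof (rule ccontr)
 assume "f x \<noteq> 0"
 define U where "U = S \<inter> {x. f x \<noteq> 0}"
 have "open U" unfolding U_def using c by (intro open_Int S open_Collect_neq continuous_at_imp_continuous_on) auto
 moreover have "x \<in> U" using S \<open>f x \<noteq> 0\<close> by (simp add: U_def)
 ultimately have n: "\<not> negligible U" using open_not_negligible[of U] by blast
 have "AE x in lborel. x \<notin> U" using assms(1) by eventually_elim (auto simp: U_def)
 then have "U \<in> null_sets lborel" using AE_iff_null_sets[of U lborel] \<open>open U\<close> by simp
 then have "negligible U" unfolding negligible_iff_null_sets by (rule null_sets_completionI)
 with n show False by simp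
qed

section \<open>Entire functions with a double Gaussian bound\<close>

text \<open>The half line accumulates inside the strip, which is connected because it is
  convex.\<close>

lemma zero_on_imaginary_halfline:
 assumes L: "L holomorphic_on {z. (abs (Re z)) < \<delta>}" and \<delta>: "\<delta> > 0"
  and z: "\<And>\<mu>. \<mu> > R \<Longrightarrow> L (\<i> * cor \<mu>) = 0" and w: "abs (Re w) < \<delta>"
 shows "L w = 0"
proof (rule analytic_continuation[OF L, where U="(\<lambda>\<mu>. \<i> * cor \<mu>) ` {R<..}" and \<xi>="\<i> * cor (R + 1)"])
 show "open {z::complex. (abs (Re z)) < \<delta>}" by (intro open_Collect_less continuous_intros)
 have "{z::complex. (abs (Re z)) < \<delta>} = {z. Re z < \<delta>} \<inter> {z. Re z > - \<delta>}" by auto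
 then have "convex {z::complex. (abs (Re z)) < \<delta>}" by (metis convex_Int convex_halfspace_Re_lt convex_halfspace_Re_gt)
 then show "connected {z::complex. (abs (Re z)) < \<delta>}" by (rule convex_connected)
 have "(R + 1) islimpt {R<..}" by (intro interior_limit_point) (simp add: interior_open)
 then obtain X where X: "\<And>n. X n \<in> {R<..} - {R + 1}" "X \<longlonglongrightarrow> R + 1" unfolding islimpt_sequential by blast
 show "(\<i> * cor (R + 1)) islimpt (\<lambda>\<mu>. \<i> * cor \<mu>) ` {R<..}" unfolding islimpt_sequential
 proof (intro exI[of _ "\<lambda>n. \<i> * cor (X n)"] conjI allI)
  fix n
  have "X n \<noteq> R + 1" "X n > R" using X(1)[of n] by auto
  then show "\<i> * cor (X n) \<in> (\<lambda>\<mu>. \<i> * cor \<mu>) ` {R<..} - {\<i> * cor (R + 1)}" by (auto simp del: of_real_add)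
 qed (intro tendsto_intros X(2))
qed (use \<delta> z w in auto)

lemma gaussian_exp_integrable:
 "integrable lborel (\<lambda>a::real. exp (- a\<^sup>2 / 2) * exp (y * abs a))"
proof -
 have "integrable lborel (\<lambda>a::real. exp (y\<^sup>2) * exp (- (1/4) * (norm a)\<^sup>2))"
  by (intro integrable_mult_right integrable_gaussian) simp
 then show ?thesis
 proof (rule Bochner_Integration.integrable_bound)
  have "- a\<^sup>2 / 2 + y * abs a \<le> y\<^sup>2 + - (1/4) * a\<^sup>2" for a :: real
   using zero_le_power2[of "abs a / 2 - y"] by (simp add: power2_diff power_divide mult.commute[of y])
  then show "AE a in lborel. norm (exp (- a\<^sup>2 / 2) * exp (y * abs a)) \<le> norm (exp (y\<^sup>2) * exp (- (1/4) * (norm a)\<^sup>2))"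
   by (intro AE_I2) (simp add: exp_add[symmetric])
 qed measurable
qed

text \<open>Both sides are holomorphic in a strip containing \<open>z\<close>, and on the imaginary
  axis the formula is the Fourier transform of the Gaussian.\<close>

lemma gaussian_laplace:
 fixes z :: complex
 shows "(LBINT a. cexp (- a\<^sup>2 / 2) * exp (z * cor a))
  = cor (sqrt (2 * pi)) * exp (z\<^sup>2 / 2)"
proof -
 define L where "L z = (LBINT a. cexp (- a\<^sup>2 / 2) * exp (z * cor a))
   - cor (sqrt (2 * pi)) * exp (z\<^sup>2 / 2)" for z
 define \<delta> where "\<delta> = abs (Re z) + 1"
 have "L z = 0"
 proof (rule zero_on_imaginary_halfline[where L=L and w=z and \<delta>=\<delta> and R=0])
  show "L holomorphic_on {z. (abs (Re z)) < \<delta>}" unfolding L_def by (intro holomorphic_intros holomorphic_laplace)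
     (use gaussian_exp_integrable[of \<delta>] in \<open>auto simp: \<delta>_def\<close>)
  fix \<mu> :: real
  have "(LBINT a. cexp (- a\<^sup>2 / 2) * exp (\<i> * cor \<mu> * cor a))
   = (LBINT a. cexp (- 1 * a\<^sup>2 / 2) * cis (a * \<mu>))" by (simp add: cis_conv_exp mult_ac)
  also have "... = cor (sqrt (2 * pi / 1) * exp (- \<mu>\<^sup>2 / (2 * 1)))" by (rule gaussian_1d(2)) simp
  finally show "L (\<i> * cor \<mu>) = 0" by (simp add: L_def power_mult_distrib exp_of_real[symmetric])
 qed (auto simp: \<delta>_def)
 then show ?thesis by (simp add: L_def)
qed

text \<open>One pair of bounds for a whole family of entire functions: any two members can be
  multiplied as \<open>F z * G (\<i> * z)\<close>, and this is what allows their exponents to be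
  compared.\<close>

locale double_gaussian_bound =
 fixes A B :: "real \<Rightarrow> real" and C A0 :: real and N :: nat
 assumes even: "A (- x) = A x" "B (- x) = B x"
  and AB: "A x * B x \<le> C * (1 + abs x) ^ N" and A0: "A x \<le> A0" and nonneg: "A x \<ge> 0" "B x \<ge> 0"
begin

definition admissible :: "(complex \<Rightarrow> complex) \<Rightarrow> bool" where
 "admissible F \<longleftrightarrow> F holomorphic_on UNIV \<and>
   (\<forall>z. norm (F z) \<le> exp ((Im z)\<^sup>2 / 2) * A (Re z) \<and> norm (F z) \<le> B (Im z))"

text \<open>One may use the first bound for \<open>F\<close> and the second for \<open>G\<close>, or
  the other way round. Each time \<open>A\<close> and \<open>B\<close> meet at the same argument and
  multiply to a polynomial, so the smaller of the two exponentials remains.\<close>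

lemma admissible_product:
 assumes F: "admissible F" and G: "admissible G"
 shows "\<exists>p. \<forall>z. F z * G (\<i> * z) = poly p z"
proof (rule product_is_polynomial[where C="max C 1" and N=N])
 fix z
 let ?x = "Re z" and ?y = "Im z"
 have F1: "norm (F z) \<le> exp (?y\<^sup>2 / 2) * A ?x" and F2: "norm (F z) \<le> B ?y" using F by (auto simp: admissible_def)
 have "norm (G (\<i> * z)) \<le> exp ((Im (\<i> * z))\<^sup>2 / 2) * A (Re (\<i> * z)) \<and> norm (G (\<i> * z)) \<le> B (Im (\<i> * z))"
  using G unfolding admissible_def by blast
 then have G1: "norm (G (\<i> * z)) \<le> exp (?x\<^sup>2 / 2) * A ?y" and G2: "norm (G (\<i> * z)) \<le> B ?x" by (auto simp: even)
 have le: "C * (1 + abs t) ^ N \<le> max C 1 * (1 + norm z) ^ N" if "abs t \<le> norm z" for t using that by (intro mult_mono power_mono) auto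
 have "norm (F z) * norm (G (\<i> * z)) \<le> (exp (?y\<^sup>2 / 2) * A ?x) * B ?x" using F1 G2 nonneg by (intro mult_mono) auto
 also have "... \<le> exp (?y\<^sup>2 / 2) * (max C 1 * (1 + norm z) ^ N)" using order_trans[OF AB le[OF abs_Re_le_cmod]] by (simp add: mult.assoc)
 finally have 1: "norm (F z) * norm (G (\<i> * z)) \<le> exp (?y\<^sup>2 / 2) * (max C 1 * (1 + norm z) ^ N)" .
 have "norm (F z) * norm (G (\<i> * z)) \<le> B ?y * (exp (?x\<^sup>2 / 2) * A ?y)" using F2 G1 nonneg by (intro mult_mono) auto
 also have "... = exp (?x\<^sup>2 / 2) * (A ?y * B ?y)" by (simp add: mult_ac)
 also have "... \<le> exp (?x\<^sup>2 / 2) * (max C 1 * (1 + norm z) ^ N)" using order_trans[OF AB le[OF abs_Im_le_cmod]] by (simp add: mult.assoc)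
 finally have 2: "norm (F z) * norm (G (\<i> * z)) \<le> exp (?x\<^sup>2 / 2) * (max C 1 * (1 + norm z) ^ N)" .
 show "norm (F z * G (\<i> * z)) \<le> max C 1 * (1 + norm z) ^ N * exp (min (?x\<^sup>2) (?y\<^sup>2) / 2)"
  using 1 2 by (cases "?x\<^sup>2 \<le> ?y\<^sup>2") (simp_all add: norm_mult mult.commute min_def)
qed (use F G in \<open>auto simp: admissible_def\<close>)

text \<open>Reflection in the real axis conjugates the Gaussian exponent; comparison with the
  original function then forces the exponent to be real.\<close>

lemma admissible_cnj: "admissible F \<Longrightarrow> admissible (\<lambda>z. cnj (F (cnj z)))"
proof -
 assume F: "admissible F"
 have "(cnj \<circ> F \<circ> cnj) holomorphic_on UNIV"
  using F by (intro holomorphic_on_compose_cnj_cnj) (auto simp: admissible_def intro: holomorphic_on_subset)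
 moreover have "norm (F (cnj z)) \<le> exp ((Im (cnj z))\<^sup>2 / 2) * A (Re (cnj z)) \<and> norm (F (cnj z)) \<le> B (Im (cnj z))" for z
  using F unfolding admissible_def by blast
 ultimately show ?thesis by (simp add: admissible_def o_def even)
qed

text \<open>The product \<open>F z * G (\<i> * z)\<close> is a polynomial, yet it carries a Gaussian
  with exponent \<open>\<gamma> - \<gamma>'\<close>.\<close>

lemma admissible_same_exponent:
 assumes F: "admissible F" "R \<noteq> 0" "\<And>z. F z = poly R z * exp (\<gamma> * z\<^sup>2)"
  and G: "admissible G" "S \<noteq> 0" "\<And>z. G z = poly S z * exp (\<gamma>' * z\<^sup>2)"
 shows "\<gamma> = \<gamma>'"
proof -
 obtain p where p: "\<And>z. F z * G (\<i> * z) = poly p z" using admissible_product[OF F(1) G(1)] by blast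
 have "poly (R * pcompose S [:0, \<i>:]) z * exp (0 * z + (\<gamma> - \<gamma>') * z\<^sup>2) = poly p z" for z
 proof -
  have "(\<gamma> - \<gamma>') * z\<^sup>2 = \<gamma> * z\<^sup>2 + \<gamma>' * (\<i> * z)\<^sup>2" by (simp add: power_mult_distrib algebra_simps)
  then show ?thesis unfolding p[symmetric] F(3) G(3) by (simp add: exp_add poly_pcompose mult_ac)
 qed
 moreover have "R * pcompose S [:0, \<i>:] \<noteq> 0" using F(2) G(2) by (auto simp: pcompose_eq_0_iff)
 ultimately have "\<gamma> - \<gamma>' = 0" using exp_quadratic_polynomial by blast
 then show ?thesis by simp
qed

lemma admissible_gaussian:
 assumes F: "admissible F" and nz: "F w \<noteq> 0"
 shows "\<exists>R \<gamma>. R \<noteq> 0 \<and> (\<forall>z. F z = poly R z * exp (cor \<gamma> * z\<^sup>2))"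
proof -
 obtain p where p: "\<And>z. F z * F (\<i> * z) = poly p z" using admissible_product[OF F F] by blast
 have A00: "A0 \<ge> 0" using A0[of 0] nonneg(1)[of 0] by linarith
 have growth: "norm (F z) \<le> A0 * exp (1/2 * (norm z)\<^sup>2)" for z
 proof -
  have "norm (F z) \<le> exp ((Im z)\<^sup>2 / 2) * A (Re z)" using F by (auto simp: admissible_def)
  also have "... \<le> exp (1/2 * (norm z)\<^sup>2) * A0" using nonneg A0 by (intro mult_mono) (auto simp: cmod_power2)
  finally show ?thesis by (simp add: mult.commute)
 qed
 obtain R \<gamma> where R: "R \<noteq> 0" "\<And>z. F z = poly R z * exp (\<gamma> * z\<^sup>2)"
  using hadamard_gaussian[where F=F, OF _ nz growth _ p] F by (auto simp: admissible_def)
 have "cnj (F (cnj z)) = poly (map_poly cnj R) z * exp (cnj \<gamma> * z\<^sup>2)" for z using poly_cnj[of R "cnj z"] by (simp add: R(2) exp_cnj)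
 moreover have "map_poly cnj R \<noteq> 0" using R(1) by (simp add: map_poly_eq_0_iff)
 ultimately have "\<gamma> = cnj \<gamma>" using admissible_same_exponent[OF F R admissible_cnj[OF F]] by blast
 then have "\<gamma> = cor (Re \<gamma>)" by (simp add: complex_eq_iff)
 with R show ?thesis by metis
qed

end

section \<open>Growth at infinity, null sets and interpolation\<close>

lemma poly_lower_bound:
 fixes R :: "complex poly"
 assumes "R \<noteq> 0"
 obtains r0 \<epsilon> where "r0 \<ge> 1" "\<epsilon> > 0" "\<And>t::real. (abs t) \<ge> r0 \<Longrightarrow> \<epsilon> * abs t ^ degree R \<le> norm (poly R (cor t))"
proof -
 define \<epsilon> where "\<epsilon> = norm (lead_coeff R) / 2"
 have \<epsilon>: "\<epsilon> > 0" using assms by (simp add: \<epsilon>_def)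
 have "((\<lambda>x. norm (poly R x / x ^ degree R)) \<longlongrightarrow> norm (lead_coeff R)) at_infinity"
  by (intro tendsto_norm poly_divide_tendsto_aux)
 then have "\<forall>\<^sub>F x in at_infinity. \<epsilon> < norm (poly R x / x ^ degree R)"
  using \<epsilon> by (intro order_tendstoD) (auto simp: \<epsilon>_def)
 then obtain b where b: "\<And>x. norm x \<ge> b \<Longrightarrow> \<epsilon> < norm (poly R x / x ^ degree R)"
  unfolding eventually_at_infinity by blast
 have "\<epsilon> * abs t ^ degree R \<le> norm (poly R (cor t))" if "abs t \<ge> max b 1" for t :: real
 proof -
  have "\<epsilon> < norm (poly R (cor t)) / abs t ^ degree R" using b[of "cor t"] that by (simp add: norm_divide norm_power)
  moreover have "abs t ^ degree R > 0" using that by (intro zero_less_power) linarith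
  ultimately show ?thesis by (simp add: field_simps)
 qed
 with \<epsilon> show thesis using that[of "max b 1" \<epsilon>] by auto
qed

lemma nn_integral_inverse_infinite:
 fixes r K :: real
 assumes "r \<ge> 1" "K > 0"
 shows "(NN a. ennreal (K / a) * indicator {r..} a) = \<infinity>"
proof -
 have "ennreal (real n) \<le> (NN a. ennreal (K / a) * indicator {r..} a)" for n :: nat
 proof -
  define b where "b = r * exp (real n / K)"
  have b: "b \<ge> r" using assms by (simp add: b_def)
  have "(NN a. ennreal (K / a) * indicator {r..b} a) = ennreal (K * ln b - K * ln r)"
   using assms b by (intro nn_integral_FTC_Icc) (auto intro!: derivative_eq_intros)
  also have "K * ln b - K * ln r = real n" using assms by (simp add: b_def ln_mult field_simps)
  finally have "ennreal (real n) = (NN a. ennreal (K / a) * indicator {r..b} a)" ..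
  also have "... \<le> (NN a. ennreal (K / a) * indicator {r..} a)" by (intro nn_integral_mono) (auto simp: indicator_def)
  finally show ?thesis .
 qed
 then show ?thesis by (metis ennreal_of_nat_eq_real_of_nat ennreal_top_neq_of_nat infinity_ennreal_def not_less ennreal_Ex_less_of_nat less_top)
qed

lemma norm_integral_le_nn_integral:
 fixes f :: "'a \<Rightarrow> complex"
 shows "nrm (\<integral>x. f x \<partial>M) \<le> (\<integral>\<^sup>+x. nrm (f x) \<partial>M)"
 by (cases "integrable M f") (auto simp: integral_norm_bound_ennreal not_integrable_integral_eq)

lemma AE_pair_lborel:
 fixes P :: "'a::euclidean_space \<times> 'b::euclidean_space \<Rightarrow> bool"
 assumes "{p. P p} \<in> sets borel"
 shows "(AE p in lborel. P p) \<longleftrightarrow> (AE x in lborel. AE y in lborel. P (x, y))"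
  and "(AE p in lborel. P p) \<longleftrightarrow> (AE y in lborel. AE x in lborel. P (x, y))"
proof -
 have m: "{p \<in> space (lborel \<Otimes>\<^sub>M lborel). P (fst p, snd p)} \<in> sets (lborel \<Otimes>\<^sub>M lborel)"
  using assms unfolding lborel_prod by simp
 show 1: "(AE p in lborel. P p) \<longleftrightarrow> (AE x in lborel. AE y in lborel. P (x, y))"
  using lborel_pair.AE_pair_iff[OF m] unfolding lborel_prod prod.collapse by simp
 show "(AE p in lborel. P p) \<longleftrightarrow> (AE y in lborel. AE x in lborel. P (x, y))" using lborel_pair.AE_commute[OF m] 1 by simp
qed

text \<open>The conjugate of the sign of \<open>f\<close> is itself a permitted test
  function.\<close>

lemma AE_zero_of_bounded_tests:
 fixes f :: "'a::euclidean_space \<Rightarrow> complex"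
 assumes f: "integrable lborel f"
  and z: "\<And>h. h \<in> Borel \<Longrightarrow> (\<And>x. norm (h x) \<le> 1) \<Longrightarrow> (LBINT x. f x * h x) = 0"
 shows "AE x in lborel. f x = 0"
proof -
 have [measurable]: "f \<in> Borel" using f by (auto dest: borel_measurable_integrable)
 have "(LBINT x. f x * cnj (sgn (f x))) = 0"
 proof (rule z)
  show "(\<lambda>x. cnj (sgn (f x))) \<in> Borel" unfolding sgn_div_norm by measurable
 qed (simp add: norm_sgn)
 moreover have "f x * cnj (sgn (f x)) = cor (norm (f x))" for x
  by (simp add: sgn_div_norm scaleR_conv_of_real complex_norm_square[symmetric] power2_eq_square field_simps)
 ultimately have "(LBINT x. norm (f x)) = 0" by simp
 then have "AE x in lborel. norm (f x) = 0" using f by (subst (asm) integral_nonneg_eq_0_iff_AE) auto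
 then show ?thesis by simp
qed

lemma lagrange_interpolation:
 fixes S :: "complex set"
 assumes S: "finite S"
 obtains L where "\<And>k. k \<in> S \<Longrightarrow> degree (L k) < card S"
  "\<And>Q x. degree Q < card S \<Longrightarrow> poly Q x = (\<Sum>k\<in>S. poly Q k * poly (L k) x)"
proof -
 define L where "L k = smult (1 / (\<Prod>j\<in>S - {k}. k - j)) (\<Prod>j\<in>S - {k}. [:- j, 1:])" for k
 have d: "degree (L k) < card S" if "k \<in> S" for k
 proof -
  have "degree (L k) \<le> degree (\<Prod>j\<in>S - {k}. [:- j, 1:])" unfolding L_def by (rule degree_smult_le)
  also have "... \<le> (\<Sum>j\<in>S - {k}. degree [:- j, 1:])" using degree_prod_sum_le[of "S - {k}" "\<lambda>j. [:- j, 1:]"] S by (simp add: o_def)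
  also have "... = card S - 1" using S that by simp
  finally have "degree (L k) \<le> card S - 1" .
  moreover have "card S > 0" using S that card_gt_0_iff by blast
  ultimately show ?thesis by linarith
 qed
 have v: "poly (L k) x = of_bool (x = k)" if "k \<in> S" "x \<in> S" for k x
 proof (cases "x = k")
  case True
  have "(\<Prod>j\<in>S - {k}. k - j) \<noteq> 0" using S by auto
  then show ?thesis using True by (simp add: L_def poly_prod)
 next
  case False
  then have "(\<Prod>j\<in>S - {k}. x - j) = 0" using S that by (intro prod_zero) auto
  then show ?thesis using False by (simp add: L_def poly_prod)
 qed
 have "poly Q x = (\<Sum>k\<in>S. poly Q k * poly (L k) x)" if Q: "degree Q < card S" for Q x
 proof -
  have "Q = (\<Sum>k\<in>S. smult (poly Q k) (L k))"
  proof (rule poly_eqI_degree[where A=S])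
   fix x assume x: "x \<in> S"
   have "poly (\<Sum>k\<in>S. smult (poly Q k) (L k)) x = (\<Sum>k\<in>S. if x = k then poly Q k else 0)"
    unfolding poly_sum by (intro sum.cong) (auto simp: v x)
   then show "poly Q x = poly (\<Sum>k\<in>S. smult (poly Q k) (L k)) x" using S x by simp
  next
   have "degree (\<Sum>k\<in>S. smult (poly Q k) (L k)) \<le> card S - 1"
    using d by (intro degree_sum_le S) (force intro: order_trans[OF degree_smult_le])
   then show "degree (\<Sum>k\<in>S. smult (poly Q k) (L k)) < card S" using Q by linarith
  qed (rule Q)
  from arg_cong[OF this, of "\<lambda>p. poly p x"] show ?thesis by (simp add: poly_sum)
 qed
 with d show thesis using that by blast
qed

section \<open>A vector-valued Beurling theorem\<close>

text \<open>Frequencies below 1 are dropped: there the exponential is too weak to compensate a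
  change of the polynomial denominator, and \<open>abs \<mu> powr \<kappa>\<close> is not bounded
  below by 1.\<close>

definition beurling_weight :: "real \<Rightarrow> real \<Rightarrow> real \<Rightarrow> real \<Rightarrow> real" where
 "beurling_weight \<kappa> M a \<mu> = (if 1 \<le> abs \<mu> then abs \<mu> powr \<kappa> * exp (abs a * abs \<mu>) / (1 + abs a + abs \<mu>) powr M else 0)"

lemma beurling_weight_borel [measurable (raw)]:
 assumes [measurable]: "f \<in> borel_measurable N" "g \<in> borel_measurable N"
 shows "(\<lambda>x. beurling_weight \<kappa> M (f x) (g x)) \<in> borel_measurable N"
 unfolding beurling_weight_def by measurable

text \<open>\<open>v\<close> stands for a function of one real variable with values in
  \<open>L\<^sup>1\<close>. The exponential moment makes its Fourier transform analytic near the
  real line, which settles the case of bounded spectrum.\<close>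

locale beurling_pair =
 fixes v :: "'v::euclidean_space \<times> real \<Rightarrow> complex" and \<kappa> M \<delta> :: real
 assumes v: "integrable lborel v" and M: "M \<ge> 0" and \<kappa>: "\<kappa> \<ge> 0" and \<delta>: "\<delta> > 0"
  and strip: "(NN p. ennreal (norm (v p) * exp (\<delta> * abs (snd p)))) < \<infinity>"
begin

definition "mass a = (NN z. nrm (v (z, a)))"

definition "ft z \<mu> = (LBINT a. v (z, a) * cis (a * \<mu>))"

definition "ft_mass \<mu> = (NN z. nrm (ft z \<mu>))"

definition "beurling_integral = (NN a. NN \<mu>. mass a * ft_mass \<mu> * ennreal (beurling_weight \<kappa> M a \<mu>))"

text \<open>Bounded functions of \<open>z\<close> form the dual of \<open>L\<^sup>1\<close>: pairing
  with them reduces everything to the scalar functions \<open>av h\<close> without loss of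
  information.\<close>

definition test :: "('v \<Rightarrow> complex) \<Rightarrow> bool" where
 "test h \<longleftrightarrow> h \<in> Borel \<and> (\<forall>z. norm (h z) \<le> 1)"

definition "av h a = (LBINT z. v (z, a) * h z)"

lemma v_borel: "v \<in> Borel"
 using v by (auto dest: borel_measurable_integrable)

lemma v_borel_pair [measurable]: "v \<in> borel_measurable (borel \<Otimes>\<^sub>M borel)"
 using v_borel by (simp add: borel_prod)

lemma test_borel [measurable_dest]: "test h \<Longrightarrow> h \<in> Borel"
 by (simp add: test_def)

lemma mass_borel [measurable]: "mass \<in> Borel"
 unfolding mass_def by measurable

lemma ft_borel_pair [measurable]: "(\<lambda>p. ft (fst p) (snd p)) \<in> borel_measurable (borel \<Otimes>\<^sub>M borel)"
 unfolding ft_def by measurable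

lemma ft_borel [measurable]: "(\<lambda>z. ft z \<mu>) \<in> Borel"
 unfolding ft_def by measurable

lemma ft_mass_borel [measurable]: "ft_mass \<in> Borel"
proof -
 have [measurable]: "(\<lambda>p. ft (snd p) (fst p)) \<in> borel_measurable (borel \<Otimes>\<^sub>M borel)" unfolding ft_def by measurable
 have "(\<lambda>\<mu>. (NN z. nrm (ft (snd (\<mu>, z)) (fst (\<mu>, z))))) \<in> Borel"
  by (rule lborel.borel_measurable_nn_integral) (simp add: case_prod_beta')
 then show ?thesis unfolding ft_mass_def by simp
qed

lemma av_borel [measurable]:
 assumes "test h"
 shows "av h \<in> Borel"
proof -
 note [measurable] = test_borel[OF assms]
 show ?thesis unfolding av_def by measurable
qed

lemma mass_finite: "(NN a. mass a) < \<infinity>"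
proof -
 have "(NN a. mass a) = (NN p. nrm (v p))" unfolding mass_def by (subst tonelli_2) (use v_borel in auto)
 then show ?thesis using v by (simp add: integrable_iff_bounded)
qed

lemma test_integrable:
 assumes h: "test h"
 shows "integrable lborel (\<lambda>p. v p * h (fst p))"
proof (rule Bochner_Integration.integrable_bound[OF v])
 note [measurable] = test_borel[OF h]
 show "(\<lambda>p. v p * h (fst p)) \<in> borel_measurable lborel" by (simp add: borel_prod[symmetric])
 show "AE p in lborel. norm (v p * h (fst p)) \<le> norm (v p)" using h by (intro AE_I2) (simp add: norm_mult test_def mult_left_le)
qed

lemma av_integrable: "test h \<Longrightarrow> integrable lborel (av h)"
 using fubini_2(3)[OF test_integrable] by (simp add: av_def[abs_def])

lemma av_le: "test h \<Longrightarrow> nrm (av h a) \<le> mass a"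
 unfolding av_def mass_def by (rule order_trans[OF norm_integral_le_nn_integral], rule nn_integral_mono)
   (auto simp: test_def norm_mult mult_left_le intro!: ennreal_leI)

lemma fourier_av: "test h \<Longrightarrow> fourier (av h) \<mu> = (LBINT z. ft z \<mu> * h z)"
proof -
 assume h: "test h"
 have i: "integrable lborel (\<lambda>p. (v p * h (fst p)) * cis (snd p * \<mu>))"
  by (intro integrable_mult_cis test_integrable h) (simp add: borel_prod[symmetric])
 have "fourier (av h) \<mu> = (LBINT a. LBINT z. (v (z, a) * h z) * cis (a * \<mu>))" unfolding fourier_def av_def by simp
 also have "... = (LBINT z. LBINT a. (v (z, a) * h z) * cis (a * \<mu>))" using fubini_1(1)[OF i] fubini_2(1)[OF i] by simp
 also have "... = (LBINT z. ft z \<mu> * h z)" unfolding ft_def by (simp add: mult_ac flip: integral_mult_right_zero)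
 finally show ?thesis .
qed

lemma fourier_av_le: "test h \<Longrightarrow> nrm (fourier (av h) \<mu>) \<le> ft_mass \<mu>"
 unfolding fourier_av ft_mass_def by (rule order_trans[OF norm_integral_le_nn_integral], rule nn_integral_mono)
   (auto simp: test_def norm_mult mult_left_le intro!: ennreal_leI)

lemma ft_mass_le: "ft_mass \<mu> \<le> (NN a. mass a)"
proof -
 have "ft_mass \<mu> \<le> (NN z. NN a. nrm (v (z, a)))" unfolding ft_mass_def ft_def
  by (rule nn_integral_mono, rule order_trans[OF norm_integral_le_nn_integral]) (simp add: norm_mult)
 also have "... = (NN a. mass a)"
  unfolding mass_def using tonelli_1[of "\<lambda>p. nrm (v p)"] tonelli_2[of "\<lambda>p. nrm (v p)"] v_borel by simp
 finally show ?thesis .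
qed

lemma ft_integrable: "integrable lborel (\<lambda>z. ft z \<mu>)"
 using le_less_trans[OF ft_mass_le mass_finite] by (simp add: integrable_iff_bounded ft_mass_def)

lemma ft_zero_of_tests: "(\<And>h. test h \<Longrightarrow> fourier (av h) \<mu> = 0) \<Longrightarrow> AE z in lborel. ft z \<mu> = 0"
 by (rule AE_zero_of_bounded_tests[OF ft_integrable]) (simp add: fourier_av[symmetric] test_def)

lemma AE_ft_eq_fourier: "AE z in lborel. integrable lborel (\<lambda>a. v (z, a)) \<and> (\<forall>\<mu>. ft z \<mu> = fourier (\<lambda>a. v (z, a)) \<mu>)"
 using fubini_1(2)[OF v] by eventually_elim (simp add: ft_def fourier_def)

text \<open>The exceptional set of \<open>z\<close> depends on \<open>\<mu>\<close>; Fubini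
  exchanges the quantifiers before uniqueness is applied for fixed \<open>z\<close>.\<close>

lemma v_zero_of_ft_zero:
 assumes "\<And>\<mu>. AE z in lborel. ft z \<mu> = 0"
 shows "AE p in lborel. v p = 0"
proof -
 have "{p \<in> space (borel \<Otimes>\<^sub>M borel). ft (fst p) (snd p) = 0} \<in> sets (borel \<Otimes>\<^sub>M borel)" by measurable
 then have 1: "{p. ft (fst p) (snd p) = 0} \<in> sets borel" unfolding borel_prod by simp
 have "AE \<mu> in lborel. AE z in lborel. ft (fst (z, \<mu>)) (snd (z, \<mu>)) = 0" using assms by simp
 then have "AE z in lborel. AE \<mu> in lborel. ft z \<mu> = 0" using AE_pair_lborel[OF 1] by simp
 then have "AE z in lborel. AE a in lborel. v (z, a) = 0" using AE_ft_eq_fourier by eventually_elim (rule fourier_zero_imp, auto)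
 moreover have "{p. v p = 0} \<in> sets borel" using v_borel by measurable
 ultimately show ?thesis by (subst AE_pair_lborel(1)) auto
qed

text \<open>By the exponential moment each scalar transform extends to a strip, and a holomorphic
  function there that vanishes on a half line of the axis is zero.\<close>

lemma compact_spectrum_zero:
 assumes W: "AE \<mu> in lborel. R < abs \<mu> \<longrightarrow> ft_mass \<mu> = 0"
 shows "AE p in lborel. v p = 0"
proof (rule v_zero_of_ft_zero, rule ft_zero_of_tests)
 fix \<mu> h assume h: "test h"
 define R' where "R' = max R 0"
 have z: "fourier (av h) \<mu> = 0" if "\<mu> > R'" for \<mu>
 proof (rule AE_continuous_zero[where S="{R'<..}"])
  show "AE \<mu> in lborel. \<mu> \<in> {R'<..} \<longrightarrow> fourier (av h) \<mu> = 0" using W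
  proof eventually_elim
   case (elim \<mu>)
   then show ?case using fourier_av_le[OF h, of \<mu>] by (auto simp: R'_def)
  qed
 qed (use that continuous_fourier[OF av_integrable[OF h]] in auto)
 have int: "integrable lborel (\<lambda>a. norm (av h a) * exp (\<delta> * abs a))" unfolding integrable_iff_bounded
 proof
  show "(\<lambda>a. norm (av h a) * exp (\<delta> * abs a)) \<in> borel_measurable lborel" using h by measurable
  have "(NN a. nrm (norm (av h a) * exp (\<delta> * abs a))) \<le> (NN a. mass a * ennreal (exp (\<delta> * abs a)))"
   by (intro nn_integral_mono) (simp add: ennreal_mult mult_right_mono av_le[OF h])
  also have "... = (NN p. ennreal (norm (v p) * exp (\<delta> * abs (snd p))))"
  proof (subst tonelli_2)
   show "(\<lambda>p. ennreal (norm (v p) * exp (\<delta> * abs (snd p)))) \<in> Borel" by (simp add: borel_prod[symmetric])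
  qed (simp add: mass_def ennreal_mult nn_integral_multc)
  finally show "(NN a. nrm (norm (av h a) * exp (\<delta> * abs a))) < \<infinity>" using strip by (rule le_less_trans)
 qed
 define L where "L z = (LBINT a. av h a * exp (z * cor a))" for z
 have Lf: "L (\<i> * cor \<mu>) = fourier (av h) \<mu>" for \<mu> unfolding L_def fourier_def by (simp add: cis_conv_exp mult_ac)
 have "L (\<i> * cor \<mu>) = 0"
 proof (rule zero_on_imaginary_halfline[OF _ \<delta>, where R=R' and L=L and w="\<i> * cor \<mu>"])
  show "L holomorphic_on {z. (abs (Re z)) < \<delta>}" unfolding L_def by (rule holomorphic_laplace[OF av_borel[OF h] \<delta> int])
 qed (use z Lf \<delta> in auto)
 then show "fourier (av h) \<mu> = 0" by (simp add: Lf)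
qed

end

text \<open>Unbounded spectrum supplies, beyond any \<open>R\<close>, frequencies at which the
  transform is not zero; these are the source of all exponential moments of
  \<open>mass\<close>.\<close>

locale beurling_unbounded = beurling_pair +
 assumes fin: "beurling_integral < \<infinity>"
  and unbounded: "\<And>R. \<not> (AE \<mu> in lborel. R < abs \<mu> \<longrightarrow> ft_mass \<mu> = 0)"
begin

lemma mass_not_zero: "\<not> (AE a in lborel. mass a = 0)"
proof
 assume "AE a in lborel. mass a = 0"
 then have "(NN a. mass a) = 0" by (subst nn_integral_0_iff_AE) auto
 then have "ft_mass \<mu> = 0" for \<mu> using ft_mass_le[of \<mu>] by simp
 then show False using unbounded[of 0] by simp
qed

text \<open>By Fubini there is a frequency beyond \<open>R + 1\<close> at which
  \<open>ft_mass\<close> is not 0 and the inner integral is finite; its exponential dominates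
  \<open>exp (R * abs a)\<close>.\<close>

lemma mass_exp_finite: "(NN a. mass a * ennreal (exp (R * abs a))) < \<infinity>"
proof -
 \<comment> \<open>The extra 1 pays for the polynomial denominator, and the maximum with 0 puts the
   frequency where the weight does not vanish.\<close>
 define R' where "R' = max R 0 + 1"
 have "beurling_integral = (NN \<mu>. NN a. mass a * ft_mass \<mu> * ennreal (beurling_weight \<kappa> M a \<mu>))"
  unfolding beurling_integral_def by (rule lborel_pair.Fubini'[symmetric]) (simp add: case_prod_beta')
 then have "AE \<mu> in lborel. (NN a. mass a * ft_mass \<mu> * ennreal (beurling_weight \<kappa> M a \<mu>)) \<noteq> \<infinity>"
  using fin by (intro nn_integral_noteq_infinite) (auto simp: case_prod_beta')
 then have "\<exists>\<mu>. R' < abs \<mu> \<and> ft_mass \<mu> \<noteq> 0 \<and> (NN a. mass a * ft_mass \<mu> * ennreal (beurling_weight \<kappa> M a \<mu>)) \<noteq> \<infinity>"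
 proof (rule contrapos_pp)
  assume n: "\<not> ?thesis"
  show "\<not> (AE \<mu> in lborel. (NN a. mass a * ft_mass \<mu> * ennreal (beurling_weight \<kappa> M a \<mu>)) \<noteq> \<infinity>)"
  proof
   assume "AE \<mu> in lborel. (NN a. mass a * ft_mass \<mu> * ennreal (beurling_weight \<kappa> M a \<mu>)) \<noteq> \<infinity>"
   then have "AE \<mu> in lborel. R' < abs \<mu> \<longrightarrow> ft_mass \<mu> = 0" by eventually_elim (use n in blast)
   with unbounded show False by blast
  qed
 qed
 then obtain \<mu> where \<mu>: "R' < abs \<mu>" "ft_mass \<mu> \<noteq> 0"
  and f: "(NN a. mass a * ft_mass \<mu> * ennreal (beurling_weight \<kappa> M a \<mu>)) \<noteq> \<infinity>" by blast
 define L where "L = abs \<mu>"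
 have L: "L \<ge> 1" "R + 1 \<le> L" using \<mu> by (auto simp: L_def R'_def)
 obtain C where C: "C > 0" "\<And>x. x \<ge> 0 \<Longrightarrow> (1 + x) powr M \<le> C * exp (1 * x)" using powr_le_exp[of 1 M] by auto
 have pt: "exp (R * abs a) \<le> C * exp L * beurling_weight \<kappa> M a \<mu>" for a
 proof -
  have "1 * (1 + abs a + L) powr M \<le> L powr \<kappa> * (C * exp (1 * (abs a + L)))"
   using C(2)[of "abs a + L"] L \<kappa> by (intro mult_mono) (auto simp: ge_one_powr_ge_zero add.assoc)
  then have "exp (R * abs a) * (1 + abs a + L) powr M \<le> exp (R * abs a) * (L powr \<kappa> * (C * exp (1 * (abs a + L))))"
   by (intro mult_left_mono) auto
  also have "... = L powr \<kappa> * C * exp L * exp ((R + 1) * abs a)"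
  proof -
   have "exp ((R + 1) * abs a) = exp (R * abs a) * exp (abs a)" by (simp add: exp_add[symmetric] distrib_right)
   then show ?thesis by (simp add: exp_add)
  qed
  also have "... \<le> L powr \<kappa> * C * exp L * exp (L * abs a)" using L C by (intro mult_left_mono) (auto intro!: mult_right_mono)
  finally have "exp (R * abs a) \<le> L powr \<kappa> * C * exp L * exp (L * abs a) / (1 + abs a + L) powr M"
   using L by (simp add: pos_le_divide_eq)
  then show ?thesis using L by (simp add: beurling_weight_def L_def[symmetric] mult_ac)
 qed
 have "ft_mass \<mu> * (NN a. mass a * ennreal (exp (R * abs a)))
   = (NN a. ft_mass \<mu> * (mass a * ennreal (exp (R * abs a))))" by (rule nn_integral_cmult[symmetric]) measurable
 also have "... \<le> (NN a. ennreal (C * exp L) * (mass a * ft_mass \<mu> * ennreal (beurling_weight \<kappa> M a \<mu>)))"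
 proof (rule nn_integral_mono)
  fix a
  have "ennreal (exp (R * abs a)) \<le> ennreal (C * exp L) * ennreal (beurling_weight \<kappa> M a \<mu>)"
   using pt[of a] C by (simp add: ennreal_mult'[symmetric] ennreal_leI)
  then have "(ft_mass \<mu> * mass a) * ennreal (exp (R * abs a)) \<le> (ft_mass \<mu> * mass a) * (ennreal (C * exp L) * ennreal (beurling_weight \<kappa> M a \<mu>))"
   by (rule mult_left_mono) simp
  then show "ft_mass \<mu> * (mass a * ennreal (exp (R * abs a))) \<le> ennreal (C * exp L) * (mass a * ft_mass \<mu> * ennreal (beurling_weight \<kappa> M a \<mu>))"
   by (simp only: mult_ac)
 qed
 also have "... = ennreal (C * exp L) * (NN a. mass a * ft_mass \<mu> * ennreal (beurling_weight \<kappa> M a \<mu>))"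
  by (rule nn_integral_cmult) measurable
 also have "... < \<infinity>" using f by (simp add: ennreal_mult_less_top less_top)
 finally show ?thesis using \<mu>(2) by (auto simp: ennreal_mult_less_top)
qed

section \<open>Two bounds for the Gaussian convolution\<close>

text \<open>Majorants in the two directions of the complex plane: \<open>bound1\<close> comes from
  the integral over \<open>a\<close>, \<open>bound2\<close> from the integral over frequencies after
  Fourier inversion. They depend on \<open>v\<close> alone and so serve all tests at once.\<close>

definition "bound1 x = (NN a. mass a * ennreal (exp (- (abs x - abs a)\<^sup>2 / 2)))"

definition "bound2 y = (NN \<mu>. ft_mass \<mu> * ennreal (exp (- \<mu>\<^sup>2 / 2 + abs \<mu> * abs y)))"

text \<open>Completing the square gives the exponent
  \<open>abs a * abs \<mu> - r\<^sup>2 / 2\<close> with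
  \<open>r = abs (abs x - abs a - abs \<mu>)\<close>. Since \<open>1 + abs a + abs \<mu>\<close> is
  at most \<open>(1 + abs x) * (1 + r)\<close>, the Gaussian in \<open>r\<close> pays for a
  denominator in \<open>x\<close> alone.\<close>

lemma bound_product_pointwise:
 obtains C where "C > 0" "\<And>x a \<mu>. exp (- (abs x - abs a)\<^sup>2 / 2) * exp (- \<mu>\<^sup>2 / 2 + abs \<mu> * abs x)
  \<le> C * (1 + abs x) powr M * beurling_weight \<kappa> M a \<mu> + indicator {-1..1} \<mu> * exp (abs a + 1/2)"
proof -
 obtain C where C: "C > 0" "\<And>x. x \<ge> 0 \<Longrightarrow> (1 + x) powr M \<le> C * exp (1 * x)" using powr_le_exp[of 1 M] by auto
 have "exp (- (abs x - abs a)\<^sup>2 / 2) * exp (- \<mu>\<^sup>2 / 2 + abs \<mu> * abs x)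
  \<le> (C * exp (1/2)) * (1 + abs x) powr M * beurling_weight \<kappa> M a \<mu> + indicator {-1..1} \<mu> * exp (abs a + 1/2)" for x a \<mu>
 proof (cases "1 \<le> abs \<mu>")
  case True
  let ?r = "abs (abs x - abs a - abs \<mu>)"
  have e: "- (abs x - abs a)\<^sup>2 / 2 + (- \<mu>\<^sup>2 / 2 + abs \<mu> * abs x) = - ?r\<^sup>2 / 2 + abs a * abs \<mu>"
   by (simp add: power2_eq_square field_simps)
  have "1 + abs a + abs \<mu> \<le> 1 + abs x + ?r" by linarith
  also have "... \<le> (1 + abs x) * (1 + ?r)" by (simp add: algebra_simps)
  finally have "(1 + abs a + abs \<mu>) powr M \<le> ((1 + abs x) * (1 + ?r)) powr M" using M by (intro powr_mono2) auto
  also have "... = (1 + abs x) powr M * (1 + ?r) powr M" by (simp add: powr_mult)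
  also have "... \<le> (1 + abs x) powr M * (C * exp (1 * ?r))" by (intro mult_left_mono C) auto
  also have "... \<le> (1 + abs x) powr M * (C * exp (1/2 + ?r\<^sup>2 / 2))"
  proof -
   have "?r \<le> 1/2 + ?r\<^sup>2 / 2" using zero_le_power2[of "?r - 1"] unfolding power2_diff by simp
   then show ?thesis using C by (intro mult_left_mono) auto
  qed
  finally have p: "(1 + abs a + abs \<mu>) powr M \<le> (C * exp (1/2)) * (1 + abs x) powr M * exp (?r\<^sup>2 / 2)" by (simp add: exp_add mult_ac)
  have k: "1 \<le> abs \<mu> powr \<kappa>" using True \<kappa> by (rule ge_one_powr_ge_zero)
  have "exp (- ?r\<^sup>2 / 2) * (1 + abs a + abs \<mu>) powr M \<le> exp (- ?r\<^sup>2 / 2) * ((C * exp (1/2)) * (1 + abs x) powr M * exp (?r\<^sup>2 / 2))"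
   using p by (rule mult_left_mono) simp
  also have "... = (C * exp (1/2)) * (1 + abs x) powr M" by (simp add: exp_minus field_simps)
  also have "... \<le> (C * exp (1/2)) * (1 + abs x) powr M * abs \<mu> powr \<kappa>"
   using mult_left_mono[OF k, of "(C * exp (1/2)) * (1 + abs x) powr M"] C by simp
  finally have "exp (- ?r\<^sup>2 / 2) \<le> (C * exp (1/2)) * (1 + abs x) powr M * abs \<mu> powr \<kappa> / (1 + abs a + abs \<mu>) powr M"
   by (simp add: pos_le_divide_eq)
  then have "exp (- ?r\<^sup>2 / 2) * exp (abs a * abs \<mu>) \<le> (C * exp (1/2)) * (1 + abs x) powr M * abs \<mu> powr \<kappa> / (1 + abs a + abs \<mu>) powr M * exp (abs a * abs \<mu>)"
   by (rule mult_right_mono) simp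
  also have "... = (C * exp (1/2)) * (1 + abs x) powr M * beurling_weight \<kappa> M a \<mu>" using True by (simp add: beurling_weight_def)
  finally show ?thesis unfolding exp_add[symmetric] e by (simp add: add_increasing2)
 next
  case False
  \<comment> \<open>At low frequencies the weight is 0, and the left side is bounded by an
    exponential in \<open>abs a\<close> only.\<close>
  have "- (abs x - abs a)\<^sup>2 / 2 + (- \<mu>\<^sup>2 / 2 + abs \<mu> * abs x) \<le> - (abs x - abs a)\<^sup>2 / 2 + abs x"
  proof -
   have "abs \<mu> * abs x \<le> 1 * abs x" using False by (intro mult_right_mono) auto
   then show ?thesis using zero_le_power2[of \<mu>] by linarith
  qed
  also have "... \<le> abs a + 1/2" using zero_le_power2[of "abs x - abs a - 1"] unfolding power2_diff[of "abs x - abs a" 1] by simp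
  finally have le: "- (abs x - abs a)\<^sup>2 / 2 + (- \<mu>\<^sup>2 / 2 + abs \<mu> * abs x) \<le> abs a + 1/2" .
  have "-1 \<le> \<mu>" "\<mu> \<le> 1" using False by linarith+
  then show ?thesis using le False unfolding exp_add[symmetric] by (simp add: beurling_weight_def indicator_def)
 qed
 then show thesis using that[of "C * exp (1/2)"] C(1) by simp
qed

text \<open>The low-frequency term is finite because \<open>ft_mass\<close> is bounded and
  \<open>mass\<close> has exponential moments.\<close>

lemma bound_product: "\<exists>C N. \<forall>x. bound1 x * bound2 x \<le> ennreal (C * (1 + abs x) ^ N)"
proof -
 obtain C where C: "C > 0" "\<And>x a \<mu>. exp (- (abs x - abs a)\<^sup>2 / 2) * exp (- \<mu>\<^sup>2 / 2 + abs \<mu> * abs x)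
  \<le> C * (1 + abs x) powr M * beurling_weight \<kappa> M a \<mu> + indicator {-1..1} \<mu> * exp (abs a + 1/2)"
  by (rule bound_product_pointwise) blast
 define N where "N = nat \<lceil>M\<rceil>"
 define E where "E = (NN a. mass a * ennreal (exp (abs a + 1/2)))"
 have E: "E < \<infinity>"
 proof -
  have "E = (NN a. mass a * ennreal (exp (1 * abs a)) * ennreal (exp (1/2)))" unfolding E_def by (simp add: exp_add ennreal_mult mult.assoc)
  then show ?thesis using mass_exp_finite[of 1] by (simp add: nn_integral_multc ennreal_mult_less_top)
 qed
 define W1 where "W1 = (NN \<mu>. ft_mass \<mu> * indicator {-1..1} \<mu>)"
 have W1: "W1 < \<infinity>"
 proof -
  have "W1 \<le> (NN \<mu>. (NN a. mass a) * indicator {-1..1::real} \<mu>)"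
   unfolding W1_def by (intro nn_integral_mono mult_right_mono ft_mass_le) simp
  also have "... < \<infinity>" using mass_finite by (simp add: nn_integral_cmult ennreal_mult_less_top)
  finally show ?thesis .
 qed
 define D where "D = ennreal C * beurling_integral + E * W1"
 have D: "D < \<infinity>" using fin E W1 by (simp add: D_def ennreal_mult_less_top)
 have "bound1 x * bound2 x \<le> ennreal (enn2real D * (1 + abs x) ^ N)" for x
 proof -
  let ?p = "(1 + abs x) powr M"
  have p1: "1 \<le> ?p" using M by (intro ge_one_powr_ge_zero) auto
  have "bound1 x * bound2 x = (NN a. NN \<mu>. (mass a * ennreal (exp (- (abs x - abs a)\<^sup>2 / 2))) * (ft_mass \<mu> * ennreal (exp (- \<mu>\<^sup>2 / 2 + abs \<mu> * abs x))))"
   unfolding bound1_def bound2_def by (simp add: nn_integral_cmult nn_integral_multc)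
  also have "... \<le> (NN a. NN \<mu>. ennreal (C * ?p) * (mass a * ft_mass \<mu> * ennreal (beurling_weight \<kappa> M a \<mu>))
    + (mass a * ennreal (exp (abs a + 1/2))) * (ft_mass \<mu> * indicator {-1..1} \<mu>))"
  proof (intro nn_integral_mono)
   fix a \<mu> :: real
   have "beurling_weight \<kappa> M a \<mu> \<ge> 0" by (simp add: beurling_weight_def)
   then have "ennreal (exp (- (abs x - abs a)\<^sup>2 / 2)) * ennreal (exp (- \<mu>\<^sup>2 / 2 + abs \<mu> * abs x))
     \<le> ennreal (C * ?p) * ennreal (beurling_weight \<kappa> M a \<mu>) + indicator {-1..1} \<mu> * ennreal (exp (abs a + 1/2))"
    using ennreal_leI[OF C(2)[of x a \<mu>]] C(1) by (simp add: ennreal_mult[symmetric] ennreal_plus ennreal_indicator[symmetric])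
   then have "(mass a * ft_mass \<mu>) * (ennreal (exp (- (abs x - abs a)\<^sup>2 / 2)) * ennreal (exp (- \<mu>\<^sup>2 / 2 + abs \<mu> * abs x)))
     \<le> (mass a * ft_mass \<mu>) * (ennreal (C * ?p) * ennreal (beurling_weight \<kappa> M a \<mu>) + indicator {-1..1} \<mu> * ennreal (exp (abs a + 1/2)))"
    by (rule mult_left_mono) simp
   then show "(mass a * ennreal (exp (- (abs x - abs a)\<^sup>2 / 2))) * (ft_mass \<mu> * ennreal (exp (- \<mu>\<^sup>2 / 2 + abs \<mu> * abs x)))
    \<le> ennreal (C * ?p) * (mass a * ft_mass \<mu> * ennreal (beurling_weight \<kappa> M a \<mu>))
    + (mass a * ennreal (exp (abs a + 1/2))) * (ft_mass \<mu> * indicator {-1..1} \<mu>)" by (simp only: distrib_left mult_ac)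
  qed
  also have "... = ennreal (C * ?p) * beurling_integral + E * W1" unfolding beurling_integral_def E_def W1_def
   by (simp add: nn_integral_add nn_integral_cmult nn_integral_multc case_prod_beta')
  also have "... \<le> ennreal ?p * D"
  proof -
   have "1 * (E * W1) \<le> ennreal ?p * (E * W1)" using p1 by (intro mult_right_mono) auto
   then show ?thesis using C(1) by (simp add: D_def distrib_left ennreal_mult mult_ac)
  qed
  also have "... \<le> ennreal ((1 + abs x) ^ N) * D"
  proof -
   have "?p \<le> (1 + abs x) powr real N" unfolding N_def by (intro powr_mono real_nat_ceiling_ge) auto
   then show ?thesis by (intro mult_right_mono ennreal_leI) (auto simp: powr_realpow)
  qed
  also have "... = ennreal (enn2real D * (1 + abs x) ^ N)" using D by (simp add: ennreal_mult mult.commute)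
  finally show ?thesis .
 qed
 then show ?thesis by blast
qed

lemma bound1_le: "bound1 x \<le> (NN a. mass a)"
proof -
 have "bound1 x \<le> (NN a. mass a * 1)" unfolding bound1_def by (intro nn_integral_mono mult_left_mono) auto
 then show ?thesis by simp
qed

lemma bound1_finite: "bound1 x < \<infinity>"
 using bound1_le mass_finite by (rule le_less_trans)

text \<open>If \<open>bound2 x\<close> were infinite, the product estimate would force
  \<open>bound1 x\<close> to be 0 and hence \<open>mass\<close> to vanish.\<close>

lemma bound2_finite: "bound2 x < \<infinity>"
proof (rule ccontr)
 assume "\<not> bound2 x < \<infinity>"
 then have b: "bound2 x = \<infinity>" by (simp add: less_top[symmetric])
 obtain C N where "bound1 x * bound2 x \<le> ennreal (C * (1 + abs x) ^ N)" using bound_product by blast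
 then have "bound1 x * bound2 x < \<infinity>" by (rule le_less_trans) simp
 then have "bound1 x = 0" using b by (auto simp: ennreal_mult_less_top)
 then have "AE a in lborel. mass a * ennreal (exp (- (abs x - abs a)\<^sup>2 / 2)) = 0"
  unfolding bound1_def by (subst (asm) nn_integral_0_iff_AE) auto
 then have "AE a in lborel. mass a = 0" by eventually_elim auto
 then show False using mass_not_zero by blast
qed

text \<open>The convolution of \<open>av h\<close> with a Gaussian at complex arguments. Factoring
  out \<open>exp (- z\<^sup>2 / 2)\<close> exhibits a Laplace transform, hence an entire
  function.\<close>

definition "transform h z = exp (- z\<^sup>2 / 2) * (LBINT a. (av h a * cexp (- a\<^sup>2 / 2)) * exp (z * cor a))"

lemma transform_holomorphic:
 assumes h: "test h"
 shows "transform h holomorphic_on UNIV"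
proof -
 note [measurable] = av_borel[OF h]
 have L: "(\<lambda>z. (LBINT a. (av h a * cexp (- a\<^sup>2 / 2)) * exp (z * cor a))) holomorphic_on {z. (abs (Re z)) < d}" if d: "d > 0" for d
 proof (rule holomorphic_laplace[OF _ d])
  have "integrable lborel (\<lambda>a. exp (d\<^sup>2 / 2) * norm (av h a))" using av_integrable[OF h] by auto
  then show "integrable lborel (\<lambda>a. norm (av h a * cexp (- a\<^sup>2 / 2)) * exp (d * abs a))"
  proof (rule Bochner_Integration.integrable_bound)
   have "exp (- a\<^sup>2 / 2) * exp (d * abs a) \<le> exp (d\<^sup>2 / 2)" for a :: real
    using zero_le_power2[of "abs a - d"] by (simp add: exp_add[symmetric] power2_diff mult_ac)
   then have "norm (av h a) * (exp (- a\<^sup>2 / 2) * exp (d * abs a)) \<le> norm (av h a) * exp (d\<^sup>2 / 2)" for a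
    by (intro mult_left_mono) auto
   then show "AE a in lborel. norm (norm (av h a * cexp (- a\<^sup>2 / 2)) * exp (d * abs a)) \<le> norm (exp (d\<^sup>2 / 2) * norm (av h a))"
    by (intro AE_I2) (simp add: norm_mult mult_ac)
  qed measurable
 qed measurable
 have "(\<lambda>z. (LBINT a. (av h a * cexp (- a\<^sup>2 / 2)) * exp (z * cor a))) field_differentiable at z" for z
 proof (rule holomorphic_on_imp_differentiable_at[OF L[of "abs (Re z) + 1"]])
  show "open {w. (abs (Re w)) < abs (Re z) + 1}" by (intro open_Collect_less continuous_intros)
 qed auto
 then have "(\<lambda>z. (LBINT a. (av h a * cexp (- a\<^sup>2 / 2)) * exp (z * cor a))) holomorphic_on UNIV" by (simp add: holomorphic_on_def)
 then show ?thesis unfolding transform_def[abs_def] by (intro holomorphic_intros) auto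
qed

lemma transform_eq: "transform h z = (LBINT a. av h a * exp (- (z - cor a)\<^sup>2 / 2))"
proof -
 have "exp (- z\<^sup>2 / 2) * ((av h a * cexp (- a\<^sup>2 / 2)) * exp (z * cor a))
   = av h a * exp (- (z - cor a)\<^sup>2 / 2)" for a
 proof -
  have e: "- (z - cor a)\<^sup>2 / 2 = - z\<^sup>2 / 2 + (cor (- a\<^sup>2 / 2) + z * cor a)" by (simp add: power2_diff field_simps)
  show ?thesis unfolding e by (simp only: exp_add exp_of_real mult_ac)
 qed
 then show ?thesis unfolding transform_def integral_mult_right_zero[symmetric] by (simp only:)
qed

lemma norm_exp_square: "norm (exp (- (z - cor a)\<^sup>2 / 2)) = exp ((Im z)\<^sup>2 / 2) * exp (- (Re z - a)\<^sup>2 / 2)"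
 by (simp add: Re_power2 exp_add[symmetric] diff_divide_distrib)

lemma transform_le_bound1:
 assumes h: "test h"
 shows "nrm (transform h z) \<le> ennreal (exp ((Im z)\<^sup>2 / 2)) * bound1 (Re z)"
proof -
 have "nrm (transform h z) \<le> (NN a. nrm (av h a * exp (- (z - cor a)\<^sup>2 / 2)))"
  unfolding transform_eq by (rule norm_integral_le_nn_integral)
 also have "... \<le> (NN a. ennreal (exp ((Im z)\<^sup>2 / 2)) * (mass a * ennreal (exp (- (abs (Re z) - abs a)\<^sup>2 / 2))))"
 proof (rule nn_integral_mono)
  fix a :: real
  have "(abs (Re z) - abs a)\<^sup>2 \<le> (Re z - a)\<^sup>2" using abs_triangle_ineq3[of "Re z" a] by (simp add: abs_le_square_iff)
  then have e: "exp (- (Re z - a)\<^sup>2 / 2) \<le> exp (- (abs (Re z) - abs a)\<^sup>2 / 2)" by simp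
  have "nrm (av h a * exp (- (z - cor a)\<^sup>2 / 2))
    = nrm (av h a) * (ennreal (exp ((Im z)\<^sup>2 / 2)) * ennreal (exp (- (Re z - a)\<^sup>2 / 2)))"
   unfolding norm_mult norm_exp_square by (simp add: ennreal_mult)
  also have "... \<le> mass a * (ennreal (exp ((Im z)\<^sup>2 / 2)) * ennreal (exp (- (abs (Re z) - abs a)\<^sup>2 / 2)))"
   using e by (intro mult_mono av_le[OF h] ennreal_leI) auto
  finally show "nrm (av h a * exp (- (z - cor a)\<^sup>2 / 2))
    \<le> ennreal (exp ((Im z)\<^sup>2 / 2)) * (mass a * ennreal (exp (- (abs (Re z) - abs a)\<^sup>2 / 2)))" by (simp only: mult_ac)
 qed
 also have "... = ennreal (exp ((Im z)\<^sup>2 / 2)) * bound1 (Re z)" unfolding bound1_def by (rule nn_integral_cmult) measurable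
 finally show ?thesis .
qed

text \<open>The Gaussian is written as an inverse Fourier integral, valid for complex
  \<open>z\<close> by the Laplace formula, and the order of integration is exchanged.\<close>

lemma transform_eq_fourier:
 assumes h: "test h"
 shows "transform h z = cor (1 / sqrt (2 * pi)) *
  (LBINT \<mu>. fourier (av h) \<mu> * (cexp (- \<mu>\<^sup>2 / 2) * exp (- \<i> * z * cor \<mu>)))"
proof -
 note [measurable] = av_borel[OF h]
 define g where "g \<mu> = cexp (- \<mu>\<^sup>2 / 2) * exp (- \<i> * z * cor \<mu>)" for \<mu> :: real
 have g: "integrable lborel g"
 proof (rule Bochner_Integration.integrable_bound[OF gaussian_exp_integrable[of "abs (Im z)"]])
  show "g \<in> borel_measurable lborel" unfolding g_def by measurable
  have "Im z * \<mu> \<le> abs (Im z) * abs \<mu>" for \<mu> by (metis abs_ge_self abs_mult)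
  then show "AE \<mu> in lborel. norm (g \<mu>) \<le> norm (exp (- \<mu>\<^sup>2 / 2) * exp (abs (Im z) * abs \<mu>))"
   by (intro AE_I2) (simp add: g_def norm_mult)
 qed
 define K where "K p = (av h (fst p) * g (snd p)) * cis (fst p * snd p)" for p
 have K: "integrable lborel K" unfolding K_def by (intro integrable_mult_cis integrable_tensor av_integrable h g) (simp add: borel_prod[symmetric])
 have inner: "(LBINT \<mu>. K (a, \<mu>)) = cor (sqrt (2 * pi)) * (av h a * exp (- (z - cor a)\<^sup>2 / 2))" for a
 proof -
  have "K (a, \<mu>) = av h a * (cexp (- \<mu>\<^sup>2 / 2) * exp ((\<i> * (cor a - z)) * cor \<mu>))" for \<mu>
   by (simp add: K_def g_def cis_conv_exp exp_add[symmetric] algebra_simps)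
  then have "(LBINT \<mu>. K (a, \<mu>)) = av h a * (cor (sqrt (2 * pi)) * exp ((\<i> * (cor a - z))\<^sup>2 / 2))"
   by (simp only: integral_mult_right_zero gaussian_laplace)
  also have "(\<i> * (cor a - z))\<^sup>2 / 2 = - (z - cor a)\<^sup>2 / 2" by (simp add: power_mult_distrib power2_commute)
  finally show ?thesis by (simp add: mult_ac)
 qed
 have "cor (sqrt (2 * pi)) * transform h z = (LBINT a. LBINT \<mu>. K (a, \<mu>))" unfolding inner transform_eq by simp
 also have "... = (LBINT \<mu>. LBINT a. K (a, \<mu>))" using fubini_1(1)[OF K] fubini_2(1)[OF K] by simp
 also have "... = (LBINT \<mu>. fourier (av h) \<mu> * g \<mu>)" unfolding K_def fourier_def by (simp add: mult_ac flip: integral_mult_right_zero)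
 finally have "cor (sqrt (2 * pi)) * transform h z = (LBINT \<mu>. fourier (av h) \<mu> * g \<mu>)" .
 then have "transform h z = (LBINT \<mu>. fourier (av h) \<mu> * g \<mu>) / cor (sqrt (2 * pi))" by (simp add: nonzero_eq_divide_eq mult.commute)
 then show ?thesis by (simp add: g_def)
qed

lemma transform_le_bound2:
 assumes h: "test h"
 shows "nrm (transform h z) \<le> bound2 (Im z)"
proof -
 have "norm (cor (1 / sqrt (2 * pi))) \<le> 1" using pi_gt3 by (simp add: norm_divide divide_le_eq real_le_rsqrt)
 then have "norm (transform h z) \<le> 1 * norm (LBINT \<mu>. fourier (av h) \<mu> * (cexp (- \<mu>\<^sup>2 / 2) * exp (- \<i> * z * cor \<mu>)))"
  unfolding transform_eq_fourier[OF h] norm_mult by (rule mult_right_mono) simp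
 then have "nrm (transform h z) \<le> nrm (LBINT \<mu>. fourier (av h) \<mu> * (cexp (- \<mu>\<^sup>2 / 2) * exp (- \<i> * z * cor \<mu>)))"
  by (simp add: ennreal_leI)
 also have "... \<le> (NN \<mu>. nrm (fourier (av h) \<mu> * (cexp (- \<mu>\<^sup>2 / 2) * exp (- \<i> * z * cor \<mu>))))"
  by (rule norm_integral_le_nn_integral)
 also have "... \<le> bound2 (Im z)" unfolding bound2_def
 proof (rule nn_integral_mono)
  fix \<mu> :: real
  have "Im z * \<mu> \<le> abs \<mu> * abs (Im z)" by (metis abs_ge_self abs_mult mult.commute)
  then have "norm (cexp (- \<mu>\<^sup>2 / 2) * exp (- \<i> * z * cor \<mu>)) \<le> exp (- \<mu>\<^sup>2 / 2 + abs \<mu> * abs (Im z))"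
   by (simp add: norm_mult exp_add[symmetric])
  then show "nrm (fourier (av h) \<mu> * (cexp (- \<mu>\<^sup>2 / 2) * exp (- \<i> * z * cor \<mu>)))
    \<le> ft_mass \<mu> * ennreal (exp (- \<mu>\<^sup>2 / 2 + abs \<mu> * abs (Im z)))"
   unfolding norm_mult[of "fourier (av h) \<mu>"] ennreal_mult[OF norm_ge_zero norm_ge_zero]
   by (intro mult_mono fourier_av_le[OF h] ennreal_leI) auto
 qed
 finally show ?thesis .
qed

end


section \<open>Exponents, degrees and coefficients\<close>

context beurling_unbounded
begin

lemma fourier_av_bounded: "test h \<Longrightarrow> norm (fourier (av h) \<mu>) \<le> (LBINT a. norm (av h a))"
 unfolding fourier_def using integral_norm_bound[of lborel "\<lambda>a. av h a * cis (a \<bullet> \<mu>)"] by (simp add: norm_mult)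

lemma damped_integrable:
 assumes h: "test h"
 shows "integrable lborel (\<lambda>\<mu>. fourier (av h) \<mu> * cexp (- \<mu>\<^sup>2 / 2))"
proof -
 note [measurable] = av_borel[OF h]
 have "integrable lborel (\<lambda>\<mu>::real. (LBINT a. norm (av h a)) * exp (- (1/2) * (norm \<mu>)\<^sup>2))"
  by (intro integrable_mult_right integrable_gaussian) simp
 then show ?thesis by (rule Bochner_Integration.integrable_bound)
    (use fourier_av_bounded[OF h] in \<open>auto simp: norm_mult intro!: mult_right_mono\<close>)
qed

text \<open>Seen this way, \<open>transform\<close> on the real line is the Fourier transform of the
  damped function, so \<open>fourier (av h)\<close> can be recovered by uniqueness.\<close>

lemma fourier_damped:
 assumes h: "test h"
 shows "fourier (\<lambda>\<mu>. fourier (av h) \<mu> * cexp (- \<mu>\<^sup>2 / 2)) x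
  = cor (sqrt (2 * pi)) * transform h (- cor x)"
proof -
 have "fourier (\<lambda>\<mu>. fourier (av h) \<mu> * cexp (- \<mu>\<^sup>2 / 2)) x
  = (LBINT \<mu>. fourier (av h) \<mu> * (cexp (- \<mu>\<^sup>2 / 2) * exp (- \<i> * (- cor x) * cor \<mu>)))"
  unfolding fourier_def[of "\<lambda>\<mu>. fourier (av h) \<mu> * cexp (- \<mu>\<^sup>2 / 2)"] by (simp add: cis_conv_exp mult_ac)
 then show ?thesis unfolding transform_eq_fourier[OF h] by simp
qed

lemma fourier_av_eqI:
 assumes h: "test h" and f: "AE \<mu> in lborel. fourier (av h) \<mu> = f \<mu>" and c: "\<And>\<mu>. isCont f \<mu>"
 shows "fourier (av h) \<mu> = f \<mu>"
proof -
 have "fourier (av h) \<mu> - f \<mu> = 0"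
 proof (rule AE_continuous_zero[where S=UNIV and f="\<lambda>\<mu>. fourier (av h) \<mu> - f \<mu>" and x=\<mu>])
  show "AE \<mu> in lborel. \<mu> \<in> UNIV \<longrightarrow> fourier (av h) \<mu> - f \<mu> = 0" using f by eventually_elim simp
  show "isCont (\<lambda>\<mu>. fourier (av h) \<mu> - f \<mu>) \<mu>" for \<mu> by (intro continuous_intros c continuous_fourier av_integrable h)
 qed auto
 then show ?thesis by simp
qed

lemma exists_nonzero_fourier: "\<exists>h \<mu>. test h \<and> fourier (av h) \<mu> \<noteq> 0"
proof (rule ccontr)
 assume "\<nexists>h \<mu>. test h \<and> fourier (av h) \<mu> \<noteq> 0"
 then have "AE z in lborel. ft z \<mu> = 0" for \<mu> by (intro ft_zero_of_tests) blast
 then have "ft_mass \<mu> = 0" for \<mu> unfolding ft_mass_def by (subst nn_integral_0_iff_AE) auto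
 then show False using unbounded[of 0] by simp
qed

lemma transform_zero_imp:
 assumes h: "test h" and z: "\<And>x::real. transform h (cor x) = 0"
 shows "fourier (av h) \<mu> = 0"
proof (rule fourier_av_eqI[OF h, where f="\<lambda>_. 0"])
 have "AE \<mu> in lborel. fourier (av h) \<mu> * cexp (- \<mu>\<^sup>2 / 2) = 0"
 proof (rule fourier_zero_imp[OF damped_integrable[OF h]], rule AE_I2)
  fix x :: real
  have "transform h (- cor x) = 0" using z[of "- x"] by simp
  then show "fourier (\<lambda>\<mu>. fourier (av h) \<mu> * cexp (- \<mu>\<^sup>2 / 2)) x = 0" by (simp only: fourier_damped[OF h]) simp
 qed
 then show "AE \<mu> in lborel. fourier (av h) \<mu> = 0" by eventually_elim simp
qed simp

text \<open>The bounds do not depend on \<open>h\<close>, so all transforms are admissible for the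
  same pair and share one exponent.\<close>

lemma transform_gaussian_form:
 "\<exists>\<gamma>::real. \<forall>h. test h \<longrightarrow> (\<exists>R. \<forall>z. transform h z = poly R z * exp (cor \<gamma> * z\<^sup>2))"
proof -
 obtain C N where CN: "\<And>x. bound1 x * bound2 x \<le> ennreal (C * (1 + abs x) ^ N)" using bound_product by blast
 define A where "A x = enn2real (bound1 x)" for x
 define B where "B x = enn2real (bound2 x)" for x
 have A: "bound1 x = ennreal (A x)" for x using bound1_finite[of x] by (simp add: A_def)
 have B: "bound2 x = ennreal (B x)" for x using bound2_finite[of x] by (simp add: B_def)
 have nn: "A x \<ge> 0" "B x \<ge> 0" for x by (simp_all add: A_def B_def)
 interpret G: double_gaussian_bound A B "max C 1" "enn2real (NN a. mass a)" N
 proof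
  fix x
  show "A (- x) = A x" "B (- x) = B x" by (simp_all add: A_def B_def bound1_def bound2_def)
  show "A x \<ge> 0" "B x \<ge> 0" by (rule nn)+
  show "A x \<le> enn2real (NN a. mass a)" unfolding A_def using bound1_le mass_finite by (intro enn2real_mono) auto
  have "ennreal (A x * B x) \<le> ennreal (C * (1 + abs x) ^ N)" using CN[of x] nn by (simp add: A B ennreal_mult)
  also have "... \<le> ennreal (max C 1 * (1 + abs x) ^ N)" by (intro ennreal_leI mult_right_mono) auto
  finally show "A x * B x \<le> max C 1 * (1 + abs x) ^ N" by (subst (asm) ennreal_le_iff) auto
 qed
 have adm: "G.admissible (transform h)" if h: "test h" for h unfolding G.admissible_def
 proof (intro conjI allI)
  show "transform h holomorphic_on UNIV" by (rule transform_holomorphic[OF h])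
  fix z
  show "norm (transform h z) \<le> exp ((Im z)\<^sup>2 / 2) * A (Re z)"
   using transform_le_bound1[OF h, of z] nn by (simp add: A ennreal_mult[symmetric])
  show "norm (transform h z) \<le> B (Im z)" using transform_le_bound2[OF h, of z] nn by (simp add: B)
 qed
 show ?thesis
 proof (cases "\<exists>h w. test h \<and> transform h w \<noteq> 0")
  case False
  then show ?thesis by (intro exI[of _ 0] allI impI exI[of _ 0]) auto
 next
  case True
  then obtain h0 w where h0: "test h0" "transform h0 w \<noteq> 0" by blast
  from G.admissible_gaussian[OF adm[OF h0(1)] h0(2)]
  obtain R0 \<gamma> where R0: "R0 \<noteq> 0" "\<And>z. transform h0 z = poly R0 z * exp (cor \<gamma> * z\<^sup>2)" by blast
  have "\<exists>R. \<forall>z. transform h z = poly R z * exp (cor \<gamma> * z\<^sup>2)" if h: "test h" for h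
  proof (cases "\<exists>w. transform h w \<noteq> 0")
   case False
   then show ?thesis by (intro exI[of _ 0]) auto
  next
   case True
   then obtain R \<gamma>' where R: "R \<noteq> 0" "\<And>z. transform h z = poly R z * exp (cor \<gamma>' * z\<^sup>2)"
    using G.admissible_gaussian[OF adm[OF h]] by blast
   have "cor \<gamma> = cor \<gamma>'" by (rule G.admissible_same_exponent[OF adm[OF h0(1)] R0 adm[OF h] R])
   then show ?thesis using R(2) by auto
  qed
  then show ?thesis by blast
 qed
qed

text \<open>Convolution of an integrable function with a Gaussian is integrable. A polynomial times
  a Gaussian with nonnegative exponent is not, unless it is zero.\<close>

lemma transform_real_integrable:
 assumes h: "test h"
 shows "(NN x. nrm (transform h (cor x))) < \<infinity>"
proof -
 note [measurable] = av_borel[OF h]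
 have g: "integrable lborel (\<lambda>x::real. exp (- x\<^sup>2 / 2))" using integrable_gaussian[of "1/2", where 'a=real] by simp
 have "(NN x. nrm (transform h (cor x)))
   \<le> (NN x. NN a. nrm (av h a) * ennreal (exp (- (x - a)\<^sup>2 / 2)))"
 proof (rule nn_integral_mono)
  fix x
  have "nrm (transform h (cor x)) \<le> (NN a. nrm (av h a * exp (- (cor x - cor a)\<^sup>2 / 2)))"
   unfolding transform_eq by (rule norm_integral_le_nn_integral)
  also have "... = (NN a. nrm (av h a) * ennreal (exp (- (x - a)\<^sup>2 / 2)))"
   unfolding norm_mult norm_exp_square by (simp add: ennreal_mult)
  finally show "nrm (transform h (cor x)) \<le> (NN a. nrm (av h a) * ennreal (exp (- (x - a)\<^sup>2 / 2)))" .
 qed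
 also have "... = (NN a. NN x. nrm (av h a) * ennreal (exp (- (x - a)\<^sup>2 / 2)))" by (rule lborel_pair.Fubini') measurable
 also have "... = (NN a. nrm (av h a) * (NN x. ennreal (exp (- x\<^sup>2 / 2))))"
 proof (rule nn_integral_cong)
  fix a
  show "(NN x. nrm (av h a) * ennreal (exp (- (x - a)\<^sup>2 / 2)))
   = nrm (av h a) * (NN x. ennreal (exp (- x\<^sup>2 / 2)))"
   using nn_integral_translate(2)[of "\<lambda>x. ennreal (exp (- x\<^sup>2 / 2))" a] by (simp add: nn_integral_cmult)
 qed
 also have "... < \<infinity>" using av_integrable[OF h] g by (simp add: nn_integral_multc integrable_iff_bounded ennreal_mult_less_top)
 finally show ?thesis .
qed

lemma nn_integral_halfline_infinite:
 fixes r :: real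
 assumes "\<epsilon> > 0"
 shows "(NN x. ennreal \<epsilon> * indicator {r..} x) = \<infinity>"
proof -
 have "emeasure lborel {r..} = \<infinity>"
 proof (rule ccontr)
  assume "emeasure lborel {r..} \<noteq> \<infinity>"
  then obtain n :: nat where n: "emeasure lborel {r..} < of_nat n" using ennreal_Ex_less_of_nat[of "emeasure lborel {r..}"] by (auto simp: less_top)
  have "of_nat n = emeasure lborel {r..r + real n}" by (simp add: ennreal_of_nat_eq_real_of_nat)
  also have "... \<le> emeasure lborel {r..}" by (intro emeasure_mono) auto
  finally show False using n by simp
 qed
 then show ?thesis using assms by (simp add: nn_integral_cmult ennreal_mult_top)
qed

lemma exponent_negative:
 assumes h: "test h" and R: "R \<noteq> 0" and eq: "\<And>z. transform h z = poly R z * exp (cor \<gamma> * z\<^sup>2)"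
 shows "\<gamma> < 0"
proof (rule ccontr)
 assume "\<not> \<gamma> < 0"
 then have \<gamma>: "\<gamma> \<ge> 0" by simp
 obtain r0 \<epsilon> where r: "r0 \<ge> 1" "\<epsilon> > 0" "\<And>t::real. (abs t) \<ge> r0 \<Longrightarrow> \<epsilon> * abs t ^ degree R \<le> norm (poly R (cor t))"
  using poly_lower_bound[OF R] by blast
 have "\<infinity> = (NN x. ennreal \<epsilon> * indicator {r0..} x)" using nn_integral_halfline_infinite[OF r(2)] by simp
 also have "... \<le> (NN x. nrm (transform h (cor x)))"
 proof (rule nn_integral_mono)
  fix x :: real
  have "\<epsilon> \<le> norm (transform h (cor x))" if x: "r0 \<le> x"
  proof -
   have "\<epsilon> * 1 \<le> \<epsilon> * abs x ^ degree R" using r x by (intro mult_left_mono one_le_power) auto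
   also have "... \<le> norm (poly R (cor x)) * 1" using r(1) r(3)[of x] x by simp
   also have "... \<le> norm (poly R (cor x)) * norm (exp (cor \<gamma> * (cor x)\<^sup>2))"
    using \<gamma> by (intro mult_left_mono) (auto simp: Re_power2)
   finally show ?thesis unfolding eq norm_mult by simp
  qed
  then show "ennreal \<epsilon> * indicator {r0..} x \<le> nrm (transform h (cor x))" by (auto simp: indicator_def ennreal_leI)
 qed
 finally show False using transform_real_integrable[OF h] by simp
qed

lemma fourier_av_gaussian_form:
 "\<exists>b::real. \<forall>h. test h \<longrightarrow> (\<exists>Q. \<forall>\<mu>::real. fourier (av h) \<mu> = poly Q (cor \<mu>) * cexp (- b * \<mu>\<^sup>2))"
proof -
 obtain \<gamma> :: real where form: "\<And>h. test h \<Longrightarrow> \<exists>R. \<forall>z. transform h z = poly R z * exp (cor \<gamma> * z\<^sup>2)"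
  using transform_gaussian_form by blast
 obtain h0 \<mu>0 where h0: "test h0" "fourier (av h0) \<mu>0 \<noteq> 0" using exists_nonzero_fourier by blast
 obtain R0 where R0: "\<And>z. transform h0 z = poly R0 z * exp (cor \<gamma> * z\<^sup>2)" using form[OF h0(1)] by blast
 have "R0 \<noteq> 0"
 proof
  assume "R0 = 0"
  then have "transform h0 z = 0" for z by (simp add: R0)
  then show False using transform_zero_imp[OF h0(1)] h0(2) by blast
 qed
 then have \<gamma>: "\<gamma> < 0" using exponent_negative[OF h0(1) _ R0] by blast
 \<comment> \<open>With this \<open>c\<close> the Fourier transform of
   \<open>exp (- c * a\<^sup>2)\<close> has exponent \<open>\<gamma>\<close>. Undoing the damping by
   \<open>exp (- \<mu>\<^sup>2 / 2)\<close> replaces \<open>c\<close> by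
   \<open>c - 1/2\<close>.\<close>
 define c where "c = - 1 / (4 * \<gamma>)"
 have c: "c > 0" "1 / (4 * c) = - \<gamma>" using \<gamma> by (auto simp: c_def divide_neg_neg)
 have "\<exists>Q. \<forall>\<mu>::real. fourier (av h) \<mu> = poly Q (cor \<mu>) * cexp (- (c - 1/2) * \<mu>\<^sup>2)" if h: "test h" for h
 proof -
  obtain R where R: "\<And>z. transform h z = poly R z * exp (cor \<gamma> * z\<^sup>2)" using form[OF h] by blast
  obtain P where P: "\<And>x::real. (LBINT a. poly P (cor a) * cexp (- c * a\<^sup>2) * cis (a * x))
    = poly (smult (cor (sqrt (2 * pi))) (pcompose R [:0, -1:])) (cor x) * cexp (- x\<^sup>2 / (4 * c))"
   using gaussian_polynomial_transform[OF c(1)] by blast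
  have "AE \<mu> in lborel. fourier (av h) \<mu> * cexp (- \<mu>\<^sup>2 / 2) = poly P (cor \<mu>) * cexp (- c * \<mu>\<^sup>2)"
  proof (rule fourier_unique[OF damped_integrable[OF h] poly_gaussian_integrable[OF c(1)]], intro AE_I2)
   fix x :: real
   have e: "- x\<^sup>2 / (4 * c) = \<gamma> * x\<^sup>2" using c(2) by (metis mult.commute mult_minus_left times_divide_eq_left mult_1 mult_minus_right divide_minus_left minus_minus)
   have "fourier (\<lambda>\<mu>. poly P (cor \<mu>) * cexp (- c * \<mu>\<^sup>2)) x
    = cor (sqrt (2 * pi)) * (poly R (- cor x) * cexp (\<gamma> * x\<^sup>2))"
    using P[of x] unfolding e by (simp add: fourier_def poly_pcompose)
   also have "... = cor (sqrt (2 * pi)) * transform h (- cor x)" unfolding R by (simp add: exp_of_real[symmetric])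
   finally show "fourier (\<lambda>\<mu>. fourier (av h) \<mu> * cexp (- \<mu>\<^sup>2 / 2)) x
    = fourier (\<lambda>\<mu>. poly P (cor \<mu>) * cexp (- c * \<mu>\<^sup>2)) x" by (simp only: fourier_damped[OF h])
  qed
  then have "AE \<mu> in lborel. fourier (av h) \<mu> = poly P (cor \<mu>) * cexp (- (c - 1/2) * \<mu>\<^sup>2)"
  proof eventually_elim
   case (elim \<mu>)
   have "fourier (av h) \<mu> = (fourier (av h) \<mu> * cexp (- \<mu>\<^sup>2 / 2)) * cexp (\<mu>\<^sup>2 / 2)"
    by (simp add: mult.assoc exp_minus flip: of_real_mult)
   also have "... = poly P (cor \<mu>) * cor (exp (- c * \<mu>\<^sup>2) * exp (\<mu>\<^sup>2 / 2))" unfolding elim by simp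
   also have "exp (- c * \<mu>\<^sup>2) * exp (\<mu>\<^sup>2 / 2) = exp (- (c - 1/2) * \<mu>\<^sup>2)"
    by (simp add: exp_add[symmetric] field_simps)
   finally show ?case .
  qed
  then have "fourier (av h) \<mu> = poly P (cor \<mu>) * cexp (- (c - 1/2) * \<mu>\<^sup>2)" for \<mu>
   by (rule fourier_av_eqI[OF h]) (intro continuous_intros)
  then show ?thesis by blast
 qed
 then show ?thesis by blast
qed

text \<open>For \<open>b \<le> 0\<close> the transform stays away from 0 at large frequencies, and
  so does the weight when \<open>a\<close> is not 0. The inner integral then diverges wherever
  \<open>mass a\<close> is not 0.\<close>

lemma fourier_exponent_positive:
 assumes h: "test h" and Q: "Q \<noteq> 0"
  and eq: "\<And>\<mu>::real. fourier (av h) \<mu> = poly Q (cor \<mu>) * cexp (- b * \<mu>\<^sup>2)"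
 shows "b > 0"
proof (rule ccontr)
 assume "\<not> b > 0"
 then have b: "b \<le> 0" by simp
 obtain r0 \<epsilon> where r: "r0 \<ge> 1" "\<epsilon> > 0" "\<And>t::real. (abs t) \<ge> r0 \<Longrightarrow> \<epsilon> * abs t ^ degree Q \<le> norm (poly Q (cor t))"
  using poly_lower_bound[OF Q] by blast
 have low: "ennreal \<epsilon> \<le> ft_mass \<mu>" if \<mu>: "r0 \<le> \<mu>" for \<mu>
 proof -
  have "\<epsilon> * 1 \<le> \<epsilon> * abs \<mu> ^ degree Q" using r \<mu> by (intro mult_left_mono one_le_power) auto
  also have "... \<le> norm (poly Q (cor \<mu>)) * 1" using r(1) r(3)[of \<mu>] \<mu> by simp
  also have "... \<le> norm (poly Q (cor \<mu>)) * exp (- b * \<mu>\<^sup>2)" using b by (intro mult_left_mono) (auto simp: mult_nonpos_nonneg)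
  finally have "\<epsilon> \<le> norm (fourier (av h) \<mu>)" unfolding eq norm_mult by simp
  then show ?thesis using fourier_av_le[OF h, of \<mu>] by (meson ennreal_leI order_trans)
 qed
 have "AE a in lborel. (NN \<mu>. mass a * ft_mass \<mu> * ennreal (beurling_weight \<kappa> M a \<mu>)) \<noteq> \<infinity>"
  using fin unfolding beurling_integral_def by (intro nn_integral_noteq_infinite) auto
 moreover have "AE a in lborel. a \<noteq> (0::real)" by (rule AE_lborel_singleton)
 ultimately have "AE a in lborel. mass a = 0"
 proof eventually_elim
  case (elim a)
  then have a: "abs a > 0" by simp
  obtain C where C: "C > 0" "\<And>x. x \<ge> 0 \<Longrightarrow> (1 + x) powr M \<le> C * exp (abs a * x)" using powr_le_exp[OF a] by blast
  \<comment> \<open>The exponential with rate \<open>abs a\<close> absorbs the denominator, which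
    leaves a constant lower bound of the weight for \<open>\<mu> \<ge> 1\<close>.\<close>
  define k where "k = 1 / (C * exp (abs a * abs a))"
  have k: "k > 0" using C by (simp add: k_def)
  have w: "k \<le> beurling_weight \<kappa> M a \<mu>" if \<mu>: "1 \<le> \<mu>" for \<mu>
  proof -
   have "(1 + abs a + \<mu>) powr M \<le> C * exp (abs a * abs a) * exp (abs a * \<mu>)"
    using C(2)[of "abs a + \<mu>"] \<mu> by (simp add: exp_add distrib_left mult_ac add.assoc)
   then have "k \<le> exp (abs a * \<mu>) / (1 + abs a + \<mu>) powr M" using C \<mu> by (simp add: k_def field_simps)
   also have "... \<le> \<mu> powr \<kappa> * exp (abs a * \<mu>) / (1 + abs a + \<mu>) powr M"
    using ge_one_powr_ge_zero[OF \<mu> \<kappa>] by (intro divide_right_mono) (auto simp: mult_le_cancel_right1)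
   finally show ?thesis using \<mu> by (simp add: beurling_weight_def)
  qed
  show "mass a = 0"
  proof (rule ccontr)
   assume m: "mass a \<noteq> 0"
   have "mass a * (NN \<mu>. ennreal (\<epsilon> * k) * indicator {r0..} \<mu>) = (NN \<mu>. mass a * (ennreal (\<epsilon> * k) * indicator {r0..} \<mu>))"
    by (rule nn_integral_cmult[symmetric]) measurable
   also have "... \<le> (NN \<mu>. mass a * ft_mass \<mu> * ennreal (beurling_weight \<kappa> M a \<mu>))"
   proof (rule nn_integral_mono)
    fix \<mu> :: real
    have "ennreal \<epsilon> * ennreal k \<le> ft_mass \<mu> * ennreal (beurling_weight \<kappa> M a \<mu>)" if "r0 \<le> \<mu>"
     using that r(1) by (intro mult_mono low ennreal_leI w) auto
    then show "mass a * (ennreal (\<epsilon> * k) * indicator {r0..} \<mu>) \<le> mass a * ft_mass \<mu> * ennreal (beurling_weight \<kappa> M a \<mu>)"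
     using r k by (auto simp: indicator_def ennreal_mult mult.assoc intro!: mult_left_mono)
   qed
   finally have "mass a * \<infinity> \<le> (NN \<mu>. mass a * ft_mass \<mu> * ennreal (beurling_weight \<kappa> M a \<mu>))"
    using nn_integral_halfline_infinite[of "\<epsilon> * k" r0] r k by simp
   then show False using m elim(1) by (simp add: ennreal_mult_top top_unique)
  qed
 qed
 then show False using mass_not_zero by blast
qed

lemma av_gaussian_form:
 assumes h: "test h" and b: "b > 0"
  and eq: "\<And>\<mu>::real. fourier (av h) \<mu> = poly Q (cor \<mu>) * cexp (- b * \<mu>\<^sup>2)"
 shows "\<exists>P. degree P = degree Q \<and> (AE a in lborel. av h a = poly P (cor a) * cexp (- (1 / (4 * b)) * a\<^sup>2))"
proof -
 have c: "1 / (4 * b) > 0" using b by simp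
 obtain P where P: "degree P = degree Q" "\<And>\<mu>::real. (LBINT a. poly P (cor a) * cexp (- (1 / (4 * b)) * a\<^sup>2) * cis (a * \<mu>))
   = poly Q (cor \<mu>) * cexp (- \<mu>\<^sup>2 / (4 * (1 / (4 * b))))" using gaussian_polynomial_transform[OF c] by blast
 have "AE a in lborel. av h a = poly P (cor a) * cexp (- (1 / (4 * b)) * a\<^sup>2)"
 proof (rule fourier_unique[OF av_integrable[OF h] poly_gaussian_integrable[OF c]], intro AE_I2)
  fix \<mu> :: real
  have "- \<mu>\<^sup>2 / (4 * (1 / (4 * b))) = - b * \<mu>\<^sup>2" using b by simp
  then show "fourier (av h) \<mu> = fourier (\<lambda>a. poly P (cor a) * cexp (- (1 / (4 * b)) * a\<^sup>2)) \<mu>"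
   using P(2)[of \<mu>] by (simp add: eq fourier_def[of "\<lambda>a. poly P (cor a) * _ a"])
 qed
 with P(1) show ?thesis by blast
qed

text \<open>On the line \<open>\<mu> = 2 * c * a\<close> the two Gaussians and
  \<open>exp (a * \<mu>)\<close> balance exactly. In a strip of width 1 beside it the integrand is
  at least a constant times \<open>a powr (2 * d + \<kappa> - M)\<close>, so finiteness requires an
  exponent below -1.\<close>

lemma degree_bound:
 assumes h: "test h" and b: "b > 0" and Q: "Q \<noteq> 0"
  and eq: "\<And>\<mu>::real. fourier (av h) \<mu> = poly Q (cor \<mu>) * cexp (- b * \<mu>\<^sup>2)"
 shows "2 * real (degree Q) + \<kappa> - M < -1"
proof (rule ccontr)
 assume n: "\<not> 2 * real (degree Q) + \<kappa> - M < -1"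
 define d where "d = degree Q"
 define c where "c = 1 / (4 * b)"
 have c: "c > 0" using b by (simp add: c_def)
 obtain P where P: "degree P = d" "AE a in lborel. av h a = poly P (cor a) * cexp (- c * a\<^sup>2)"
  using av_gaussian_form[OF h b eq] unfolding c_def d_def by blast
 have P0: "P \<noteq> 0"
 proof
  assume "P = 0"
  then have "AE a in lborel. av h a = 0" using P(2) by simp
  then have "AE a in lborel. av h a * cis (a \<bullet> \<mu>) = 0" for \<mu> by eventually_elim simp
  then have "fourier (av h) \<mu> = 0" for \<mu> unfolding fourier_def by (rule integral_eq_zero_AE)
  then have z: "poly Q (cor \<mu>) = 0" for \<mu> :: real using eq[of \<mu>] by simp
  have "infinite (range cor)" by (meson finite_imageD infinite_UNIV_char_0 inj_of_real)
  then show False using poly_roots_finite[OF Q] z finite_subset[of "range cor" "{x. poly Q x = 0}"] by auto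
 qed
 obtain r1 e1 where r1: "r1 \<ge> 1" "e1 > 0" "\<And>t::real. (abs t) \<ge> r1 \<Longrightarrow> e1 * abs t ^ d \<le> norm (poly P (cor t))"
  using poly_lower_bound[OF P0] unfolding P(1) by blast
 obtain r2 e2 where r2: "r2 \<ge> 1" "e2 > 0" "\<And>t::real. (abs t) \<ge> r2 \<Longrightarrow> e2 * abs t ^ d \<le> norm (poly Q (cor t))"
  using poly_lower_bound[OF Q] unfolding d_def by blast
 \<comment> \<open>Beyond \<open>r\<close> both polynomial lower bounds hold, the second one because
   \<open>\<mu>\<close> is at least \<open>2 * c * a\<close>.\<close>
 define r where "r = Max {r1, r2 / (2 * c), 1}"
 have r: "r \<ge> r1" "r \<ge> r2 / (2 * c)" "r \<ge> 1" unfolding r_def by (auto intro: Max_ge)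
 \<comment> \<open>\<open>K\<close> collects the constants left when \<open>\<mu>\<close> is
   replaced by \<open>2 * c * a\<close> in the positive powers and \<open>1 + a + \<mu>\<close> by
   \<open>(3 + 2 * c) * a\<close>; the last factor is the least value of the exponentials in the
   strip.\<close>
 define K where "K = e1 * e2 * (2 * c) ^ d * (2 * c) powr \<kappa> * (3 + 2 * c) powr (- M) * exp (- 1 / (4 * c))"
 have K: "K > 0" unfolding K_def using r1 r2 c by simp
 have pt: "K / a \<le> e1 * a ^ d * exp (- c * a\<^sup>2) * (e2 * \<mu> ^ d * exp (- b * \<mu>\<^sup>2)) * beurling_weight \<kappa> M a \<mu>"
  if a: "r \<le> a" and \<mu>: "2 * c * a \<le> \<mu>" "\<mu> \<le> 2 * c * a + 1" "1 \<le> \<mu>" for a \<mu>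
 proof -
  have a1: "1 \<le> a" using a r by simp
  have ca: "0 < 2 * c * a" using a1 c by simp
  have "exp (- 1 / (4 * c)) \<le> exp (- c * a\<^sup>2 - b * \<mu>\<^sup>2 + a * \<mu>)"
  proof -
   have "- c * a\<^sup>2 - b * \<mu>\<^sup>2 + a * \<mu> = - (\<mu> - 2 * c * a)\<^sup>2 / (4 * c)"
    using c b by (simp add: c_def power2_eq_square field_simps)
   moreover have "(\<mu> - 2 * c * a)\<^sup>2 \<le> 1\<^sup>2" using \<mu> by (intro power_mono) auto
   ultimately show ?thesis using c by (simp add: divide_right_mono)
  qed
  moreover have "(1 + a + \<mu>) powr (- M) \<ge> ((3 + 2 * c) * a) powr (- M)"
  proof -
   have "1 + a + \<mu> \<le> (3 + 2 * c) * a" using \<mu> a1 by (simp add: algebra_simps)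
   then show ?thesis using M a1 \<mu> by (intro powr_mono2') auto
  qed
  moreover have "\<mu> ^ d \<ge> (2 * c * a) ^ d" using \<mu> ca by (intro power_mono) auto
  moreover have "\<mu> powr \<kappa> \<ge> (2 * c * a) powr \<kappa>" using \<mu> ca \<kappa> by (intro powr_mono2) auto
  ultimately have "(2 * c * a) ^ d * (2 * c * a) powr \<kappa> * ((3 + 2 * c) * a) powr (- M) * exp (- 1 / (4 * c))
    \<le> \<mu> ^ d * \<mu> powr \<kappa> * (1 + a + \<mu>) powr (- M) * exp (- c * a\<^sup>2 - b * \<mu>\<^sup>2 + a * \<mu>)"
   using ca \<mu> by (intro mult_mono) auto
  then have "(e1 * e2 * a ^ d) * ((2 * c * a) ^ d * (2 * c * a) powr \<kappa> * ((3 + 2 * c) * a) powr (- M) * exp (- 1 / (4 * c)))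
    \<le> (e1 * e2 * a ^ d) * (\<mu> ^ d * \<mu> powr \<kappa> * (1 + a + \<mu>) powr (- M) * exp (- c * a\<^sup>2 - b * \<mu>\<^sup>2 + a * \<mu>))"
   using r1 r2 a1 by (intro mult_left_mono) auto
  also have "... = e1 * a ^ d * exp (- c * a\<^sup>2) * (e2 * \<mu> ^ d * exp (- b * \<mu>\<^sup>2)) * beurling_weight \<kappa> M a \<mu>"
  proof -
   have "exp (- c * a\<^sup>2 - b * \<mu>\<^sup>2 + a * \<mu>) = exp (- c * a\<^sup>2) * exp (- b * \<mu>\<^sup>2) * exp (a * \<mu>)"
    by (simp add: exp_add[symmetric])
   then show ?thesis using \<mu> a1 by (simp add: beurling_weight_def powr_minus divide_inverse mult_ac)
  qed
  finally have 1: "(e1 * e2 * a ^ d) * ((2 * c * a) ^ d * (2 * c * a) powr \<kappa> * ((3 + 2 * c) * a) powr (- M) * exp (- 1 / (4 * c)))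
    \<le> e1 * a ^ d * exp (- c * a\<^sup>2) * (e2 * \<mu> ^ d * exp (- b * \<mu>\<^sup>2)) * beurling_weight \<kappa> M a \<mu>" .
  have "K / a = K * a powr (-1)" using a1 by (simp add: powr_minus divide_inverse)
  also have "... \<le> K * a powr (2 * real d + \<kappa> - M)" using K a1 n by (intro mult_left_mono powr_mono) (auto simp: d_def)
  also have "a powr (2 * real d + \<kappa> - M) = a ^ d * a ^ d * a powr \<kappa> * a powr (- M)"
  proof -
   have "2 * real d + \<kappa> - M = real d + real d + \<kappa> + (- M)" by simp
   then show ?thesis using a1 by (simp only: powr_add powr_realpow)
  qed
  also have "K * (a ^ d * a ^ d * a powr \<kappa> * a powr (- M)) = (e1 * e2 * a ^ d) * ((2 * c * a) ^ d * (2 * c * a) powr \<kappa> * ((3 + 2 * c) * a) powr (- M) * exp (- 1 / (4 * c)))"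
   using a1 c by (simp add: K_def power_mult_distrib powr_mult mult_ac)
  also note 1
  finally show ?thesis .
 qed
 have "\<infinity> = (NN a. ennreal (K / a) * indicator {r..} a)" using nn_integral_inverse_infinite[OF r(3) K] by simp
 also have "... \<le> beurling_integral" unfolding beurling_integral_def
 proof (rule nn_integral_mono_AE)
  show "AE a in lborel. ennreal (K / a) * indicator {r..} a \<le> (NN \<mu>. mass a * ft_mass \<mu> * ennreal (beurling_weight \<kappa> M a \<mu>))"
   using P(2)
  proof eventually_elim
   case (elim a)
   show ?case
   proof (cases "r \<le> a")
    case True
    have a1: "1 \<le> a" using True r by simp
    have m: "ennreal (e1 * a ^ d * exp (- c * a\<^sup>2)) \<le> mass a"
    proof -
     have "e1 * a ^ d * exp (- c * a\<^sup>2) \<le> norm (av h a)"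
      unfolding elim norm_mult using r1(3)[of a] True r a1 by (simp add: mult_right_mono)
     then show ?thesis using av_le[OF h, of a] by (meson ennreal_leI order_trans)
    qed
    let ?s = "max 1 (2 * c * a)"
    have "ennreal (K / a) * indicator {r..} a = ennreal (K / a) * emeasure lborel {2 * c * a .. 2 * c * a + 1}" using True by simp
    also have "... = (NN \<mu>. ennreal (K / a) * indicator {2 * c * a .. 2 * c * a + 1} \<mu>)"
     by (rule nn_integral_cmult_indicator[symmetric]) simp
    also have "... \<le> (NN \<mu>. mass a * ft_mass \<mu> * ennreal (beurling_weight \<kappa> M a \<mu>))"
    proof (rule nn_integral_mono)
     fix \<mu> :: real
     show "ennreal (K / a) * indicator {2 * c * a .. 2 * c * a + 1} \<mu> \<le> mass a * ft_mass \<mu> * ennreal (beurling_weight \<kappa> M a \<mu>)"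
     proof (cases "\<mu> \<in> {2 * c * a .. 2 * c * a + 1}")
      case \<mu>: True
      have "r2 \<le> 2 * c * r" using r(2) c by (simp add: field_simps)
      also have "2 * c * r \<le> 2 * c * a" using True c by (intro mult_left_mono) auto
      finally have "r2 \<le> 2 * c * a" .
      then have r2\<mu>: "r2 \<le> \<mu>" using \<mu> by simp
      have f: "ennreal (e2 * \<mu> ^ d * exp (- b * \<mu>\<^sup>2)) \<le> ft_mass \<mu>"
      proof -
       have "e2 * \<mu> ^ d * exp (- b * \<mu>\<^sup>2) \<le> norm (fourier (av h) \<mu>)"
        unfolding eq norm_mult using r2(3)[of \<mu>] r2\<mu> r2(1) by (simp add: mult_right_mono)
       then show ?thesis using fourier_av_le[OF h, of \<mu>] by (meson ennreal_leI order_trans)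
      qed
      have "beurling_weight \<kappa> M a \<mu> \<ge> 0" by (simp add: beurling_weight_def)
      moreover have "\<mu> \<ge> 0" using r2\<mu> r2(1) by simp
      ultimately have "ennreal (K / a) \<le> ennreal (e1 * a ^ d * exp (- c * a\<^sup>2)) * ennreal (e2 * \<mu> ^ d * exp (- b * \<mu>\<^sup>2)) * ennreal (beurling_weight \<kappa> M a \<mu>)"
       using pt[OF True, of \<mu>] \<mu> r2\<mu> r2 r1 a1 by (simp add: ennreal_mult[symmetric] ennreal_leI)
      also have "... \<le> mass a * ft_mass \<mu> * ennreal (beurling_weight \<kappa> M a \<mu>)" by (intro mult_mono m f) auto
      finally show ?thesis using \<mu> by simp
     qed simp
    qed
    finally show ?thesis .
   qed simp
  qed
 qed
 finally show False using fin by simp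
qed

text \<open>The nodes come from a prescribed infinite set, so that the coefficients inherit
  properties of \<open>ft\<close> known only at frequencies of that set.\<close>

theorem gaussian_decomposition:
 assumes \<Lambda>: "infinite \<Lambda>"
 shows "\<exists>(c::real) (l::int) L q. real_of_int l < (M - \<kappa> - 1) / 2 \<and> finite L \<and> L \<subseteq> \<Lambda> \<and>
  (AE p in lborel. v p = cexp (- c * (snd p)\<^sup>2) *
    (\<Sum>j\<in>{0..l}. (\<Sum>k\<in>L. q j k * ft (fst p) k) * cor (snd p ^ nat j)))"
proof -
 obtain b :: real where form: "\<And>h. test h \<Longrightarrow> \<exists>Q. \<forall>\<mu>::real. fourier (av h) \<mu> = poly Q (cor \<mu>) * cexp (- b * \<mu>\<^sup>2)"
  using fourier_av_gaussian_form by blast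
 obtain h0 \<mu>0 where h0: "test h0" "fourier (av h0) \<mu>0 \<noteq> 0" using exists_nonzero_fourier by blast
 obtain Q0 where Q0: "\<And>\<mu>::real. fourier (av h0) \<mu> = poly Q0 (cor \<mu>) * cexp (- b * \<mu>\<^sup>2)" using form[OF h0(1)] by blast
 have Q00: "Q0 \<noteq> 0" using h0(2) Q0 by auto
 have b: "b > 0" by (rule fourier_exponent_positive[OF h0(1) Q00 Q0])
 define T where "T = (M - \<kappa> - 1) / 2"
 have deg: "real (degree Q) < T" if "test h" "Q \<noteq> 0"
  "\<And>\<mu>::real. fourier (av h) \<mu> = poly Q (cor \<mu>) * cexp (- b * \<mu>\<^sup>2)" for h Q
  using degree_bound[OF that(1) b that(2,3)] by (simp add: T_def)
 have T0: "T > 0" using deg[OF h0(1) Q00 Q0] by (meson less_le_trans not_le of_nat_0_le_iff order_less_le_trans)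
 \<comment> \<open>The largest integer strictly below \<open>T\<close>; it bounds every degree, and
   it is nonnegative because \<open>T\<close> is positive.\<close>
 define l where "l = \<lceil>T\<rceil> - 1"
 have l: "real_of_int l < T" "0 \<le> l" using T0 unfolding l_def by linarith+
 define n where "n = nat l"
 have degn: "degree Q \<le> n" if "test h"
  "\<And>\<mu>::real. fourier (av h) \<mu> = poly Q (cor \<mu>) * cexp (- b * \<mu>\<^sup>2)" for h Q
 proof (cases "Q = 0")
  case False
  from deg[OF that(1) this that(2)] have "int (degree Q) < \<lceil>T\<rceil>" by (simp add: less_ceiling_iff)
  then show ?thesis by (simp add: n_def l_def)
 qed simp
 obtain L where L: "finite L" "card L = Suc n" "L \<subseteq> \<Lambda>" using infinite_arbitrarily_large[OF \<Lambda>, of "Suc n"] by blast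
 define S where "S = cor ` L"
 have S: "finite S" "card S = Suc n" using L by (simp_all add: S_def card_image inj_on_def)
 obtain \<phi> where \<phi>: "\<And>k. k \<in> S \<Longrightarrow> degree (\<phi> k) < card S"
  "\<And>Q x. degree Q < card S \<Longrightarrow> poly Q x = (\<Sum>k\<in>S. poly Q k * poly (\<phi> k) x)"
  using lagrange_interpolation[OF S(1)] by blast
 define e where "e k = cexp (b * k\<^sup>2)" for k :: real
 have e: "cexp (- b * k\<^sup>2) * e k = 1" for k by (simp add: e_def exp_minus flip: of_real_mult)
 have sumS: "(\<Sum>k\<in>S. f k) = (\<Sum>k\<in>L. f (cor k))" for f :: "complex \<Rightarrow> complex"
  unfolding S_def by (subst sum.reindex) (auto simp: inj_on_def)
 \<comment> \<open>Tested against a bounded \<open>h\<close> this is Lagrange interpolation for the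
   polynomial belonging to \<open>h\<close>. Nodes and interpolating polynomials do not depend on
   \<open>h\<close>, which allows the test to be removed.\<close>
 have interp: "AE z in lborel. ft z \<mu> = cexp (- b * \<mu>\<^sup>2) * (\<Sum>k\<in>L. (ft z k * e k) * poly (\<phi> k) (cor \<mu>))" for \<mu> :: real
 proof -
  let ?D = "\<lambda>z. ft z \<mu> - cexp (- b * \<mu>\<^sup>2) * (\<Sum>k\<in>L. (ft z k * e k) * poly (\<phi> k) (cor \<mu>))"
  have "AE z in lborel. ?D z = 0"
  proof (rule AE_zero_of_bounded_tests)
   show "integrable lborel ?D"
    by (intro Bochner_Integration.integrable_diff integrable_mult_right Bochner_Integration.integrable_sum integrable_mult_left ft_integrable)
   fix h :: "'a \<Rightarrow> complex" assume "h \<in> Borel" "\<And>x. norm (h x) \<le> 1"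
   then have h: "test h" by (simp add: test_def)
   obtain Q where Q: "\<And>\<mu>::real. fourier (av h) \<mu> = poly Q (cor \<mu>) * cexp (- b * \<mu>\<^sup>2)" using form[OF h] by blast
   have fh: "integrable lborel (\<lambda>z. ft z k * h z)" for k
   proof (rule Bochner_Integration.integrable_bound[OF ft_integrable[of k]])
    note [measurable] = test_borel[OF h]
    show "(\<lambda>z. ft z k * h z) \<in> borel_measurable lborel" by measurable
    show "AE z in lborel. norm (ft z k * h z) \<le> norm (ft z k)" using h by (intro AE_I2) (simp add: norm_mult test_def mult_left_le)
   qed
   have "(LBINT z. ?D z * h z)
    = (LBINT z. ft z \<mu> * h z - (\<Sum>k\<in>L. (cexp (- b * \<mu>\<^sup>2) * e k * poly (\<phi> k) (cor \<mu>)) * (ft z k * h z)))"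
    by (intro Bochner_Integration.integral_cong refl) (simp add: algebra_simps sum_distrib_left sum_distrib_right)
   also have "... = fourier (av h) \<mu> - (\<Sum>k\<in>L. (cexp (- b * \<mu>\<^sup>2) * e k * poly (\<phi> k) (cor \<mu>)) * fourier (av h) k)"
    by (subst Bochner_Integration.integral_diff)
      (auto intro!: fh integrable_mult_right Bochner_Integration.integrable_sum simp: fourier_av[OF h] Bochner_Integration.integral_sum fh)
   also have "(\<Sum>k\<in>L. (cexp (- b * \<mu>\<^sup>2) * e k * poly (\<phi> k) (cor \<mu>)) * fourier (av h) k)
     = cexp (- b * \<mu>\<^sup>2) * (\<Sum>k\<in>L. poly Q (cor k) * poly (\<phi> k) (cor \<mu>))" unfolding sum_distrib_left
   proof (rule sum.cong[OF refl])
    fix k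
    have "cexp (- b * \<mu>\<^sup>2) * e k * poly (\<phi> k) (cor \<mu>) * (poly Q (cor k) * cexp (- b * k\<^sup>2))
     = cexp (- b * \<mu>\<^sup>2) * (poly Q (cor k) * poly (\<phi> k) (cor \<mu>)) * (cexp (- b * k\<^sup>2) * e k)"
     by (simp only: mult_ac)
    then show "cexp (- b * \<mu>\<^sup>2) * e k * poly (\<phi> k) (cor \<mu>) * fourier (av h) k
     = cexp (- b * \<mu>\<^sup>2) * (poly Q (cor k) * poly (\<phi> k) (cor \<mu>))" unfolding Q e by simp
   qed
   also have "(\<Sum>k\<in>L. poly Q (cor k) * poly (\<phi> k) (cor \<mu>)) = poly Q (cor \<mu>)"
    using \<phi>(2)[of Q "cor \<mu>"] degn[OF h Q] S by (simp add: sumS)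
   finally show "(LBINT z. ?D z * h z) = 0" by (simp add: Q mult.commute)
  qed
  then show ?thesis by simp
 qed
 define c where "c = 1 / (4 * b)"
 have c: "c > 0" and c4: "- \<mu>\<^sup>2 / (4 * c) = - b * \<mu>\<^sup>2" for \<mu> :: real using b by (simp_all add: c_def)
 have "\<forall>k. \<exists>P. degree P = degree (\<phi> k) \<and> (\<forall>\<mu>::real. (LBINT a. poly P (cor a) * cexp (- c * a\<^sup>2) * cis (a * \<mu>))
   = poly (\<phi> k) (cor \<mu>) * cexp (- b * \<mu>\<^sup>2))" using gaussian_polynomial_transform[OF c] unfolding c4 by blast
 then obtain P where P0: "\<forall>k. degree (P k) = degree (\<phi> k) \<and> (\<forall>\<mu>::real. (LBINT a. poly (P k) (cor a) * cexp (- c * a\<^sup>2) * cis (a * \<mu>))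
   = poly (\<phi> k) (cor \<mu>) * cexp (- b * \<mu>\<^sup>2))" unfolding choice_iff by blast
 then have P: "\<And>k. degree (P k) = degree (\<phi> k)"
  "\<And>k \<mu>. (LBINT a. poly (P k) (cor a) * cexp (- c * a\<^sup>2) * cis (a * \<mu>))
   = poly (\<phi> k) (cor \<mu>) * cexp (- b * \<mu>\<^sup>2)" by auto
 let ?g = "\<lambda>z a. \<Sum>k\<in>L. (ft z k * e k) * (poly (P k) (cor a) * cexp (- c * a\<^sup>2))"
 have gi: "integrable lborel (?g z)" for z by (intro Bochner_Integration.integrable_sum integrable_mult_right poly_gaussian_integrable c)
 have gf: "fourier (?g z) \<mu> = cexp (- b * \<mu>\<^sup>2) * (\<Sum>k\<in>L. (ft z k * e k) * poly (\<phi> k) (cor \<mu>))" for z \<mu>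
 proof -
  have i: "integrable lborel (\<lambda>a. poly (P k) (cor a) * cexp (- c * a\<^sup>2) * cis (a * \<mu>))" for k
   by (intro integrable_mult_cis poly_gaussian_integrable c) simp
  have "fourier (?g z) \<mu> = (LBINT a. (\<Sum>k\<in>L. (ft z k * e k) * (poly (P k) (cor a) * cexp (- c * a\<^sup>2) * cis (a * \<mu>))))"
   unfolding fourier_def by (simp add: sum_distrib_right mult.assoc)
  also have "... = (\<Sum>k\<in>L. (ft z k * e k) * (LBINT a. poly (P k) (cor a) * cexp (- c * a\<^sup>2) * cis (a * \<mu>)))"
   by (subst Bochner_Integration.integral_sum) (rule integrable_mult_right i refl | simp)+
  finally show ?thesis unfolding P(2) by (simp add: sum_distrib_left mult_ac)
 qed
 have meas: "{p::'a \<times> real. ft (fst p) (snd p) = fourier (?g (fst p)) (snd p)} \<in> sets borel"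
 proof -
  have [measurable]: "(\<lambda>p::'a \<times> real. ft (fst p) k) \<in> borel_measurable (borel \<Otimes>\<^sub>M borel)" for k by measurable
  have "{p \<in> space (borel \<Otimes>\<^sub>M borel). ft (fst p) (snd p) = cexp (- b * (snd p)\<^sup>2) * (\<Sum>k\<in>L. (ft (fst p) k * e k) * poly (\<phi> k) (cor (snd p)))}
   \<in> sets (borel \<Otimes>\<^sub>M borel)" by measurable
  then show ?thesis unfolding gf borel_prod by simp
 qed
 have "AE \<mu> in lborel. AE z in lborel. ft (fst (z, \<mu>)) (snd (z, \<mu>)) = fourier (?g (fst (z, \<mu>))) (snd (z, \<mu>))"
  unfolding gf using interp by simp
 then have "AE z in lborel. AE \<mu> in lborel. ft z \<mu> = fourier (?g z) \<mu>" using AE_pair_lborel[OF meas] by simp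
 then have "AE z in lborel. AE a in lborel. v (z, a) = ?g z a" using AE_ft_eq_fourier
 proof eventually_elim
  case (elim z)
  show ?case
  proof (rule fourier_unique[OF _ gi])
   show "integrable lborel (\<lambda>a. v (z, a))" using elim(2) by blast
   show "AE \<mu> in lborel. fourier (\<lambda>a. v (z, a)) \<mu> = fourier (?g z) \<mu>" using elim(1) by eventually_elim (use elim(2) in simp)
  qed
 qed
 then have "AE p in lborel. v p = ?g (fst p) (snd p)"
 proof (subst AE_pair_lborel(1))
  have [measurable]: "(\<lambda>p::'a \<times> real. ft (fst p) k) \<in> borel_measurable (borel \<Otimes>\<^sub>M borel)" for k by measurable
  have "{p \<in> space (borel \<Otimes>\<^sub>M borel). v p = ?g (fst p) (snd p)} \<in> sets (borel \<Otimes>\<^sub>M borel)" by measurable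
  then show "{p. v p = ?g (fst p) (snd p)} \<in> sets borel" unfolding borel_prod by simp
 qed simp
 moreover have "?g z a = cexp (- c * a\<^sup>2) *
    (\<Sum>j\<in>{0..l}. (\<Sum>k\<in>L. (e k * coeff (P k) (nat j)) * ft z k) * cor (a ^ nat j))" for z a
 proof -
  have "poly (P k) (cor a) = (\<Sum>j\<in>{0..l}. coeff (P k) (nat j) * cor (a ^ nat j))" if "k \<in> L" for k
  proof -
   have "degree (P k) \<le> n" using \<phi>(1)[of "cor k"] that S P(1) by (simp add: S_def)
   then have "poly (P k) (cor a) = (\<Sum>j\<le>n. coeff (P k) j * cor a ^ j)"
    unfolding poly_altdef by (intro sum.mono_neutral_left) (auto simp: coeff_eq_0)
   also have "... = (\<Sum>j\<in>{0..l}. coeff (P k) (nat j) * cor (a ^ nat j))"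
    using l(2) by (intro sum.reindex_bij_witness[of _ nat int]) (auto simp: n_def)
   finally show ?thesis .
  qed
  then have "?g z a = (\<Sum>k\<in>L. (ft z k * e k) * ((\<Sum>j\<in>{0..l}. coeff (P k) (nat j) * cor (a ^ nat j)) * cexp (- c * a\<^sup>2)))"
   by (intro sum.cong) auto
  also have "... = (\<Sum>k\<in>L. \<Sum>j\<in>{0..l}. cexp (- c * a\<^sup>2) * ((e k * coeff (P k) (nat j)) * ft z k * cor (a ^ nat j)))"
   by (simp only: sum_distrib_left sum_distrib_right mult_ac)
  also have "... = (\<Sum>j\<in>{0..l}. \<Sum>k\<in>L. cexp (- c * a\<^sup>2) * ((e k * coeff (P k) (nat j)) * ft z k * cor (a ^ nat j)))"
   by (rule sum.swap)
  also have "... = cexp (- c * a\<^sup>2) *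
    (\<Sum>j\<in>{0..l}. (\<Sum>k\<in>L. (e k * coeff (P k) (nat j)) * ft z k) * cor (a ^ nat j))"
   by (simp only: sum_distrib_left sum_distrib_right)
  finally show ?thesis .
 qed
 ultimately have "AE p in lborel. v p = cexp (- c * (snd p)\<^sup>2) *
    (\<Sum>j\<in>{0..l}. (\<Sum>k\<in>L. (e k * coeff (P k) (nat j)) * ft (fst p) k) * cor (snd p ^ nat j))" by simp
 then show ?thesis using l(1) L unfolding T_def
  by (intro exI[of _ c] exI[of _ l] exI[of _ L] exI[of _ "\<lambda>j k. e k * coeff (P k) (nat j)"]) auto
qed

end

text \<open>If the spectrum is bounded, \<open>v\<close> vanishes almost everywhere, and an empty
  set of nodes makes every coefficient zero for any integer \<open>l\<close> below the
  bound.\<close>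

theorem (in beurling_pair) beurling_decomposition:
 assumes fin: "beurling_integral < \<infinity>" and \<Lambda>: "infinite \<Lambda>"
 shows "\<exists>(c::real) (l::int) L q. real_of_int l < (M - \<kappa> - 1) / 2 \<and> finite L \<and> L \<subseteq> \<Lambda> \<and>
  (AE p in lborel. v p = cexp (- c * (snd p)\<^sup>2) *
    (\<Sum>j\<in>{0..l}. (\<Sum>k\<in>L. q j k * ft (fst p) k) * cor (snd p ^ nat j)))"
proof (cases "\<exists>R. AE \<mu> in lborel. R < abs \<mu> \<longrightarrow> ft_mass \<mu> = 0")
 case True
 then have "AE p in lborel. v p = 0" using compact_spectrum_zero by blast
 moreover have "real_of_int (\<lceil>(M - \<kappa> - 1) / 2\<rceil> - 1) < (M - \<kappa> - 1) / 2" by linarith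
 ultimately show ?thesis by (intro exI[of _ 0] exI[of _ "\<lceil>(M - \<kappa> - 1) / 2\<rceil> - 1"] exI[of _ "{}"]) auto
next
 case False
 then interpret beurling_unbounded v \<kappa> M \<delta> by unfold_locales (use fin in auto)
 show ?thesis by (rule gaussian_decomposition[OF \<Lambda>])
qed

section \<open>Test functions\<close>

text \<open>A one-variable stand-in for \<open>C_k\<close>: closure under products and composition
  is simpler for a chain of vector derivatives than for iterated Frechet derivatives.\<close>

primrec diff_k :: "nat \<Rightarrow> (real \<Rightarrow> complex) \<Rightarrow> bool" where
 "diff_k 0 f \<longleftrightarrow> (\<forall>x. isCont f x)"
| "diff_k (Suc k) f \<longleftrightarrow> (\<exists>f'. (\<forall>x. (f has_vector_derivative f' x) (at x)) \<and> diff_k k f')"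

lemma diff_k_SucI: "(\<And>x. (f has_vector_derivative f' x) (at x)) \<Longrightarrow> diff_k k f' \<Longrightarrow> diff_k (Suc k) f"
 by auto

lemma diff_k_isCont: "diff_k k f \<Longrightarrow> isCont f x"
 by (cases k) (auto dest: has_vector_derivative_continuous)

lemma diff_k_Suc_imp: "diff_k (Suc k) f \<Longrightarrow> diff_k k f"
proof (induction k arbitrary: f)
 case 0
 then show ?case using diff_k_isCont[of "Suc 0" f] by simp
next
 case (Suc k)
 then show ?case by (metis diff_k.simps(2))
qed

lemma diff_k_add: "diff_k k f \<Longrightarrow> diff_k k g \<Longrightarrow> diff_k k (\<lambda>x. f x + g x)"
proof (induction k arbitrary: f g)
 case (Suc k)
 then obtain f' g' where *: "\<And>x. (f has_vector_derivative f' x) (at x)" "diff_k k f'"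
  "\<And>x. (g has_vector_derivative g' x) (at x)" "diff_k k g'" by auto
 then have "\<forall>x. ((\<lambda>x. f x + g x) has_vector_derivative f' x + g' x) (at x)" by (auto intro: has_vector_derivative_add)
 then show ?case using Suc.IH[OF *(2,4)] by auto
qed (auto intro: continuous_intros)

lemma diff_k_const: "diff_k k (\<lambda>x. c)"
 by (induction k arbitrary: c) (auto intro: has_vector_derivative_const)

lemma diff_k_mult: "diff_k k f \<Longrightarrow> diff_k k g \<Longrightarrow> diff_k k (\<lambda>x. f x * g x)"
proof (induction k arbitrary: f g)
 case (Suc k)
 then obtain f' g' where *: "\<And>x. (f has_vector_derivative f' x) (at x)" "diff_k k f'"
  "\<And>x. (g has_vector_derivative g' x) (at x)" "diff_k k g'" by auto
 then have "\<forall>x. ((\<lambda>x. f x * g x) has_vector_derivative f x * g' x + f' x * g x) (at x)" by (auto intro: has_vector_derivative_mult)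
 moreover have "diff_k k (\<lambda>x. f x * g' x + f' x * g x)"
  by (intro diff_k_add Suc.IH * diff_k_Suc_imp[OF Suc.prems(1)] diff_k_Suc_imp[OF Suc.prems(2)])
 ultimately show ?case by auto
qed (auto intro: continuous_intros)

lemma diff_k_of_real: "diff_k k (\<lambda>x. cor x)"
proof (cases k)
 case (Suc n)
 have "\<forall>x. (cor has_vector_derivative 1) (at x)" using has_vector_derivative_of_real[OF DERIV_ident, where 'a=complex] by simp
 then show ?thesis using Suc diff_k_const by auto
qed (auto intro: continuous_intros)

lemma diff_k_cis: "diff_k k (\<lambda>x. cis (\<mu> * x))"
proof (induction k)
 case 0
 show ?case unfolding cis_conv_exp by (auto intro!: continuous_intros)
next
 case (Suc k)
 have "((\<lambda>x. cis (\<mu> * x)) has_vector_derivative (\<i> * cor \<mu>) * cis (\<mu> * x)) (at x)" for x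
 proof -
  have "((\<lambda>z. exp (\<i> * (cor \<mu> * z))) has_field_derivative (\<i> * cor \<mu>) * exp (\<i> * (cor \<mu> * x))) (at (cor x))"
   by (auto intro!: derivative_eq_intros)
  from has_vector_derivative_real_field[OF this] show ?thesis by (simp add: cis_conv_exp)
 qed
 then show ?case by (rule diff_k_SucI) (rule diff_k_mult[OF diff_k_const Suc])
qed

lemma diff_k_compose_quadratic:
 "diff_k k f \<Longrightarrow> diff_k k (\<lambda>x. f (c0 + c1 * x + c2 * x\<^sup>2))"
proof (induction k arbitrary: f)
 case 0
 then have "isCont (\<lambda>x. f (c0 + c1 * x + c2 * x\<^sup>2)) x" for x
  by (intro isCont_o2[where f="\<lambda>x. c0 + c1 * x + c2 * x\<^sup>2" and g=f] continuous_intros) auto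
 then show ?case by simp
next
 case (Suc k)
 then obtain f' where f: "\<And>x. (f has_vector_derivative f' x) (at x)" "diff_k k f'" by auto
 have "((\<lambda>x. f (c0 + c1 * x + c2 * x\<^sup>2)) has_vector_derivative (cor c1 + cor (2 * c2) * cor x) * f' (c0 + c1 * x + c2 * x\<^sup>2)) (at x)" for x
 proof -
  have "((\<lambda>x. c0 + c1 * x + c2 * x\<^sup>2) has_vector_derivative (c1 + 2 * c2 * x)) (at x)"
   unfolding has_real_derivative_iff_has_vector_derivative[symmetric] by (auto intro!: derivative_eq_intros)
  from vector_diff_chain_at[OF this f(1)]
  show ?thesis by (simp add: o_def scaleR_conv_of_real)
 qed
 moreover have "diff_k k (\<lambda>x. (cor c1 + cor (2 * c2) * cor x) * f' (c0 + c1 * x + c2 * x\<^sup>2))"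
  by (intro diff_k_mult diff_k_add diff_k_const diff_k_of_real Suc.IH f)
 ultimately show ?case by (rule diff_k_SucI)
qed

section \<open>Smooth bumps\<close>

text \<open>\<open>flat 0\<close> is the classical flat function; the powers in the denominator make
  the family closed under differentiation up to linear combinations.\<close>

definition flat :: "nat \<Rightarrow> real \<Rightarrow> real" where
 "flat j y = (if 0 < y then exp (- 1 / y) / y ^ j else 0)"

lemma flat_tendsto_0: "(flat j \<longlongrightarrow> 0) (at 0)"
proof -
 have "((\<lambda>u::real. u ^ j / exp u) \<longlongrightarrow> 0) at_top" by (rule tendsto_power_div_exp_0)
 then have "((\<lambda>y::real. (inverse y) ^ j / exp (inverse y)) \<longlongrightarrow> 0) (at_right 0)"
  using filterlim_compose filterlim_inverse_at_top_right by blast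
 then have "(flat j \<longlongrightarrow> 0) (at_right 0)" by (rule Lim_transform_eventually)
    (auto simp: flat_def exp_minus inverse_eq_divide power_one_over field_simps eventually_at_right_less intro!: eventually_at_right_less[THEN eventually_mono])
 moreover have "(flat j \<longlongrightarrow> 0) (at_left 0)"
  by (rule tendsto_eventually) (auto simp: flat_def eventually_at_left_field intro!: exI[of _ "-1"])
 ultimately show ?thesis by (simp add: filterlim_split_at)
qed

lemma flat_derivative: "(flat j has_real_derivative - real j * flat (Suc j) y + flat (Suc (Suc j)) y) (at y)"
proof (cases y "0::real" rule: linorder_cases)
 case less
 have "((\<lambda>_. 0) has_real_derivative 0) (at y)" by simp
 then have "(flat j has_real_derivative 0) (at y)"
  by (rule has_field_derivative_transform_within_open[where S="{..<0}"]) (use less in \<open>auto simp: flat_def\<close>)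
 then show ?thesis using less by (simp add: flat_def)
next
 case equal
 have "((\<lambda>h. (flat j (0 + h) - flat j 0) / h) \<longlongrightarrow> 0) (at 0)"
 proof (rule Lim_transform_eventually[OF flat_tendsto_0[of "Suc j"]])
  show "\<forall>\<^sub>F h in at 0. flat (Suc j) h = (flat j (0 + h) - flat j 0) / h" by (auto simp: flat_def eventually_at_filter)
 qed
 then show ?thesis using equal by (simp add: DERIV_def flat_def)
next
 case greater
 have "((\<lambda>y. exp (- 1 / y) / y ^ j) has_real_derivative - real j * flat (Suc j) y + flat (Suc (Suc j)) y) (at y)"
 proof -
  have "((\<lambda>y. exp (- 1 / y) * inverse y ^ j) has_real_derivative
    exp (- 1 / y) * (1 / (y * y)) * inverse y ^ j + exp (- 1 / y) * (real j * inverse y ^ (j - 1) * (- (inverse y * inverse y)))) (at y)"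
   using greater by (auto intro!: derivative_eq_intros simp: power2_eq_square)
  moreover have "exp (- 1 / y) * (1 / (y * y)) * inverse y ^ j + exp (- 1 / y) * (real j * inverse y ^ (j - 1) * (- (inverse y * inverse y)))
   = - real j * flat (Suc j) y + flat (Suc (Suc j)) y"
  proof (cases j)
   case (Suc n)
   then show ?thesis using greater by (simp add: flat_def power_inverse field_simps)
  qed (use greater in \<open>simp add: flat_def field_simps\<close>)
  ultimately show ?thesis by (simp add: divide_inverse power_inverse)
 qed
 then show ?thesis by (rule has_field_derivative_transform_within_open[where S="{0<..}"]) (use greater in \<open>auto simp: flat_def\<close>)
qed

lemma diff_k_flat: "diff_k k (\<lambda>y. cor (flat j y))"
proof (induction k arbitrary: j)
 case 0
 have "isCont (flat j) y" for y using DERIV_isCont[OF flat_derivative] .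
 then show ?case by (auto intro!: continuous_intros)
next
 case (Suc k)
 have "((\<lambda>y. cor (flat j y)) has_vector_derivative cor (- real j) * cor (flat (Suc j) y) + cor (flat (Suc (Suc j)) y)) (at y)" for y
  using has_vector_derivative_of_real[OF flat_derivative[of j y], where 'a=complex] by simp
 moreover have "diff_k k (\<lambda>y. cor (- real j) * cor (flat (Suc j) y) + cor (flat (Suc (Suc j)) y))"
  by (intro diff_k_add diff_k_mult diff_k_const Suc)
 ultimately show ?case by (rule diff_k_SucI)
qed

text \<open>The factor \<open>Suc n\<close> steepens the flanks: the bumps tend to the indicator of
  the open interval while staying between 0 and 1.\<close>

definition bump :: "real \<Rightarrow> real \<Rightarrow> nat \<Rightarrow> real \<Rightarrow> real" where
 "bump a b n x = flat 0 (real (Suc n) * ((x - a) * (b - x)))"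

lemma diff_k_bump: "diff_k k (\<lambda>x. cor (bump a b n x))"
proof -
 have eq: "bump a b n x = flat 0 (- (real (Suc n) * (a * b)) + (real (Suc n) * (a + b)) * x + (- real (Suc n)) * x\<^sup>2)" for x
  unfolding bump_def by (rule arg_cong[where f="flat 0"]) (simp only: power2_eq_square algebra_simps)
 show ?thesis unfolding eq by (rule diff_k_compose_quadratic[OF diff_k_flat])
qed

lemma bump_bounds: "0 \<le> bump a b n x" "bump a b n x \<le> 1"
 by (auto simp: bump_def flat_def)

lemma bump_outside: "x \<notin> {a<..<b} \<Longrightarrow> a \<le> b \<Longrightarrow> bump a b n x = 0"
proof -
 assume "x \<notin> {a<..<b}" "a \<le> b"
 then have "(x - a) * (b - x) \<le> 0" by (auto simp: mult_le_0_iff)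
 then have "real (Suc n) * ((x - a) * (b - x)) \<le> 0" by (rule mult_nonneg_nonpos[rotated]) simp
 then show ?thesis by (simp add: bump_def flat_def)
qed

lemma bump_tendsto: "x \<in> {a<..<b} \<Longrightarrow> (\<lambda>n. bump a b n x) \<longlonglongrightarrow> 1"
proof -
 assume x: "x \<in> {a<..<b}"
 define c where "c = (x - a) * (b - x)"
 have c: "c > 0" using x by (simp add: c_def)
 have "(\<lambda>n. exp (- (inverse (real (Suc n)) * inverse c))) \<longlonglongrightarrow> exp (- (0 * inverse c))"
  by (intro tendsto_intros LIMSEQ_inverse_real_of_nat)
 moreover have "bump a b n x = exp (- (inverse (real (Suc n)) * inverse c))" for n
 proof -
  have "0 < real (Suc n) * c" using c by simp
  then show ?thesis unfolding bump_def c_def[symmetric] flat_def by (simp add: field_simps)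
 qed
 ultimately show ?thesis by simp
qed

section \<open>Smooth functions of several variables\<close>

lemma has_derivative_inner_compose:
 assumes "(\<beta> has_vector_derivative d) (at (x \<bullet> i))"
 shows "((\<lambda>x. \<beta> (x \<bullet> i)) has_derivative (\<lambda>v. cor (v \<bullet> i) * d)) (at (x::'a::euclidean_space))"
proof -
 have "((\<lambda>x. x \<bullet> i) has_derivative (\<lambda>v. v \<bullet> i)) (at x)" by (auto intro!: derivative_eq_intros)
 from has_derivative_compose[OF this assms[unfolded has_vector_derivative_def]]
 show ?thesis by (simp add: scaleR_conv_of_real)
qed

lemma C_k_coord: "diff_k k \<beta> \<Longrightarrow> C_k k (\<lambda>x::'a::euclidean_space. \<beta> (x \<bullet> i))"
proof (induction k arbitrary: \<beta>)
 case 0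
 then have "isCont (\<lambda>x. \<beta> (x \<bullet> i)) x" for x :: 'a
  by (intro isCont_o2[where f="\<lambda>x. x \<bullet> i" and g=\<beta>] continuous_intros) auto
 then show ?case by (simp add: continuous_at_imp_continuous_on)
next
 case (Suc k)
 then obtain d where d: "\<And>x. (\<beta> has_vector_derivative d x) (at x)" "diff_k k d" by auto
 have D: "((\<lambda>x. \<beta> (x \<bullet> i)) has_derivative (\<lambda>v. cor (v \<bullet> i) * d (x \<bullet> i))) (at x)" for x :: 'a
  by (rule has_derivative_inner_compose[OF d(1)])
 have "C_k k (\<lambda>x. frechet_derivative (\<lambda>x. \<beta> (x \<bullet> i)) (at x) v)" for v :: 'a
  unfolding frechet_derivative_at[OF D, symmetric] by (rule Suc.IH[of "\<lambda>y. cor (v \<bullet> i) * d y"]) (intro diff_k_mult diff_k_const d)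
 moreover have "(\<lambda>x. \<beta> (x \<bullet> i)) differentiable (at x)" for x :: 'a using D differentiable_def by blast
 ultimately show ?case by simp
qed

lemma C_k_continuous: "C_k k f \<Longrightarrow> continuous_on UNIV f"
proof (cases k)
 case (Suc n)
 assume "C_k k f"
 then have "f differentiable (at x)" for x unfolding Suc by simp
 then show ?thesis by (simp add: differentiable_imp_continuous_within continuous_at_imp_continuous_on)
qed simp

lemma C_k_Suc_imp: "C_k (Suc k) f \<Longrightarrow> C_k k f"
proof (induction k arbitrary: f)
 case 0
 then show ?case using C_k_continuous[of "Suc 0" f] by simp
next
 case (Suc k)
 have "\<forall>x. f differentiable (at x)" and "\<forall>v. C_k (Suc k) (\<lambda>x. frechet_derivative f (at x) v)"
  using Suc.prems unfolding C_k.simps(2)[of "Suc k"] by blast+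
 then show ?case using Suc.IH unfolding C_k.simps(2)[of k f] by blast
qed

lemma C_k_has_derivative: "C_k (Suc k) f \<Longrightarrow> (f has_derivative frechet_derivative f (at x)) (at x)"
 using frechet_derivative_works by auto

lemma C_k_add: "C_k k f \<Longrightarrow> C_k k g \<Longrightarrow> C_k k (\<lambda>x. f x + g x)"
proof (induction k arbitrary: f g)
 case (Suc k)
 note f = C_k_has_derivative[OF Suc.prems(1)] and g = C_k_has_derivative[OF Suc.prems(2)]
 have D: "((\<lambda>x. f x + g x) has_derivative (\<lambda>v. frechet_derivative f (at x) v + frechet_derivative g (at x) v)) (at x)" for x
  by (rule has_derivative_add[OF f g])
 have "C_k k (\<lambda>x. frechet_derivative (\<lambda>x. f x + g x) (at x) v)" for v
  unfolding frechet_derivative_at[OF D, symmetric] using Suc.prems by (intro Suc.IH) auto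
 moreover have "(\<lambda>x. f x + g x) differentiable (at x)" for x using D differentiable_def by blast
 ultimately show ?case by simp
qed (auto intro: continuous_intros)

lemma C_k_mult: "C_k k f \<Longrightarrow> C_k k g \<Longrightarrow> C_k k (\<lambda>x. f x * g x)"
proof (induction k arbitrary: f g)
 case (Suc k)
 note f = C_k_has_derivative[OF Suc.prems(1)] and g = C_k_has_derivative[OF Suc.prems(2)]
 have D: "((\<lambda>x. f x * g x) has_derivative (\<lambda>v. f x * frechet_derivative g (at x) v + frechet_derivative f (at x) v * g x)) (at x)" for x
  by (rule has_derivative_mult[OF f g])
 have "C_k k (\<lambda>x. frechet_derivative (\<lambda>x. f x * g x) (at x) v)" for v unfolding frechet_derivative_at[OF D, symmetric]
  using Suc.prems C_k_Suc_imp[OF Suc.prems(1)] C_k_Suc_imp[OF Suc.prems(2)] by (intro C_k_add Suc.IH) auto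
 moreover have "(\<lambda>x. f x * g x) differentiable (at x)" for x using D differentiable_def by blast
 ultimately show ?case by simp
qed (auto intro: continuous_intros)

lemma C_k_const: "C_k k (\<lambda>x. c)"
proof (induction k arbitrary: c)
 case (Suc k)
 have D: "((\<lambda>x. c) has_derivative (\<lambda>v. 0)) (at x)" for x :: 'a by simp
 show ?case using Suc D unfolding C_k.simps frechet_derivative_at[OF D, symmetric] by auto
qed auto

lemma C_k_prod: "finite I \<Longrightarrow> (\<And>i. i \<in> I \<Longrightarrow> C_k k (f i)) \<Longrightarrow> C_k k (\<lambda>x. \<Prod>i\<in>I. f i x)"
 by (induction I rule: finite_induct) (auto intro: C_k_const C_k_mult)

lemma test_functionI:
 assumes "\<And>k. C_k k \<phi>" and "\<And>x. \<phi> x \<noteq> 0 \<Longrightarrow> norm x \<le> R"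
 shows "test_function \<phi>"
proof -
 have "bounded {x. \<phi> x \<noteq> 0}" unfolding bounded_iff using assms(2) by auto
 then show ?thesis using assms(1) by (simp add: test_function_def compact_closure)
qed

lemma test_function_product_bump:
 fixes a b :: "'a::euclidean_space"
 assumes ab: "\<And>i. i \<in> Basis \<Longrightarrow> a \<bullet> i \<le> b \<bullet> i"
 shows "test_function (\<lambda>x. \<Prod>i\<in>Basis. cor (bump (a \<bullet> i) (b \<bullet> i) n (x \<bullet> i)))"
proof -
 obtain R where R: "\<And>x. x \<in> box a b \<Longrightarrow> norm x \<le> R" using bounded_box[of a b] by (auto simp: bounded_iff)
 show ?thesis
 proof (rule test_functionI[where R=R])
  show "C_k k (\<lambda>x. \<Prod>i\<in>Basis. cor (bump (a \<bullet> i) (b \<bullet> i) n (x \<bullet> i)))" for k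
   by (intro C_k_prod C_k_coord diff_k_bump) auto
  fix x assume "(\<Prod>i\<in>Basis. cor (bump (a \<bullet> i) (b \<bullet> i) n (x \<bullet> i))) \<noteq> 0"
  then have "x \<bullet> i \<in> {a \<bullet> i <..< b \<bullet> i}" if "i \<in> Basis" for i
   using bump_outside[OF _ ab[OF that], of "x \<bullet> i" n] that by (auto simp: prod_zero_iff)
  then show "norm x \<le> R" by (intro R) (auto simp: box_def)
 qed
qed

text \<open>Products of bumps converge boundedly to indicators of boxes, so testing with them is as
  good as integrating over boxes.\<close>

lemma AE_zero_of_product_bumps:
 fixes H :: "'a::euclidean_space \<Rightarrow> complex"
 assumes H: "loc_integrable H"
  and z: "\<And>a b n. (\<And>i. i \<in> Basis \<Longrightarrow> a \<bullet> i \<le> b \<bullet> i) \<Longrightarrow>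
   (LBINT x. H x * (\<Prod>i\<in>Basis. cor (bump (a \<bullet> i) (b \<bullet> i) n (x \<bullet> i)))) = 0"
 shows "AE x in lborel. H x = 0"
proof (rule AE_zero_rational_box[OF H])
 have [measurable]: "H \<in> Borel" using H by (rule loc_integrable_borel)
 fix B :: "'a set" assume "B \<in> rational_box"
 then obtain a b where B: "B = box a b" unfolding rational_box_def by blast
 show "(LINT x:B|lborel. H x) = 0"
 proof (cases "B = {}")
  case False
  then have ab: "a \<bullet> i \<le> b \<bullet> i" if "i \<in> Basis" for i using that B by (force simp: box_ne_empty)
  let ?\<alpha> = "\<lambda>n x. \<Prod>i\<in>Basis. cor (bump (a \<bullet> i) (b \<bullet> i) n (x \<bullet> i))"
  have bm[measurable]: "(\<lambda>x. bump a' b' n x) \<in> Borel" for a' b' n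
  proof -
   have "isCont (\<lambda>x. cor (bump a' b' n x)) x" for x using diff_k_bump by (rule diff_k_isCont)
   then have "continuous_on UNIV (\<lambda>x. Re (cor (bump a' b' n x)))" by (intro continuous_intros continuous_at_imp_continuous_on) auto
   then show ?thesis by (simp add: borel_measurable_continuous_onI)
  qed
  have "(\<lambda>n. (LBINT x. H x * ?\<alpha> n x)) \<longlonglongrightarrow> (LBINT x. indicator B x *\<^sub>R H x)"
  proof (rule integral_dominated_convergence[where w="\<lambda>x. norm (indicator B x *\<^sub>R H x)"])
   show "integrable lborel (\<lambda>x. norm (indicator B x *\<^sub>R H x))"
    using loc_integrable_set[OF H, of B] B by (intro integrable_norm) (simp add: set_integrable_def)
   show "AE x in lborel. (\<lambda>n. H x * ?\<alpha> n x) \<longlonglongrightarrow> indicator B x *\<^sub>R H x"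
   proof (intro AE_I2)
    fix x
    show "(\<lambda>n. H x * ?\<alpha> n x) \<longlonglongrightarrow> indicator B x *\<^sub>R H x"
    proof (cases "x \<in> B")
     case True
     have "(\<lambda>n. H x * ?\<alpha> n x) \<longlonglongrightarrow> H x * (\<Prod>i\<in>(Basis::'a set). cor 1)"
      using True B by (intro tendsto_intros bump_tendsto) (auto simp: box_def)
     then show ?thesis using True by simp
    next
     case False
     then obtain i where i: "i \<in> Basis" "x \<bullet> i \<notin> {a \<bullet> i <..< b \<bullet> i}" using B by (auto simp: box_def)
     then have "?\<alpha> n x = 0" for n using bump_outside[OF i(2) ab[OF i(1)]] i(1) by (intro prod_zero bexI[of _ i]) auto
     then show ?thesis using False by (simp only:) simp
    qed
   qed
   show "AE x in lborel. norm (H x * ?\<alpha> n x) \<le> norm (indicator B x *\<^sub>R H x)" for n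
   proof (intro AE_I2)
    fix x
    show "norm (H x * ?\<alpha> n x) \<le> norm (indicator B x *\<^sub>R H x)"
    proof (cases "x \<in> B")
     case True
     have "norm (?\<alpha> n x) \<le> 1" unfolding prod_norm[symmetric] by (intro prod_le_1) (auto simp: bump_bounds)
     then show ?thesis using True by (simp add: norm_mult mult_left_le)
    next
     case False
     then obtain i where i: "i \<in> Basis" "x \<bullet> i \<notin> {a \<bullet> i <..< b \<bullet> i}" using B by (auto simp: box_def)
     then have "?\<alpha> n x = 0" using bump_outside[OF i(2) ab[OF i(1)]] i(1) by (intro prod_zero bexI[of _ i]) auto
     then show ?thesis by (simp only:) simp
    qed
   qed
   have [measurable]: "B \<in> sets borel" using B by simp
   show "(\<lambda>x. indicator B x *\<^sub>R H x) \<in> borel_measurable lborel"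
    "(\<lambda>x. H x * ?\<alpha> n x) \<in> borel_measurable lborel" for n by measurable
  qed
  moreover have "(LBINT x. H x * ?\<alpha> n x) = 0" for n by (rule z[OF ab])
  ultimately show ?thesis by (simp add: set_lebesgue_integral_def LIMSEQ_const_iff)
 qed (simp add: set_lebesgue_integral_def)
qed

lemma compactly_supported_integrable:
 fixes f :: "real \<Rightarrow> complex"
 assumes c: "\<And>x. isCont f x" and z: "\<And>x. (abs x) > R \<Longrightarrow> f x = 0"
 shows "integrable lborel f"
proof -
 have "integrable lborel (\<lambda>x. indicator {-R..R} x *\<^sub>R f x)"
  by (rule borel_integrable_compact) (auto intro: continuous_at_imp_continuous_on c)
 moreover have "(\<lambda>x. indicator {-R..R} x *\<^sub>R f x) = f" using z by (auto simp: indicator_def fun_eq_iff)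
 ultimately show ?thesis by simp
qed

section \<open>Decay of Fourier transforms of smooth functions\<close>

text \<open>Each integration by parts trades one derivative for one factor of the frequency; bounded
  support removes the boundary terms.\<close>

lemma fourier_decay_power:
 fixes \<beta> :: "real \<Rightarrow> complex"
 assumes "diff_k k \<beta>" and "\<And>x. (abs x) > R \<Longrightarrow> \<beta> x = 0"
 shows "\<exists>C. \<forall>\<mu>. abs \<mu> ^ k * norm (fourier \<beta> \<mu>) \<le> C"
 using assms
proof (induction k arbitrary: \<beta>)
 case 0
 have "norm (fourier \<beta> \<mu>) \<le> (LBINT x. norm (\<beta> x))" for \<mu>
  unfolding fourier_def using integral_norm_bound[of lborel "\<lambda>x. \<beta> x * cis (x \<bullet> \<mu>)"] by (simp add: norm_mult)
 then show ?case by auto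
next
 case (Suc k)
 then obtain d where d: "\<And>x. (\<beta> has_vector_derivative d x) (at x)" "diff_k k d" by auto
 have dz: "d x = 0" if x: "abs x > R" for x
 proof -
  have "((\<lambda>_. 0) has_vector_derivative 0) (at x)" by (rule has_vector_derivative_const)
  moreover have "open {x::real. (abs x) > R}" by (intro open_Collect_less continuous_intros)
  ultimately have "(\<beta> has_vector_derivative 0) (at x)" by (rule has_vector_derivative_transform_within_open) (use x Suc.prems(2) in auto)
  then show ?thesis using d(1) vector_derivative_unique_at by blast
 qed
 obtain C where C: "\<And>\<mu>. abs \<mu> ^ k * norm (fourier d \<mu>) \<le> C" using Suc.IH[OF d(2) dz] by blast
 have bi: "integrable lborel \<beta>" by (rule compactly_supported_integrable[OF _ Suc.prems(2)]) (rule diff_k_isCont[OF Suc.prems(1)])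
 have di: "integrable lborel d" by (rule compactly_supported_integrable[OF _ dz]) (rule diff_k_isCont[OF d(2)])
 have "fourier d \<mu> = - \<i> * cor \<mu> * fourier \<beta> \<mu>" for \<mu>
 proof -
  have cd: "((\<lambda>x. cis (x * \<mu>)) has_vector_derivative (\<i> * cor \<mu>) * cis (x * \<mu>)) (at x)" for x
  proof -
   have "((\<lambda>z. exp (\<i> * (z * cor \<mu>))) has_field_derivative (\<i> * cor \<mu>) * exp (\<i> * (x * cor \<mu>))) (at (cor x))"
    by (auto intro!: derivative_eq_intros)
   from has_vector_derivative_real_field[OF this] show ?thesis by (simp add: cis_conv_exp)
  qed
  have cc: "isCont (\<lambda>x. cis (x * \<mu>)) x" for x using cd has_vector_derivative_continuous by blast
  have i1: "integrable lborel (\<lambda>x. d x * cis (x * \<mu>))" and i2: "integrable lborel (\<lambda>x. \<beta> x * cis (x * \<mu>))"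
   by (intro integrable_mult_cis di bi, simp)+
  have "(LBINT x. \<beta> x * ((\<i> * cor \<mu>) * cis (x * \<mu>)) + d x * cis (x * \<mu>)) = 0"
  proof (rule integral_derivative_zero[where f="\<lambda>x. \<beta> x * cis (x * \<mu>)"])
   show "((\<lambda>x. \<beta> x * cis (x * \<mu>)) has_vector_derivative \<beta> x * ((\<i> * cor \<mu>) * cis (x * \<mu>)) + d x * cis (x * \<mu>)) (at x)" for x
    by (rule has_vector_derivative_mult[OF d(1) cd])
   show "isCont (\<lambda>x. \<beta> x * ((\<i> * cor \<mu>) * cis (x * \<mu>)) + d x * cis (x * \<mu>)) x" for x
    by (intro continuous_intros cc diff_k_isCont[OF Suc.prems(1)] diff_k_isCont[OF d(2)])
   show "integrable lborel (\<lambda>x. \<beta> x * ((\<i> * cor \<mu>) * cis (x * \<mu>)) + d x * cis (x * \<mu>))"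
    using integrable_mult_right[OF i2, of "\<i> * cor \<mu>"] i1 by (intro Bochner_Integration.integrable_add) (simp_all add: mult_ac)
   obtain m :: nat where m: "R < real m" using reals_Archimedean2 by blast
   have z: "\<beta> (real n) = 0" "\<beta> (- real n) = 0" if "m \<le> n" for n using that m by (auto intro!: Suc.prems(2))
   show "(\<lambda>n. \<beta> (real n) * cis (real n * \<mu>)) \<longlonglongrightarrow> 0" "(\<lambda>n. \<beta> (- real n) * cis (- real n * \<mu>)) \<longlonglongrightarrow> 0"
    by (rule tendsto_eventually, unfold eventually_sequentially, rule exI[of _ m], simp add: z)+
  qed
  moreover have "(LBINT x. \<beta> x * ((\<i> * cor \<mu>) * cis (x * \<mu>)) + d x * cis (x * \<mu>))
    = (LBINT x. (\<i> * cor \<mu>) * (\<beta> x * cis (x * \<mu>))) + (LBINT x. d x * cis (x * \<mu>))"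
   by (subst Bochner_Integration.integral_add[OF integrable_mult_right[OF i2] i1, symmetric]) (simp add: mult_ac)
  ultimately have "\<i> * cor \<mu> * fourier \<beta> \<mu> + fourier d \<mu> = 0" by (simp add: fourier_def)
  then show ?thesis by (simp add: add_eq_0_iff)
 qed
 then have "abs \<mu> ^ Suc k * norm (fourier \<beta> \<mu>) = abs \<mu> ^ k * norm (fourier d \<mu>)" for \<mu> by (simp add: norm_mult)
 then have "abs \<mu> ^ Suc k * norm (fourier \<beta> \<mu>) \<le> C" for \<mu> using C by metis
 then show ?case by blast
qed

lemma fourier_decay:
 fixes \<beta> :: "real \<Rightarrow> complex"
 assumes d: "\<And>k. diff_k k \<beta>" and z: "\<And>x. (abs x) > R \<Longrightarrow> \<beta> x = 0"
 shows "\<exists>C\<ge>0. \<forall>\<mu>. norm (fourier \<beta> \<mu>) \<le> C * (1 + abs \<mu>) powr (- real N)"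
proof -
 obtain C0 where C0: "\<And>\<mu>. abs \<mu> ^ 0 * norm (fourier \<beta> \<mu>) \<le> C0" using fourier_decay_power[OF d[of 0] z] by blast
 obtain C1 where C1: "\<And>\<mu>. abs \<mu> ^ N * norm (fourier \<beta> \<mu>) \<le> C1" using fourier_decay_power[OF d[of N] z] by blast
 have C0': "C0 \<ge> 0" and C1': "C1 \<ge> 0" using order_trans[OF _ C0[of 0]] order_trans[OF _ C1[of 0]] by auto
 have "norm (fourier \<beta> \<mu>) \<le> (2 ^ N * (C0 + C1)) * (1 + abs \<mu>) powr (- real N)" for \<mu>
 proof -
  have "(1 + abs \<mu>) ^ N \<le> 2 ^ N * (1 + abs \<mu> ^ N)"
  proof (cases "abs \<mu> \<le> 1")
   case True
   then have "(1 + abs \<mu>) ^ N \<le> 2 ^ N * 1" using power_mono[of "1 + abs \<mu>" 2 N] by simp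
   also have "... \<le> 2 ^ N * (1 + abs \<mu> ^ N)" by (intro mult_left_mono) auto
   finally show ?thesis .
  next
   case False
   then have "(1 + abs \<mu>) ^ N \<le> (2 * abs \<mu>) ^ N" by (intro power_mono) auto
   also have "... \<le> 2 ^ N * (1 + abs \<mu> ^ N)" by (simp add: power_mult_distrib)
   finally show ?thesis .
  qed
  then have "(1 + abs \<mu>) ^ N * norm (fourier \<beta> \<mu>) \<le> 2 ^ N * (1 + abs \<mu> ^ N) * norm (fourier \<beta> \<mu>)"
   by (rule mult_right_mono) simp
  also have "... = 2 ^ N * (abs \<mu> ^ 0 * norm (fourier \<beta> \<mu>) + abs \<mu> ^ N * norm (fourier \<beta> \<mu>))" by (simp add: algebra_simps)
  also have "... \<le> 2 ^ N * (C0 + C1)" by (intro mult_left_mono add_mono C0 C1) auto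
  finally show ?thesis by (simp add: powr_minus powr_realpow field_simps)
 qed
 moreover have "2 ^ N * (C0 + C1) \<ge> 0" using C0' C1' by simp
 ultimately show ?thesis by blast
qed

section \<open>Fractional powers of the central Laplacian\<close>

lemma integrable_powr_decay:
 assumes p: "p > 1"
 shows "integrable lborel (\<lambda>x::real. (1 + abs x) powr (- p))"
proof (rule integrableI_bounded)
 define f where "f x = ennreal ((1 + x) powr (- p)) * indicator {0..} x" for x :: real
 have [measurable]: "f \<in> Borel" unfolding f_def by measurable
 have "(NN x. f x) = ennreal (0 - (- ((1 + 0) powr (1 - p) / (p - 1))))" unfolding f_def
 proof (rule nn_integral_FTC_atLeast)
  show "DERIV (\<lambda>x. - ((1 + x) powr (1 - p) / (p - 1))) x :> (1 + x) powr (- p)" if "0 \<le> x" for x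
  proof -
   have "((\<lambda>y. y powr (1 - p)) has_real_derivative (1 - p) * (1 + x) powr (1 - p - 1)) (at (1 + x))"
    using that by (intro has_real_derivative_powr) simp
   then have "((\<lambda>x. (1 + x) powr (1 - p)) has_real_derivative (1 - p) * (1 + x) powr (1 - p - 1)) (at x)"
    using DERIV_shift[of "\<lambda>y. y powr (1 - p)" _ x 1] by (simp add: add.commute)
   then have "((\<lambda>x. (- 1 / (p - 1)) * (1 + x) powr (1 - p)) has_real_derivative (- 1 / (p - 1)) * ((1 - p) * (1 + x) powr (1 - p - 1))) (at x)"
    by (rule DERIV_cmult)
   moreover have "(- 1 / (p - 1)) * ((1 - p) * (1 + x) powr (1 - p - 1)) = (1 + x) powr (- p)" using p by (simp add: field_simps)
   ultimately show ?thesis by simp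
  qed
  have "((\<lambda>x. (1 + x) powr (1 - p)) \<longlongrightarrow> 0) at_top"
   using p by (intro tendsto_neg_powr filterlim_tendsto_add_at_top[OF tendsto_const] filterlim_ident) auto
  then show "((\<lambda>x. - ((1 + x) powr (1 - p) / (p - 1))) \<longlongrightarrow> 0) at_top"
   using tendsto_minus[OF tendsto_divide[OF _ tendsto_const[of "p - 1"]], of "\<lambda>x. (1 + x) powr (1 - p)" 0 at_top] p by simp
 qed auto
 then have fin: "(NN x. f x) < \<infinity>" by simp
 have "(NN x. nrm ((1 + abs x) powr (- p))) \<le> (NN x. f x + f (0 - x))"
  by (intro nn_integral_mono) (auto simp: f_def indicator_def abs_if)
 also have "... = (NN x. f x) + (NN x. f x)"
  by (subst nn_integral_add) (auto simp only: nn_integral_translate(3) \<open>f \<in> Borel\<close>, measurable)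
 finally show "(NN x. nrm ((1 + abs x) powr (- p))) < \<infinity>" using fin by (auto simp: order_le_less_trans less_top)
qed measurable

lemma integrable_product_decay:
 assumes p: "p > 1"
 shows "integrable lborel (\<lambda>x::'a::euclidean_space. \<Prod>i\<in>Basis. (1 + abs (x \<bullet> i)) powr (- p))"
proof -
 have "integrable lborel (\<lambda>x::'a. \<Prod>i\<in>Basis. cor ((1 + abs (x \<bullet> i)) powr (- p)))"
  by (rule lborel_product_integral(1)) (rule integrable_of_real[OF integrable_powr_decay[OF p]])
 from integrable_Re[OF this] show ?thesis by (simp flip: of_real_prod)
qed

text \<open>Since \<open>1 + norm x\<close> is at least every
  \<open>1 + abs (x \<bullet> i)\<close>, splitting the exponent evenly among the coordinates
  reduces the claim to dimension one.\<close>

lemma integrable_norm_decay: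
 assumes p: "p > real DIM('a)"
 shows "integrable lborel (\<lambda>x::'a::euclidean_space. (1 + norm x) powr (- p))"
proof -
 define q where "q = p / real DIM('a)"
 have q: "q > 1" using p by (simp add: q_def)
 show ?thesis
 proof (rule Bochner_Integration.integrable_bound[OF integrable_product_decay[OF q]])
  show "AE x::'a in lborel. norm ((1 + norm x) powr (- p)) \<le> norm (\<Prod>i\<in>Basis. (1 + abs (x \<bullet> i)) powr (- q))"
  proof (rule AE_I2)
   fix x :: 'a
   have "0 < 1 + norm x" by (simp add: add_pos_nonneg)
   then have "((1 + norm x) powr (- q)) ^ DIM('a) = (1 + norm x) powr (- q * real DIM('a))"
    by (subst powr_realpow[symmetric]) (simp_all add: powr_powr)
   then have "(1 + norm x) powr (- p) = (\<Prod>i\<in>(Basis::'a set). (1 + norm x) powr (- q))" by (simp add: q_def)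
   also have "... \<le> (\<Prod>i\<in>(Basis::'a set). (1 + abs (x \<bullet> i)) powr (- q))"
    using q Basis_le_norm[of _ x] by (intro prod_mono conjI powr_mono2') auto
   finally show "norm ((1 + norm x) powr (- p)) \<le> norm (\<Prod>i\<in>Basis. (1 + abs (x \<bullet> i)) powr (- q))" by simp
  qed
 qed measurable
qed

lemma one_plus_norm_le_prod: "1 + norm x \<le> (\<Prod>i\<in>Basis. 1 + abs (x \<bullet> i))" for x :: "'a::euclidean_space"
proof -
 have "1 + (\<Sum>i\<in>A. (abs (x \<bullet> i))) \<le> (\<Prod>i\<in>A. 1 + abs (x \<bullet> i))" if "finite A" for A :: "'a set" using that
 proof (induction A rule: finite_induct)
  case (insert i A)
  have "1 \<le> (\<Prod>i\<in>A. 1 + abs (x \<bullet> i))" by (intro prod_ge_1) auto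
  then have "abs (x \<bullet> i) * 1 \<le> abs (x \<bullet> i) * (\<Prod>i\<in>A. 1 + abs (x \<bullet> i))" by (intro mult_left_mono) auto
  then show ?case using insert by (simp add: distrib_right)
 qed simp
 from this[OF finite_Basis] norm_le_l1[of x] show ?thesis by linarith
qed

section \<open>A smooth cutoff and its Fourier transform\<close>

text \<open>A tensor product of bumps, so that its Fourier transform factors into one-variable
  transforms.\<close>

definition cutoff :: "'a::euclidean_space \<Rightarrow> real" where
 "cutoff x = (\<Prod>i\<in>Basis. bump (-1) 1 0 (x \<bullet> i))"

lemma cutoff_bounds: "0 \<le> cutoff x" "cutoff x \<le> 1"
 unfolding cutoff_def by (auto intro!: prod_nonneg prod_le_1 simp: bump_bounds)

lemma cutoff_0: "cutoff (0 :: 'a::euclidean_space) > 0"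
 unfolding cutoff_def by (intro prod_pos) (simp add: bump_def flat_def)

lemma continuous_bump: "isCont (bump a b n) x"
 using isCont_Re[OF diff_k_isCont[OF diff_k_bump[of 0 a b n]], of x] by simp

lemma bump_borel [measurable]: "bump a b n \<in> Borel"
 by (intro borel_measurable_continuous_onI continuous_at_imp_continuous_on ballI continuous_bump)

lemma continuous_cutoff: "isCont cutoff x"
 unfolding cutoff_def[abs_def] by (intro continuous_intros isCont_o2[where f="\<lambda>x. x \<bullet> _" and g="bump (-1) 1 0"] continuous_bump)

lemma cutoff_borel [measurable]: "cutoff \<in> Borel"
 unfolding cutoff_def[abs_def] by measurable

lemma bump_outside_unit: "abs x > 1 \<Longrightarrow> bump (-1) 1 n x = 0"
 by (rule bump_outside) (auto simp: abs_if split: if_splits)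

lemma bump_integrable: "integrable lborel (\<lambda>x. cor (bump (-1) 1 0 x))"
 by (rule compactly_supported_integrable[where R=1]) (auto intro!: diff_k_isCont[OF diff_k_bump] bump_outside_unit)

lemma fourier_cutoff:
 "fourier (\<lambda>x. cor (cutoff x)) y = (\<Prod>i\<in>Basis. fourier (\<lambda>x. cor (bump (-1) 1 0 x)) (y \<bullet> i))"
 for y :: "'a::euclidean_space"
proof -
 have "cor (cutoff x) * cis (x \<bullet> y) = (\<Prod>i\<in>Basis. cor (bump (-1) 1 0 (x \<bullet> i)) * cis ((x \<bullet> i) * (y \<bullet> i)))" for x
  by (subst euclidean_inner) (simp add: cutoff_def cis_sum prod.distrib)
 then show ?thesis unfolding fourier_def
  using lborel_product_integral(2)[of "\<lambda>i::'a. \<lambda>x. cor (bump (-1) 1 0 x) * cis (x * (y \<bullet> i))"]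
  by (simp add: integrable_mult_cis[OF bump_integrable])
qed

text \<open>As \<open>1 + norm y\<close> is at most the product of the
  \<open>1 + abs (y \<bullet> i)\<close>, the weight splits into coordinates just as the transform
  does.\<close>

lemma fourier_cutoff_weighted_integrable:
 fixes q :: real
 assumes q: "q \<ge> 0"
 shows "integrable lborel (\<lambda>y::'a::euclidean_space. norm (fourier (\<lambda>x. cor (cutoff x)) y) * (1 + norm y) powr q)"
proof -
 define \<beta> where "\<beta> = fourier (\<lambda>x. cor (bump (-1) 1 0 x))"
 \<comment> \<open>Two powers beyond \<open>q\<close> leave an integrable factor in each
   coordinate.\<close>
 obtain N :: nat where N: "q + 2 \<le> real N" using real_arch_simple by blast
 have "\<exists>C\<ge>0. \<forall>\<mu>. norm (\<beta> \<mu>) \<le> C * (1 + abs \<mu>) powr (- real N)"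
  unfolding \<beta>_def by (rule fourier_decay[where R=1]) (auto intro: diff_k_bump bump_outside_unit)
 then obtain C where C: "C \<ge> 0" "\<And>\<mu>. norm (\<beta> \<mu>) \<le> C * (1 + abs \<mu>) powr (- real N)" by blast
 show ?thesis
 proof (rule Bochner_Integration.integrable_bound[OF integrable_mult_right[OF integrable_product_decay[of 2, where 'a='a], of "C ^ DIM('a)"]])
  show "(\<lambda>y::'a. norm (fourier (\<lambda>x. cor (cutoff x)) y) * (1 + norm y) powr q) \<in> borel_measurable lborel" by measurable
  show "AE y::'a in lborel. norm (norm (fourier (\<lambda>x. cor (cutoff x)) y) * (1 + norm y) powr q)
   \<le> norm (C ^ DIM('a) * (\<Prod>i\<in>Basis. (1 + abs (y \<bullet> i)) powr (- 2)))"
  proof (rule AE_I2)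
   fix y :: 'a
   have "(1 + norm y) powr q \<le> (\<Prod>i\<in>Basis. 1 + abs (y \<bullet> i)) powr q"
    using q one_plus_norm_le_prod[of y] by (intro powr_mono2) auto
   also have "... = (\<Prod>i\<in>Basis. (1 + abs (y \<bullet> i)) powr q)" by (rule prod_powr_distrib)
   finally have "norm (fourier (\<lambda>x. cor (cutoff x)) y) * (1 + norm y) powr q
    \<le> (\<Prod>i\<in>Basis. norm (\<beta> (y \<bullet> i))) * (\<Prod>i\<in>Basis. (1 + abs (y \<bullet> i)) powr q)"
    unfolding fourier_cutoff \<beta>_def[symmetric] prod_norm[symmetric] by (intro mult_left_mono) (auto intro: prod_nonneg)
   also have "... = (\<Prod>i\<in>Basis. norm (\<beta> (y \<bullet> i)) * (1 + abs (y \<bullet> i)) powr q)" by (simp add: prod.distrib)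
   also have "... \<le> (\<Prod>i\<in>(Basis::'a set). C * (1 + abs (y \<bullet> i)) powr (- 2))"
   proof (intro prod_mono conjI)
    fix i :: 'a
    have "norm (\<beta> (y \<bullet> i)) * (1 + abs (y \<bullet> i)) powr q \<le> C * (1 + abs (y \<bullet> i)) powr (- real N) * (1 + abs (y \<bullet> i)) powr q"
     by (intro mult_right_mono C) auto
    also have "... = C * (1 + abs (y \<bullet> i)) powr (q - real N)" by (simp add: powr_add[symmetric] add.commute)
    also have "... \<le> C * (1 + abs (y \<bullet> i)) powr (- 2)" using N C by (intro mult_left_mono powr_mono) auto
    finally show "norm (\<beta> (y \<bullet> i)) * (1 + abs (y \<bullet> i)) powr q \<le> C * (1 + abs (y \<bullet> i)) powr (- 2)" .
   qed auto
   also have "... = C ^ DIM('a) * (\<Prod>i\<in>Basis. (1 + abs (y \<bullet> i)) powr (- 2))" by (simp add: prod.distrib)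
   finally show "norm (norm (fourier (\<lambda>x. cor (cutoff x)) y) * (1 + norm y) powr q)
    \<le> norm (C ^ DIM('a) * (\<Prod>i\<in>Basis. (1 + abs (y \<bullet> i)) powr (- 2)))" using C(1) by (simp add: prod_nonneg)
  qed
 qed simp
qed

section \<open>Wave packets and the central multiplier\<close>

text \<open>As \<open>\<epsilon>\<close> tends to 0 the packet approaches a multiple of the
  character \<open>cis (\<mu> \<bullet> t)\<close>, so pairing with it reads off the central Fourier
  transform at \<open>\<mu>\<close>, averaged in \<open>z\<close> by the bumps.\<close>

lemma test_function_wave_packet:
 fixes a b :: "'v::euclidean_space" and \<mu> :: "'z::euclidean_space"
 assumes ab: "\<And>i. i \<in> Basis \<Longrightarrow> a \<bullet> i \<le> b \<bullet> i" and \<epsilon>: "\<epsilon> > 0"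
 shows "test_function (\<lambda>p. (\<Prod>i\<in>Basis. cor (bump (a \<bullet> i) (b \<bullet> i) n (fst p \<bullet> i))) *
  (cor (cutoff (\<epsilon> *\<^sub>R snd p)) * cis (\<mu> \<bullet> snd p)))"
  (is "test_function ?\<phi>")
proof -
 obtain R where R: "\<And>x. x \<in> box a b \<Longrightarrow> norm x \<le> R" using bounded_box[of a b] by (auto simp: bounded_iff)
 obtain S where S: "\<And>x::'z. x \<in> box (- One) One \<Longrightarrow> norm x \<le> S" using bounded_box[of "- One" One] by (auto simp: bounded_iff)
 show ?thesis
 proof (rule test_functionI[where R="abs R + abs S / \<epsilon>"])
  fix k
  have q: "diff_k k (\<lambda>x. cor (bump (-1) 1 0 (\<epsilon> * x)))"
   using diff_k_compose_quadratic[OF diff_k_bump, of k "-1" 1 0 0 \<epsilon> 0] by simp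
  have 1: "C_k k (\<lambda>p::'v \<times> 'z. \<Prod>i\<in>Basis. cor (bump (a \<bullet> i) (b \<bullet> i) n (p \<bullet> (i, 0))))"
   by (intro C_k_prod C_k_coord diff_k_bump) auto
  have 2: "C_k k (\<lambda>p::'v \<times> 'z. \<Prod>j\<in>Basis. cor (bump (-1) 1 0 (\<epsilon> * (p \<bullet> (0, j)))))"
   by (intro C_k_prod C_k_coord[OF q]) auto
  have 3: "C_k k (\<lambda>p::'v \<times> 'z. cis (1 * (p \<bullet> (0, \<mu>))))" by (rule C_k_coord[OF diff_k_cis])
  have "?\<phi> = (\<lambda>p. (\<Prod>i\<in>Basis. cor (bump (a \<bullet> i) (b \<bullet> i) n (p \<bullet> (i, 0)))) *
   ((\<Prod>j\<in>Basis. cor (bump (-1) 1 0 (\<epsilon> * (p \<bullet> (0, j))))) * cis (1 * (p \<bullet> (0, \<mu>)))))"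
   by (auto simp: cutoff_def inner_Pair_0 fun_eq_iff inner_commute)
  then show "C_k k ?\<phi>" using C_k_mult[OF 1 C_k_mult[OF 2 3]] by simp
 next
  fix p :: "'v \<times> 'z" assume nz: "?\<phi> p \<noteq> 0"
  have "fst p \<bullet> i \<in> {a \<bullet> i <..< b \<bullet> i}" if "i \<in> Basis" for i
   using bump_outside[OF _ ab[OF that], of "fst p \<bullet> i" n] nz that by (auto simp: prod_zero_iff)
  then have 1: "norm (fst p) \<le> R" by (intro R) (auto simp: box_def)
  have "\<epsilon> *\<^sub>R snd p \<bullet> j \<in> {-1<..<1}" if "j \<in> Basis" for j
   using bump_outside[of "\<epsilon> *\<^sub>R snd p \<bullet> j" "-1" 1 0] nz that by (auto simp: prod_zero_iff cutoff_def)
  then have "norm (\<epsilon> *\<^sub>R snd p) \<le> S" by (intro S) (auto simp: box_def)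
  then have "norm (snd p) \<le> abs S / \<epsilon>" using \<epsilon> by (simp add: field_simps)
  then show "norm p \<le> abs R + abs S / \<epsilon>" using 1 norm_Pair_le[of "fst p" "snd p"] by simp
 qed
qed

text \<open>The Fourier transform of the packet in \<open>t\<close> concentrates at
  \<open>- \<mu>\<close> on the scale \<open>\<epsilon>\<close>. The substitution
  \<open>\<eta> = \<epsilon> *\<^sub>R \<nu> - \<mu>\<close> unfolds it, and the powers of
  \<open>\<epsilon>\<close> cancel.\<close>

lemma central_frac_laplacian_wave_packet:
 fixes \<alpha> :: "'v::euclidean_space \<Rightarrow> complex" and \<mu> :: "'z::euclidean_space"
 assumes \<epsilon>: "\<epsilon> > 0"
 shows "central_frac_laplacian s (\<lambda>p. \<alpha> (fst p) * (cor (cutoff (\<epsilon> *\<^sub>R snd p)) * cis (\<mu> \<bullet> snd p))) (z, t)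
  = cor (1 / (2 * pi) ^ DIM('z)) * \<alpha> z *
   (LBINT \<nu>. cor (norm (\<epsilon> *\<^sub>R \<nu> - \<mu>) powr (2 * s)) * cis ((\<mu> - \<epsilon> *\<^sub>R \<nu>) \<bullet> t) *
     fourier (\<lambda>x. cor (cutoff x)) \<nu>)"
proof -
 have inner: "(LBINT t'. (\<alpha> z * (cor (cutoff (\<epsilon> *\<^sub>R t')) * cis (\<mu> \<bullet> t'))) * cis ((- \<mu> + \<epsilon> *\<^sub>R \<nu>) \<bullet> t'))
   = \<alpha> z * cor (1 / \<epsilon> ^ DIM('z)) * fourier (\<lambda>x. cor (cutoff x)) \<nu>" for \<nu>
 proof -
  have "fourier (\<lambda>x. cor (cutoff x)) \<nu>
   = abs \<epsilon> ^ DIM('z) *\<^sub>R (LBINT t. cor (cutoff (0 + \<epsilon> *\<^sub>R t)) * cis ((0 + \<epsilon> *\<^sub>R t) \<bullet> \<nu>))"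
   unfolding fourier_def using \<epsilon> by (intro integral_affine) simp
  then have 1: "(LBINT t. cor (cutoff (\<epsilon> *\<^sub>R t)) * cis (\<epsilon> * (t \<bullet> \<nu>)))
   = cor (1 / \<epsilon> ^ DIM('z)) * fourier (\<lambda>x. cor (cutoff x)) \<nu>" using \<epsilon> by (simp add: scaleR_conv_of_real)
  have "(\<alpha> z * (cor (cutoff (\<epsilon> *\<^sub>R t')) * cis (\<mu> \<bullet> t'))) * cis ((- \<mu> + \<epsilon> *\<^sub>R \<nu>) \<bullet> t')
   = \<alpha> z * (cor (cutoff (\<epsilon> *\<^sub>R t')) * cis (\<epsilon> * (t' \<bullet> \<nu>)))" for t'
   by (simp add: cis_mult mult.assoc inner_diff_left inner_diff_right inner_commute)
  then have "(LBINT t'. (\<alpha> z * (cor (cutoff (\<epsilon> *\<^sub>R t')) * cis (\<mu> \<bullet> t'))) * cis ((- \<mu> + \<epsilon> *\<^sub>R \<nu>) \<bullet> t'))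
   = (LBINT t'. \<alpha> z * (cor (cutoff (\<epsilon> *\<^sub>R t')) * cis (\<epsilon> * (t' \<bullet> \<nu>))))" by presburger
  then show ?thesis using 1 by simp
 qed
 have "(LBINT \<eta>. cor (norm \<eta> powr (2 * s)) * cis (- (\<eta> \<bullet> t)) *
      (LBINT t'. (\<alpha> z * (cor (cutoff (\<epsilon> *\<^sub>R t')) * cis (\<mu> \<bullet> t'))) * cis (\<eta> \<bullet> t')))
  = abs \<epsilon> ^ DIM('z) *\<^sub>R (LBINT \<nu>. cor (norm (- \<mu> + \<epsilon> *\<^sub>R \<nu>) powr (2 * s)) * cis (- ((- \<mu> + \<epsilon> *\<^sub>R \<nu>) \<bullet> t)) *
      (LBINT t'. (\<alpha> z * (cor (cutoff (\<epsilon> *\<^sub>R t')) * cis (\<mu> \<bullet> t'))) * cis ((- \<mu> + \<epsilon> *\<^sub>R \<nu>) \<bullet> t')))"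
  using \<epsilon> by (intro integral_affine) simp
 also have "... = abs \<epsilon> ^ DIM('z) *\<^sub>R (LBINT \<nu>. (\<alpha> z * cor (1 / \<epsilon> ^ DIM('z))) * (cor (norm (\<epsilon> *\<^sub>R \<nu> - \<mu>) powr (2 * s)) * cis ((\<mu> - \<epsilon> *\<^sub>R \<nu>) \<bullet> t) *
     fourier (\<lambda>x. cor (cutoff x)) \<nu>))" unfolding inner by (simp add: inner_diff_left inner_add_left mult_ac)
 also have "... = \<alpha> z * (LBINT \<nu>. cor (norm (\<epsilon> *\<^sub>R \<nu> - \<mu>) powr (2 * s)) * cis ((\<mu> - \<epsilon> *\<^sub>R \<nu>) \<bullet> t) *
     fourier (\<lambda>x. cor (cutoff x)) \<nu>)" unfolding integral_mult_right_zero using \<epsilon> by (simp add: scaleR_conv_of_real)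
 finally show ?thesis by (simp add: central_frac_laplacian_def)
qed

text \<open>The triangle inequality in multiplicative form, which yields a majorant independent of
  \<open>\<epsilon>\<close>.\<close>

lemma wave_packet_symbol_bound:
 fixes \<mu> :: "'z::euclidean_space"
 assumes "s \<ge> 0" "0 < \<epsilon>" "\<epsilon> \<le> 1"
 shows "norm (\<epsilon> *\<^sub>R \<nu> - \<mu>) powr (2 * s) \<le> (1 + norm \<mu>) powr (2 * s) * (1 + norm \<nu>) powr (2 * s)"
proof -
 have "norm (\<epsilon> *\<^sub>R \<nu> - \<mu>) \<le> \<epsilon> * norm \<nu> + norm \<mu>"
  using norm_triangle_ineq4[of "\<epsilon> *\<^sub>R \<nu>" \<mu>] assms by simp
 also have "\<epsilon> * norm \<nu> + norm \<mu> \<le> 1 * norm \<nu> + norm \<mu>" using assms by (intro add_mono mult_right_mono) auto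
 also have "... \<le> (1 + norm \<mu>) * (1 + norm \<nu>)" by (simp add: algebra_simps)
 finally have "norm (\<epsilon> *\<^sub>R \<nu> - \<mu>) powr (2 * s) \<le> ((1 + norm \<mu>) * (1 + norm \<nu>)) powr (2 * s)"
  using assms by (intro powr_mono2) auto
 then show ?thesis by (simp add: powr_mult)
qed

text \<open>Dominated convergence against the rapidly decaying transform of the cutoff;
  \<open>\<mu> \<noteq> 0\<close> keeps the base of \<open>powr\<close> away from 0 in the limit.
  The uniform bound is the majorant for the subsequent integration against \<open>f\<close>.\<close>

lemma wave_packet_limit:
 fixes \<mu> t :: "'z::euclidean_space"
 assumes s: "s \<ge> 0" and \<mu>: "\<mu> \<noteq> 0" and e: "\<And>k. 0 < e k" "\<And>k. e k \<le> 1" "e \<longlonglongrightarrow> 0"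
 defines "X \<equiv> fourier (\<lambda>x::'z. cor (cutoff x))"
 defines "I \<equiv> \<lambda>k t. (LBINT \<nu>. cor (norm (e k *\<^sub>R \<nu> - \<mu>) powr (2 * s)) * cis ((\<mu> - e k *\<^sub>R \<nu>) \<bullet> t) * X \<nu>)"
 shows "(\<lambda>k. I k t) \<longlonglongrightarrow> cor (norm \<mu> powr (2 * s)) * cis (\<mu> \<bullet> t) * (LBINT \<nu>. X \<nu>)"
  and "\<exists>B. \<forall>k t. norm (I k t) \<le> B"
  and "\<And>k. I k \<in> Borel"
proof -
 define w where "w \<nu> = (1 + norm \<mu>) powr (2 * s) * (norm (X \<nu>) * (1 + norm \<nu>) powr (2 * s))" for \<nu>
 have [measurable]: "X \<in> Borel" unfolding X_def by measurable
 have w: "integrable lborel w" unfolding w_def X_def using s by (intro integrable_mult_right fourier_cutoff_weighted_integrable) simp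
 have bd: "norm (cor (norm (e k *\<^sub>R \<nu> - \<mu>) powr (2 * s)) * cis ((\<mu> - e k *\<^sub>R \<nu>) \<bullet> t) * X \<nu>) \<le> w \<nu>" for k \<nu> t
  using mult_right_mono[OF wave_packet_symbol_bound[OF s e(1,2), of k \<nu> \<mu>], of "norm (X \<nu>)"] by (simp add: w_def norm_mult mult_ac)
 have "(\<lambda>k. I k t) \<longlonglongrightarrow> (LBINT \<nu>. cor (norm (0 *\<^sub>R \<nu> - \<mu>) powr (2 * s)) * cis ((\<mu> - 0 *\<^sub>R \<nu>) \<bullet> t) * X \<nu>)"
  unfolding I_def
 proof (rule integral_dominated_convergence[OF _ _ w])
  show "AE \<nu> in lborel. (\<lambda>k. cor (norm (e k *\<^sub>R \<nu> - \<mu>) powr (2 * s)) * cis ((\<mu> - e k *\<^sub>R \<nu>) \<bullet> t) * X \<nu>)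
   \<longlonglongrightarrow> cor (norm (0 *\<^sub>R \<nu> - \<mu>) powr (2 * s)) * cis ((\<mu> - 0 *\<^sub>R \<nu>) \<bullet> t) * X \<nu>"
   unfolding cis_conv_exp using \<mu> by (intro AE_I2 tendsto_intros e(3)) auto
 qed (use bd in auto)
 then show "(\<lambda>k. I k t) \<longlonglongrightarrow> cor (norm \<mu> powr (2 * s)) * cis (\<mu> \<bullet> t) * (LBINT \<nu>. X \<nu>)" by simp
 have "norm (I k t) \<le> (LBINT \<nu>. w \<nu>)" for k t unfolding I_def by (rule Bochner_Integration.integral_norm_bound_integral[OF _ w bd])
   (rule Bochner_Integration.integrable_bound[OF w], measurable, use bd in \<open>force intro: AE_I2 order_trans[OF _ abs_ge_self]\<close>)
 then show "\<exists>B. \<forall>k t. norm (I k t) \<le> B" by blast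
 show "I k \<in> Borel" for k unfolding I_def by measurable
qed

text \<open>The distributional identity is tested with wave packets of growing width. As
  \<open>w\<close> is positive and continuous, integrability against it is plain integrability on
  the bounded support of the bumps. By Fourier inversion \<open>K\<close> equals 1; it is carried as
  a constant independent of \<open>\<mu>\<close> and \<open>z\<close>.\<close>

theorem central_frac_laplacian_fourier:
 fixes f g :: "'v::euclidean_space \<times> 'z::euclidean_space \<Rightarrow> complex" and \<mu> :: 'z and w :: "'v \<Rightarrow> real"
 assumes f: "integrable lborel f" and g: "is_central_frac_laplacian s f g" and s: "s \<ge> 0" and \<mu>: "\<mu> \<noteq> 0"
  and w: "\<And>z. w z > 0" "continuous_on UNIV w"
  and gw: "integrable lborel (\<lambda>p. g p * cor (w (fst p)))"
 defines "K \<equiv> cor (1 / (2 * pi) ^ DIM('z)) * (LBINT \<nu>. fourier (\<lambda>x::'z. cor (cutoff x)) \<nu>) / cor (cutoff (0::'z))"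
 shows "AE z in lborel. (LBINT t. g (z, t) * cis (\<mu> \<bullet> t))
  = K * cor (norm \<mu> powr (2 * s)) * (LBINT t. f (z, t) * cis (\<mu> \<bullet> t))"
proof -
 have [measurable]: "f \<in> Borel" "g \<in> Borel" using f g by (auto simp: is_central_frac_laplacian_def)
 have [measurable]: "w \<in> Borel" using w(2) by (rule borel_measurable_continuous_onI)
 define G where "G z = (LBINT t. g (z, t) * cis (\<mu> \<bullet> t))" for z
 define F where "F z = (LBINT t. f (z, t) * cis (\<mu> \<bullet> t))" for z
 have gp: "(\<lambda>q. g q) \<in> borel_measurable (borel \<Otimes>\<^sub>M borel)" and fp: "(\<lambda>q. f q) \<in> borel_measurable (borel \<Otimes>\<^sub>M borel)"
  unfolding borel_prod by simp_all
 note [measurable] = gp fp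
 have [measurable]: "G \<in> Borel" "F \<in> Borel" unfolding G_def F_def by measurable
 have Fi: "integrable lborel F"
  unfolding F_def using fubini_2(3)[of "\<lambda>q. f q * cis (\<mu> \<bullet> snd q)"] fubini_1(3)[of "\<lambda>q. f q * cis (\<mu> \<bullet> snd q)"]
  by (simp add: integrable_mult_cis[OF f])
 have Gwi: "integrable lborel (\<lambda>z. G z * cor (w z))"
 proof -
  have "integrable lborel (\<lambda>z. (LBINT t. (g (z, t) * cor (w z)) * cis (\<mu> \<bullet> t)))"
   using fubini_1(3)[of "\<lambda>q. (g q * cor (w (fst q))) * cis (\<mu> \<bullet> snd q)"] integrable_mult_cis[OF gw] by simp
  moreover have "(LBINT t. (g (z, t) * cor (w z)) * cis (\<mu> \<bullet> t)) = G z * cor (w z)" for z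
   unfolding G_def by (subst integral_mult_left_zero[symmetric]) (simp add: mult_ac)
  ultimately show ?thesis by simp
 qed
 \<comment> \<open>On a nonempty compact set \<open>w\<close> attains a positive minimum, so the
   weight can be divided out there.\<close>
 have Gl: "loc_integrable G" unfolding loc_integrable_def
 proof (intro conjI allI impI)
  fix A :: "'v set" assume A: "compact A"
  show "set_integrable lborel A G"
  proof (cases "A = {}")
   case False
   obtain x0 where x0: "x0 \<in> A" "\<And>x. x \<in> A \<Longrightarrow> w x0 \<le> w x"
    using continuous_attains_inf[OF A False] continuous_on_subset[OF w(2)] by blast
   show ?thesis unfolding set_integrable_def
   proof (rule Bochner_Integration.integrable_bound[OF integrable_mult_right[OF Gwi, of "cor (1 / w x0)"]])
    have [measurable]: "A \<in> sets borel" using A by (simp add: compact_imp_closed)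
    show "(\<lambda>x. indicator A x *\<^sub>R G x) \<in> borel_measurable lborel" by measurable
    show "AE x in lborel. norm (indicator A x *\<^sub>R G x) \<le> norm (cor (1 / w x0) * (G x * cor (w x)))"
    proof (intro AE_I2)
     fix x
     have "norm (G x) * 1 \<le> norm (G x) * (w x / w x0)" if "x \<in> A" using x0(2)[OF that] w(1)[of x0] by (intro mult_left_mono) auto
     then show "norm (indicator A x *\<^sub>R G x) \<le> norm (cor (1 / w x0) * (G x * cor (w x)))"
      using w(1)[of x] w(1)[of x0] by (auto simp: indicator_def norm_mult norm_divide)
    qed
   qed
  qed (simp add: set_integrable_def)
 qed simp
 define H where "H z = G z - K * cor (norm \<mu> powr (2 * s)) * F z" for z
 have "AE z in lborel. H z = 0"
 proof (rule AE_zero_of_product_bumps)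
  show "loc_integrable H" unfolding H_def by (intro loc_integrable_diff Gl integrable_imp_loc_integrable integrable_mult_right Fi)
  fix a b :: 'v and n assume ab: "\<And>i. i \<in> Basis \<Longrightarrow> a \<bullet> i \<le> b \<bullet> i"
  define \<alpha> where "\<alpha> z = (\<Prod>i\<in>Basis. cor (bump (a \<bullet> i) (b \<bullet> i) n (z \<bullet> i)))" for z
  have [measurable]: "\<alpha> \<in> Borel" unfolding \<alpha>_def by measurable
  have \<alpha>1: "norm (\<alpha> z) \<le> 1" for z unfolding \<alpha>_def prod_norm[symmetric] by (intro prod_le_1) (auto simp: bump_bounds)
  have \<alpha>0: "\<alpha> z = 0" if "z \<notin> box a b" for z
  proof -
   from that obtain i where i: "i \<in> Basis" "z \<bullet> i \<notin> {a \<bullet> i <..< b \<bullet> i}" by (auto simp: box_def)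
   then show ?thesis unfolding \<alpha>_def using bump_outside[OF i(2) ab[OF i(1)]] i(1) by (intro prod_zero bexI[of _ i]) auto
  qed
  have \<alpha>f: "integrable lborel (\<lambda>p. f p * \<alpha> (fst p))"
   by (rule Bochner_Integration.integrable_bound[OF f], measurable) (auto simp: norm_mult mult_left_le \<alpha>1)
  have \<alpha>g: "integrable lborel (\<lambda>p. g p * \<alpha> (fst p))"
  proof (cases "box a b = {}")
   case False
   have "compact (cbox a b)" "cbox a b \<noteq> {}" using False box_subset_cbox[of a b] by auto
   then obtain x0 where x0: "\<And>x. x \<in> cbox a b \<Longrightarrow> w x0 \<le> w x"
    using continuous_attains_inf[of "cbox a b" w] continuous_on_subset[OF w(2)] by blast
   show ?thesis
   proof (rule Bochner_Integration.integrable_bound[OF integrable_mult_right[OF gw, of "cor (1 / w x0)"]], measurable, intro AE_I2)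
    fix p :: "'v \<times> 'z"
    show "norm (g p * \<alpha> (fst p)) \<le> norm (cor (1 / w x0) * (g p * cor (w (fst p))))"
    proof (cases "fst p \<in> box a b")
     case True
     have "1 \<le> w (fst p) / w x0" using x0[of "fst p"] True box_subset_cbox[of a b] w(1)[of x0] by auto
     then have "norm (\<alpha> (fst p)) \<le> w (fst p) / w x0" using \<alpha>1[of "fst p"] by linarith
     then have "norm (g p) * norm (\<alpha> (fst p)) \<le> norm (g p) * (w (fst p) / w x0)" by (intro mult_left_mono) auto
     then show ?thesis using w(1)[of "fst p"] w(1)[of x0] by (simp add: norm_mult norm_divide)
    qed (simp add: \<alpha>0)
   qed
  qed (simp add: \<alpha>0)
  define e where "e k = 1 / real (Suc k)" for k
  have e: "0 < e k" "e k \<le> 1" for k by (simp_all add: e_def)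
  have e0: "e \<longlonglongrightarrow> 0" unfolding e_def using LIMSEQ_inverse_real_of_nat by (simp add: inverse_eq_divide)
  define X where "X = fourier (\<lambda>x::'z. cor (cutoff x))"
  define I where "I k t = (LBINT \<nu>. cor (norm (e k *\<^sub>R \<nu> - \<mu>) powr (2 * s)) * cis ((\<mu> - e k *\<^sub>R \<nu>) \<bullet> t) * X \<nu>)" for k t
  define c where "c = cor (1 / (2 * pi) ^ DIM('z))"
  note lim = wave_packet_limit[OF s \<mu> e e0, folded X_def, folded I_def]
  have [measurable]: "I k \<in> Borel" for k by (rule lim(3))
  obtain B where B: "\<And>k t. norm (I k t) \<le> B" using lim(2) by blast
  define J where "J = cor (norm \<mu> powr (2 * s)) * (LBINT \<nu>. X \<nu>)"
  have pk: "(LBINT p. (g p * \<alpha> (fst p)) * (cor (cutoff (e k *\<^sub>R snd p)) * cis (\<mu> \<bullet> snd p)))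
   = (LBINT p. (f p * \<alpha> (fst p)) * (c * I k (snd p)))" for k
  proof -
   let ?\<phi> = "\<lambda>p. \<alpha> (fst p) * (cor (cutoff (e k *\<^sub>R snd p)) * cis (\<mu> \<bullet> snd p))"
   have "test_function ?\<phi>" unfolding \<alpha>_def by (rule test_function_wave_packet[OF ab e(1)])
   then have "(LBINT p. g p * ?\<phi> p) = (LBINT p. f p * central_frac_laplacian s ?\<phi> p)"
    using g unfolding is_central_frac_laplacian_def by blast
   moreover have "central_frac_laplacian s ?\<phi> p = \<alpha> (fst p) * (c * I k (snd p))" for p
    using central_frac_laplacian_wave_packet[OF e(1)[of k], of s \<alpha> \<mu> "fst p" "snd p"] by (simp add: c_def I_def X_def mult_ac)
   ultimately show ?thesis by (simp add: mult.assoc)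
  qed
  have "(\<lambda>k. (LBINT p. (g p * \<alpha> (fst p)) * (cor (cutoff (e k *\<^sub>R snd p)) * cis (\<mu> \<bullet> snd p))))
   \<longlonglongrightarrow> (LBINT p. (g p * \<alpha> (fst p)) * (cor (cutoff (0::'z)) * cis (\<mu> \<bullet> snd p)))"
  proof (rule integral_dominated_convergence[OF _ _ integrable_norm[OF \<alpha>g]])
   show "AE p in lborel. (\<lambda>k. (g p * \<alpha> (fst p)) * (cor (cutoff (e k *\<^sub>R snd p)) * cis (\<mu> \<bullet> snd p)))
    \<longlonglongrightarrow> (g p * \<alpha> (fst p)) * (cor (cutoff (0::'z)) * cis (\<mu> \<bullet> snd p))"
   proof (intro AE_I2 tendsto_intros)
    fix p :: "'v \<times> 'z"
    have "(\<lambda>k. e k *\<^sub>R snd p) \<longlonglongrightarrow> 0 *\<^sub>R snd p" by (intro tendsto_intros e0)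
    then show "(\<lambda>k. cutoff (e k *\<^sub>R snd p)) \<longlonglongrightarrow> cutoff (0::'z)"
     by (intro isCont_tendsto_compose[OF continuous_cutoff]) simp
   qed
   show "AE p in lborel. norm ((g p * \<alpha> (fst p)) * (cor (cutoff (e k *\<^sub>R snd p)) * cis (\<mu> \<bullet> snd p))) \<le> norm (g p * \<alpha> (fst p))" for k
    by (intro AE_I2) (simp add: norm_mult mult_left_le cutoff_bounds)
  qed measurable
  moreover have "(\<lambda>k. (LBINT p. (f p * \<alpha> (fst p)) * (c * I k (snd p))))
   \<longlonglongrightarrow> (LBINT p. (f p * \<alpha> (fst p)) * (c * (cor (norm \<mu> powr (2 * s)) * cis (\<mu> \<bullet> snd p) * (LBINT \<nu>. X \<nu>))))"
  proof (rule integral_dominated_convergence[OF _ _ integrable_mult_left[OF integrable_norm[OF \<alpha>f], of "norm c * B"]])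
   show "AE p in lborel. (\<lambda>k. (f p * \<alpha> (fst p)) * (c * I k (snd p)))
    \<longlonglongrightarrow> (f p * \<alpha> (fst p)) * (c * (cor (norm \<mu> powr (2 * s)) * cis (\<mu> \<bullet> snd p) * (LBINT \<nu>. X \<nu>)))"
    by (intro AE_I2 tendsto_mult tendsto_const lim(1))
   show "AE p in lborel. norm ((f p * \<alpha> (fst p)) * (c * I k (snd p))) \<le> norm (f p * \<alpha> (fst p)) * (norm c * B)" for k
    unfolding norm_mult by (intro AE_I2 mult_left_mono B) auto
  qed measurable
  ultimately have "(LBINT p. (g p * \<alpha> (fst p)) * (cor (cutoff (0::'z)) * cis (\<mu> \<bullet> snd p)))
   = (LBINT p. (f p * \<alpha> (fst p)) * (c * (cor (norm \<mu> powr (2 * s)) * cis (\<mu> \<bullet> snd p) * (LBINT \<nu>. X \<nu>))))"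
   unfolding pk by (rule LIMSEQ_unique)
  moreover have "(LBINT p. (g p * \<alpha> (fst p)) * (cor (cutoff (0::'z)) * cis (\<mu> \<bullet> snd p)))
   = cor (cutoff (0::'z)) * (LBINT z. G z * \<alpha> z)"
  proof -
   have "(LBINT p. (g p * \<alpha> (fst p)) * (cor (cutoff (0::'z)) * cis (\<mu> \<bullet> snd p)))
    = (LBINT p. cor (cutoff (0::'z)) * ((g p * \<alpha> (fst p)) * cis (\<mu> \<bullet> snd p)))" by (simp only: mult_ac)
   also have "... = cor (cutoff (0::'z)) * (LBINT z. LBINT t. (g (z, t) * cis (\<mu> \<bullet> t)) * \<alpha> z)"
    unfolding integral_mult_right_zero by (subst fubini_1(1)[OF integrable_mult_cis[OF \<alpha>g]]) (simp_all add: mult_ac)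
   finally show ?thesis unfolding integral_mult_left_zero G_def .
  qed
  moreover have "(LBINT p. (f p * \<alpha> (fst p)) * (c * (cor (norm \<mu> powr (2 * s)) * cis (\<mu> \<bullet> snd p) * (LBINT \<nu>. X \<nu>))))
   = c * J * (LBINT z. F z * \<alpha> z)"
  proof -
   have "(LBINT p. (f p * \<alpha> (fst p)) * (c * (cor (norm \<mu> powr (2 * s)) * cis (\<mu> \<bullet> snd p) * (LBINT \<nu>. X \<nu>))))
    = (LBINT p. (c * J) * ((f p * \<alpha> (fst p)) * cis (\<mu> \<bullet> snd p)))" by (simp only: mult_ac J_def)
   also have "... = (c * J) * (LBINT z. LBINT t. (f (z, t) * cis (\<mu> \<bullet> t)) * \<alpha> z)"
    unfolding integral_mult_right_zero by (subst fubini_1(1)[OF integrable_mult_cis[OF \<alpha>f]]) (simp_all add: mult_ac)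
   finally show ?thesis unfolding integral_mult_left_zero F_def .
  qed
  moreover have "K * cor (norm \<mu> powr (2 * s)) * cor (cutoff (0::'z)) = c * J"
   using cutoff_0[where 'a='z] by (simp add: K_def c_def J_def X_def)
  ultimately have eq: "cor (cutoff (0::'z)) * ((LBINT z. G z * \<alpha> z) - K * cor (norm \<mu> powr (2 * s)) * (LBINT z. F z * \<alpha> z)) = 0"
   by (simp add: right_diff_distrib) (metis mult.assoc mult.commute)
  have Fa: "integrable lborel (\<lambda>z. F z * \<alpha> z)"
   by (rule Bochner_Integration.integrable_bound[OF Fi], measurable) (auto simp: norm_mult mult_left_le \<alpha>1)
  have Ga: "integrable lborel (\<lambda>z. G z * \<alpha> z)"
  proof (rule Bochner_Integration.integrable_bound[where f="\<lambda>z. indicator (box a b) z *\<^sub>R G z"])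
   show "integrable lborel (\<lambda>z. indicator (box a b) z *\<^sub>R G z)"
    using loc_integrable_set[OF Gl, of "box a b"] by (simp add: set_integrable_def)
   show "AE z in lborel. norm (G z * \<alpha> z) \<le> norm (indicator (box a b) z *\<^sub>R G z)"
    by (intro AE_I2) (auto simp: indicator_def norm_mult mult_left_le \<alpha>1 \<alpha>0)
  qed measurable
  have "(LBINT z. H z * \<alpha> z) = (LBINT z. G z * \<alpha> z - K * cor (norm \<mu> powr (2 * s)) * (F z * \<alpha> z))"
   unfolding H_def by (simp add: left_diff_distrib mult.assoc)
  also have "... = (LBINT z. G z * \<alpha> z) - K * cor (norm \<mu> powr (2 * s)) * (LBINT z. F z * \<alpha> z)"
   by (subst Bochner_Integration.integral_diff[OF Ga integrable_mult_right[OF Fa]]) simp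
  also have "... = 0" using eq cutoff_0[where 'a='z] by simp
  finally show "(LBINT z. H z * (\<Prod>i\<in>Basis. cor (bump (a \<bullet> i) (b \<bullet> i) n (z \<bullet> i)))) = 0" unfolding \<alpha>_def .
 qed
 then show ?thesis by (simp add: H_def G_def F_def)
qed

section \<open>Orthonormal coordinates\<close>

text \<open>Uniqueness of Haar measure, so that no Jacobian has to be computed.\<close>

lemma distr_translation_invariant:
 fixes T :: "'x \<Rightarrow> 'a::euclidean_space"
 assumes M: "sigma_finite_measure M" and T[measurable]: "T \<in> measurable M borel"
  and inv: "\<And>h t. h \<in> Borel \<Longrightarrow> (\<integral>\<^sup>+x. h (T x + t) \<partial>M) = (\<integral>\<^sup>+x. h (T x) \<partial>M)"
  and fin: "emeasure M (T -` box 0 One \<inter> space M) < \<infinity>" and nz: "emeasure M (space M) \<noteq> 0"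
 shows "\<exists>c>0. distr M borel T = density lborel (\<lambda>_. ennreal c)"
proof -
 interpret sigma_finite_measure M by fact
 interpret pair_sigma_finite M "lborel :: 'a measure" ..
 define Q where "Q = emeasure M (T -` box 0 One \<inter> space M)"
 have eq: "emeasure (distr M borel T) A = Q * emeasure lborel A" if [measurable]: "A \<in> sets borel" for A
 proof -
  define f g :: "'a \<Rightarrow> ennreal" where "f = indicator A" and "g = indicator (box 0 One)"
  have [measurable]: "f \<in> Borel" "g \<in> Borel" by (auto simp: f_def g_def)
  have "emeasure (distr M borel T) A = (\<integral>\<^sup>+t. f t \<partial>distr M borel T)" by (simp add: f_def)
  also have "... = (\<integral>\<^sup>+x. f (T x) \<partial>M)" by (rule nn_integral_distr) measurable
  \<comment> \<open>The indicator \<open>g\<close> of the unit cube integrates to 1 over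
    \<open>y\<close>. After the exchange, invariance of the image moves the shift from
    \<open>g\<close> to \<open>f\<close>, and the two integrals separate.\<close>
  also have "... = (\<integral>\<^sup>+x. f (T x) * (NN y. g (y + T x)) \<partial>M)" by (simp add: nn_integral_translate g_def)
  also have "... = (\<integral>\<^sup>+x. (NN y. f (T x) * g (y + T x)) \<partial>M)" by (simp add: nn_integral_cmult)
  also have "... = (NN y. \<integral>\<^sup>+x. f (T x) * g (y + T x) \<partial>M)" by (rule Fubini'[symmetric]) measurable
  also have "... = (NN y. \<integral>\<^sup>+x. f (T x - y) * g (T x) \<partial>M)"
  proof (rule nn_integral_cong)
   fix y
   show "(\<integral>\<^sup>+x. f (T x) * g (y + T x) \<partial>M) = (\<integral>\<^sup>+x. f (T x - y) * g (T x) \<partial>M)"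
    using inv[of "\<lambda>t. f (t - y) * g t" y] by (simp add: add.commute)
  qed
  also have "... = (\<integral>\<^sup>+x. (NN y. f (T x - y) * g (T x)) \<partial>M)" by (rule Fubini') measurable
  also have "... = (\<integral>\<^sup>+x. emeasure lborel A * g (T x) \<partial>M)" by (simp add: nn_integral_multc nn_integral_translate f_def)
  also have "... = emeasure lborel A * (\<integral>\<^sup>+t. g t \<partial>distr M borel T)"
   by (subst nn_integral_distr) (simp_all add: nn_integral_cmult)
  also have "(\<integral>\<^sup>+t. g t \<partial>distr M borel T) = Q" by (simp add: g_def Q_def emeasure_distr)
  finally show ?thesis by (simp add: mult.commute)
 qed
 have "Q \<noteq> 0"
 proof
  assume "Q = 0"
  then have "emeasure (distr M borel T) UNIV = 0" by (simp add: eq)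
  then show False using nz by (simp add: emeasure_distr)
 qed
 then obtain c where c: "c > 0" "Q = ennreal c" using fin unfolding Q_def[symmetric] by (cases Q) (auto simp: less_le)
 have "distr M borel T = density lborel (\<lambda>_. ennreal c)" by (rule measure_eqI) (auto simp: eq c emeasure_density_const)
 with c(1) show ?thesis by blast
qed

lemma nn_integral_linear_coordinates:
 assumes "distr M borel T = density lborel (\<lambda>_. ennreal c)" and [measurable]: "T \<in> measurable M borel" "h \<in> Borel"
 shows "(\<integral>\<^sup>+x. h (T x) \<partial>M) = ennreal c * (NN t. h t)"
 using nn_integral_distr[of T M borel h] unfolding assms(1) by (simp add: nn_integral_density nn_integral_cmult)

lemma integral_linear_coordinates:
 fixes h :: "'a::euclidean_space \<Rightarrow> complex"
 assumes d: "distr M borel T = density lborel (\<lambda>_. ennreal c)" and c: "c > 0" and [measurable]: "T \<in> measurable M borel"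
  and h: "integrable lborel h"
 shows "integrable M (\<lambda>x. h (T x))" "(\<integral>x. h (T x) \<partial>M) = cor c * (LBINT t. h t)"
proof -
 have [measurable]: "h \<in> Borel" using h by (auto dest: borel_measurable_integrable)
 have "integrable (distr M borel T) h" unfolding d using h c by (subst integrable_density) auto
 then show "integrable M (\<lambda>x. h (T x))" by (simp add: integrable_distr_eq)
 have "(\<integral>x. h (T x) \<partial>M) = integral\<^sup>L (distr M borel T) h" by (simp add: integral_distr)
 then show "(\<integral>x. h (T x) \<partial>M) = cor c * (LBINT t. h t)"
  unfolding d using c by (subst (asm) integral_density) (auto simp: scaleR_conv_of_real)
qed

section \<open>Coordinates in the complement of the centre\<close>

locale orthonormal_frame =
 fixes E E' :: "'n::finite \<Rightarrow> 'v::euclidean_space"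
 assumes orth: "\<And>i j. E i \<bullet> E j = of_bool (i = j)" "\<And>i j. E' i \<bullet> E' j = of_bool (i = j)" "\<And>i j. E i \<bullet> E' j = 0"
  and spn: "span (range E \<union> range E') = UNIV"
begin

definition T :: "(real^'n) \<times> (real^'n) \<Rightarrow> 'v" where "T q = coord E E' (fst q) (snd q)"

lemma linear_T: "linear T"
 by (rule linearI) (simp_all add: T_def coord_def sum.distrib scaleR_add_left scaleR_sum_right algebra_simps)

lemma T_borel [measurable]: "T \<in> Borel"
 by (intro borel_measurable_continuous_onI linear_continuous_on linear_conv_bounded_linear[THEN iffD1] linear_T)

lemma T_inner: "T q \<bullet> E j = fst q $ j" "T q \<bullet> E' j = snd q $ j"
 using orth(3) by (simp_all add: T_def coord_def inner_sum_left inner_add_left sum.distrib orth inner_commute[of "E' _" "E _"] if_distrib sum.delta cong: if_cong)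

lemma T_surj: "\<exists>q. T q = t"
proof -
 have "E j = T (axis j 1, 0)" "E' j = T (0, axis j 1)" for j
  by (simp_all add: T_def coord_def axis_def if_distrib[of "\<lambda>r. r *\<^sub>R _"] cong: if_cong)
 then have "range E \<union> range E' \<subseteq> range T" by auto
 then have "span (range E \<union> range E') \<subseteq> range T" by (intro span_minimal linear_subspace_image linear_T subspace_UNIV)
 then show ?thesis using spn by (metis UNIV_I imageE subsetD)
qed

text \<open>\<open>T\<close> is linear and onto, so translations of the target lift to translations
  of the source. Coordinates are inner products with frame vectors, which bounds the preimage of the
  unit cube.\<close>

lemma coordinates: "\<exists>c>0. distr lborel borel T = density lborel (\<lambda>_. ennreal c)"
proof (rule distr_translation_invariant[of lborel T])
 show "(NN x. h (T x + t)) = (NN x. h (T x))" if [measurable]: "h \<in> Borel" for h t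
 proof -
  obtain q where "T q = t" using T_surj by blast
  then have "h (T x + t) = h (T (x + q))" for x using linear_add[OF linear_T, of x q] by simp
  then show ?thesis using nn_integral_translate(1)[of "\<lambda>x. h (T x)" q] by simp
 qed
 have "norm q \<le> real CARD('n) * norm (T q) + real CARD('n) * norm (T q)" for q
 proof -
  have n: "norm (E j) = 1" "norm (E' j) = 1" for j by (simp_all add: norm_eq_sqrt_inner orth)
  have "norm (fst q) \<le> (\<Sum>j\<in>UNIV. (abs (fst q $ j)))" "norm (snd q) \<le> (\<Sum>j\<in>UNIV. (abs (snd q $ j)))" by (rule norm_le_l1_cart)+
  moreover have "(\<Sum>j\<in>UNIV. (abs (fst q $ j))) \<le> real CARD('n) * norm (T q)"
   by (rule sum_bounded_above) (metis Cauchy_Schwarz_ineq2 T_inner n mult.right_neutral)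
  moreover have "(\<Sum>j\<in>UNIV. (abs (snd q $ j))) \<le> real CARD('n) * norm (T q)"
   by (rule sum_bounded_above) (metis Cauchy_Schwarz_ineq2 T_inner n mult.right_neutral)
  ultimately show ?thesis using norm_Pair_le[of "fst q" "snd q"] by simp
 qed
 moreover obtain R where "\<And>x::'v. x \<in> box 0 One \<Longrightarrow> norm x \<le> R" using bounded_box[of 0 One] by (auto simp: bounded_iff)
 ultimately have "norm q \<le> real CARD('n) * R + real CARD('n) * R" if "q \<in> T -` box 0 One" for q
  using that by (meson add_mono mult_left_mono of_nat_0_le_iff order_trans vimageD)
 then have "bounded (T -` box 0 One)" unfolding bounded_iff by blast
 then show "emeasure lborel (T -` box 0 One \<inter> space lborel) < \<infinity>" using emeasure_bounded_finite by simp
qed (auto intro: sigma_finite_lborel)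

end

text \<open>The orthonormal basis chosen by \<^const>\<open>hyperplane_lebesgue\<close>.\<close>

definition hyperplane_basis :: "'z::euclidean_space \<Rightarrow> 'z set" where
 "hyperplane_basis \<omega> = (SOME B. orthonormal_basis_of ({\<omega>}\<^sup>\<bottom>) B)"

section \<open>Coordinates along a direction and in its hyperplane\<close>

locale unit_direction =
 fixes \<omega> :: "'z::euclidean_space"
 assumes unit: "norm \<omega> = 1"
begin

abbreviation "B \<equiv> hyperplane_basis \<omega>"

definition P :: "('z \<Rightarrow> real) measure" where "P = (\<Pi>\<^sub>M b\<in>B. lborel)"

definition T :: "real \<times> ('z \<Rightarrow> real) \<Rightarrow> 'z" where "T q = fst q *\<^sub>R \<omega> + (\<Sum>b\<in>B. snd q b *\<^sub>R b)"

lemma B: "pairwise orthogonal B" "\<And>b. b \<in> B \<Longrightarrow> norm b = 1" "span B = {\<omega>}\<^sup>\<bottom>"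
proof -
 obtain B' where "B' \<subseteq> {\<omega>}\<^sup>\<bottom>" "pairwise orthogonal B'" "\<And>x. x \<in> B' \<Longrightarrow> norm x = 1" "independent B'" "span B' = {\<omega>}\<^sup>\<bottom>"
  using orthonormal_basis_subspace[OF subspace_orthogonal_comp[of "{\<omega>}"]] by metis
 then have "orthonormal_basis_of ({\<omega>}\<^sup>\<bottom>) B'" by (auto simp: orthonormal_basis_of_def)
 then have "orthonormal_basis_of ({\<omega>}\<^sup>\<bottom>) B" unfolding hyperplane_basis_def by (rule someI)
 then show "pairwise orthogonal B" "\<And>b. b \<in> B \<Longrightarrow> norm b = 1" "span B = {\<omega>}\<^sup>\<bottom>"
  by (auto simp: orthonormal_basis_of_def)
qed

lemma finite_B: "finite B"
proof -
 have "0 \<notin> B" using B(2) by force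
 then show ?thesis by (rule independent_imp_finite[OF pairwise_orthogonal_independent[OF B(1)]])
qed

lemma B_orth: "b \<in> B \<Longrightarrow> b \<bullet> \<omega> = 0"
 using B(3) span_base[of b B] by (simp add: orthogonal_comp_def orthogonal_def inner_commute)

lemma T_inner: "T q \<bullet> \<omega> = fst q" "b \<in> B \<Longrightarrow> T q \<bullet> b = snd q b"
proof -
 have "(\<Sum>b\<in>B. snd q b *\<^sub>R b) \<bullet> \<omega> = 0" by (simp add: inner_sum_left B_orth)
 moreover have "\<omega> \<bullet> \<omega> = 1" using unit by (simp add: norm_eq_1)
 ultimately show "T q \<bullet> \<omega> = fst q" by (simp add: T_def inner_add_left)
 assume b: "b \<in> B"
 have "(\<Sum>b'\<in>B. snd q b' *\<^sub>R b') \<bullet> b = (\<Sum>b'\<in>B. if b' = b then snd q b else 0)"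
  unfolding inner_sum_left using B(1,2) b by (intro sum.cong) (auto simp: pairwise_def orthogonal_def norm_eq_1)
 then show "T q \<bullet> b = snd q b" using b finite_B B_orth[OF b] by (simp add: T_def inner_add_left inner_commute[of \<omega> b])
qed

lemma T_expand: "T (t \<bullet> \<omega>, \<lambda>b. t \<bullet> b) = t"
proof -
 define r where "r = t - (t \<bullet> \<omega>) *\<^sub>R \<omega>"
 have "r \<in> span B" unfolding B(3) using unit by (simp add: r_def orthogonal_comp_def orthogonal_def inner_diff_right norm_eq_1 inner_commute)
 then have "(\<Sum>b\<in>B. (r \<bullet> b) *\<^sub>R b) = r" by (intro orthonormal_basis_expand B finite_B)
 moreover have "(\<Sum>b\<in>B. (r \<bullet> b) *\<^sub>R b) = (\<Sum>b\<in>B. (t \<bullet> b) *\<^sub>R b)"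
  by (intro sum.cong refl) (simp add: r_def inner_diff_left B_orth inner_commute[of \<omega>])
 ultimately have "(\<Sum>b\<in>B. (t \<bullet> b) *\<^sub>R b) = t - (t \<bullet> \<omega>) *\<^sub>R \<omega>" by (simp only: r_def)
 then show ?thesis by (simp add: T_def)
qed

lemma abs_fst_le: "abs (fst q) \<le> norm (T q)"
 using Cauchy_Schwarz_ineq2[of "T q" \<omega>] unit by (simp add: T_inner)

sublocale PS: sigma_finite_measure P
 unfolding P_def by (rule product_sigma_finite.sigma_finite[OF _ finite_B]) (rule product_sigma_finite.intro, rule sigma_finite_lborel)

lemma T_borel [measurable]: "T \<in> measurable (borel \<Otimes>\<^sub>M P) borel"
proof -
 have [measurable]: "(\<lambda>q. snd q b) \<in> measurable (borel \<Otimes>\<^sub>M P) borel" if "b \<in> B" for b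
  using that unfolding P_def by measurable
 show ?thesis unfolding T_def by measurable
qed

text \<open>The shifted point is restricted to \<open>B\<close> because the product space consists
  of functions with the default value outside \<open>B\<close>.\<close>

lemma nn_integral_P_translate:
 assumes h: "h \<in> borel_measurable P"
 shows "(\<integral>\<^sup>+y. h (\<lambda>b\<in>B. y b + x b) \<partial>P) = (\<integral>\<^sup>+y. h y \<partial>P)"
proof -
 interpret product_sigma_finite "\<lambda>_::'z. lborel :: real measure" ..
 let ?s = "\<lambda>y. \<lambda>b\<in>B. y b + x b"
 have s[measurable]: "?s \<in> measurable P P" unfolding P_def by measurable
 have "distr P P ?s = P" unfolding P_def
 proof (rule PiM_eqI)
  fix A :: "'z \<Rightarrow> real set" assume A: "\<And>i. i \<in> B \<Longrightarrow> A i \<in> sets lborel"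
  have shift: "emeasure lborel ((\<lambda>y. y + x i) -` A i) = emeasure lborel (A i)" if "i \<in> B" for i
  proof -
   have [measurable]: "A i \<in> sets borel" using A[OF that] by simp
   have "emeasure lborel ((\<lambda>y. y + x i) -` A i) = (NN y. indicator ((\<lambda>y. y + x i) -` A i) y)"
    by (rule nn_integral_indicator[symmetric], simp, rule measurable_sets_borel[of _ borel]) measurable
   also have "... = (NN y. indicator (A i) (y + x i))" by (simp add: indicator_def)
   also have "... = (NN y. indicator (A i) y)" by (rule nn_integral_translate(1)) measurable
   finally show ?thesis by simp
  qed
  have "?s -` Pi\<^sub>E B A \<inter> space (\<Pi>\<^sub>M b\<in>B. lborel) = Pi\<^sub>E B (\<lambda>i. (\<lambda>y. y + x i) -` A i)"
   by (auto simp: space_PiM PiE_iff)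
  moreover have "(\<lambda>y. y + x i) -` A i \<in> sets lborel" if "i \<in> B" for i
  proof -
   have [measurable]: "A i \<in> sets borel" using A[OF that] by simp
   show ?thesis by (simp, rule measurable_sets_borel[of _ borel]) measurable
  qed
  ultimately show "emeasure (distr (\<Pi>\<^sub>M b\<in>B. lborel) (\<Pi>\<^sub>M b\<in>B. lborel) ?s) (Pi\<^sub>E B A) = (\<Prod>i\<in>B. emeasure lborel (A i))"
   using A s unfolding P_def by (subst emeasure_distr) (auto simp: emeasure_PiM finite_B shift sets_PiM_I_finite)
 qed (auto simp: finite_B)
 then show ?thesis using nn_integral_distr[OF s, of h] h by simp
qed

text \<open>A translation of the target splits into a shift of \<open>a\<close> and one of each
  hyperplane coordinate. In dimension one \<open>B\<close> is empty and \<open>P\<close> is a unit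
  mass.\<close>

lemma coordinates: "\<exists>c>0. distr (lborel \<Otimes>\<^sub>M P) borel T = density lborel (\<lambda>_. ennreal c)"
proof -
 interpret pair_sigma_finite "lborel :: real measure" P ..
 have Tm[measurable]: "T \<in> measurable (lborel \<Otimes>\<^sub>M P) borel" using T_borel by (simp cong: measurable_cong_sets)
 show ?thesis
 proof (rule distr_translation_invariant[of "lborel \<Otimes>\<^sub>M P" T])
  show "(\<integral>\<^sup>+q. h (T q + t) \<partial>(lborel \<Otimes>\<^sub>M P)) = (\<integral>\<^sup>+q. h (T q) \<partial>(lborel \<Otimes>\<^sub>M P))" if [measurable]: "h \<in> Borel" for h t
  proof -
   have e: "h (T (a, y) + t) = h (T (a + t \<bullet> \<omega>, \<lambda>b\<in>B. y b + t \<bullet> b))" for a y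
    using T_expand[of t] by (intro arg_cong[where f=h]) (simp add: T_def scaleR_add_left sum.distrib algebra_simps)
   have "(\<integral>\<^sup>+q. h (T q + t) \<partial>(lborel \<Otimes>\<^sub>M P)) = (NN a. \<integral>\<^sup>+y. h (T (a + t \<bullet> \<omega>, \<lambda>b\<in>B. y b + t \<bullet> b)) \<partial>P)"
    using PS.nn_integral_fst[of "\<lambda>q. h (T q + t)" lborel] by (simp add: e)
   also have "... = (NN a. \<integral>\<^sup>+y. h (T (a + t \<bullet> \<omega>, y)) \<partial>P)"
    by (intro nn_integral_cong nn_integral_P_translate) measurable
   also have "... = (NN a. \<integral>\<^sup>+y. h (T (a, y)) \<partial>P)"
    by (rule nn_integral_translate(1)[of "\<lambda>a. \<integral>\<^sup>+y. h (T (a, y)) \<partial>P"]) measurable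
   also have "... = (\<integral>\<^sup>+q. h (T q) \<partial>(lborel \<Otimes>\<^sub>M P))" by (rule PS.nn_integral_fst) measurable
   finally show ?thesis .
  qed
  obtain R where R: "\<And>t::'z. t \<in> box 0 One \<Longrightarrow> norm t \<le> R" using bounded_box[of 0 One] by (auto simp: bounded_iff)
  have "T -` box 0 One \<inter> space (lborel \<Otimes>\<^sub>M P) \<subseteq> {-R..R} \<times> Pi\<^sub>E B (\<lambda>_. {-R..R})"
  proof
   fix q assume q: "q \<in> T -` box 0 One \<inter> space (lborel \<Otimes>\<^sub>M P)"
   then have n: "norm (T q) \<le> R" using R by simp
   have "abs (snd q b) \<le> R" if "b \<in> B" for b using Cauchy_Schwarz_ineq2[of "T q" b] that n by (simp add: T_inner B(2))
   moreover have "abs (fst q) \<le> R" using abs_fst_le[of q] n by linarith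
   ultimately show "q \<in> {-R..R} \<times> Pi\<^sub>E B (\<lambda>_. {-R..R})"
    using q by (auto simp: space_pair_measure P_def space_PiM PiE_iff abs_le_iff mem_Times_iff minus_le_iff)
  qed
  then have "emeasure (lborel \<Otimes>\<^sub>M P) (T -` box 0 One \<inter> space (lborel \<Otimes>\<^sub>M P)) \<le> emeasure (lborel \<Otimes>\<^sub>M P) ({-R..R} \<times> Pi\<^sub>E B (\<lambda>_. {-R..R}))"
   by (rule emeasure_mono) (auto intro!: pair_measureI sets_PiM_I_finite finite_B simp: P_def)
  also have "... = emeasure lborel {-R..R} * emeasure P (Pi\<^sub>E B (\<lambda>_. {-R..R}))"
   by (intro PS.emeasure_pair_measure_Times) (auto intro!: sets_PiM_I_finite finite_B simp: P_def)
  also have "emeasure P (Pi\<^sub>E B (\<lambda>_. {-R..R})) = (\<Prod>b\<in>B. emeasure lborel {-R..R})"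
   unfolding P_def by (subst product_sigma_finite.emeasure_PiM[OF _ finite_B]) (auto intro: product_sigma_finite.intro sigma_finite_lborel)
  also have "emeasure lborel {-R..R} * (\<Prod>b\<in>B. emeasure lborel {-R..R}) < \<infinity>"
   by (simp add: ennreal_mult_less_top power_less_top_ennreal emeasure_lborel_Icc_eq less_top)
  finally show "emeasure (lborel \<Otimes>\<^sub>M P) (T -` box 0 One \<inter> space (lborel \<Otimes>\<^sub>M P)) < \<infinity>" .
  have "emeasure P (space P) \<noteq> 0"
   unfolding P_def space_PiM by (subst product_sigma_finite.emeasure_PiM[OF _ finite_B]) (auto intro: product_sigma_finite.intro sigma_finite_lborel)
  then show "emeasure (lborel \<Otimes>\<^sub>M P) (space (lborel \<Otimes>\<^sub>M P)) \<noteq> 0"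
   unfolding space_pair_measure by (subst PS.emeasure_pair_measure_Times) auto
 qed (auto intro: sigma_finite_measure_axioms)
qed

lemma partial_radon_eq:
 assumes [measurable]: "g \<in> Borel"
 shows "partial_radon g \<omega> z a = (\<integral>y. g (z, T (a, y)) \<partial>P)"
proof -
 have "(\<lambda>t. g (z, t)) \<in> Borel"
  by (rule measurable_compose[OF _ assms]) (intro borel_measurable_continuous_onI continuous_intros)
 moreover have "(\<lambda>y. T (a, y)) \<in> measurable P borel" by measurable
 ultimately show ?thesis using integral_distr[of "\<lambda>y. T (a, y)" P borel "\<lambda>t. g (z, t)"]
  by (simp add: partial_radon_def hyperplane_lebesgue_def Let_def hyperplane_basis_def[symmetric] P_def T_def)
qed

end

section \<open>Consequences of the integrability condition\<close>

text \<open>Extended valued, because the central Fourier transform may fail to be square integrable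
  at some frequencies.\<close>

definition L2_norm :: "('a::euclidean_space \<Rightarrow> complex) \<Rightarrow> ennreal" where
 "L2_norm h = (let S = (NN x. nrmsq (h x))
  in if S = \<infinity> then \<infinity> else ennreal (sqrt (enn2real S)))"

lemma L2_norm_power2: "(L2_norm h)\<^sup>2 = (NN x. nrmsq (h x))"
 by (cases "NN x. nrmsq (h x)") (auto simp: L2_norm_def Let_def ennreal_power)

lemma ennreal_power2_le_imp_le: "a\<^sup>2 \<le> b\<^sup>2 \<Longrightarrow> a \<le> (b::ennreal)"
 by (cases a; cases b) (auto simp: ennreal_power top_unique power_eq_top_ennreal intro!: ennreal_leI dest: power2_le_imp_le)

lemma L2_norm_eq_0:
 assumes [measurable]: "h \<in> Borel" and z: "L2_norm h = 0"
 shows "AE x in lborel. h x = 0"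
proof -
 have "(NN x. nrmsq (h x)) = 0" using z by (simp add: L2_norm_power2[symmetric])
 then have "AE x in lborel. nrmsq (h x) = 0" by (subst (asm) nn_integral_0_iff_AE) auto
 then show ?thesis by eventually_elim simp
qed

lemma borel_measurable_ft [measurable]:
 fixes f :: "'v::euclidean_space \<times> 'z::euclidean_space \<Rightarrow> complex"
 assumes "f \<in> Borel"
 shows "(\<lambda>q. (LBINT t. f (snd q, t) * cis (fst q \<bullet> t))) \<in> borel_measurable (borel \<Otimes>\<^sub>M borel)"
proof -
 have [measurable]: "f \<in> borel_measurable (borel \<Otimes>\<^sub>M borel)" unfolding borel_prod by fact
 show ?thesis by measurable
qed

text \<open>In frame coordinates this is the estimate for the Weyl transform. The unknown ratio of
  the Lebesgue measures enters \<open>c\<close>, and \<open>(2 * pi) ^ CARD('n)\<close> is replaced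
  by the smaller value 1.\<close>

lemma (in orthonormal_frame) hs_norm_group_fourier_ge:
 fixes f :: "'v \<times> 'z::euclidean_space \<Rightarrow> complex"
 assumes f: "integrable lborel f"
 shows "\<exists>c>0. \<forall>\<nu>. \<nu> \<noteq> 0 \<longrightarrow> ennreal c * L2_norm (\<lambda>z. (LBINT t. f (z, t) * cis ((\<nu> *\<^sub>R \<omega>) \<bullet> t)))
  \<le> ennreal (abs \<nu> powr (real CARD('n) / 2)) * hs_norm (group_fourier E E' f \<nu> \<omega>)"
proof -
 obtain c where c: "c > 0" "distr lborel borel T = density lborel (\<lambda>_. ennreal c)" using coordinates by blast
 have fb[measurable]: "f \<in> Borel" using f by (auto dest: borel_measurable_integrable)
 have [measurable]: "f \<in> borel_measurable (borel \<Otimes>\<^sub>M borel)" unfolding borel_prod by (rule fb)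
 have Tl: "T \<in> measurable lborel borel" by simp
 define F where "F p = f (T (fst p), snd p)" for p :: "((real^'n) \<times> (real^'n)) \<times> 'z"
 have F: "integrable lborel F"
 proof (rule integrable_pairI)
  have "F \<in> borel_measurable (borel \<Otimes>\<^sub>M borel)" unfolding F_def by measurable
  then show "F \<in> Borel" by (simp only: borel_prod)
  have "(NN q. NN t. nrm (F (q, t))) = ennreal c * (NN z. NN t. nrm (f (z, t)))"
   using nn_integral_linear_coordinates[OF c(2) Tl, of "\<lambda>z. (NN t. nrm (f (z, t)))"] by (simp add: F_def)
  also have "... = ennreal c * (NN p. nrm (f p))" by (subst tonelli_1) simp_all
  finally show "(NN q. NN t. nrm (F (q, t))) < \<infinity>" using f by (simp add: ennreal_mult_less_top integrable_iff_bounded)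
 qed
 have "ennreal (sqrt c) * L2_norm (\<lambda>z. (LBINT t. f (z, t) * cis ((\<nu> *\<^sub>R \<omega>) \<bullet> t)))
  \<le> ennreal (abs \<nu> powr (real CARD('n) / 2)) * hs_norm (group_fourier E E' f \<nu> \<omega>)" if \<nu>: "\<nu> \<noteq> 0" for \<nu>
 proof (rule ennreal_power2_le_imp_le)
  let ?h = "\<lambda>z. (LBINT t. f (z, t) * cis ((\<nu> *\<^sub>R \<omega>) \<bullet> t))"
  have "1 \<le> (2 * pi) ^ CARD('n)" using pi_gt3 by (intro one_le_power) simp
  then have "1 * (ennreal c * (NN z. nrmsq (?h z))) \<le> ennreal ((2 * pi) ^ CARD('n)) * (ennreal c * (NN z. nrmsq (?h z)))"
   using ennreal_leI[of 1 "(2 * pi) ^ CARD('n)"] by (intro mult_right_mono) auto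
  also have "ennreal ((2 * pi) ^ CARD('n)) * (ennreal c * (NN z. nrmsq (?h z)))
   = ennreal ((2 * pi) ^ CARD('n)) * (NN q. nrmsq (?h (T q)))" by (subst nn_integral_linear_coordinates[OF c(2) Tl]) measurable
  also have "(NN q. nrmsq (?h (T q))) = (NN q. nrmsq (LBINT t. F (q, t) * cis (\<nu> * (t \<bullet> \<omega>))))"
   by (simp add: F_def inner_commute)
  also have "ennreal ((2 * pi) ^ CARD('n)) * ... \<le> ennreal (abs \<nu> ^ CARD('n)) *
   (hs_norm (\<lambda>\<phi> \<xi>. \<integral>((x, u), t). F ((x, u), t) * schroedinger_rep \<omega> \<nu> x u t \<phi> \<xi> \<partial>lborel))\<^sup>2"
   by (rule weyl_transform_hs_norm_ge[OF F \<nu>])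
  also have "(\<lambda>\<phi> \<xi>. \<integral>((x, u), t). F ((x, u), t) * schroedinger_rep \<omega> \<nu> x u t \<phi> \<xi> \<partial>lborel) = group_fourier E E' f \<nu> \<omega>"
   by (simp add: fun_eq_iff group_fourier_def F_def T_def)
  also have "abs \<nu> ^ CARD('n) = (abs \<nu> powr (real CARD('n) / 2))\<^sup>2" using \<nu> by (simp add: powr_realpow[symmetric] powr_powr)
  finally show "(ennreal (sqrt c) * L2_norm ?h)\<^sup>2 \<le> (ennreal (abs \<nu> powr (real CARD('n) / 2)) * hs_norm (group_fourier E E' f \<nu> \<omega>))\<^sup>2"
   using c(1) by (simp add: power_mult_distrib L2_norm_power2 ennreal_power)
 qed
 then show ?thesis using c(1) by (intro exI[of _ "sqrt c"]) auto
qed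

section \<open>The condition for all directions together\<close>

text \<open>The assumption on \<open>M1\<close> puts the weight \<open>w\<close> in
  \<open>L\<^sup>2\<close>, which turns \<open>L\<^sup>2\<close> norms of central Fourier transforms
  into weighted \<open>L\<^sup>1\<close> norms.\<close>

locale beurling_hypothesis =
 fixes f g :: "'v::euclidean_space \<times> 'z::euclidean_space \<Rightarrow> complex" and E E' :: "'z \<Rightarrow> 'n::finite \<Rightarrow> 'v" and M1 M2 s :: real
 assumes frame: "\<And>\<omega>. norm \<omega> = 1 \<Longrightarrow> orthonormal_frame (E \<omega>) (E' \<omega>)"
  and f: "integrable lborel f" and s: "s \<ge> 0" and g: "is_central_frac_laplacian s f g"
  and M1: "2 * M1 > real DIM('v)" and M2: "M2 \<ge> 0"
  and beurling: "\<And>\<omega>. norm \<omega> = 1 \<Longrightarrow>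
   (\<integral>\<^sup>+(z, t). (NN \<nu>.
     ennreal (norm (g (z, t)) * exp (norm t * abs \<nu>) * abs \<nu> powr (real CARD('n) + 2 * s)
          / ((1 + norm z) powr M1 * (1 + abs \<nu> + norm t) powr M2))
     * hs_norm (group_fourier (E \<omega>) (E' \<omega>) f \<nu> \<omega>)) \<partial>lborel) < \<infinity>"
begin

definition "w z = (1 + norm z) powr (- M1)" for z :: 'v

definition "F \<mu> z = (LBINT t. f (z, t) * cis (\<mu> \<bullet> t))"

definition "N \<omega> \<nu> = L2_norm (F (\<nu> *\<^sub>R \<omega>))"

text \<open>Half of the power \<open>CARD('n)\<close> in the condition is spent on bounding
  \<open>N\<close> by the Hilbert--Schmidt norm; \<open>CARD('n) / 2\<close> remains here.\<close>

definition "weight p \<nu> = norm (g p) * w (fst p) *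
 (exp (norm (snd p) * abs \<nu>) * abs \<nu> powr (real CARD('n) / 2 + 2 * s) / (1 + abs \<nu> + norm (snd p)) powr M2)"

lemma w_pos: "w z > 0" by (simp add: w_def add_nonneg_eq_0_iff)

lemma M1_pos: "M1 > 0" using M1 by (smt (verit) of_nat_0_le_iff)

lemma w_le: "w z \<le> 1" using M1_pos powr_mono2'[of "- M1" 1 "1 + norm z"] by (simp add: w_def)

lemma w_continuous: "continuous_on UNIV w"
proof -
 have nz: "1 + norm z \<noteq> 0" for z :: 'v by (metis add_pos_nonneg less_irrefl norm_ge_zero zero_less_one)
 show ?thesis unfolding w_def[abs_def] by (intro continuous_intros ballI nz)
qed

lemma w_borel [measurable]: "w \<in> Borel" by (intro borel_measurable_continuous_onI w_continuous)

lemma f_borel [measurable]: "f \<in> Borel" "f \<in> borel_measurable (borel \<Otimes>\<^sub>M borel)"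
 using f unfolding borel_prod by (auto dest: borel_measurable_integrable)

lemma g_borel [measurable]: "g \<in> Borel" "g \<in> borel_measurable (borel \<Otimes>\<^sub>M borel)"
 using g unfolding borel_prod by (auto simp: is_central_frac_laplacian_def)

lemma F_borel [measurable (raw)]:
 assumes [measurable]: "a \<in> borel_measurable M" "b \<in> borel_measurable M"
 shows "(\<lambda>x. F (a x) (b x)) \<in> borel_measurable M"
 using measurable_compose[OF _ borel_measurable_ft[OF f_borel(1)], of "\<lambda>x. (a x, b x)" M] by (simp add: F_def)

lemma N_borel [measurable]: "N \<omega> \<in> Borel"
 unfolding N_def L2_norm_def Let_def by measurable

lemma weight_borel [measurable (raw)]:
 assumes [measurable]: "a \<in> borel_measurable M" "b \<in> borel_measurable M"
 shows "(\<lambda>x. weight (a x) (b x)) \<in> borel_measurable M"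
 unfolding weight_def by measurable

lemma weight_nonneg: "weight p \<nu> \<ge> 0" using w_pos[of "fst p"] by (simp add: weight_def)

lemma weighted_integral_finite:
 assumes \<omega>: "norm \<omega> = 1"
 shows "(NN p. NN \<nu>. ennreal (weight p \<nu>) * N \<omega> \<nu>) < \<infinity>"
  and "(NN \<nu>. NN p. ennreal (weight p \<nu>) * N \<omega> \<nu>) < \<infinity>"
proof -
 interpret orthonormal_frame "E \<omega>" "E' \<omega>" by (rule frame[OF \<omega>])
 obtain c where c: "c > 0" "\<And>\<nu>. \<nu> \<noteq> 0 \<Longrightarrow> ennreal c * N \<omega> \<nu> \<le> ennreal (abs \<nu> powr (real CARD('n) / 2)) * hs_norm (group_fourier (E \<omega>) (E' \<omega>) f \<nu> \<omega>)"
  using hs_norm_group_fourier_ge[OF f, of \<omega>] unfolding N_def F_def by blast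
 have "ennreal c * (NN p. NN \<nu>. ennreal (weight p \<nu>) * N \<omega> \<nu>)
  = (NN p. NN \<nu>. ennreal (weight p \<nu>) * (ennreal c * N \<omega> \<nu>))"
 proof -
  have "(NN \<nu>. ennreal (weight p \<nu>) * (ennreal c * N \<omega> \<nu>)) = ennreal c * (NN \<nu>. ennreal (weight p \<nu>) * N \<omega> \<nu>)" for p
   by (subst nn_integral_cmult[symmetric]) (measurable, simp add: mult_ac)
  then show ?thesis by (simp add: nn_integral_cmult)
 qed
 also have "... \<le> (\<integral>\<^sup>+(z, t). (NN \<nu>.
     ennreal (norm (g (z, t)) * exp (norm t * abs \<nu>) * abs \<nu> powr (real CARD('n) + 2 * s)
          / ((1 + norm z) powr M1 * (1 + abs \<nu> + norm t) powr M2))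
     * hs_norm (group_fourier (E \<omega>) (E' \<omega>) f \<nu> \<omega>)) \<partial>lborel)"
 proof (rule nn_integral_mono, simp only: split_beta, rule nn_integral_mono)
  fix p :: "'v \<times> 'z" and \<nu> :: real
  let ?h = "hs_norm (group_fourier (E \<omega>) (E' \<omega>) f \<nu> \<omega>)"
  show "ennreal (weight p \<nu>) * (ennreal c * N \<omega> \<nu>) \<le> ennreal (norm (g (fst p, snd p)) * exp (norm (snd p) * abs \<nu>) * abs \<nu> powr (real CARD('n) + 2 * s)
          / ((1 + norm (fst p)) powr M1 * (1 + abs \<nu> + norm (snd p)) powr M2)) * ?h"
  \<comment> \<open>At frequency 0 the weight is 0, since \<open>0 powr x\<close> is 0.\<close>
  proof (cases "\<nu> = 0")
   case False
   have q: "abs \<nu> powr (real CARD('n) + 2 * s) = abs \<nu> powr (real CARD('n) / 2 + 2 * s) * abs \<nu> powr (real CARD('n) / 2)"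
    by (simp add: powr_add[symmetric])
   have e: "norm (g (fst p, snd p)) * exp (norm (snd p) * abs \<nu>) * abs \<nu> powr (real CARD('n) + 2 * s)
          / ((1 + norm (fst p)) powr M1 * (1 + abs \<nu> + norm (snd p)) powr M2) = weight p \<nu> * abs \<nu> powr (real CARD('n) / 2)"
    unfolding q weight_def w_def powr_minus divide_inverse prod.collapse inverse_mult_distrib by (simp only: mult_ac)
   have "ennreal (weight p \<nu>) * (ennreal c * N \<omega> \<nu>) \<le> ennreal (weight p \<nu>) * (ennreal (abs \<nu> powr (real CARD('n) / 2)) * ?h)"
    by (intro mult_left_mono c False) simp
   then show ?thesis unfolding e by (simp add: ennreal_mult weight_nonneg mult.assoc)
  qed (simp add: weight_def)
 qed
 also have "... < \<infinity>" by (rule beurling[OF \<omega>])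
 finally show *: "(NN p. NN \<nu>. ennreal (weight p \<nu>) * N \<omega> \<nu>) < \<infinity>" using c(1) by (auto simp: ennreal_mult_less_top)
 have "(\<lambda>(p, \<nu>). ennreal (weight p \<nu>) * N \<omega> \<nu>) \<in> borel_measurable (lborel \<Otimes>\<^sub>M lborel)"
  unfolding split_beta by measurable
 from lborel_pair.Fubini'[OF this] * show "(NN \<nu>. NN p. ennreal (weight p \<nu>) * N \<omega> \<nu>) < \<infinity>" by simp
qed

text \<open>Lines through the origin cover the frequency space, so the central Fourier transform of
  \<open>f\<close> vanishes and \<open>f\<close> is zero. Then \<open>g\<close> vanishes as a
  distribution, tested on bumps.\<close>

lemma g_zero_of_N_zero:
 assumes z: "\<And>\<omega>. norm \<omega> = 1 \<Longrightarrow> AE \<nu> in lborel. N \<omega> \<nu> = 0"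
 shows "AE p in lborel. g p = 0"
proof -
 have fi: "AE z in lborel. integrable lborel (\<lambda>t. f (z, t))" by (rule fubini_1(2)[OF f])
 have Fz: "F \<mu> z = fourier (\<lambda>t. f (z, t)) \<mu>" for \<mu> z by (simp add: F_def fourier_def inner_commute)
 \<comment> \<open>Continuity upgrades almost every \<open>\<nu>\<close> to every
   \<open>\<nu>\<close> on the line, so the exceptional set of \<open>z\<close> depends on
   \<open>\<omega>\<close> only.\<close>
 have line: "AE z in lborel. \<forall>\<nu>. F (\<nu> *\<^sub>R \<omega>) z = 0" if \<omega>: "norm \<omega> = 1" for \<omega>
 proof -
  have "{q \<in> space (borel \<Otimes>\<^sub>M borel). F (snd q *\<^sub>R \<omega>) (fst q) = 0} \<in> sets (borel \<Otimes>\<^sub>M borel)" by measurable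
  then have meas: "{q. F (snd q *\<^sub>R \<omega>) (fst q) = 0} \<in> sets borel" unfolding borel_prod by simp
  have "AE \<nu> in lborel. AE z in lborel. F (\<nu> *\<^sub>R \<omega>) z = 0"
   using z[OF \<omega>] by eventually_elim (simp add: N_def L2_norm_eq_0)
  then have "AE z in lborel. AE \<nu> in lborel. F (\<nu> *\<^sub>R \<omega>) z = 0" using AE_pair_lborel[OF meas] by simp
  then show ?thesis using fi
  proof eventually_elim
   case (elim z)
   show ?case
   proof
    fix \<nu> :: real
    show "F (\<nu> *\<^sub>R \<omega>) z = 0"
    proof (rule AE_continuous_zero[where S=UNIV and f="\<lambda>\<nu>. F (\<nu> *\<^sub>R \<omega>) z" and x=\<nu>])
     show "isCont (\<lambda>\<nu>. F (\<nu> *\<^sub>R \<omega>) z) \<nu>" for \<nu>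
      unfolding Fz by (intro isCont_o2[where f="\<lambda>\<nu>. \<nu> *\<^sub>R \<omega>" and g="fourier (\<lambda>t. f (z, t))"] continuous_fourier elim continuous_intros)
    qed (use elim in auto)
   qed
  qed
 qed
 have all: "AE z in lborel. F \<mu> z = 0" for \<mu>
 proof -
  obtain \<omega> :: 'z where \<omega>: "norm \<omega> = 1" "\<mu> = norm \<mu> *\<^sub>R \<omega>"
  proof (cases "\<mu> = 0")
   case True
   obtain b :: 'z where "b \<in> Basis" using nonempty_Basis by blast
   then show ?thesis using True by (intro that[of b]) auto
  next
   case False
   then show ?thesis by (intro that[of "sgn \<mu>"]) (simp_all add: norm_sgn sgn_div_norm)
  qed
  show ?thesis using line[OF \<omega>(1)] by eventually_elim (metis \<omega>(2))
 qed
 have "AE z in lborel. AE \<mu> in lborel. F \<mu> z = 0"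
 proof -
  have "{q \<in> space (borel \<Otimes>\<^sub>M borel). F (snd q) (fst q) = 0} \<in> sets (borel \<Otimes>\<^sub>M borel)" by measurable
  then have "{q. F (snd q) (fst q) = 0} \<in> sets borel" unfolding borel_prod by simp
  from AE_pair_lborel[OF this] show ?thesis using all by simp
 qed
 then have "AE z in lborel. AE t in lborel. f (z, t) = 0" using fi by eventually_elim (rule fourier_zero_imp, auto simp: Fz)
 moreover have "{p \<in> space (borel \<Otimes>\<^sub>M borel). f p = 0} \<in> sets (borel \<Otimes>\<^sub>M borel)" by measurable
 then have "{p. f p = 0} \<in> sets borel" unfolding borel_prod by simp
 ultimately have f0: "AE p in lborel. f p = 0" using AE_pair_lborel(1) by blast
 show ?thesis
 proof (rule AE_zero_of_product_bumps)
  show "loc_integrable g" using g by (simp add: loc_integrable_def is_central_frac_laplacian_def)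
  fix a b :: "'v \<times> 'z" and n assume ab: "\<And>i. i \<in> Basis \<Longrightarrow> a \<bullet> i \<le> b \<bullet> i"
  let ?\<phi> = "\<lambda>x. \<Prod>i\<in>Basis. cor (bump (a \<bullet> i) (b \<bullet> i) n (x \<bullet> i))"
  have "(LBINT p. g p * ?\<phi> p) = (LBINT p. f p * central_frac_laplacian s ?\<phi> p)"
   using g test_function_product_bump[OF ab] unfolding is_central_frac_laplacian_def by blast
  also have "... = 0" by (rule integral_eq_zero_AE) (use f0 in eventually_elim, simp)
  finally show "(LBINT p. g p * ?\<phi> p) = 0" .
 qed
qed

text \<open>One direction and one frequency with \<open>N \<omega> \<nu> \<noteq> 0\<close> suffice:
  the weight involves \<open>norm t\<close> rather than \<open>t \<bullet> \<omega>\<close>, so the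
  moment serves every direction. Half of the exponential rate pays for the denominator.\<close>

lemma exponential_moment:
 assumes nz: "\<not> (AE p in lborel. g p = 0)"
 shows "\<exists>\<delta>>0. (NN p. ennreal (norm (g p) * w (fst p) * exp (\<delta> * norm (snd p)))) < \<infinity>"
proof -
 obtain \<omega> where \<omega>: "norm \<omega> = 1" "\<not> (AE \<nu> in lborel. N \<omega> \<nu> = 0)" using g_zero_of_N_zero nz by blast
 have "AE \<nu> in lborel. (NN p. ennreal (weight p \<nu>) * N \<omega> \<nu>) \<noteq> \<infinity>"
  using weighted_integral_finite(2)[OF \<omega>(1)] by (intro nn_integral_noteq_infinite) auto
 moreover have "AE \<nu> in lborel. \<nu> \<noteq> (0::real)" by (rule AE_lborel_singleton)
 ultimately have ae: "AE \<nu> in lborel. \<nu> \<noteq> 0 \<and> (NN p. ennreal (weight p \<nu>) * N \<omega> \<nu>) \<noteq> \<infinity>" by eventually_elim simp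
 have "\<exists>\<nu>. \<nu> \<noteq> 0 \<and> (NN p. ennreal (weight p \<nu>) * N \<omega> \<nu>) \<noteq> \<infinity> \<and> N \<omega> \<nu> \<noteq> 0"
 proof (rule ccontr)
  assume no: "\<not> ?thesis"
  from ae have "AE \<nu> in lborel. N \<omega> \<nu> = 0" by (rule eventually_mono) (use no in blast)
  with \<omega>(2) show False by blast
 qed
 then obtain \<nu> where \<nu>: "\<nu> \<noteq> 0" "(NN p. ennreal (weight p \<nu>) * N \<omega> \<nu>) \<noteq> \<infinity>" "N \<omega> \<nu> \<noteq> 0" by blast

 have fin: "(NN p. ennreal (weight p \<nu>)) < \<infinity>" using \<nu>(2,3) by (simp add: nn_integral_multc ennreal_mult_eq_top_iff less_top)
 have "abs \<nu> / 2 > 0" using \<nu> by simp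
 then obtain C where C: "C > 0" "\<And>x. x \<ge> 0 \<Longrightarrow> (1 + x) powr M2 \<le> C * exp (abs \<nu> / 2 * x)" using powr_le_exp by blast
 define k where "k = abs \<nu> powr (real CARD('n) / 2 + 2 * s) / (C * exp (abs \<nu> / 2 * abs \<nu>))"
 have k: "k > 0" using C \<nu> by (simp add: k_def)
 have le: "k * (norm (g p) * w (fst p) * exp (abs \<nu> / 2 * norm (snd p))) \<le> weight p \<nu>" for p
 proof -
  let ?x = "abs \<nu> + norm (snd p)"
  have "(1 + ?x) powr M2 \<le> C * exp (abs \<nu> / 2 * abs \<nu>) * exp (abs \<nu> / 2 * norm (snd p))"
  proof -
   have "exp (abs \<nu> / 2 * ?x) = exp (abs \<nu> / 2 * abs \<nu>) * exp (abs \<nu> / 2 * norm (snd p))"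
    unfolding exp_add[symmetric] distrib_left ..
   then show ?thesis using C(2)[of ?x] by (simp only: mult.assoc) simp
  qed
  moreover have "0 < (1 + ?x) powr M2" by (simp add: add_nonneg_eq_0_iff)
  ultimately have "inverse (C * exp (abs \<nu> / 2 * abs \<nu>) * exp (abs \<nu> / 2 * norm (snd p))) \<le> inverse ((1 + ?x) powr M2)"
   by (intro le_imp_inverse_le)
  then have "exp (abs \<nu> * norm (snd p)) * inverse (C * exp (abs \<nu> / 2 * abs \<nu>) * exp (abs \<nu> / 2 * norm (snd p))) \<le> exp (abs \<nu> * norm (snd p)) * inverse ((1 + ?x) powr M2)"
   by (intro mult_left_mono) auto
  moreover have "exp (abs \<nu> * norm (snd p)) * inverse (C * exp (abs \<nu> / 2 * abs \<nu>) * exp (abs \<nu> / 2 * norm (snd p)))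
   = exp (abs \<nu> / 2 * norm (snd p)) / (C * exp (abs \<nu> / 2 * abs \<nu>))"
  proof -
   have e: "exp (abs \<nu> * norm (snd p)) = exp (abs \<nu> / 2 * norm (snd p)) * exp (abs \<nu> / 2 * norm (snd p))" by (simp add: exp_add[symmetric])
   have "x * x * inverse (y * x) = x / y" if "x \<noteq> 0" for x y :: real using that by (simp add: divide_inverse)
   then show ?thesis unfolding e using exp_not_eq_zero by blast
  qed
  ultimately have "exp (abs \<nu> / 2 * norm (snd p)) / (C * exp (abs \<nu> / 2 * abs \<nu>)) \<le> exp (norm (snd p) * abs \<nu>) / (1 + abs \<nu> + norm (snd p)) powr M2"
   by (simp only: divide_inverse mult.commute[of "norm (snd p)" "abs \<nu>"] add.assoc)
  then have "(norm (g p) * w (fst p) * abs \<nu> powr (real CARD('n) / 2 + 2 * s)) * (exp (abs \<nu> / 2 * norm (snd p)) / (C * exp (abs \<nu> / 2 * abs \<nu>)))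
   \<le> (norm (g p) * w (fst p) * abs \<nu> powr (real CARD('n) / 2 + 2 * s)) * (exp (norm (snd p) * abs \<nu>) / (1 + abs \<nu> + norm (snd p)) powr M2)"
   using w_pos[of "fst p"] by (intro mult_left_mono) auto
  then show ?thesis unfolding weight_def k_def divide_inverse by (simp only: mult_ac)
 qed
 have "ennreal k * (NN p. ennreal (norm (g p) * w (fst p) * exp (abs \<nu> / 2 * norm (snd p))))
  = (NN p. ennreal (k * (norm (g p) * w (fst p) * exp (abs \<nu> / 2 * norm (snd p)))))"
  using k w_pos by (subst nn_integral_cmult[symmetric]) (auto simp: ennreal_mult less_imp_le)
 also have "... \<le> (NN p. ennreal (weight p \<nu>))" by (intro nn_integral_mono ennreal_leI le)
 finally have "ennreal k * (NN p. ennreal (norm (g p) * w (fst p) * exp (abs \<nu> / 2 * norm (snd p)))) < \<infinity>"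
  using fin by (rule le_less_trans)
 then show ?thesis using k \<nu>(1) by (intro exI[of _ "abs \<nu> / 2"]) (auto simp: ennreal_mult_less_top)
qed

text \<open>These frequencies become interpolation nodes. At a point with
  \<open>g p \<noteq> 0\<close> the weight is positive for \<open>\<nu> \<noteq> 0\<close>, so a
  finite inner integral makes \<open>N \<omega> \<nu>\<close> finite for almost every
  \<open>\<nu>\<close>.\<close>

lemma N_finite_infinite:
 assumes nz: "\<not> (AE p in lborel. g p = 0)" and \<omega>: "norm \<omega> = 1"
 shows "infinite {\<nu>. \<nu> \<noteq> 0 \<and> N \<omega> \<nu> \<noteq> \<infinity>}"
proof
 assume fin: "finite {\<nu>. \<nu> \<noteq> 0 \<and> N \<omega> \<nu> \<noteq> \<infinity>}"
 have ae: "AE p in lborel. (NN \<nu>. ennreal (weight p \<nu>) * N \<omega> \<nu>) \<noteq> \<infinity>"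
  using weighted_integral_finite(1)[OF \<omega>] by (intro nn_integral_noteq_infinite) auto
 have "\<exists>p. g p \<noteq> 0 \<and> (NN \<nu>. ennreal (weight p \<nu>) * N \<omega> \<nu>) \<noteq> \<infinity>"
 proof (rule ccontr)
  assume no: "\<not> ?thesis"
  from ae have "AE p in lborel. g p = 0" by (rule eventually_mono) (use no in blast)
  with nz show False by blast
 qed
 then obtain p where p: "g p \<noteq> 0" "(NN \<nu>. ennreal (weight p \<nu>) * N \<omega> \<nu>) \<noteq> \<infinity>" by blast

 have "AE \<nu> in lborel. ennreal (weight p \<nu>) * N \<omega> \<nu> \<noteq> \<infinity>" using p(2) by (intro nn_integral_noteq_infinite) auto
 moreover have "finite ({\<nu>. \<nu> \<noteq> 0 \<and> N \<omega> \<nu> \<noteq> \<infinity>} \<union> {0})" using fin by simp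
 then have "AE \<nu> in lborel. \<nu> \<notin> {\<nu>. \<nu> \<noteq> 0 \<and> N \<omega> \<nu> \<noteq> \<infinity>} \<union> {0}"
  by (intro AE_not_in countable_imp_null_set_lborel countable_finite)
 ultimately have "AE \<nu>::real in lborel. False"
 proof eventually_elim
  case (elim \<nu>)
  then have "\<nu> \<noteq> 0" "N \<omega> \<nu> = \<infinity>" by auto
  moreover from this have "weight p \<nu> > 0"
   unfolding weight_def using p(1) w_pos[of "fst p"] by (intro mult_pos_pos divide_pos_pos) (auto simp: add_pos_nonneg add_nonneg_eq_0_iff)
  ultimately show False using elim(1) by (simp add: ennreal_mult_eq_top_iff)
 qed
 then show False using AE_iff_measurable[of UNIV lborel "\<lambda>_::real. False"] by simp
qed

end

section \<open>The partial Radon transform\<close>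

context unit_direction
begin

lemma T_lborel: "T \<in> measurable (lborel \<Otimes>\<^sub>M P) borel"
 using T_borel by (simp cong: measurable_cong_sets)

lemma nn_integral_radon:
 fixes H :: "'v::euclidean_space \<times> 'z \<Rightarrow> ennreal"
 assumes d: "distr (lborel \<Otimes>\<^sub>M P) borel T = density lborel (\<lambda>_. ennreal c)" and H: "H \<in> Borel"
 shows "(NN a. NN z. \<integral>\<^sup>+y. H (z, T (a, y)) \<partial>P) = ennreal c * (NN p. H p)"
proof -
 have [measurable]: "H \<in> borel_measurable (borel \<Otimes>\<^sub>M borel)" unfolding borel_prod by (rule H)
 note [measurable] = T_lborel
 have "(NN a. NN z. \<integral>\<^sup>+y. H (z, T (a, y)) \<partial>P) = (NN z. NN a. \<integral>\<^sup>+y. H (z, T (a, y)) \<partial>P)"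
  by (rule lborel_pair.Fubini') measurable
 also have "... = (NN z. \<integral>\<^sup>+q. H (z, T q) \<partial>(lborel \<Otimes>\<^sub>M P))"
  by (intro nn_integral_cong PS.nn_integral_fst) measurable
 also have "... = (NN z. ennreal c * (NN t. H (z, t)))" by (intro nn_integral_cong nn_integral_linear_coordinates[OF d T_lborel]) measurable
 also have "... = ennreal c * (NN p. H p)" by (simp add: nn_integral_cmult tonelli_1[OF H])
 finally show ?thesis .
qed

lemma partial_radon_borel:
 fixes g :: "'v::euclidean_space \<times> 'z \<Rightarrow> complex"
 assumes g: "g \<in> Borel"
 shows "(\<lambda>p. partial_radon g \<omega> (fst p) (snd p)) \<in> borel_measurable (borel \<Otimes>\<^sub>M borel)"
proof -
 have [measurable]: "g \<in> borel_measurable (borel \<Otimes>\<^sub>M borel)" unfolding borel_prod by (rule g)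
 show ?thesis unfolding partial_radon_eq[OF g] by measurable
qed

text \<open>Under the integral a weight in \<open>a\<close> may be exchanged for any weight in
  \<open>t\<close> that dominates it on the hyperplane of height \<open>a\<close>.\<close>

lemma nn_integral_partial_radon_le:
 fixes g :: "'v::euclidean_space \<times> 'z \<Rightarrow> complex"
 assumes d: "distr (lborel \<Otimes>\<^sub>M P) borel T = density lborel (\<lambda>_. ennreal c)" and g: "g \<in> Borel"
  and h: "h \<in> Borel" and h0: "h0 \<in> Borel" and le: "\<And>z q. h0 (z, fst q) \<le> h (z, T q)"
 shows "(NN p. nrm (partial_radon g \<omega> (fst p) (snd p)) * h0 p)
  \<le> ennreal c * (NN p. nrm (g p) * h p)"
proof -
 have [measurable]: "g \<in> borel_measurable (borel \<Otimes>\<^sub>M borel)" "h \<in> borel_measurable (borel \<Otimes>\<^sub>M borel)"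
  unfolding borel_prod by (rule g h)+
 note [measurable] = h0 g h
 have [measurable]: "(\<lambda>p. partial_radon g \<omega> (fst p) (snd p)) \<in> Borel"
  using partial_radon_borel[OF g] unfolding borel_prod .
 have "(NN p. nrm (partial_radon g \<omega> (fst p) (snd p)) * h0 p)
  = (NN a. NN z. nrm (partial_radon g \<omega> z a) * h0 (z, a))" by (subst tonelli_2) simp_all
 also have "... \<le> (NN a. NN z. \<integral>\<^sup>+y. nrm (g (z, T (a, y))) * h (z, T (a, y)) \<partial>P)"
 proof (intro nn_integral_mono)
  fix a z
  have "nrm (partial_radon g \<omega> z a) * h0 (z, a) \<le> (\<integral>\<^sup>+y. nrm (g (z, T (a, y))) \<partial>P) * h0 (z, a)"
   unfolding partial_radon_eq[OF g] by (intro mult_right_mono norm_integral_le_nn_integral) simp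
  also have "... = (\<integral>\<^sup>+y. nrm (g (z, T (a, y))) * h0 (z, a) \<partial>P)"
   by (rule nn_integral_multc[symmetric]) measurable
  also have "... \<le> (\<integral>\<^sup>+y. nrm (g (z, T (a, y))) * h (z, T (a, y)) \<partial>P)"
   using le[of z "(a, _)"] by (intro nn_integral_mono mult_left_mono) auto
  finally show "nrm (partial_radon g \<omega> z a) * h0 (z, a) \<le> (\<integral>\<^sup>+y. nrm (g (z, T (a, y))) * h (z, T (a, y)) \<partial>P)" .
 qed
 also have "... = ennreal c * (NN p. nrm (g p) * h p)" by (rule nn_integral_radon[OF d]) measurable
 finally show ?thesis .
qed

text \<open>The Fourier slice theorem, stated for a single \<open>z\<close> because integrability in
  \<open>t\<close> is available only for almost every \<open>z\<close>.\<close>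

lemma fourier_partial_radon:
 fixes g :: "'v::euclidean_space \<times> 'z \<Rightarrow> complex"
 assumes d: "distr (lborel \<Otimes>\<^sub>M P) borel T = density lborel (\<lambda>_. ennreal c)" and c: "c > 0"
  and g: "g \<in> Borel" and gz: "integrable lborel (\<lambda>t. g (z, t))"
 shows "(LBINT a. partial_radon g \<omega> z a * cis (a * \<nu>)) = cor c * (LBINT t. g (z, t) * cis ((\<nu> *\<^sub>R \<omega>) \<bullet> t))"
proof -
 interpret pair_sigma_finite "lborel :: real measure" P ..
 let ?h = "\<lambda>t. g (z, t) * cis ((\<nu> *\<^sub>R \<omega>) \<bullet> t)"
 have h: "integrable lborel ?h" by (intro integrable_mult_cis gz) simp
 have "partial_radon g \<omega> z a * cis (a * \<nu>) = (\<integral>y. ?h (T (a, y)) \<partial>P)" for a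
  unfolding partial_radon_eq[OF g] by (simp add: T_inner inner_commute[of \<omega>] mult.commute)
 then have "(LBINT a. partial_radon g \<omega> z a * cis (a * \<nu>)) = (LBINT a. \<integral>y. ?h (T (a, y)) \<partial>P)" by simp
 also have "... = (\<integral>q. ?h (T q) \<partial>(lborel \<Otimes>\<^sub>M P))"
  by (rule integral_fst'[OF integral_linear_coordinates(1)[OF d c T_lborel h]])
 finally show ?thesis unfolding integral_linear_coordinates(2)[OF d c T_lborel h] .
qed

end

section \<open>The decomposition in a fixed direction\<close>

text \<open>Changing \<open>t\<close> to \<open>abs a\<close> in the denominator costs at most a
  power of \<open>1 + (t - abs a)\<close>. The exponential gains
  \<open>exp (abs \<nu> * (t - abs a))\<close>, which absorbs it once
  \<open>abs \<nu> \<ge> 1\<close>.\<close>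

lemma beurling_weight_le:
 assumes "M \<ge> 0"
 obtains C where "C > 0" "\<And>a t \<nu>. abs a \<le> t \<Longrightarrow> beurling_weight \<kappa> M a \<nu> \<le> C * (exp (t * abs \<nu>) * abs \<nu> powr \<kappa> / (1 + abs \<nu> + t) powr M)"
proof -
 obtain C where C: "C > 0" "\<And>x. x \<ge> 0 \<Longrightarrow> (1 + x) powr M \<le> C * exp (1 * x)" using powr_le_exp[of 1] by auto
 have "beurling_weight \<kappa> M a \<nu> \<le> C * (exp (t * abs \<nu>) * abs \<nu> powr \<kappa> / (1 + abs \<nu> + t) powr M)" if at: "abs a \<le> t" for a t \<nu>
 proof (cases "1 \<le> abs \<nu>")
  case True
  define r where "r = abs \<nu>"
  have r: "1 \<le> r" using True by (simp add: r_def)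
  have "(1 + r + t) powr M \<le> ((1 + abs a + r) * (1 + (t - abs a))) powr M"
  proof (rule powr_mono2)
   have "0 \<le> (abs a + r) * (t - abs a)" using at r by (intro mult_nonneg_nonneg) auto
   then show "1 + r + t \<le> (1 + abs a + r) * (1 + (t - abs a))" by (simp add: algebra_simps)
  qed (use assms at r in auto)
  also have "... = (1 + abs a + r) powr M * (1 + (t - abs a)) powr M" using at r by (intro powr_mult)
  also have "... \<le> (1 + abs a + r) powr M * (C * exp (r * (t - abs a)))"
  proof (rule mult_left_mono)
   have "1 * (t - abs a) \<le> r * (t - abs a)" using at r by (intro mult_right_mono) auto
   then have "C * exp (1 * (t - abs a)) \<le> C * exp (r * (t - abs a))" using C(1) by (intro mult_left_mono) auto
   then show "(1 + (t - abs a)) powr M \<le> C * exp (r * (t - abs a))" using C(2)[of "t - abs a"] at by linarith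
  qed simp
  finally have 1: "(1 + r + t) powr M \<le> (1 + abs a + r) powr M * (C * exp (r * (t - abs a)))" .
  have p: "0 < (1 + r + t) powr M" "0 < (1 + abs a + r) powr M" using at r by auto
  have "exp (abs a * r) * (1 + r + t) powr M \<le> exp (abs a * r) * ((1 + abs a + r) powr M * (C * exp (r * (t - abs a))))"
   by (rule mult_left_mono[OF 1]) simp
  also have "... = C * exp (t * r) * (1 + abs a + r) powr M"
  proof -
   have "exp (t * r) = exp (abs a * r) * exp (r * (t - abs a))" by (simp add: exp_add[symmetric] algebra_simps)
   then show ?thesis by (simp only: mult_ac)
  qed
  finally have "exp (abs a * r) / (1 + abs a + r) powr M \<le> C * exp (t * r) / (1 + r + t) powr M"
   using p by (simp add: divide_le_eq pos_le_divide_eq)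
  then have "r powr \<kappa> * (exp (abs a * r) / (1 + abs a + r) powr M) \<le> r powr \<kappa> * (C * exp (t * r) / (1 + r + t) powr M)"
   by (rule mult_left_mono) simp
  then show ?thesis using True unfolding beurling_weight_def r_def by (simp add: mult_ac)
 qed (use C(1) in \<open>simp add: beurling_weight_def\<close>)
 then show ?thesis using that[of C] C(1) by blast
qed

theorem (in beurling_hypothesis) partial_radon_decomposition:
 assumes \<omega>: "norm \<omega> = 1"
 shows "\<exists>(c::real) (l::int) (\<psi> :: int \<Rightarrow> 'v \<Rightarrow> complex). real_of_int l < (M2 - real CARD('n) / 2 - 1) / 2 \<and>
  (\<forall>j\<in>{0..l}. integrable lborel (\<psi> j) \<and> L2_fun (\<psi> j)) \<and>
  (AE p in lborel. partial_radon g \<omega> (fst p) (snd p) = cexp (- c * (snd p)\<^sup>2) *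
   cor ((1 + norm (fst p)) powr M1) * (\<Sum>j\<in>{0..l}. \<psi> j (fst p) * cor (snd p ^ nat j)))"
proof -
 interpret U: unit_direction \<omega> by unfold_locales (rule \<omega>)
 obtain c0 where c0: "c0 > 0" "distr (lborel \<Otimes>\<^sub>M U.P) borel U.T = density lborel (\<lambda>_. ennreal c0)" using U.coordinates by blast
 define R where "R p = partial_radon g \<omega> (fst p) (snd p)" for p
 have Rp: "R \<in> borel_measurable (borel \<Otimes>\<^sub>M borel)" unfolding R_def by (rule U.partial_radon_borel) simp
 then have Rb: "R \<in> Borel" unfolding borel_prod .
 note [measurable] = Rp Rb
 have le: "(NN p. nrm (R p) * h0 p) \<le> ennreal c0 * (NN p. nrm (g p) * h p)"
  if "h \<in> Borel" "h0 \<in> Borel" "\<And>z q. h0 (z, fst q) \<le> h (z, U.T q)" for h h0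
  unfolding R_def by (rule U.nn_integral_partial_radon_le[OF c0(2) _ that]) simp
 show ?thesis
 proof (cases "AE p in lborel. g p = 0")
  case True
  have "(NN p. nrm (R p) * 1) \<le> ennreal c0 * (NN p. nrm (g p) * 1)" by (rule le) auto
  also have "(NN p. nrm (g p) * 1) = 0" using True by (subst nn_integral_0_iff_AE) auto
  finally have "AE p in lborel. nrm (R p) = 0" by (subst (asm) mult_zero_right) (simp add: nn_integral_0_iff_AE)
  then have "AE p in lborel. R p = 0" by eventually_elim simp
  \<comment> \<open>A negative upper index makes the sum empty; it must also stay below the bound,
    which may itself be negative.\<close>
  moreover define l where "l = min (-1) (\<lceil>(M2 - real CARD('n) / 2 - 1) / 2\<rceil> - 1)"
  have "real_of_int l < (M2 - real CARD('n) / 2 - 1) / 2" unfolding l_def by linarith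
  moreover have "{0..l} = {}" unfolding l_def by auto
  ultimately show ?thesis unfolding R_def by (intro exI[of _ 0] exI[of _ l]) auto
 next
  case False
  obtain \<delta> where \<delta>: "\<delta> > 0" "(NN p. ennreal (norm (g p) * w (fst p) * exp (\<delta> * norm (snd p)))) < \<infinity>"
   using exponential_moment[OF False] by blast
  have gw: "integrable lborel (\<lambda>p. g p * cor (w (fst p)))"
  proof (rule integrableI_bounded)
   have "(NN p. nrm (g p * cor (w (fst p)))) \<le> (NN p. ennreal (norm (g p) * w (fst p) * exp (\<delta> * norm (snd p))))"
   proof (intro nn_integral_mono ennreal_leI)
    fix p
    have "norm (g p) * w (fst p) * 1 \<le> norm (g p) * w (fst p) * exp (\<delta> * norm (snd p))"
     using \<delta>(1) w_pos[of "fst p"] by (intro mult_left_mono) auto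
    then show "norm (g p * cor (w (fst p))) \<le> norm (g p) * w (fst p) * exp (\<delta> * norm (snd p))"
     using w_pos[of "fst p"] by (simp add: norm_mult)
   qed
   then show "(NN p. nrm (g p * cor (w (fst p)))) < \<infinity>" using \<delta>(2) by (rule le_less_trans)
  qed measurable
  \<comment> \<open>The weight makes the Radon transform integrable in \<open>z\<close>; it is
    divided out again at the end.\<close>
  define v where "v p = cor (w (fst p)) * R p" for p
  have nv: "norm (v p) = norm (R p) * w (fst p)" for p using w_pos[of "fst p"] by (simp add: v_def norm_mult)
  have strip: "(NN p. ennreal (norm (v p) * exp (\<delta> * abs (snd p)))) < \<infinity>"
  proof -
   have "(NN p. ennreal (norm (v p) * exp (\<delta> * abs (snd p)))) = (NN p. nrm (R p) * ennreal (w (fst p) * exp (\<delta> * abs (snd p))))"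
    using w_pos by (simp add: nv ennreal_mult[symmetric] less_imp_le mult.assoc)
   also have "... \<le> ennreal c0 * (NN p. nrm (g p) * ennreal (w (fst p) * exp (\<delta> * norm (snd p))))"
    using \<delta>(1) w_pos U.abs_fst_le by (intro le) (measurable, auto intro!: ennreal_leI mult_left_mono simp: less_imp_le)
   also have "... = ennreal c0 * (NN p. ennreal (norm (g p) * w (fst p) * exp (\<delta> * norm (snd p))))"
    using w_pos by (simp add: ennreal_mult[symmetric] less_imp_le mult.assoc)
   also have "... < \<infinity>" using \<delta>(2) by (simp add: ennreal_mult_less_top)
   finally show ?thesis .
  qed
  have vi: "integrable lborel v"
  proof (rule integrableI_bounded)
   have "(NN p. nrm (v p)) \<le> (NN p. ennreal (norm (v p) * exp (\<delta> * abs (snd p))))"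
    using \<delta>(1) by (intro nn_integral_mono ennreal_leI) (auto simp: mult_le_cancel_left1)
   then show "(NN p. nrm (v p)) < \<infinity>" using strip by (rule le_less_trans)
  qed (unfold v_def, measurable)
  interpret B: beurling_pair v "real CARD('n) / 2" M2 \<delta> by unfold_locales (use vi M2 \<delta>(1) strip in auto)
  obtain K where K: "\<And>\<mu>. \<mu> \<noteq> 0 \<Longrightarrow> AE z in lborel. (LBINT t. g (z, t) * cis (\<mu> \<bullet> t)) = K * cor (norm \<mu> powr (2 * s)) * F \<mu> z"
   using central_frac_laplacian_fourier[OF f g s _ w_pos w_continuous gw] unfolding F_def by blast
  have gz: "AE z in lborel. integrable lborel (\<lambda>t. g (z, t))" using fubini_1(2)[OF gw]
  proof eventually_elim
   case (elim z)
   then have "integrable lborel (\<lambda>t. g (z, t) * cor (w z))" by simp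
   then have "integrable lborel (\<lambda>t. g (z, t) * cor (w z) * cor (1 / w z))" by (rule integrable_mult_left)
   then show ?case using w_pos[of z] by (simp add: mult.assoc flip: of_real_mult)
  qed
  have ft: "AE z in lborel. norm (B.ft z \<nu>) = (c0 * norm K * abs \<nu> powr (2 * s)) * (w z * norm (F (\<nu> *\<^sub>R \<omega>) z))" if \<nu>: "\<nu> \<noteq> 0" for \<nu>
  proof -
   have "\<nu> *\<^sub>R \<omega> \<noteq> 0" using \<nu> \<omega> by auto
   from K[OF this] gz show ?thesis
   proof eventually_elim
    case (elim z)
    have "B.ft z \<nu> = cor (w z) * (LBINT a. R (z, a) * cis (a * \<nu>))" unfolding B.ft_def v_def by (simp add: mult.assoc)
    also have "(LBINT a. R (z, a) * cis (a * \<nu>)) = cor c0 * (K * cor (norm (\<nu> *\<^sub>R \<omega>) powr (2 * s)) * F (\<nu> *\<^sub>R \<omega>) z)"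
     unfolding elim(1)[symmetric] R_def fst_conv snd_conv by (rule U.fourier_partial_radon[OF c0(2,1) _ elim(2)]) simp
    finally show ?case using w_pos[of z] c0(1) \<omega> by (simp add: norm_mult mult_ac)
   qed
  qed
  define W where "W = (LBINT z. (w z)\<^sup>2)"
  have w2: "(w z)\<^sup>2 = (1 + norm z) powr (- (2 * M1))" for z
   using powr_powr[of "1 + norm z" "- M1" 2] by (simp add: w_def powr_realpow[symmetric] mult.commute)
  have "integrable lborel (\<lambda>z. (w z)\<^sup>2)" unfolding w2 by (rule integrable_norm_decay[OF M1])
  then have W: "(NN z. (ennreal (w z))\<^sup>2) = ennreal W"
   unfolding W_def by (subst nn_integral_eq_integral[symmetric]) (auto simp: ennreal_power less_imp_le[OF w_pos])
  have W0: "W \<ge> 0" by (simp add: W_def)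
  define A where "A = c0 * norm K * sqrt W"
  have A: "A \<ge> 0" using c0(1) W0 by (simp add: A_def)
  have mass_le: "B.ft_mass \<nu> \<le> ennreal (A * abs \<nu> powr (2 * s)) * N \<omega> \<nu>" if \<nu>: "\<nu> \<noteq> 0" for \<nu>
  proof -
   \<comment> \<open>Cauchy--Schwarz in \<open>z\<close>, with \<open>w\<close> in
     \<open>L\<^sup>2\<close>.\<close>
   have "(NN z. ennreal (w z) * nrm (F (\<nu> *\<^sub>R \<omega>) z)) \<le> ennreal (sqrt W) * N \<omega> \<nu>"
   proof (rule ennreal_power2_le_imp_le)
    have "(NN z. ennreal (w z) * nrm (F (\<nu> *\<^sub>R \<omega>) z))\<^sup>2
     \<le> (NN z. (ennreal (w z))\<^sup>2) * (NN z. (nrm (F (\<nu> *\<^sub>R \<omega>) z))\<^sup>2)"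
     by (rule Cauchy_Schwarz_nn_integral) measurable
    then show "(NN z. ennreal (w z) * nrm (F (\<nu> *\<^sub>R \<omega>) z))\<^sup>2 \<le> (ennreal (sqrt W) * N \<omega> \<nu>)\<^sup>2"
     using W0 by (simp add: W N_def power_mult_distrib L2_norm_power2 ennreal_power)
   qed
   then have "ennreal (c0 * norm K * abs \<nu> powr (2 * s)) * (NN z. ennreal (w z) * nrm (F (\<nu> *\<^sub>R \<omega>) z))
    \<le> ennreal (c0 * norm K * abs \<nu> powr (2 * s)) * (ennreal (sqrt W) * N \<omega> \<nu>)" by (rule mult_left_mono) simp
   moreover have "B.ft_mass \<nu> = (NN z. ennreal (c0 * norm K * abs \<nu> powr (2 * s)) * (ennreal (w z) * nrm (F (\<nu> *\<^sub>R \<omega>) z)))"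
    unfolding B.ft_mass_def
   proof (rule nn_integral_cong_AE)
    show "AE z in lborel. nrm (B.ft z \<nu>) = ennreal (c0 * norm K * abs \<nu> powr (2 * s)) * (ennreal (w z) * nrm (F (\<nu> *\<^sub>R \<omega>) z))"
     using ft[OF \<nu>]
    proof eventually_elim
     case (elim z)
     show ?case unfolding elim using c0(1) w_pos[of z] by (simp add: ennreal_mult less_imp_le)
    qed
   qed
   moreover have "ennreal (c0 * norm K * abs \<nu> powr (2 * s)) * (ennreal (sqrt W) * N \<omega> \<nu>) = ennreal (A * abs \<nu> powr (2 * s)) * N \<omega> \<nu>"
   proof -
    have e: "A * abs \<nu> powr (2 * s) = (c0 * norm K * abs \<nu> powr (2 * s)) * sqrt W" by (simp only: A_def mult_ac)
    have "ennreal (A * abs \<nu> powr (2 * s)) = ennreal (c0 * norm K * abs \<nu> powr (2 * s)) * ennreal (sqrt W)"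
     unfolding e using c0(1) W0 by (intro ennreal_mult) auto
    then show ?thesis by (simp only: mult.assoc)
   qed
   moreover have "(NN z. ennreal (c0 * norm K * abs \<nu> powr (2 * s)) * (ennreal (w z) * nrm (F (\<nu> *\<^sub>R \<omega>) z)))
    = ennreal (c0 * norm K * abs \<nu> powr (2 * s)) * (NN z. ennreal (w z) * nrm (F (\<nu> *\<^sub>R \<omega>) z))"
    by (rule nn_integral_cmult) measurable
   ultimately show ?thesis by (simp only:)
  qed
  obtain C where C: "C > 0" "\<And>a t \<nu>. abs a \<le> t \<Longrightarrow> beurling_weight (real CARD('n) / 2) M2 a \<nu> \<le> C * (exp (t * abs \<nu>) * abs \<nu> powr (real CARD('n) / 2) / (1 + abs \<nu> + t) powr M2)"
   using beurling_weight_le[OF M2] by blast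
  define bw where "bw = beurling_weight (real CARD('n) / 2) M2"
  have bw0: "bw a \<nu> \<ge> 0" for a \<nu> by (simp add: bw_def beurling_weight_def)
  define h where "h \<nu> p = w (fst p) * (C * (exp (norm (snd p) * abs \<nu>) * abs \<nu> powr (real CARD('n) / 2) / (1 + abs \<nu> + norm (snd p)) powr M2))" for \<nu> and p :: "'v \<times> 'z"
  have h0: "h \<nu> p \<ge> 0" for \<nu> p using w_pos[of "fst p"] C(1) by (simp add: h_def)
  \<comment> \<open>The factor \<open>abs \<nu> powr (2 * s)\<close> of the multiplier joins the
    power \<open>CARD('n) / 2\<close> of the Beurling weight; together they are the power in
    \<open>weight\<close>.\<close>
  have inner: "B.ft_mass \<nu> * (NN a. B.mass a * ennreal (bw a \<nu>))
   \<le> ennreal (A * c0 * C) * (NN p. ennreal (weight p \<nu>) * N \<omega> \<nu>)" if \<nu>: "\<nu> \<noteq> 0" for \<nu>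
  proof -
   have "(NN a. B.mass a * ennreal (bw a \<nu>)) = (NN a. NN z. nrm (R (z, a)) * ennreal (w z * bw a \<nu>))"
   proof (rule nn_integral_cong)
    fix a
    have "B.mass a * ennreal (bw a \<nu>) = (NN z. nrm (v (z, a)) * ennreal (bw a \<nu>))"
     unfolding B.mass_def by (rule nn_integral_multc[symmetric]) measurable
    then show "B.mass a * ennreal (bw a \<nu>) = (NN z. nrm (R (z, a)) * ennreal (w z * bw a \<nu>))"
     using w_pos bw0 by (simp add: nv ennreal_mult less_imp_le mult.assoc)
   qed
   also have "... = (NN p. nrm (R p) * ennreal (w (fst p) * bw (snd p) \<nu>))" by (subst tonelli_2) (simp_all add: bw_def)
   also have "... \<le> ennreal c0 * (NN p. nrm (g p) * ennreal (h \<nu> p))"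
   proof (rule le)
    show "(\<lambda>p. ennreal (h \<nu> p)) \<in> Borel" unfolding h_def by measurable
    show "(\<lambda>p. ennreal (w (fst p) * bw (snd p) \<nu>)) \<in> Borel" unfolding bw_def by measurable
    show "ennreal (w (fst (z, fst q)) * bw (snd (z, fst q)) \<nu>) \<le> ennreal (h \<nu> (z, U.T q))" for z q
     unfolding h_def bw_def fst_conv snd_conv using w_pos[of z] by (intro ennreal_leI mult_left_mono C(2) U.abs_fst_le) simp
   qed
   finally have 1: "(NN a. B.mass a * ennreal (bw a \<nu>)) \<le> ennreal c0 * (NN p. nrm (g p) * ennreal (h \<nu> p))" .
   have "B.ft_mass \<nu> * (NN a. B.mass a * ennreal (bw a \<nu>))
    \<le> (ennreal (A * abs \<nu> powr (2 * s)) * N \<omega> \<nu>) * (ennreal c0 * (NN p. nrm (g p) * ennreal (h \<nu> p)))"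
    by (intro mult_mono mass_le[OF \<nu>] 1) auto
   also have "... = (NN p. (ennreal (A * abs \<nu> powr (2 * s)) * N \<omega> \<nu>) * (ennreal c0 * (nrm (g p) * ennreal (h \<nu> p))))"
    by (simp add: nn_integral_cmult h_def)
   also have "... = (NN p. ennreal (A * c0 * C) * (ennreal (weight p \<nu>) * N \<omega> \<nu>))"
   proof (rule nn_integral_cong)
    fix p
    have "abs \<nu> powr (real CARD('n) / 2 + 2 * s) = abs \<nu> powr (real CARD('n) / 2) * abs \<nu> powr (2 * s)" by (rule powr_add)
    then have e: "A * abs \<nu> powr (2 * s) * (c0 * (norm (g p) * h \<nu> p)) = A * c0 * C * weight p \<nu>"
     unfolding h_def weight_def divide_inverse by (simp only: mult_ac)
    have "(ennreal (A * abs \<nu> powr (2 * s)) * N \<omega> \<nu>) * (ennreal c0 * (nrm (g p) * ennreal (h \<nu> p)))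
     = ennreal (A * abs \<nu> powr (2 * s) * (c0 * (norm (g p) * h \<nu> p))) * N \<omega> \<nu>"
     using A c0(1) h0[of \<nu> p] by (simp add: ennreal_mult mult_ac)
    also have "... = ennreal (A * c0 * C) * (ennreal (weight p \<nu>) * N \<omega> \<nu>)"
    proof -
     have "ennreal (A * c0 * C * weight p \<nu>) = ennreal (A * c0 * C) * ennreal (weight p \<nu>)"
      using A c0(1) C(1) weight_nonneg[of p \<nu>] by (intro ennreal_mult) auto
     then show ?thesis unfolding e by (simp only: mult.assoc)
    qed
    finally show "(ennreal (A * abs \<nu> powr (2 * s)) * N \<omega> \<nu>) * (ennreal c0 * (nrm (g p) * ennreal (h \<nu> p)))
     = ennreal (A * c0 * C) * (ennreal (weight p \<nu>) * N \<omega> \<nu>)" .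
   qed
   also have "... = ennreal (A * c0 * C) * (NN p. ennreal (weight p \<nu>) * N \<omega> \<nu>)" by (rule nn_integral_cmult) measurable
   finally show ?thesis .
  qed
  have fin: "B.beurling_integral < \<infinity>"
  proof -
   have "B.beurling_integral = (NN \<nu>. NN a. B.mass a * B.ft_mass \<nu> * ennreal (bw a \<nu>))"
    unfolding B.beurling_integral_def bw_def by (rule lborel_pair.Fubini'[symmetric]) measurable
   also have "... \<le> (NN \<nu>. ennreal (A * c0 * C) * (NN p. ennreal (weight p \<nu>) * N \<omega> \<nu>))"
   proof (rule nn_integral_mono)
    fix \<nu> :: real
    have "(NN a. B.mass a * B.ft_mass \<nu> * ennreal (bw a \<nu>)) = B.ft_mass \<nu> * (NN a. B.mass a * ennreal (bw a \<nu>))"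
     unfolding bw_def by (subst nn_integral_cmult[symmetric]) (measurable, simp add: mult_ac)
    then show "(NN a. B.mass a * B.ft_mass \<nu> * ennreal (bw a \<nu>)) \<le> ennreal (A * c0 * C) * (NN p. ennreal (weight p \<nu>) * N \<omega> \<nu>)"
     using inner[of \<nu>] by (cases "\<nu> = 0") (simp_all add: bw_def beurling_weight_def)
   qed
   also have "... = ennreal (A * c0 * C) * (NN \<nu>. NN p. ennreal (weight p \<nu>) * N \<omega> \<nu>)" by (rule nn_integral_cmult) measurable
   also have "... < \<infinity>" using weighted_integral_finite(2)[OF \<omega>] by (simp add: ennreal_mult_less_top)
   finally show ?thesis .
  qed
  obtain c l L q where dec: "real_of_int l < (M2 - real CARD('n) / 2 - 1) / 2" "finite L" "L \<subseteq> {\<nu>. \<nu> \<noteq> 0 \<and> N \<omega> \<nu> \<noteq> \<infinity>}"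
   "AE p in lborel. v p = cexp (- c * (snd p)\<^sup>2) * (\<Sum>j\<in>{0..l}. (\<Sum>k\<in>L. q j k * B.ft (fst p) k) * cor (snd p ^ nat j))"
   using B.beurling_decomposition[OF fin N_finite_infinite[OF False \<omega>]] by blast
  \<comment> \<open>At a node \<open>N\<close> is finite, and this bounds the
    \<open>L\<^sup>2\<close> norm of \<open>ft\<close> because \<open>w\<close> is at most
    1.\<close>
  have L2: "L2_fun (\<lambda>z. B.ft z k)" if "k \<in> L" for k
  proof (rule L2_funI)
   have k: "k \<noteq> 0" "N \<omega> k \<noteq> \<infinity>" using that dec(3) by auto
   let ?c = "c0 * norm K * abs k powr (2 * s)"
   have "(NN z. nrmsq (B.ft z k)) \<le> (NN z. ennreal (?c\<^sup>2) * nrmsq (F (k *\<^sub>R \<omega>) z))"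
   proof (rule nn_integral_mono_AE)
    show "AE z in lborel. nrmsq (B.ft z k) \<le> ennreal (?c\<^sup>2) * nrmsq (F (k *\<^sub>R \<omega>) z)"
     using ft[OF k(1)]
    proof eventually_elim
     case (elim z)
     have "norm (B.ft z k) \<le> ?c * (1 * norm (F (k *\<^sub>R \<omega>) z))"
      unfolding elim using c0(1) w_le[of z] by (intro mult_left_mono mult_right_mono) auto
     then have "(norm (B.ft z k))\<^sup>2 \<le> (?c * (1 * norm (F (k *\<^sub>R \<omega>) z)))\<^sup>2" by (rule power_mono) simp
     also have "... = ?c\<^sup>2 * (norm (F (k *\<^sub>R \<omega>) z))\<^sup>2" by (simp only: power_mult_distrib mult_1)
     finally show ?case using ennreal_leI by (simp only: ennreal_mult[symmetric] zero_le_power2)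
    qed
   qed
   also have "... = ennreal (?c\<^sup>2) * (N \<omega> k)\<^sup>2" unfolding N_def L2_norm_power2 by (rule nn_integral_cmult) measurable
   also have "... < \<infinity>" using k(2) by (simp add: ennreal_mult_less_top less_top power_less_top_ennreal)
   finally show "(NN z. nrmsq (B.ft z k)) < \<infinity>" .
  qed simp
  define \<psi> where "\<psi> j z = (\<Sum>k\<in>L. q j k * B.ft z k)" for j z
  have "integrable lborel (\<psi> j) \<and> L2_fun (\<psi> j)" for j
   unfolding \<psi>_def by (intro conjI Bochner_Integration.integrable_sum integrable_mult_right B.ft_integrable L2_fun_sum L2_fun_scale L2 dec(2))
  moreover have "AE p in lborel. R p = cexp (- c * (snd p)\<^sup>2) *
   cor ((1 + norm (fst p)) powr M1) * (\<Sum>j\<in>{0..l}. \<psi> j (fst p) * cor (snd p ^ nat j))" using dec(4)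
  proof eventually_elim
   case (elim p)
   have "(1 + norm (fst p)) powr M1 * w (fst p) = 1" by (simp add: w_def powr_minus add_nonneg_eq_0_iff)
   then have "R p = cor ((1 + norm (fst p)) powr M1) * v p" unfolding v_def mult.assoc[symmetric] of_real_mult[symmetric] by simp
   then show ?case unfolding elim \<psi>_def by (simp only: mult_ac)
  qed
  ultimately show ?thesis using dec(1) unfolding R_def by (intro exI[of _ c] exI[of _ l] exI[of _ \<psi>]) auto
 qed
qed

theorem theorem1p5:
  fixes br :: "'v::euclidean_space \<times> 'z::euclidean_space \<Rightarrow> 'v \<times> 'z \<Rightarrow> 'v \<times> 'z"
    and E E' :: "'z \<Rightarrow> 'n::finite \<Rightarrow> 'v"
    and f g :: "'v \<times> 'z \<Rightarrow> complex"
    and M1 M2 :: real and n m :: nat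
  assumes htype: "H_type_algebra br"
    and center: "lie_center br = {0} \<times> UNIV"
    and dims: "DIM('z) = m" "DIM('v) = 2 * n" "CARD('n) = n"
    and basis: "\<And>\<omega>. norm \<omega> = 1 \<Longrightarrow> adapted_basis br \<omega> (E \<omega>) (E' \<omega>)"
    and f_L1: "integrable lborel f" and f_L2: "L2_fun f"
    and g: "is_central_frac_laplacian ((real m - 1) / 4) f g"
    and M1: "M1 > real n" and M2: "M2 \<ge> 0"
    and beurling: "\<And>\<omega>. norm \<omega> = 1 \<Longrightarrow>
      (\<integral>\<^sup>+(z, t). (\<integral>\<^sup>+\<nu>.
          ennreal (norm (g (z, t)) * exp (norm t * \<bar>\<nu>\<bar>) * \<bar>\<nu>\<bar> powr (real n + (real m - 1) / 2)
                   / ((1 + norm z) powr M1 * (1 + \<bar>\<nu>\<bar> + norm t) powr M2))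
          * hs_norm (group_fourier (E \<omega>) (E' \<omega>) f \<nu> \<omega>) \<partial>lborel) \<partial>lborel) < \<infinity>"
  shows "\<forall>\<omega>. norm \<omega> = 1 \<longrightarrow>
    (\<exists>(c::real) (l::int) (\<psi> :: int \<Rightarrow> 'v \<Rightarrow> complex).
       real_of_int l < (M2 - real n / 2 - 1) / 2 \<and>
       (\<forall>j\<in>{0..l}. integrable lborel (\<psi> j) \<and> L2_fun (\<psi> j)) \<and>
       (AE (z, a) in lborel.
          partial_radon g \<omega> z a =
            complex_of_real (exp (- c * a\<^sup>2)) * complex_of_real ((1 + norm z) powr M1) *
            (\<Sum>j\<in>{0..l}. \<psi> j z * complex_of_real (a ^ nat j))))"
proof -
 have m: "m \<ge> 1" using dims(1) DIM_positive[where 'a='z] by linarith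
 \<comment> \<open>The exponent is nonnegative because a Euclidean space has positive dimension, and
   its double is the power \<open>(real m - 1) / 2\<close> in the condition.\<close>
 interpret beurling_hypothesis f g E E' M1 M2 "(real m - 1) / 4"
 proof (rule beurling_hypothesis.intro, goal_cases)
  case (1 \<omega>) then show ?case using basis[of \<omega>] unfolding adapted_basis_def orthonormal_frame_def by blast
 next
  case (7 \<omega>)
  have e: "2 * ((real m - 1) / 4) = (real m - 1) / 2" by simp
  show ?case unfolding e dims(3) by (rule beurling[OF 7])
 qed (use f_L1 g M1 M2 dims m in auto)
 show ?thesis using partial_radon_decomposition dims(3) unfolding split_beta by simp
qed

end
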